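(* Let $M^d$ be Euclidean, spherical or hyperbolic $d$-space, let $k\ge 1$, let $K(t)$ be a family of cell complexes in $M^d$ depending smoothly on a parameter $t$ with $K(0)=K$, and let $\omega$ be a $(k+1)$-stress on $K$. Then $$\sum_{G\in K^k}\omega(G)\,dV_k(G)=0\quad\text{at } t=0,$$ where the sum is over all $k$-cells $G$ of $K$ and $dV_k(G)$ is the differential (with respect to $t$, at $t=0$) of the $k$-dimensional volume of the corresponding cell of $K(t)$.
   Context: Spaces: $M^d$ is $\mathbb{R}^d$, the unit sphere $\mathbb{S}^d\subset\mathbb{R}^{d+1}$, or $\mathbb{H}^d=\{x\in\mathbb{R}^{d,1}: x\cdot x=-1,\ x_0>0\}$, where $\mathbb{R}^{d,1}$ is $\mathbb{R}^{d+1}$ with $x\cdot y=-x_0y_0+x_1y_1+\cdots+x_dy_d$; points and tangent vectors of $\mathbb{S}^d,\mathbb{H}^d$ are regarded as vectors of the ambient space. A $k$-dimensional convex polytope in $M^k$ is a compact subset which is a finite intersection of closed half spaces. A cell complex in $M^d$ is a finite set of convex polytopes (cells) in $M^d$ such that every face (including the empty set) of a cell is a cell in the set and any two cells share a unique maximal common face (self-intersections between cells in $M^d$ are disregarded). In the spherical case every cell is also required to lie strictly in an open half sphere. $K^r$ is the set of $r$-cells of $K$. In the family $K(t)$ the combinatorial structure is fixed and the cells vary smoothly with $t$. A $k$-stress ($2\le k\le d+1$) on a cell complex $K$ in $M^d$ is a real-valued function $\omega$ on the $(k-1)$-cells of $K$ such that for each $(k-2)$-cell $F$ of $K$, $$\sum_{G\in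 K^{k-1},\,F\subset G}\omega(G)\,u_{F,G}=0,$$ where $u_{F,G}$ is the inward unit normal to $G$ at its facet $F$. $V_k(G)$ is the $k$-dimensional volume of $G$. *)

theory Defs
  imports "HOL-Analysis.Analysis"
begin

text \<open>
  All three geometries live in an ambient space \<open>real ^ 'n\<close>. In the Euclidean case \<open>d = CARD('n)\<close>; in
  the other two \<open>d + 1 = CARD('n)\<close>. The argument of \<open>Hyperbolic\<close> is the index of the time-like
  coordinate, written \<open>x\<^sub>0\<close> in the usual presentation of the hyperboloid model.
\<close>

datatype 'n geometry = Euclidean | Spherical | Hyperbolic 'n

definition geom_dim :: "'n::finite geometry \<Rightarrow> nat" where
  "geom_dim g = (case g of Euclidean \<Rightarrow> CARD('n) | _ \<Rightarrow> CARD('n) - 1)"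

definition form :: "'n::finite geometry \<Rightarrow> real ^ 'n \<Rightarrow> real ^ 'n \<Rightarrow> real" where
  "form g x y = (case g of
      Euclidean \<Rightarrow> x \<bullet> y
    | Spherical \<Rightarrow> x \<bullet> y
    | Hyperbolic i0 \<Rightarrow> - (x $ i0 * y $ i0) + (\<Sum>i\<in>UNIV - {i0}. x $ i * y $ i))"

definition model_space :: "'n::finite geometry \<Rightarrow> (real ^ 'n) set" where
  "model_space g = (case g of
      Euclidean \<Rightarrow> UNIV
    | Spherical \<Rightarrow> sphere 0 1
    | Hyperbolic i0 \<Rightarrow> {x. form g x x = -1 \<and> x $ i0 > 0})"


subsection \<open>Polytopes and their faces\<close>

text \<open>
  Half spaces are bounded by totally geodesic hypersurfaces. In the curved cases these are the
  sections of the model space by linear hyperplanes; such a hyperplane meets hyperbolic space in a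
  hypersurface exactly when its normal vector is space-like.
\<close>

definition bounds_half_space :: "'n::finite geometry \<Rightarrow> real ^ 'n \<Rightarrow> real \<Rightarrow> bool" where
  "bounds_half_space g a b \<longleftrightarrow> (case g of
      Euclidean \<Rightarrow> a \<noteq> 0
    | Spherical \<Rightarrow> a \<noteq> 0 \<and> b = 0
    | Hyperbolic i0 \<Rightarrow> form g a a > 0 \<and> b = 0)"

definition half_space :: "'n::finite geometry \<Rightarrow> real ^ 'n \<Rightarrow> real \<Rightarrow> (real ^ 'n) set" where
  "half_space g a b = {x \<in> model_space g. form g a x \<le> b}"

text \<open>
  Polytopes of every dimension are described by half spaces of the whole space: a totally geodesic
  subspace is an intersection of half spaces, and each of its half spaces is the trace of one of the
  whole space.
\<close>

definition convex_polytope :: "'n::finite geometry \<Rightarrow> (real ^ 'n) set \<Rightarrow> bool" where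
  "convex_polytope g P \<longleftrightarrow> compact P \<and>
     (\<exists>N. finite N \<and> (\<forall>(a, b)\<in>N. bounds_half_space g a b) \<and>
          P = model_space g \<inter> (\<Inter>(a, b)\<in>N. half_space g a b))"

definition poly_face :: "'n::finite geometry \<Rightarrow> (real ^ 'n) set \<Rightarrow> (real ^ 'n) set \<Rightarrow> bool" where
  "poly_face g F P \<longleftrightarrow> F = {} \<or> F = P \<or>
     (\<exists>a b. bounds_half_space g a b \<and> P \<subseteq> half_space g a b \<and> F = {x \<in> P. form g a x = b})"

text \<open>The smallest totally geodesic subspace containing a set, and its dimension.\<close>

definition geodesic_hull :: "'n::finite geometry \<Rightarrow> (real ^ 'n) set \<Rightarrow> (real ^ 'n) set" where
  "geodesic_hull g P = (case g of
      Euclidean \<Rightarrow> affine hull P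
    | _ \<Rightarrow> model_space g \<inter> span P)"

definition geodesic_dim :: "'n::finite geometry \<Rightarrow> (real ^ 'n) set \<Rightarrow> int" where
  "geodesic_dim g P = (case g of Euclidean \<Rightarrow> aff_dim P | _ \<Rightarrow> int (dim P) - 1)"


subsection \<open>Cell complexes\<close>

definition cell_complex :: "'n::finite geometry \<Rightarrow> (real ^ 'n) set set \<Rightarrow> bool" where
  "cell_complex g K \<longleftrightarrow>
     finite K \<and>
     (\<forall>P\<in>K. convex_polytope g P) \<and>
     (\<forall>P\<in>K. \<forall>F. poly_face g F P \<longrightarrow> F \<in> K) \<and>
     (\<forall>P\<in>K. \<forall>Q\<in>K. \<exists>!F. poly_face g F P \<and> poly_face g F Q \<and>
        (\<forall>F'. poly_face g F' P \<and> poly_face g F' Q \<and> F \<subseteq> F' \<longrightarrow> F' = F)) \<and>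
     (g = Spherical \<longrightarrow> (\<forall>P\<in>K. \<exists>a. \<forall>x\<in>P. a \<bullet> x > 0))"

definition cells :: "'n::finite geometry \<Rightarrow> (real ^ 'n) set set \<Rightarrow> int \<Rightarrow> (real ^ 'n) set set" where
  "cells g K r = {G \<in> K. geodesic_dim g G = r}"


subsection \<open>Stresses\<close>

text \<open>The tangent space at \<open>y\<close> of the geodesic hull of \<open>P\<close>, as a subspace of the ambient space.\<close>

definition tangent_space :: "'n::finite geometry \<Rightarrow> (real ^ 'n) set \<Rightarrow> real ^ 'n \<Rightarrow> (real ^ 'n) set" where
  "tangent_space g P y = (case g of
      Euclidean \<Rightarrow> span ((\<lambda>x. x - y) ` P)
    | _ \<Rightarrow> {v \<in> span P. form g v y = 0})"

text \<open>
  The inward unit normal is the same ambient vector at all points of a facet. In the curved cases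
  it is orthogonal to \<open>y\<close>, so the last condition below says that its product with \<open>x\<close> is nonnegative.
\<close>

definition inward_normal ::
  "'n::finite geometry \<Rightarrow> (real ^ 'n) set \<Rightarrow> (real ^ 'n) set \<Rightarrow> real ^ 'n" where
  "inward_normal g F G = (THE u. \<forall>y\<in>F.
     u \<in> tangent_space g G y \<and>
     (\<forall>w\<in>tangent_space g F y. form g u w = 0) \<and>
     form g u u = 1 \<and>
     (\<forall>x\<in>G. form g u (x - y) \<ge> 0))"

text \<open>
  Incidence is the face relation: since cells may intersect each other arbitrarily in the model
  space, mere inclusion of point sets would not express that \<open>F\<close> is a facet of \<open>G\<close>.
\<close>

definition is_stress ::
  "'n::finite geometry \<Rightarrow> nat \<Rightarrow> (real ^ 'n) set set \<Rightarrow> ((real ^ 'n) set \<Rightarrow> real) \<Rightarrow> bool" where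
  "is_stress g k K \<omega> \<longleftrightarrow> 2 \<le> k \<and> k \<le> geom_dim g + 1 \<and>
     (\<forall>F\<in>cells g K (int k - 2).
        (\<Sum>G | G \<in> cells g K (int k - 1) \<and> poly_face g F G. \<omega> G *\<^sub>R inward_normal g F G) = 0)"


subsection \<open>Volume\<close>

text \<open>
  The Riemannian volume element of a parametrisation \<open>\<phi>\<close>: the square root of the Gram determinant
  of its partial derivatives with respect to the (induced) metric.
\<close>

definition volume_element ::
  "'n::finite geometry \<Rightarrow> (real ^ 'k \<Rightarrow> real ^ 'n) \<Rightarrow> real ^ 'k \<Rightarrow> real" where
  "volume_element g \<phi> c = sqrt (det (\<chi> i j.
     form g (frechet_derivative \<phi> (at c) (axis i 1)) (frechet_derivative \<phi> (at c) (axis j 1))))"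

text \<open>
  The \<open>CARD('k)\<close>-dimensional volume of a set \<open>G\<close> whose geodesic hull has that dimension, computed in
  a parametrisation \<open>\<phi>\<close> of a part of the geodesic hull that contains \<open>G\<close>. By change of variables the
  value does not depend on the parametrisation. A parametrisation exists for every polytope in the
  Euclidean and hyperbolic cases, and for those in an open half sphere in the spherical case. The
  integral is that of the gauge (Henstock-Kurzweil) theory; as the integrand is nonnegative, it
  agrees with the Lebesgue integral.
\<close>

definition cell_volume :: "'n::finite geometry \<Rightarrow> 'k::finite itself \<Rightarrow> (real ^ 'n) set \<Rightarrow> real" where
  "cell_volume g _ G = (THE v. \<exists>(\<phi> :: real ^ 'k \<Rightarrow> real ^ 'n) W.
     open W \<and> inj_on \<phi> W \<and> \<phi> differentiable_on W \<and>
     \<phi> ` W \<subseteq> geodesic_hull g G \<and> G \<subseteq> \<phi> ` W \<and>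
     v = integral {c \<in> W. \<phi> c \<in> G} (volume_element g \<phi>))"


subsection \<open>Smooth families\<close>

text \<open>Infinite differentiability on an open set, witnessed by the sequence of derivatives.\<close>

definition smooth_curve_on :: "real set \<Rightarrow> (real \<Rightarrow> 'a::real_normed_vector) \<Rightarrow> bool" where
  "smooth_curve_on T f \<longleftrightarrow> (\<exists>D. D 0 = f \<and>
     (\<forall>(m::nat). \<forall>t\<in>T. (D m has_vector_derivative D (Suc m) t) (at t)))"

text \<open>
  A family of cell complexes with fixed combinatorial structure, parametrised by an open interval
  \<open>T\<close> around \<open>0\<close>: \<open>\<Phi> t G\<close> is the cell at parameter \<open>t\<close> that corresponds to the cell \<open>G\<close> of
  the complex \<open>K\<close> at parameter \<open>0\<close>, so the complex at parameter \<open>t\<close> is \<open>\<Phi> t ` K\<close>.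
  As a cell is the convex hull of its vertices, and these are the \<open>0\<close>-cells contained in it as
  faces, smooth variation of the cells amounts to smooth variation of the \<open>0\<close>-cells.
\<close>

definition smooth_family ::
  "'n::finite geometry \<Rightarrow> real set \<Rightarrow> (real ^ 'n) set set \<Rightarrow>
     (real \<Rightarrow> (real ^ 'n) set \<Rightarrow> (real ^ 'n) set) \<Rightarrow> bool" where
  "smooth_family g T K \<Phi> \<longleftrightarrow>
     open T \<and> is_interval T \<and> 0 \<in> T \<and>
     (\<forall>G\<in>K. \<Phi> 0 G = G) \<and>
     (\<forall>t\<in>T. cell_complex g (\<Phi> t ` K) \<and> inj_on (\<Phi> t) K \<and>
        (\<forall>G\<in>K. geodesic_dim g (\<Phi> t G) = geodesic_dim g G) \<and>
        (\<forall>F\<in>K. \<forall>G\<in>K. poly_face g (\<Phi> t F) (\<Phi> t G) \<longleftrightarrow> poly_face g F G)) \<and>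
     (\<forall>p. {p} \<in> K \<longrightarrow> (\<exists>\<gamma>. smooth_curve_on T \<gamma> \<and> (\<forall>t\<in>T. \<Phi> t {p} = {\<gamma> t})))"

end

theory Submission
  imports Defs
begin

text \<open>
  To first order the volume of a cell \<open>G\<close> changes only through the motion of its facets: the moving
  cell can be projected orthogonally to the geodesic hull of \<open>G\<close> at an expense of \<open>O(t\<^sup>2)\<close>. In a
  central projection of that hull the projected cell is an intersection of half spaces, one for
  each facet. Replace the half spaces at parameter \<open>0\<close> by those at parameter \<open>t\<close> one at a time,
  each in a chart in which the facet \<open>F\<close> concerned lies in a coordinate hyperplane; dominated
  convergence shows that such a step contributes minus the integral over \<open>F\<close> of the inner product
  of the conormal \<open>u\<^bsub>F,G\<^esub>\<close> with a velocity field. This field is interpolated from independent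
  vertices of \<open>F\<close>, so it depends on \<open>F\<close> only and the contribution is linear in \<open>u\<^bsub>F,G\<^esub>\<close>.
  Summing over \<open>G\<close> with the weights \<open>\<omega> G\<close>, the contributions at each \<open>F\<close> cancel.
\<close>

subsection \<open>Change of variables\<close>

text \<open>The stress relates only the conormals at one facet, so everything else in the
  contribution of a facet (density, domain of integration, velocity) has to be fixed before a cell
  is chosen; frames are therefore built on the facet and completed by the conormal of the cell. A
  cell need not be a simplex, so no family of affine maps need carry it to its later positions; its
  vertices give access to the motion through the hyperplanes that they span, which is why half
  spaces are moved. Projection to the old hull costs \<open>O(t\<^sup>2)\<close> because the moved
  hull is written as a graph over the old one: the displacement is orthogonal to the hull, so mixed
  terms in the Gram matrix vanish. When some half spaces have moved and others have not, their
  intersection is no cell and need not be compact; it is cut down to a compact neighbourhood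
  \<open>D\<close> of the cell. A vertex velocity may leave the hull of the cell, but the conormal
  is a direction of the cell and sees only the component along it.\<close>

text \<open>The library has the change of variables formula for well-ordered index types only; it is
  transported along a copy of the index type that carries an arbitrary well-order.\<close>

typedef 'a ordered_copy = "UNIV :: 'a set" morphisms of_copy to_copy
  by simp

definition index_code :: "'a::finite \<Rightarrow> nat" where
  "index_code = (SOME f. inj f)"

lemma inj_index_code: "inj (index_code :: 'a::finite \<Rightarrow> nat)"
proof -
  have "\<exists>f :: 'a \<Rightarrow> nat. inj f"
    using finite_imp_inj_to_nat_seg[of "UNIV :: 'a set"] by auto
  then show ?thesis
    unfolding index_code_def by (rule someI_ex)
qed

instantiation ordered_copy :: (finite) "{finite, wellorder}"
begin

definition less_eq_ordered_copy :: "'a ordered_copy \<Rightarrow> 'a ordered_copy \<Rightarrow> bool" where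
  "x \<le> y \<longleftrightarrow> index_code (of_copy x) \<le> index_code (of_copy y)"

definition less_ordered_copy :: "'a ordered_copy \<Rightarrow> 'a ordered_copy \<Rightarrow> bool" where
  "x < y \<longleftrightarrow> index_code (of_copy x) < index_code (of_copy y)"

instance
proof
  fix P and a :: "'a ordered_copy"
  assume "\<And>x :: 'a ordered_copy. (\<And>y. y < x \<Longrightarrow> P y) \<Longrightarrow> P x"
  then show "P a"
    by (rule measure_induct_rule[of "\<lambda>x. index_code (of_copy x)"]) (simp add: less_ordered_copy_def)
next
  have "inj (of_copy :: 'a ordered_copy \<Rightarrow> 'a)"
    by (auto intro: injI simp: of_copy_inject)
  then show "finite (UNIV :: 'a ordered_copy set)"
    by (rule finite_imageD[OF finite])
next
  fix x y :: "'a ordered_copy"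
  assume "x \<le> y" "y \<le> x"
  then have "index_code (of_copy x) = index_code (of_copy y)"
    by (simp add: less_eq_ordered_copy_def)
  then show "x = y"
    using injD[OF inj_index_code] of_copy_inject by blast
qed (auto simp: less_eq_ordered_copy_def less_ordered_copy_def)

end

lemma bij_of_copy: "bij (of_copy :: 'a ordered_copy \<Rightarrow> 'a)"
  by (rule o_bij[of to_copy]) (auto simp: fun_eq_iff to_copy_inverse of_copy_inverse)

lemma of_to_copy [simp]: "of_copy (to_copy x) = x" "to_copy (of_copy y) = y"
  by (simp_all add: to_copy_inverse of_copy_inverse)

text \<open>Conjugation by \<open>h\<close> carries permutations of one index type to those of the
  other and preserves signs, so the two Leibniz sums agree term by term.\<close>

lemma det_reindex:
  fixes A :: "'a::comm_ring_1 ^ 'n::finite ^ 'n" and h :: "'m::finite \<Rightarrow> 'n"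
  assumes "bij h"
  shows "det (\<chi> i j. A $ h i $ h j) = det A"
proof -
  have inj: "inj h" and surj: "range h = UNIV"
    using assms by (auto simp: bij_def)
  have "det A = (\<Sum>p | p permutes UNIV. of_int (sign p) * (\<Prod>i\<in>UNIV. A $ h i $ p (h i)))"
    unfolding det_def
    by (intro sum.cong refl, subst prod.reindex_bij_betw[OF assms]) auto
  also have "\<dots> = (\<Sum>q | q permutes (UNIV :: 'm set).
      of_int (sign (map_permutation UNIV h q)) * (\<Prod>i\<in>UNIV. A $ h i $ map_permutation UNIV h q (h i)))"
  proof (rule sum.reindex_bij_betw[symmetric])
    have "map_permutation UNIV h =
        (\<lambda>\<pi> x. if x \<in> UNIV then h (\<pi> (inv_into UNIV h x)) else x)"
      using surj by (auto simp: fun_eq_iff map_permutation_def restrict_id_def)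
    then show "bij_betw (map_permutation UNIV h) {q. q permutes UNIV} {p. p permutes UNIV}"
      using bij_betw_permutations[OF assms] by simp
  qed
  also have "\<dots> = (\<Sum>q | q permutes (UNIV :: 'm set). of_int (sign q) * (\<Prod>i\<in>UNIV. A $ h i $ h (q i)))"
  proof (intro sum.cong refl, goal_cases)
    case (1 q)
    then have "sign (map_permutation UNIV h q) = sign q"
      by (intro sign_map_permutation inj) auto
    moreover have "map_permutation UNIV h q (h i) = h (q i)" for i
      using surj inj by (simp add: map_permutation_def restrict_id_def)
    ultimately show ?case by simp
  qed
  finally show ?thesis
    by (simp add: det_def)
qed


section \<open>Lebesgue measure and integrals under a relabelling of the coordinates\<close>

definition to_copy_vec :: "real ^ 'k::finite \<Rightarrow> real ^ 'k ordered_copy" where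
  "to_copy_vec x = (\<chi> i. x $ of_copy i)"

definition of_copy_vec :: "real ^ 'k ordered_copy \<Rightarrow> real ^ 'k::finite" where
  "of_copy_vec y = (\<chi> i. y $ to_copy i)"

lemma copy_vec_inverse [simp]: "of_copy_vec (to_copy_vec x) = x" "to_copy_vec (of_copy_vec y) = y"
  by (simp_all add: of_copy_vec_def to_copy_vec_def vec_eq_iff)

lemma linear_copy_vec: "linear to_copy_vec" "linear of_copy_vec"
  by (auto intro!: linearI simp: of_copy_vec_def to_copy_vec_def vec_eq_iff)

lemma to_copy_vec_image: "to_copy_vec ` S = of_copy_vec -` S"
proof (rule set_eqI)
  fix y
  show "y \<in> to_copy_vec ` S \<longleftrightarrow> y \<in> of_copy_vec -` S"
    by (auto intro: image_eqI[of y to_copy_vec "of_copy_vec y"])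
qed

lemma measurable_copy_vec [measurable]:
  "to_copy_vec \<in> borel \<rightarrow>\<^sub>M borel" "of_copy_vec \<in> borel \<rightarrow>\<^sub>M borel"
  by (intro borel_measurable_continuous_onI linear_continuous_on
      linear_copy_vec[unfolded linear_conv_bounded_linear])+

text \<open>Lebesgue measure is determined by its values on boxes, and a relabelling only permutes
  the side lengths of a box.\<close>

lemma lborel_of_copy_vec: "distr lborel borel of_copy_vec = (lborel :: (real ^ 'k::finite) measure)"
proof (rule lborel_eqI[symmetric])
  fix l u :: "real ^ 'k"
  assume lu: "\<And>b. b \<in> Basis \<Longrightarrow> l \<bullet> b \<le> u \<bullet> b"
  have "of_copy_vec -` box l u = box (to_copy_vec l) (to_copy_vec u)"
    by (auto simp: mem_box_cart of_copy_vec_def to_copy_vec_def) (metis of_to_copy)+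
  then have "emeasure (distr lborel borel of_copy_vec) (box l u) =
      emeasure lborel (box (to_copy_vec l) (to_copy_vec u))"
    by (simp add: emeasure_distr)
  also have "\<dots> = (\<Prod>b\<in>Basis. (to_copy_vec u - to_copy_vec l) \<bullet> b)"
  proof (rule emeasure_lborel_box)
    have "l $ i \<le> u $ i" for i
      using lu[of "axis i 1"] by (auto simp: inner_axis Basis_vec_def)
    then show "to_copy_vec l \<bullet> b \<le> to_copy_vec u \<bullet> b" if "b \<in> Basis" for b
      using that by (auto simp: Basis_vec_def inner_axis to_copy_vec_def)
  qed
  also have "\<dots> = (\<Prod>i\<in>UNIV. (to_copy_vec u - to_copy_vec l) $ i)"
    by (simp add: Basis_vec_def UNION_singleton_eq_range prod.reindex inj_on_def axis_eq_axis inner_axis)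
  also have "\<dots> = (\<Prod>i\<in>UNIV. (u - l) $ i)"
    unfolding to_copy_vec_def by (subst prod.reindex_bij_betw[OF bij_of_copy, symmetric]) simp
  also have "\<dots> = (\<Prod>b\<in>Basis. (u - l) \<bullet> b)"
    by (simp add: Basis_vec_def UNION_singleton_eq_range prod.reindex inj_on_def axis_eq_axis inner_axis)
  finally show "emeasure (distr lborel borel of_copy_vec) (box l u) = (\<Prod>b\<in>Basis. (u - l) \<bullet> b)" .
qed simp

lemma lborel_to_copy_vec: "distr lborel borel to_copy_vec = (lborel :: (real ^ 'k::finite ordered_copy) measure)"
proof -
  have "distr lborel borel to_copy_vec = distr (distr lborel borel of_copy_vec) borel (to_copy_vec :: real ^ 'k \<Rightarrow> _)"
    by (simp add: lborel_of_copy_vec)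
  also have "\<dots> = distr lborel borel (\<lambda>x. x :: real ^ 'k ordered_copy)"
    by (subst distr_distr) (auto simp: o_def)
  also have "\<dots> = lborel"
    by (rule distr_id2) simp
  finally show ?thesis .
qed

text \<open>Preservation of Borel measure passes to the completion; \<open>lebesgue\<close> is the
  measure for which absolute integrability is defined.\<close>

lemma lebesgue_distr_eq:
  fixes h :: "'a::euclidean_space \<Rightarrow> 'b::euclidean_space"
  assumes h: "h \<in> borel \<rightarrow>\<^sub>M borel" and eq: "distr lborel borel h = lborel"
  shows "h \<in> lebesgue \<rightarrow>\<^sub>M lebesgue" "distr lebesgue lebesgue h = lebesgue"
proof -
  have m: "h \<in> lebesgue \<rightarrow>\<^sub>M lborel"
    by (rule measurable_completion) (use h in simp)
  have "distr lebesgue lborel h = distr lborel lborel h"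
    by (rule distr_completion) (use h in simp)
  also have "\<dots> = distr lborel borel h"
    by (rule distr_cong) auto
  finally have d: "distr lebesgue lborel h = lborel"
    using eq by simp

  show "h \<in> lebesgue \<rightarrow>\<^sub>M lebesgue"
    by (rule completion.measurable_completion2[OF m]) (simp add: d)
  show "distr lebesgue lebesgue h = lebesgue"
    using completion.completion_distr_eq[OF m] by (simp add: d)
qed

lemmas lebesgue_of_copy_vec = lebesgue_distr_eq[OF measurable_copy_vec(2) lborel_of_copy_vec]
lemmas lebesgue_to_copy_vec = lebesgue_distr_eq[OF measurable_copy_vec(1) lborel_to_copy_vec]

text \<open>Both relabellings preserve measure: \<open>of_copy_vec\<close> transports integrability
  in one direction, \<open>to_copy_vec\<close> in the other.\<close>

lemma integral_copy_vec:
  fixes f :: "real ^ 'k::finite \<Rightarrow> real"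
  shows "(\<lambda>y. f (of_copy_vec y)) absolutely_integrable_on (to_copy_vec ` S) \<longleftrightarrow> f absolutely_integrable_on S" (is ?a)
    and "f absolutely_integrable_on S \<Longrightarrow> integral (to_copy_vec ` S) (\<lambda>y. f (of_copy_vec y)) = integral S f" (is "_ \<Longrightarrow> ?b")
proof -
  let ?f = "\<lambda>x. indicat_real S x *\<^sub>R f x"
  have ind: "indicat_real (to_copy_vec ` S) y *\<^sub>R f (of_copy_vec y) = ?f (of_copy_vec y)" for y
    by (simp add: to_copy_vec_image indicator_def)
  have 1: "integrable lebesgue (\<lambda>y. ?f (of_copy_vec y))" if "integrable lebesgue ?f"
  proof -
    have "integrable (distr lebesgue lebesgue of_copy_vec) ?f"
      using that by (simp add: lebesgue_of_copy_vec(2))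
    from integrable_distr[OF lebesgue_of_copy_vec(1) this] show ?thesis .
  qed
  have 2: "integrable lebesgue ?f" if i: "integrable lebesgue (\<lambda>y. ?f (of_copy_vec y))"
  proof -
    have "integrable (distr lebesgue lebesgue to_copy_vec) (\<lambda>y. ?f (of_copy_vec y))"
      using i by (simp add: lebesgue_to_copy_vec(2))
    from integrable_distr[OF lebesgue_to_copy_vec(1) this]
    show ?thesis by simp
  qed
  show ?a
    unfolding set_integrable_def ind using 1 2 by blast
  show ?b if f: "f absolutely_integrable_on S"
  proof -
    have i: "integrable lebesgue ?f"
      using f by (simp add: set_integrable_def)
    have "integral (to_copy_vec ` S) (\<lambda>y. f (of_copy_vec y)) = (LINT y|lebesgue. ?f (of_copy_vec y))"
      using set_lebesgue_integral_eq_integral(2)[of "to_copy_vec ` S" "\<lambda>y. f (of_copy_vec y)"] \<open>?a\<close> f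
      unfolding set_lebesgue_integral_def ind by simp
    also have "\<dots> = (LINT x|distr lebesgue lebesgue of_copy_vec. ?f x)"
      by (rule integral_distr[symmetric, OF lebesgue_of_copy_vec(1)]) (use i in auto)
    also have "\<dots> = integral S f"
      using set_lebesgue_integral_eq_integral(2)[OF f]
      by (simp add: set_lebesgue_integral_def lebesgue_of_copy_vec(2))
    finally show ?thesis .
  qed
qed

text \<open>Scalar integrands enter the change of variables as vectors with a single
  component.\<close>

lemma integral_vec_1:
  fixes f :: "'a::euclidean_space \<Rightarrow> real"
  shows "(\<lambda>x. vec (f x) :: real ^ 1) absolutely_integrable_on S \<longleftrightarrow> f absolutely_integrable_on S"
    and "f integrable_on S \<Longrightarrow> integral S (\<lambda>x. vec (f x) :: real ^ 1) = vec (integral S f)"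
proof -
  have l: "bounded_linear (vec :: real \<Rightarrow> real ^ 1)" "bounded_linear (\<lambda>x :: real ^ 1. x $ 1)"
    unfolding linear_conv_bounded_linear[symmetric] by (auto intro!: linearI simp: vec_eq_iff)
  show "(\<lambda>x. vec (f x) :: real ^ 1) absolutely_integrable_on S \<longleftrightarrow> f absolutely_integrable_on S"
    by (auto dest: absolutely_integrable_linear[OF _ l(1)] absolutely_integrable_linear[OF _ l(2)] simp: o_def)
  show "f integrable_on S \<Longrightarrow> integral S (\<lambda>x. vec (f x) :: real ^ 1) = vec (integral S f)"
    using integral_linear[OF _ l(1), of f S] by (auto simp: o_def)
qed

text \<open>\<open>h\<close> is conjugated by the relabelling. Rows and columns of its Jacobian
  matrix are permuted alike, so the determinant is unchanged and the formula for the copy translates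
  back.\<close>

theorem change_of_variables_cart:
  fixes f :: "real ^ 'k::finite \<Rightarrow> real" and h :: "real ^ 'k \<Rightarrow> real ^ 'k"
  assumes S: "S \<in> sets lebesgue"
    and der: "\<And>x. x \<in> S \<Longrightarrow> (h has_derivative h' x) (at x within S)"
    and inj: "inj_on h S"
  shows "(\<lambda>x. \<bar>det (matrix (h' x))\<bar> * f (h x)) absolutely_integrable_on S \<longleftrightarrow> f absolutely_integrable_on (h ` S)"
    and "f absolutely_integrable_on (h ` S) \<Longrightarrow>
      integral S (\<lambda>x. \<bar>det (matrix (h' x))\<bar> * f (h x)) = integral (h ` S) f"
proof -
  define S' where "S' = to_copy_vec ` S"
  define H where "H = (\<lambda>y. to_copy_vec (h (of_copy_vec y)))"
  define H' where "H' = (\<lambda>y v. to_copy_vec (h' (of_copy_vec y) (of_copy_vec v)))"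
  define F where "F = (\<lambda>y. f (of_copy_vec y))"
  have bl: "bounded_linear (to_copy_vec :: real ^ 'k \<Rightarrow> _)" "bounded_linear (of_copy_vec :: _ \<Rightarrow> real ^ 'k)"
    using linear_copy_vec unfolding linear_conv_bounded_linear by auto
  have S': "S' \<in> sets lebesgue"
    using measurable_sets[OF lebesgue_of_copy_vec(1) S] by (simp add: S'_def to_copy_vec_image)
  have im: "H ` S' = to_copy_vec ` (h ` S)"
    by (auto simp: S'_def H_def image_iff)
  have der': "(H has_derivative H' y) (at y within S')" if "y \<in> S'" for y
  proof -
    have "(h has_derivative h' (of_copy_vec y)) (at (of_copy_vec y) within of_copy_vec ` S')"
      using that der by (auto simp: S'_def image_image)
    from has_derivative_in_compose[OF bounded_linear_imp_has_derivative[OF bl(2)] this]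
    have "((\<lambda>y. h (of_copy_vec y)) has_derivative (\<lambda>v. h' (of_copy_vec y) (of_copy_vec v))) (at y within S')"
      by simp
    from bounded_linear.has_derivative[OF bl(1) this] show ?thesis
      by (simp add: H_def[abs_def] H'_def)
  qed
  have inj': "inj_on H S'"
  proof (rule inj_onI)
    fix y z assume yz: "y \<in> S'" "z \<in> S'" "H y = H z"
    then have "of_copy_vec y \<in> S" "of_copy_vec z \<in> S"
      by (auto simp: S'_def)
    moreover have "h (of_copy_vec y) = h (of_copy_vec z)"
      using arg_cong[OF yz(3), of of_copy_vec] by (simp add: H_def)
    ultimately have "of_copy_vec y = of_copy_vec z"
      using inj by (auto dest: inj_onD)
    then show "y = z"
      by (metis copy_vec_inverse(2))
  qed
  have det: "det (matrix (H' y)) = det (matrix (h' (of_copy_vec y)))" for y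
  proof -
    have ax: "of_copy_vec (axis j 1) = (axis (of_copy j) 1 :: real ^ 'k)" for j
      by (auto simp: vec_eq_iff of_copy_vec_def axis_def)
    have "matrix (H' y) = (\<chi> i j. matrix (h' (of_copy_vec y)) $ of_copy i $ of_copy j)"
      by (simp add: matrix_def H'_def to_copy_vec_def ax)
    then show ?thesis
      by (simp add: det_reindex[OF bij_of_copy])
  qed
  have key: "((\<lambda>y. \<bar>det (matrix (H' y))\<bar> *\<^sub>R (vec (F (H y)) :: real ^ 1)) absolutely_integrable_on S' \<and>
      integral S' (\<lambda>y. \<bar>det (matrix (H' y))\<bar> *\<^sub>R (vec (F (H y)) :: real ^ 1)) = b) \<longleftrightarrow>
      ((\<lambda>y. vec (F y) :: real ^ 1) absolutely_integrable_on H ` S' \<and> integral (H ` S') (\<lambda>y. vec (F y)) = b)" for b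
    by (rule has_absolute_integral_change_of_variables[OF S' der' inj', where f="\<lambda>y. vec (F y)"])
  have v: "\<bar>det (matrix (H' y))\<bar> *\<^sub>R (vec (F (H y)) :: real ^ 1)
      = vec (\<bar>det (matrix (h' (of_copy_vec y)))\<bar> * f (h (of_copy_vec y)))" for y
    by (simp add: vec_eq_iff F_def H_def det)
  show iff: "(\<lambda>x. \<bar>det (matrix (h' x))\<bar> * f (h x)) absolutely_integrable_on S \<longleftrightarrow> f absolutely_integrable_on (h ` S)"
    using key unfolding v unfolding integral_vec_1(1) im F_def
    unfolding S'_def integral_copy_vec(1)[where f="\<lambda>x. \<bar>det (matrix (h' x))\<bar> * f (h x)"] integral_copy_vec(1)[where f=f]
    by blast
  assume a: "f absolutely_integrable_on (h ` S)"
  have a': "F absolutely_integrable_on H ` S'"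
      "(\<lambda>y. \<bar>det (matrix (h' (of_copy_vec y)))\<bar> * f (h (of_copy_vec y))) absolutely_integrable_on S'"
    using a iff integral_copy_vec(1)[where f="\<lambda>x. \<bar>det (matrix (h' x))\<bar> * f (h x)"] integral_copy_vec(1)[where f=f]
    unfolding im unfolding F_def S'_def by auto
  have "vec (integral S' (\<lambda>y. \<bar>det (matrix (h' (of_copy_vec y)))\<bar> * f (h (of_copy_vec y)))) =
      (vec (integral (H ` S') F) :: real ^ 1)"
    using key[of "integral (H ` S') (\<lambda>y. vec (F y))"] a'
    unfolding v by (simp add: integral_vec_1 set_lebesgue_integral_eq_integral(1))
  then have "integral S' (\<lambda>y. \<bar>det (matrix (h' (of_copy_vec y)))\<bar> * f (h (of_copy_vec y))) = integral (H ` S') F"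
    by (simp add: vec_eq_iff)
  then show "integral S (\<lambda>x. \<bar>det (matrix (h' x))\<bar> * f (h x)) = integral (h ` S) f"
    using integral_copy_vec(2)[where f="\<lambda>x. \<bar>det (matrix (h' x))\<bar> * f (h x)" and S=S] integral_copy_vec(2)[OF a] a iff
    unfolding S'_def[symmetric] im[symmetric] unfolding F_def by simp
qed

subsection \<open>Integrals over a region with a moving wall\<close>

text \<open>Cramer's rule for the identity matrix. It yields the Jacobian of maps that alter the
  \<open>m\<close>-th coordinate only.\<close>

lemma det_one_row:
  fixes v :: "real ^ 'k::finite"
  shows "det (\<chi> i j. if i = m then v $ j else (if i = j then 1 else 0)) = v $ m"
proof -
  have "(\<chi> i j. if i = m then v $ j else (if i = j then 1 else 0)) =
     (\<chi> i. if i = m then (\<Sum>i\<in>UNIV. v $ i *s row i (mat 1 :: real ^ 'k ^ 'k)) else row i (mat 1))"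
    by (simp add: vec_eq_iff row_def mat_def if_distrib[of "(*) _"] cong: if_cong)
  then show ?thesis
    using cramer_lemma_transpose[of m v "mat 1 :: real ^ 'k ^ 'k"] by simp
qed

text \<open>With \<open>s = 0\<close> this is the orthogonal projection to the wall
  \<open>c $ m = 0\<close>. Functions on the wall are written as functions of
  \<open>reset m 0 c\<close>.\<close>

definition reset :: "'k \<Rightarrow> real \<Rightarrow> real ^ 'k::finite \<Rightarrow> real ^ 'k" where
  "reset m s c = (\<chi> i. if i = m then s else c $ i)"

lemma reset_nth [simp]: "reset m s c $ m = s" "i \<noteq> m \<Longrightarrow> reset m s c $ i = c $ i"
  by (simp_all add: reset_def)
lemma reset_reset [simp]: "reset m s (reset m r c) = reset m s c"
  by (simp add: reset_def vec_eq_iff)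

lemma reset_same [simp]: "reset m (c $ m) c = c"
  by (simp add: reset_def vec_eq_iff)


lemma continuous_reset [continuous_intros]:
  "continuous_on S f \<Longrightarrow> continuous_on S g \<Longrightarrow> continuous_on S (\<lambda>x. reset m (f x) (g x))"
  unfolding reset_def
proof (rule continuous_on_vec_lambda)
  fix i
  assume "continuous_on S f" "continuous_on S g"
  then show "continuous_on S (\<lambda>x. if i = m then f x else g x $ i)"
    by (cases "i = m") (auto intro!: continuous_intros)
qed

lemma integrable_bounded_support:
  fixes f :: "'a::euclidean_space \<Rightarrow> real"
  assumes f [measurable]: "f \<in> borel_measurable borel"
    and M: "\<And>c. \<bar>f c\<bar> \<le> M" and R: "\<And>c. R < norm c \<Longrightarrow> f c = 0"
  shows "integrable lborel f"
proof (rule Bochner_Integration.integrable_bound)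
  show "integrable lborel (\<lambda>c :: 'a. M * indicat_real (cball 0 R) c)"
    by (intro integrable_mult_right integrable_real_indicator) (use emeasure_lborel_cball_finite in \<open>auto simp: less_top\<close>)
  show "AE c in lborel. norm (f c) \<le> norm (M * indicat_real (cball 0 R) c)"
    using M R M[THEN order_trans[OF abs_ge_zero]] by (auto simp: indicator_def not_le abs_mult)
qed simp

text \<open>Scaling the \<open>m\<close>-th coordinate by \<open>q c\<close> maps the slab
  \<open>0 \<le> c $ m \<le> 1\<close> onto the region between the wall and the graph of
  \<open>q\<close>; as \<open>q\<close> ignores that coordinate, the Jacobian is \<open>q c\<close>.
  A thin region that varies with \<open>q\<close> is thus exchanged for a fixed slab, with the
  thickness in the integrand.\<close>

lemma shear_integral:
  fixes f :: "real ^ 'k::finite \<Rightarrow> real" and a :: "real ^ 'k" and b :: real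
  assumes f [measurable]: "f \<in> borel_measurable borel" and int: "integrable lborel f"
    and am: "a $ m = 0"
  defines "q \<equiv> \<lambda>c. b + a \<bullet> c"
  shows "(LINT c|lborel. f c * (of_bool (q c \<le> c $ m) - of_bool (0 \<le> c $ m))) =
    - (LINT c|lborel. q c * f (reset m (q c * c $ m) c) * of_bool (0 \<le> c $ m \<and> c $ m \<le> 1))"
proof -
  \<comment> \<open>The map collapses the segments with \<open>q c = 0\<close>; dropping them makes
    it injective, and the factor \<open>q c\<close> on the right-hand side vanishes there.\<close>
  define S where "S = {c. q c \<noteq> 0 \<and> 0 \<le> c $ m \<and> c $ m \<le> 1}"
  define h where "h = (\<lambda>c. reset m (q c * c $ m) c)"
  define h' where "h' = (\<lambda>c v. reset m (q c * v $ m + (a \<bullet> v) * c $ m) v)"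
  \<comment> \<open>The sign records whether the graph lies above the wall, so that the set between
    them is lost, or below, so that it is gained.\<close>
  define F where "F = (\<lambda>c. - sgn (q c) * f c)"
  have contq: "continuous_on UNIV q"
    unfolding q_def by (intro continuous_intros)
  have [measurable]: "q \<in> borel_measurable borel"
    by (rule borel_measurable_continuous_onI[OF contq])
  have contnth: "continuous_on UNIV (\<lambda>c :: real ^ 'k. c $ i)" for i
    by (intro continuous_intros)
  have [measurable]: "(\<lambda>c :: real ^ 'k. c $ i) \<in> borel_measurable borel" for i
    by (rule borel_measurable_continuous_onI[OF contnth])
  have "continuous_on UNIV h"
    unfolding h_def by (intro continuous_intros contq)
  then have [measurable]: "h \<in> borel \<rightarrow>\<^sub>M borel"
    by (rule borel_measurable_continuous_onI)
  have q_reset [simp]: "q (reset m s c) = q c" for s c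
    unfolding q_def inner_vec_def
    by (rule arg_cong[where f="\<lambda>x. b + x"], rule sum.cong) (use am in \<open>auto simp: reset_def\<close>)
  have Sb: "S \<in> sets borel"
    unfolding S_def by measurable
  then have S: "S \<in> sets lebesgue"
    by auto
  have comp: "(h c) $ i = (if i = m then q c * c $ m else c $ i)" for c i
    by (simp add: h_def reset_def)
  have der: "(h has_derivative h' c) (at c within S)" for c
  proof -
    have "((\<lambda>c. h c $ i) has_derivative (\<lambda>v. h' c v $ i)) (at c within S)" for i
      by (cases "i = m") (auto simp: h_def h'_def q_def intro!: derivative_eq_intros bounded_linear_imp_has_derivative[OF bounded_linear_vec_nth])
    then show ?thesis
      by (subst has_derivative_componentwise_within) (auto simp: Basis_vec_def inner_axis)
  qed
  have inj: "inj_on h S"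
  proof (rule inj_onI)
    fix c d assume cd: "c \<in> S" "d \<in> S" "h c = h d"
    have "q (h c) = q (h d)" using cd(3) by simp
    then have q: "q c = q d" by (simp add: h_def)
    have "c $ i = d $ i" for i
      using arg_cong[OF cd(3), of "\<lambda>x. x $ i"] cd q by (cases "i = m") (auto simp: h_def S_def)
    then show "c = d" by (simp add: vec_eq_iff)
  qed
  have det: "det (matrix (h' c)) = q c" for c
  proof -
    have "matrix (h' c) = (\<chi> i j. if i = m then (\<chi> j. if j = m then q c else a $ j * c $ m) $ j else (if i = j then 1 else 0))"
    proof -
      have "h' c (axis j 1) $ i = (if i = m then (\<chi> j. if j = m then q c else a $ j * c $ m) $ j else (if i = j then 1 else 0))" for i j
        using am by (cases "i = m"; cases "j = m"; simp add: h'_def inner_axis) (auto simp: axis_def)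
      then show ?thesis
        by (simp add: matrix_def)
    qed
    then show ?thesis
      by (simp add: det_one_row)
  qed
  have im: "h ` S = {c. q c \<noteq> 0 \<and> (0 \<le> c $ m \<and> c $ m \<le> q c \<or> q c \<le> c $ m \<and> c $ m \<le> 0)}" (is "_ = ?H")
  proof (intro subset_antisym subsetI)
    fix c assume "c \<in> h ` S"
    then obtain d where d: "d \<in> S" "c = h d" by auto
    then show "c \<in> ?H"
      by (cases "q d > 0") (auto simp: S_def h_def mult_left_le mult_le_0_iff zero_le_mult_iff mult_le_cancel_left2 not_less)
  next
    fix c assume c: "c \<in> ?H"
    define d where "d = reset m (c $ m / q c) c"
    have qd: "q d = q c" by (simp add: d_def)
    have "d \<in> S"
      using c by (auto simp: S_def qd) (auto simp: d_def divide_simps)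
    moreover have "h d = c"
      using c by (simp add: h_def qd) (simp add: d_def)
    ultimately show "c \<in> h ` S" by (metis image_eqI)
  qed
  have Hb: "?H \<in> sets borel" by measurable
  have [measurable]: "F \<in> borel_measurable borel"
    unfolding F_def by measurable
  have Fi: "integrable lborel F"
    by (rule Bochner_Integration.integrable_bound[OF int]) (auto simp: F_def abs_mult sgn_if)
  have setint: "set_integrable lborel ?H F"
    unfolding set_integrable_def
    by (rule integrable_mult_indicator) (use Hb Fi in auto)
  then have Fabs: "F absolutely_integrable_on (h ` S)"
    unfolding im using Hb by (simp add: set_integrable_def integrable_completion)
  have 1: "integral S (\<lambda>x. \<bar>det (matrix (h' x))\<bar> * F (h x)) = integral (h ` S) F"
    by (rule change_of_variables_cart(2)[OF S der inj Fabs])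
  have 2: "(\<lambda>x. \<bar>det (matrix (h' x))\<bar> * F (h x)) absolutely_integrable_on S"
    by (rule change_of_variables_cart(1)[OF S der inj, THEN iffD2, OF Fabs])
  have e2: "\<bar>det (matrix (h' x))\<bar> * F (h x) = - (q x * f (h x))" for x
  proof -
    have "q (h x) = q x" by (simp add: h_def)
    then show ?thesis by (simp add: det F_def abs_sgn sgn_if)
  qed
  have "(LINT c|lborel. f c * (of_bool (q c \<le> c $ m) - of_bool (0 \<le> c $ m))) =
    (LINT c|lborel. indicator ?H c * F c)"
  proof (rule integral_cong_AE)
    \<comment> \<open>Off the graph and the wall, which are hyperplanes, strict and weak
      inequalities agree.\<close>
    have n1: "negligible {c. (axis m 1 - a) \<bullet> c = b}"
      using am by (intro negligible_hyperplane) (auto simp: vec_eq_iff axis_def intro!: exI[of _ m])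
    have n2: "negligible {c :: real ^ 'k. axis m 1 \<bullet> c = 0}"
      by (intro negligible_hyperplane) (auto simp: vec_eq_iff axis_def)
    have "AE c in lborel. (axis m 1 - a) \<bullet> c \<noteq> b"
    proof (rule AE_I[where N="{c. (axis m 1 - a) \<bullet> c = b}"])
      show "emeasure lborel {c. (axis m 1 - a) \<bullet> c = b} = 0"
        using n1 by (auto simp: negligible_iff_null_sets null_sets_def emeasure_completion)
    qed auto
    moreover have "AE c in lborel. axis m 1 \<bullet> (c :: real ^ 'k) \<noteq> 0"
    proof (rule AE_I[where N="{c. axis m 1 \<bullet> c = 0}"])
      show "emeasure lborel {c :: real ^ 'k. axis m 1 \<bullet> c = 0} = 0"
        using n2 by (auto simp: negligible_iff_null_sets null_sets_def emeasure_completion)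
    qed auto
    ultimately show "AE c in lborel. f c * (of_bool (q c \<le> c $ m) - of_bool (0 \<le> c $ m)) = indicator ?H c * F c"
    proof eventually_elim
      case (elim c)
      have "c $ m \<noteq> q c" "c $ m \<noteq> 0"
        using elim by (auto simp: q_def inner_diff_left inner_axis' )
      then show ?case
        by (auto simp: F_def indicator_def sgn_if)
    qed
  qed measurable
  also have "\<dots> = integral (h ` S) F"
    using setint set_borel_integral_eq_integral(2)[of ?H F]
    by (simp add: im set_lebesgue_integral_def)
  also have "\<dots> = integral S (\<lambda>x. - (q x * f (h x)))"
    using 1 unfolding e2 by simp
  also have "\<dots> = (LINT x|lborel. indicator S x *\<^sub>R (- (q x * f (h x))))"
  proof -
    have "(\<lambda>x. indicator S x *\<^sub>R (- (q x * f (h x)))) \<in> borel_measurable lborel"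
      using Sb by measurable
    then have "set_integrable lborel S (\<lambda>x. - (q x * f (h x)))"
      using 2 unfolding e2 set_integrable_def by (simp add: integrable_completion)
    from set_borel_integral_eq_integral(2)[OF this] show ?thesis
      by (simp add: set_lebesgue_integral_def)
  qed
  also have "\<dots> = (LINT c|lborel. - (q c * f (reset m (q c * c $ m) c) * of_bool (0 \<le> c $ m \<and> c $ m \<le> 1)))"
    by (rule Bochner_Integration.integral_cong) (auto simp: S_def h_def indicator_def)
  finally show ?thesis by simp
qed


text \<open>After the shear, division by \<open>t\<close> affects only the factor
  \<open>b t + a t \<bullet> c\<close>, which tends to \<open>b' + a' \<bullet> c\<close> because
  \<open>a\<close> and \<open>b\<close> vanish at 0. The rest is bounded with bounded support, so
  dominated convergence needs only the almost everywhere limit of \<open>f t\<close> along points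
  approaching the wall.\<close>

lemma moving_graph_derivative:
  fixes f :: "real \<Rightarrow> real ^ 'k::finite \<Rightarrow> real" and a :: "real \<Rightarrow> real ^ 'k" and b :: "real \<Rightarrow> real"
  assumes f [measurable]: "\<And>t. f t \<in> borel_measurable borel"
    and M: "\<And>t c. \<bar>f t c\<bar> \<le> M" and R: "\<And>t c. R < norm c \<Longrightarrow> f t c = 0"
    and am: "\<And>t. a t $ m = 0"
    and a: "(a has_vector_derivative a') (at 0)" "a 0 = 0"
    and b: "(b has_real_derivative b') (at 0)" "b 0 = 0"
    and f0 [measurable]: "f0 \<in> borel_measurable borel"
    and lim: "AE c in lborel. 0 \<le> c $ m \<longrightarrow> c $ m \<le> 1 \<longrightarrow>
      ((\<lambda>t. f t (reset m ((b t + a t \<bullet> c) * c $ m) c)) \<longlongrightarrow> f0 c) (at 0)"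
  shows "((\<lambda>t. (LINT c|lborel. f t c * (of_bool (b t + a t \<bullet> c \<le> c $ m) - of_bool (0 \<le> c $ m))) / t)
    \<longlongrightarrow> - (LINT c|lborel. (b' + a' \<bullet> c) * f0 c * of_bool (0 \<le> c $ m \<and> c $ m \<le> 1))) (at 0)"
  \<comment> \<open>Dominated convergence speaks of sequences, so \<open>t\<close> runs through an
    arbitrary null sequence \<open>X\<close>.\<close>
  unfolding tendsto_at_iff_sequentially
proof (intro allI impI)
  fix X :: "nat \<Rightarrow> real" assume X: "\<forall>i. X i \<in> UNIV - {0}" and X0: "X \<longlonglongrightarrow> 0"
  have Xn: "X n \<noteq> 0" for n using X by simp
  have XF: "filterlim X (at 0) sequentially"
    using X0 X by (simp add: filterlim_at)
  have bl: "(\<lambda>n. b (X n) / X n) \<longlonglongrightarrow> b'"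
    using b filterlim_compose[OF _ XF, of "\<lambda>t. b t / t" "nhds b'"]
    by (simp add: has_field_derivative_iff o_def)
  have al: "(\<lambda>n. a (X n) /\<^sub>R X n) \<longlonglongrightarrow> a'"
  proof -
    have "((\<lambda>t. norm (a t - t *\<^sub>R a') / norm t) \<longlongrightarrow> 0) (at 0)"
      using a by (simp add: has_vector_derivative_def has_derivative_iff_norm)
    then have "(\<lambda>n. norm (a (X n) - X n *\<^sub>R a') / norm (X n)) \<longlonglongrightarrow> 0"
      by (rule filterlim_compose[OF _ XF])
    moreover have "norm (a (X n) - X n *\<^sub>R a') / norm (X n) = norm (a (X n) /\<^sub>R X n - a')" for n
    proof -
      have "a (X n) /\<^sub>R X n - a' = (a (X n) - X n *\<^sub>R a') /\<^sub>R X n"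
        using Xn[of n] by (simp add: scaleR_diff_right)
      then show ?thesis by (simp add: divide_inverse mult.commute)
    qed
    ultimately show ?thesis
      by (simp add: tendsto_norm_zero_iff Lim_null[of _ a'])
  qed
  obtain K where K: "\<And>n. \<bar>b (X n) / X n\<bar> \<le> K"
    using convergent_imp_Bseq[OF convergentI[OF bl]] by (auto simp: Bseq_def)
  obtain L where L: "\<And>n. norm (a (X n) /\<^sub>R X n) \<le> L"
    using convergent_imp_Bseq[OF convergentI[OF al]] by (auto simp: Bseq_def)
  have M0: "0 \<le> M" using M[of 0 0] by linarith
  have L0: "0 \<le> L" using order_trans[OF norm_ge_zero L[of 0]] .
  have K0: "0 \<le> K" using K[of 0] by linarith
  have contnth: "continuous_on UNIV (\<lambda>c :: real ^ 'k. c $ i)" for i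
    by (intro continuous_intros)
  have nth [measurable]: "(\<lambda>c :: real ^ 'k. c $ i) \<in> borel_measurable borel" for i
    by (rule borel_measurable_continuous_onI[OF contnth])
  have hc: "continuous_on UNIV (\<lambda>c :: real ^ 'k. reset m ((b t + a t \<bullet> c) * c $ m) c)" for t
    by (intro continuous_intros)
  have [measurable]: "(\<lambda>c :: real ^ 'k. reset m ((b t + a t \<bullet> c) * c $ m) c) \<in> borel \<rightarrow>\<^sub>M borel" for t
    by (rule borel_measurable_continuous_onI[OF hc])
  define s where "s = (\<lambda>n c. - (b (X n) / X n + (a (X n) /\<^sub>R X n) \<bullet> c) *
      f (X n) (reset m ((b (X n) + a (X n) \<bullet> c) * c $ m) c) * of_bool (0 \<le> c $ m \<and> c $ m \<le> 1))"
  have [measurable]: "s n \<in> borel_measurable borel" for n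
    unfolding s_def by measurable
  \<comment> \<open>The shear changes only the \<open>m\<close>-th coordinate, which lies between 0
    and 1 on the slab, so the preimage of the ball of radius \<open>R\<close> lies in one of radius
    \<open>R + 1\<close>.\<close>
  define R' where "R' = \<bar>R\<bar> + 1"
  have eq: "(LINT c|lborel. f (X n) c * (of_bool (b (X n) + a (X n) \<bullet> c \<le> c $ m) - of_bool (0 \<le> c $ m))) / X n
     = (LINT c|lborel. s n c)" for n
  proof -
    have int: "integrable lborel (f (X n))"
      by (rule integrable_bounded_support[OF f M R])
    have "s n c = - ((b (X n) + a (X n) \<bullet> c) * f (X n) (reset m ((b (X n) + a (X n) \<bullet> c) * c $ m) c) *
        of_bool (0 \<le> c $ m \<and> c $ m \<le> 1)) / X n" for c
    proof -
      have e: "b (X n) / X n + (a (X n) /\<^sub>R X n) \<bullet> c = (b (X n) + a (X n) \<bullet> c) / X n"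
        by (simp add: divide_inverse algebra_simps)
      show ?thesis unfolding s_def e by simp
    qed
    then show ?thesis
      using shear_integral[OF f int am, of "b (X n)"] by simp
  qed
  define w where "w = (\<lambda>c :: real ^ 'k. (K + L * R') * M * indicat_real (cball 0 R') c)"
  have bound: "\<bar>s n c\<bar> \<le> w c" for n c
  proof (cases "s n c = 0")
    case True
    then show ?thesis using M0 K0 L0 by (simp add: w_def R'_def)
  next
    case False
    let ?h = "reset m ((b (X n) + a (X n) \<bullet> c) * c $ m) c"
    have c01: "0 \<le> c $ m" "c $ m \<le> 1" and fn: "f (X n) ?h \<noteq> 0"
      using False by (auto simp: s_def split: if_splits)
    have nh: "norm ?h \<le> R" using R[of ?h "X n"] fn by (cases "norm ?h \<le> R") auto
    have "norm c \<le> norm ?h + 1"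
    proof -
      have "c - ?h = (c $ m - ?h $ m) *\<^sub>R axis m 1"
        by (simp add: vec_eq_iff reset_def axis_def)
      have "norm (reset m 0 c) \<le> norm ?h"
        by (rule norm_le_componentwise_cart) (simp add: reset_def)
      moreover have "c = reset m 0 c + c $ m *\<^sub>R axis m 1"
        by (simp add: vec_eq_iff reset_def axis_def)
      then have "norm c \<le> norm (reset m 0 c) + norm (c $ m *\<^sub>R axis m (1::real))"
        by (metis norm_triangle_ineq)
      moreover have "norm (c $ m *\<^sub>R (axis m (1::real) :: real ^ 'k)) \<le> 1"
        using c01 by (simp add: norm_axis_1)
      ultimately show ?thesis by linarith
    qed
    then have nc: "norm c \<le> R'" using nh by (simp add: R'_def)
    have "\<bar>(a (X n) /\<^sub>R X n) \<bullet> c\<bar> \<le> L * R'"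
      by (rule order_trans[OF Cauchy_Schwarz_ineq2]) (intro mult_mono L nc L0 norm_ge_zero)
    then have "\<bar>b (X n) / X n + (a (X n) /\<^sub>R X n) \<bullet> c\<bar> \<le> K + L * R'"
      using K[of n] by linarith
    then have "\<bar>b (X n) / X n + (a (X n) /\<^sub>R X n) \<bullet> c\<bar> * \<bar>f (X n) ?h\<bar> \<le> (K + L * R') * M"
      by (intro mult_mono M) (use K0 L0 in \<open>auto simp: R'_def\<close>)
    moreover have "\<bar>s n c\<bar> = \<bar>b (X n) / X n + (a (X n) /\<^sub>R X n) \<bullet> c\<bar> * \<bar>f (X n) ?h\<bar>"
      unfolding s_def abs_mult abs_minus_cancel using c01 by simp
    ultimately show ?thesis
      using nc by (simp add: w_def)
  qed
  have wi: "integrable lborel w"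
    unfolding w_def using emeasure_lborel_cball_finite[of 0 R']
    by (intro integrable_mult_right integrable_real_indicator) (auto simp: less_top)
  have "AE c in lborel. (\<lambda>n. s n c) \<longlonglongrightarrow> - (b' + a' \<bullet> c) * f0 c * of_bool (0 \<le> c $ m \<and> c $ m \<le> 1)"
    using lim
  proof eventually_elim
    case (elim c)
    show ?case
    proof (cases "0 \<le> c $ m \<and> c $ m \<le> 1")
      case True
      then have "(\<lambda>n. f (X n) (reset m ((b (X n) + a (X n) \<bullet> c) * c $ m) c)) \<longlonglongrightarrow> f0 c"
        using elim filterlim_compose[OF _ XF] by fast
      then show ?thesis
        unfolding s_def by (intro tendsto_intros bl al)
    qed (auto simp: s_def)
  qed
  then have "(\<lambda>n. LINT c|lborel. s n c) \<longlonglongrightarrow>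
      (LINT c|lborel. - (b' + a' \<bullet> c) * f0 c * of_bool (0 \<le> c $ m \<and> c $ m \<le> 1))"
    by (rule integral_dominated_convergence[where w=w, rotated -2]) (use bound wi in \<open>auto simp: w_def\<close>)
  then show "((\<lambda>t. (LINT c|lborel. f t c * (of_bool (b t + a t \<bullet> c \<le> c $ m) - of_bool (0 \<le> c $ m))) / t) \<circ> X)
     \<longlonglongrightarrow> - (LINT c|lborel. (b' + a' \<bullet> c) * f0 c * of_bool (0 \<le> c $ m \<and> c $ m \<le> 1))"
    unfolding o_def eq mult_minus_left by (simp only: Bochner_Integration.integral_minus)
qed

subsection \<open>Perturbation to second order\<close>

text \<open>Basis vectors among the images \<open>S (X j 0)\<close> are lifted to the moved points
  \<open>X j t\<close>. The composite of this lift with \<open>S\<close> is within 1/2 of the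
  identity for small \<open>t\<close>, hence invertible; composing the lift with the inverse
  restores an exact section, whose range lies in the moved span and which has moved by
  \<open>O(t)\<close> only.\<close>

lemma perturbed_section:
  fixes S :: "'e::euclidean_space \<Rightarrow> 'v::euclidean_space" and P0 :: "'v \<Rightarrow> 'e" and X :: "'j \<Rightarrow> real \<Rightarrow> 'e"
  assumes S: "linear S" and P0: "linear P0" and J: "finite J"
    and X0: "\<And>j. j \<in> J \<Longrightarrow> P0 (S (X j 0)) = X j 0"
    and sp: "span ((\<lambda>j. S (X j 0)) ` J) = UNIV"
    and lip: "\<And>j. j \<in> J \<Longrightarrow> \<exists>C d. d > 0 \<and> (\<forall>t. \<bar>t\<bar> < d \<longrightarrow> norm (X j t - X j 0) \<le> C * \<bar>t\<bar>)"
  shows "\<exists>C d. d > 0 \<and> C \<ge> 0 \<and> (\<forall>t. \<bar>t\<bar> < d \<longrightarrow> (\<exists>P. linear P \<and> range P \<subseteq> span ((\<lambda>j. X j t) ` J) \<and>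
    (\<forall>v. S (P v) = v) \<and> (\<forall>v. norm (P v - P0 v) \<le> C * \<bar>t\<bar> * norm v)))"
proof -
  obtain B where B: "B \<subseteq> (\<lambda>j. S (X j 0)) ` J" "independent B" "span B = UNIV"
  proof -
    obtain B where B: "B \<subseteq> (\<lambda>j. S (X j 0)) ` J" "independent B" "(\<lambda>j. S (X j 0)) ` J \<subseteq> span B"
      by (rule maximal_independent_subset)
    have "span B = UNIV"
      using span_minimal[OF B(3) subspace_span] sp by auto
    then show thesis using B that by blast
  qed
  have finB: "finite B" using B(1) J finite_surj by blast
  obtain jj where jj: "\<And>b. b \<in> B \<Longrightarrow> jj b \<in> J \<and> S (X (jj b) 0) = b"
  proof -
    have "\<forall>b\<in>B. \<exists>j. j \<in> J \<and> S (X j 0) = b" using B(1) by auto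
    then show thesis using that by (auto dest!: bchoice)
  qed
  define co where "co = (\<lambda>b v. representation B v b)"
  have co_lin: "linear (co b)" for b
    unfolding co_def by (rule linearI)
      (simp_all add: representation_add representation_scale B)
  have co_sum: "(\<Sum>b\<in>B. co b v *\<^sub>R b) = v" for v
    unfolding co_def using sum_representation_eq[OF B(2) _ finB order_refl] B(3) by auto
  have "\<forall>b\<in>B. \<exists>K. \<forall>v. \<bar>co b v\<bar> \<le> K * norm v"
    using linear_bounded[OF co_lin] by (auto simp: real_norm_def)
  then obtain K0 where K0: "\<And>b v. b \<in> B \<Longrightarrow> \<bar>co b v\<bar> \<le> K0 b * norm v"
    by (auto dest!: bchoice)
  define K where "K = (\<Sum>b\<in>B. \<bar>K0 b\<bar>)"
  have K: "\<bar>co b v\<bar> \<le> K * norm v" if "b \<in> B" for b v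
  proof -
    have "K0 b \<le> K" unfolding K_def using member_le_sum[OF that, of "\<lambda>b. \<bar>K0 b\<bar>"] finB by auto
    then have "K0 b * norm v \<le> K * norm v" by (intro mult_right_mono) auto
    then show ?thesis using K0[OF that, of v] by linarith
  qed
  have K_0: "0 \<le> K" unfolding K_def by (simp add: sum_nonneg)
  have "\<forall>b\<in>B. \<exists>C d. d > 0 \<and> (\<forall>t. \<bar>t\<bar> < d \<longrightarrow> norm (X (jj b) t - X (jj b) 0) \<le> C * \<bar>t\<bar>)"
    using lip jj by blast
  then obtain Cb db where Cb: "\<And>b. b \<in> B \<Longrightarrow> db b > 0"
    "\<And>b t. b \<in> B \<Longrightarrow> \<bar>t\<bar> < db b \<Longrightarrow> norm (X (jj b) t - X (jj b) 0) \<le> Cb b * \<bar>t\<bar>" by metis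
  define C0 where "C0 = (\<Sum>b\<in>B. \<bar>Cb b\<bar>)"
  define d0 where "d0 = Min (insert 1 (db ` B))"
  have d0: "d0 > 0" unfolding d0_def using Cb(1) finB by (subst Min_gr_iff) auto
  have X: "norm (X (jj b) t - X (jj b) 0) \<le> C0 * \<bar>t\<bar>" if "b \<in> B" "\<bar>t\<bar> < d0" for b t
  proof -
    have "d0 \<le> db b" unfolding d0_def using that finB by (intro Min_le) auto
    then have "norm (X (jj b) t - X (jj b) 0) \<le> Cb b * \<bar>t\<bar>" using Cb(2) that by simp
    also have "Cb b \<le> C0" unfolding C0_def using member_le_sum[OF that(1), of "\<lambda>b. \<bar>Cb b\<bar>"] finB by auto
    then have "Cb b * \<bar>t\<bar> \<le> C0 * \<bar>t\<bar>" by (intro mult_right_mono) auto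
    finally show ?thesis .
  qed
  have C0_0: "0 \<le> C0" unfolding C0_def by (simp add: sum_nonneg)
  define R where "R = (\<lambda>t v. \<Sum>b\<in>B. co b v *\<^sub>R X (jj b) t)"
  have R_lin: "linear (R t)" for t
    unfolding R_def by (rule linearI)
      (simp_all add: linear_add[OF co_lin] linear_scale[OF co_lin] scaleR_add_left sum.distrib scaleR_sum_right)
  have R0: "R 0 v = P0 v" for v
  proof -
    have "P0 v = P0 (\<Sum>b\<in>B. co b v *\<^sub>R b)" by (simp add: co_sum)
    also have "\<dots> = (\<Sum>b\<in>B. co b v *\<^sub>R P0 b)"
      by (simp add: linear_sum[OF P0] linear_scale[OF P0])
    also have "\<dots> = R 0 v"
      unfolding R_def
    proof (intro sum.cong refl)
      fix b assume "b \<in> B"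
      then show "co b v *\<^sub>R P0 b = co b v *\<^sub>R X (jj b) 0"
        using X0[of "jj b"] jj[of b] by simp
    qed
    finally show ?thesis ..
  qed
  define C1 where "C1 = real (card B) * K * C0"
  have C1_0: "0 \<le> C1" unfolding C1_def using K_0 C0_0 by simp
  have Rd: "norm (R t v - R 0 v) \<le> C1 * \<bar>t\<bar> * norm v" if "\<bar>t\<bar> < d0" for t v
  proof -
    have "norm (R t v - R 0 v) = norm (\<Sum>b\<in>B. co b v *\<^sub>R (X (jj b) t - X (jj b) 0))"
      unfolding R_def by (simp add: scaleR_diff_right sum_subtractf)
    also have "\<dots> \<le> (\<Sum>b\<in>B. (K * norm v) * (C0 * \<bar>t\<bar>))"
      by (intro sum_norm_le) (use K X that K_0 in \<open>auto intro!: mult_mono\<close>)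
    also have "\<dots> = C1 * \<bar>t\<bar> * norm v" by (simp add: C1_def)
    finally show ?thesis .
  qed
  obtain S1 where S1: "S1 > 0" "\<And>e. norm (S e) \<le> S1 * norm e"
    using linear_bounded_pos[OF S] by blast
  obtain Q where Q: "Q > 0" "\<And>v. norm (P0 v) \<le> Q * norm v"
    using linear_bounded_pos[OF P0] by blast
  \<comment> \<open>This bound on \<open>t\<close> gives
    \<open>S1 * C1 * \<bar>t\<bar> \<le> 1 / 2\<close>, the margin that makes \<open>A\<close>
    injective.\<close>
  define d where "d = min d0 (1 / (2 * (S1 * C1 + 1)))"
  have den: "S1 * C1 + 1 > 0" using S1 C1_0 by (simp add: add_nonneg_pos)
  have d: "d > 0" unfolding d_def using d0 den by simp
  have SP0: "S (P0 v) = v" for v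
  proof -
    have "linear (\<lambda>v. S (P0 v))" using linear_compose[OF P0 S] by (simp add: o_def)
    moreover have "S (P0 b) = b" if "b \<in> B" for b using jj[OF that] X0[of "jj b"] by simp
    ultimately show ?thesis
      using linear_eq_on_span[of "\<lambda>v. S (P0 v)" id B v] B(3) by (simp add: linear_id[unfolded id_def] id_def)
  qed
  \<comment> \<open>The factor 2 comes from \<open>norm w \<le> 2 * norm v\<close> for the preimage
    \<open>w\<close> of \<open>v\<close> under \<open>A\<close>; the two summands bound the motion
    of the lift and the correction \<open>P0 (w - v)\<close>.\<close>
  define C where "C = 2 * C1 + 2 * Q * S1 * C1"
  show ?thesis
  proof (rule exI[of _ C], rule exI[of _ d], intro conjI allI impI)
    show "d > 0" by (rule d)
    show "C \<ge> 0" unfolding C_def using C1_0 Q S1 by simp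
    fix t :: real assume t: "\<bar>t\<bar> < d"
    then have td0: "\<bar>t\<bar> < d0" by (simp add: d_def)
    have half: "S1 * C1 * \<bar>t\<bar> \<le> 1 / 2"
    proof -
      have "\<bar>t\<bar> \<le> 1 / (2 * (S1 * C1 + 1))" using t by (simp add: d_def)
      then have "(S1 * C1 + 1) * \<bar>t\<bar> \<le> (S1 * C1 + 1) * (1 / (2 * (S1 * C1 + 1)))"
        using den by (intro mult_left_mono) auto
      also have "\<dots> = 1/2" using den by (simp add: field_simps)
      finally show ?thesis by (simp add: algebra_simps)
    qed
    define A where "A = (\<lambda>v. S (R t v))"
    have A: "linear A" unfolding A_def using linear_compose[OF R_lin S] by (simp add: o_def)
    have Av: "norm (A v - v) \<le> S1 * C1 * \<bar>t\<bar> * norm v" for v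
    proof -
      have "A v - v = S (R t v - R 0 v)"
        unfolding A_def by (simp add: linear_diff[OF S] R0 SP0)
      then have "norm (A v - v) \<le> S1 * norm (R t v - R 0 v)" using S1 by simp
      also have "\<dots> \<le> S1 * (C1 * \<bar>t\<bar> * norm v)" using Rd[OF td0] S1 by (intro mult_left_mono) auto
      finally show ?thesis by (simp add: mult.assoc)
    qed
    have half_v: "norm (A v - v) \<le> norm v / 2" for v
      using Av[of v] mult_right_mono[OF half, of "norm v"] by simp
    have low: "norm v \<le> 2 * norm (A v)" for v
      using half_v[of v] norm_triangle_ineq2[of v "A v"] norm_minus_commute[of v "A v"] by simp
    have "inj A"
    proof (subst linear_injective_0[OF A], intro allI impI)
      fix v assume "A v = 0" then show "v = 0" using low[of v] by simp
    qed
    then obtain A' where A': "linear A'" "\<And>x. A (A' x) = x"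
      using linear_injective_isomorphism[OF A] by blast
    show "\<exists>P. linear P \<and> range P \<subseteq> span ((\<lambda>j. X j t) ` J) \<and>
        (\<forall>v. S (P v) = v) \<and> (\<forall>v. norm (P v - P0 v) \<le> C * \<bar>t\<bar> * norm v)"
    proof (intro exI[of _ "\<lambda>v. R t (A' v)"] conjI allI)
      show "linear (\<lambda>v. R t (A' v))" using linear_compose[OF A'(1) R_lin] by (simp add: o_def)
      show "range (\<lambda>v. R t (A' v)) \<subseteq> span ((\<lambda>j. X j t) ` J)"
        unfolding R_def by (intro image_subsetI span_sum span_scale span_base imageI) (use jj in auto)
      show "S (R t (A' v)) = v" for v using A'(2) by (simp add: A_def)
      show "norm (R t (A' v) - P0 v) \<le> C * \<bar>t\<bar> * norm v" for v
      proof -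
        define w where "w = A' v"
        have w: "A w = v" by (simp add: w_def A')
        have nw: "norm w \<le> 2 * norm v" using low[of w] w by simp
        have "R t w - P0 v = (R t w - R 0 w) + P0 (w - v)"
          by (simp add: R0 linear_diff[OF P0])
        then have "norm (R t w - P0 v) \<le> norm (R t w - R 0 w) + norm (P0 (w - v))"
          by (simp only: norm_triangle_ineq)
        also have "\<dots> \<le> C1 * \<bar>t\<bar> * norm w + Q * (S1 * C1 * \<bar>t\<bar> * norm w)"
        proof (intro add_mono Rd td0)
          have "norm (P0 (w - v)) \<le> Q * norm (w - v)" by (rule Q)
          also have "\<dots> \<le> Q * (S1 * C1 * \<bar>t\<bar> * norm w)"
            using Av[of w] Q(1) w by (intro mult_left_mono) (auto simp: norm_minus_commute)
          finally show "norm (P0 (w - v)) \<le> Q * (S1 * C1 * \<bar>t\<bar> * norm w)" .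
        qed
        also have "\<dots> = (C1 + Q * S1 * C1) * \<bar>t\<bar> * norm w" by (simp add: algebra_simps)
        also have "\<dots> \<le> (C1 + Q * S1 * C1) * \<bar>t\<bar> * (2 * norm v)"
          using nw C1_0 Q S1 by (intro mult_left_mono) auto
        also have "\<dots> = C * \<bar>t\<bar> * norm v" by (simp add: C_def algebra_simps)
        finally show ?thesis by (simp add: w_def)
      qed
    qed
  qed
qed

text \<open>Agreement with the value at \<open>t = 0\<close> to second order, uniformly on
  \<open>B\<close>: no linear term in \<open>t\<close>. The bound on \<open>f 0\<close> is included
  so that products stay in the class.\<close>

definition quad_close :: "'c set \<Rightarrow> (real \<Rightarrow> 'c \<Rightarrow> real) \<Rightarrow> bool" where
  "quad_close B f \<longleftrightarrow> (\<exists>C d. d > 0 \<and> (\<forall>t c. \<bar>t\<bar> < d \<longrightarrow> c \<in> B \<longrightarrow> \<bar>f t c - f 0 c\<bar> \<le> C * t\<^sup>2 \<and> \<bar>f 0 c\<bar> \<le> C))"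

lemma quad_closeE:
  assumes "quad_close B f"
  obtains C d where "d > 0" "C \<ge> 0" "d \<le> 1"
    "\<And>t c. \<bar>t\<bar> < d \<Longrightarrow> c \<in> B \<Longrightarrow> \<bar>f t c - f 0 c\<bar> \<le> C * t\<^sup>2" "\<And>c. c \<in> B \<Longrightarrow> \<bar>f 0 c\<bar> \<le> C"
    "\<And>t c. \<bar>t\<bar> < d \<Longrightarrow> c \<in> B \<Longrightarrow> \<bar>f t c\<bar> \<le> 2 * C"
proof -
  obtain C d where C: "d > 0" "\<And>t c. \<bar>t\<bar> < d \<Longrightarrow> c \<in> B \<Longrightarrow> \<bar>f t c - f 0 c\<bar> \<le> C * t\<^sup>2 \<and> \<bar>f 0 c\<bar> \<le> C"
    using assms by (auto simp: quad_close_def)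
  have 1: "\<bar>f t c - f 0 c\<bar> \<le> \<bar>C\<bar> * t\<^sup>2" "\<bar>f 0 c\<bar> \<le> \<bar>C\<bar>" if "\<bar>t\<bar> < min d 1" "c \<in> B" for t c
    using C(2)[of t c] that mult_right_mono[OF abs_ge_self[of C], of "t\<^sup>2"] by auto
  have 2: "\<bar>f t c\<bar> \<le> 2 * \<bar>C\<bar>" if "\<bar>t\<bar> < min d 1" "c \<in> B" for t c
  proof -
    have "t\<^sup>2 \<le> 1" using that by (simp add: abs_square_le_1)
    then have "\<bar>C\<bar> * t\<^sup>2 \<le> \<bar>C\<bar>" by (simp add: mult_left_le)
    then show ?thesis using 1[OF that] by linarith
  qed
  show thesis
    by (rule that[of "min d 1" "\<bar>C\<bar>"]) (use C(1) 1 2 1(2)[of 0] in auto)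
qed

lemma quad_close_const:
  assumes "\<And>c. c \<in> B \<Longrightarrow> \<bar>g c\<bar> \<le> C"
  shows "quad_close B (\<lambda>t. g)"
  unfolding quad_close_def
proof (rule exI[of _ "\<bar>C\<bar>"], rule exI[of _ 1], intro conjI allI impI)
  fix c assume "c \<in> B" then show "\<bar>g c\<bar> \<le> \<bar>C\<bar>" using assms[of c] by linarith
qed auto

lemma quad_close_add:
  assumes "quad_close B f" "quad_close B g"
  shows "quad_close B (\<lambda>t c. f t c + g t c)"
proof -
  from assms(1) obtain C d where C: "d > 0" "C \<ge> 0" "d \<le> 1"
    "\<And>t c. \<bar>t\<bar> < d \<Longrightarrow> c \<in> B \<Longrightarrow> \<bar>f t c - f 0 c\<bar> \<le> C * t\<^sup>2" "\<And>c. c \<in> B \<Longrightarrow> \<bar>f 0 c\<bar> \<le> C"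
    by (rule quad_closeE) blast
  from assms(2) obtain C' d' where C': "d' > 0" "C' \<ge> 0" "d' \<le> 1"
    "\<And>t c. \<bar>t\<bar> < d' \<Longrightarrow> c \<in> B \<Longrightarrow> \<bar>g t c - g 0 c\<bar> \<le> C' * t\<^sup>2" "\<And>c. c \<in> B \<Longrightarrow> \<bar>g 0 c\<bar> \<le> C'"
    by (rule quad_closeE) blast
  show ?thesis
    unfolding quad_close_def
  proof (rule exI[of _ "C + C'"], rule exI[of _ "min d d'"], intro conjI allI impI)
    fix t c assume "\<bar>t\<bar> < min d d'" "c \<in> B"
    then show "\<bar>f t c + g t c - (f 0 c + g 0 c)\<bar> \<le> (C + C') * t\<^sup>2" "\<bar>f 0 c + g 0 c\<bar> \<le> C + C'"
      using C(4)[of t c] C'(4)[of t c] C(5)[of c] C'(5)[of c] by (auto simp: distrib_right)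
  qed (use C C' in auto)
qed

lemma quad_close_mult:
  assumes "quad_close B f" "quad_close B g"
  shows "quad_close B (\<lambda>t c. f t c * g t c)"
proof -
  from assms(1) obtain C d where C: "d > 0" "C \<ge> 0" "d \<le> 1"
    "\<And>t c. \<bar>t\<bar> < d \<Longrightarrow> c \<in> B \<Longrightarrow> \<bar>f t c - f 0 c\<bar> \<le> C * t\<^sup>2" "\<And>c. c \<in> B \<Longrightarrow> \<bar>f 0 c\<bar> \<le> C"
    by (rule quad_closeE) blast
  from assms(2) obtain C' d' where C': "d' > 0" "C' \<ge> 0" "d' \<le> 1"
    "\<And>t c. \<bar>t\<bar> < d' \<Longrightarrow> c \<in> B \<Longrightarrow> \<bar>g t c - g 0 c\<bar> \<le> C' * t\<^sup>2" "\<And>c. c \<in> B \<Longrightarrow> \<bar>g 0 c\<bar> \<le> C'"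
     "\<And>t c. \<bar>t\<bar> < d' \<Longrightarrow> c \<in> B \<Longrightarrow> \<bar>g t c\<bar> \<le> 2 * C'"
    by (rule quad_closeE) blast
  show ?thesis
    unfolding quad_close_def
  proof (rule exI[of _ "3 * C * C'"], rule exI[of _ "min d d'"], intro conjI allI impI)
    fix t c assume t: "\<bar>t\<bar> < min d d'" "c \<in> B"
    have "\<bar>f t c * g t c - f 0 c * g 0 c\<bar> = \<bar>(f t c - f 0 c) * g t c + f 0 c * (g t c - g 0 c)\<bar>"
      by (simp add: algebra_simps)
    also have "\<dots> \<le> \<bar>f t c - f 0 c\<bar> * \<bar>g t c\<bar> + \<bar>f 0 c\<bar> * \<bar>g t c - g 0 c\<bar>"
      by (simp only: abs_mult[symmetric] abs_triangle_ineq)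
    also have "\<dots> \<le> (C * t\<^sup>2) * (2 * C') + C * (C' * t\<^sup>2)"
      using t C C' by (intro add_mono mult_mono) auto
    also have "\<dots> = 3 * C * C' * t\<^sup>2" by (simp add: algebra_simps)
    finally show "\<bar>f t c * g t c - f 0 c * g 0 c\<bar> \<le> 3 * C * C' * t\<^sup>2" .
    have "\<bar>f 0 c * g 0 c\<bar> \<le> C * C'"
      unfolding abs_mult using t C C' by (intro mult_mono) auto
    also have "\<dots> \<le> 3 * C * C'" using C(2) C'(2) by simp
    finally show "\<bar>f 0 c * g 0 c\<bar> \<le> 3 * C * C'" .
  qed (use C C' in auto)
qed

lemma quad_close_uminus: "quad_close B f \<Longrightarrow> quad_close B (\<lambda>t c. - f t c)"
  using quad_close_mult[OF quad_close_const[of B "\<lambda>c. -1" 1], of f] by simp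

lemma quad_close_diff: "quad_close B f \<Longrightarrow> quad_close B g \<Longrightarrow> quad_close B (\<lambda>t c. f t c - g t c)"
  using quad_close_add[OF _ quad_close_uminus[of B g], of f] by simp

lemma quad_close_sum:
  "(\<And>i. i \<in> I \<Longrightarrow> quad_close B (f i)) \<Longrightarrow> quad_close B (\<lambda>t c. \<Sum>i\<in>I. f i t c)"
  by (induction I rule: infinite_finite_induct)
    (auto intro!: quad_close_add quad_close_const[where C=0])

lemma quad_close_prod:
  "(\<And>i. i \<in> I \<Longrightarrow> quad_close B (f i)) \<Longrightarrow> quad_close B (\<lambda>t c. \<Prod>i\<in>I. f i t c)"
  by (induction I rule: infinite_finite_induct)
    (auto intro!: quad_close_mult quad_close_const[where C=1])

lemma quad_close_det:
  fixes A :: "real \<Rightarrow> 'c \<Rightarrow> real ^ 'k::finite ^ 'k"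
  assumes "\<And>i j. quad_close B (\<lambda>t c. A t c $ i $ j)"
  shows "quad_close B (\<lambda>t c. det (A t c))"
  unfolding det_def
  by (intro quad_close_sum quad_close_mult quad_close_prod assms quad_close_const[where C=1])
    (auto simp: sign_def)

lemma quad_close_inverse:
  assumes "quad_close B f" and m: "m > 0" "\<And>c. c \<in> B \<Longrightarrow> \<bar>f 0 c\<bar> \<ge> m"
  shows "quad_close B (\<lambda>t c. inverse (f t c))"
proof -
  from assms(1) obtain C d where C: "d > 0" "C \<ge> 0" "d \<le> 1"
    "\<And>t c. \<bar>t\<bar> < d \<Longrightarrow> c \<in> B \<Longrightarrow> \<bar>f t c - f 0 c\<bar> \<le> C * t\<^sup>2" "\<And>c. c \<in> B \<Longrightarrow> \<bar>f 0 c\<bar> \<le> C"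
    by (rule quad_closeE) blast
  \<comment> \<open>Since \<open>t\<^sup>2 \<le> \<bar>t\<bar>\<close> here, the deviation is at
    most \<open>m / 2\<close> and \<open>f t c\<close> stays away from 0.\<close>
  define d' where "d' = min d (m / (2 * (C + 1)))"
  have d': "d' > 0" using C m by (simp add: d'_def)
  define D where "D = 2 * C / m\<^sup>2 + 1 / m"
  show ?thesis
    unfolding quad_close_def
  proof (rule exI[of _ D], rule exI[of _ d'], intro conjI allI impI)
    fix t c assume t: "\<bar>t\<bar> < d'" "c \<in> B"
    have "C * t\<^sup>2 \<le> C * \<bar>t\<bar>"
    proof -
      have "\<bar>t\<bar> * \<bar>t\<bar> \<le> 1 * \<bar>t\<bar>" using t C by (intro mult_right_mono) (auto simp: d'_def)
      then show ?thesis using C(2) by (intro mult_left_mono) (auto simp: power2_eq_square)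
    qed
    also have "\<dots> \<le> (C + 1) * (m / (2 * (C + 1)))"
      using t C by (intro mult_mono) (auto simp: d'_def)
    also have "\<dots> = m / 2" using C(2) by (simp add: field_simps)
    finally have "C * t\<^sup>2 \<le> m / 2" .
    then have ft: "\<bar>f t c - f 0 c\<bar> \<le> C * t\<^sup>2" "\<bar>f t c\<bar> \<ge> m / 2"
      using C(4)[of t c] t m(2)[of c] by (auto simp: d'_def)
    have nz: "f t c \<noteq> 0" "f 0 c \<noteq> 0" using ft m m(2)[OF t(2)] by auto
    have "\<bar>inverse (f t c) - inverse (f 0 c)\<bar> = \<bar>f t c - f 0 c\<bar> / (\<bar>f t c\<bar> * \<bar>f 0 c\<bar>)"
    proof -
      have "inverse (f t c) - inverse (f 0 c) = (f 0 c - f t c) / (f t c * f 0 c)"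
        using nz by (simp add: field_simps)
      then show ?thesis by (simp only: abs_divide abs_mult abs_minus_commute)
    qed
    also have "\<dots> \<le> (C * t\<^sup>2) / (m / 2 * m)"
      using ft m(1) m(2)[OF t(2)] C by (intro frac_le mult_mono mult_pos_pos) auto
    also have "\<dots> = 2 * C / m\<^sup>2 * t\<^sup>2" by (simp add: power2_eq_square)
    also have "\<dots> \<le> D * t\<^sup>2" unfolding D_def using m by (intro mult_right_mono) auto
    finally show "\<bar>inverse (f t c) - inverse (f 0 c)\<bar> \<le> D * t\<^sup>2" .
    have "\<bar>inverse (f 0 c)\<bar> \<le> 1 / m"
      using m(1) m(2)[OF t(2)] by (simp add: inverse_eq_divide frac_le)
    then show "\<bar>inverse (f 0 c)\<bar> \<le> D" unfolding D_def using C m by (simp add: add_increasing)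
  qed (use d' in auto)
qed

text \<open>\<open>sqrt\<close> is extended to negative numbers as an odd function. The hypothesis
  gives \<open>x\<close> and \<open>y\<close> the same sign, so the negative case reduces to the
  positive one.\<close>

lemma sqrt_diff_le:
  fixes x y :: real
  assumes "\<bar>x - y\<bar> < \<bar>y\<bar>"
  shows "\<bar>sqrt x - sqrt y\<bar> \<le> \<bar>x - y\<bar> / sqrt \<bar>y\<bar>"
proof -
  have *: "\<bar>sqrt x - sqrt y\<bar> \<le> \<bar>x - y\<bar> / sqrt y" if "y > 0" "x > 0" for x y :: real
  proof -
    have "\<bar>x - y\<bar> = \<bar>sqrt x - sqrt y\<bar> * (sqrt x + sqrt y)"
    proof -
      have "x - y = (sqrt x - sqrt y) * (sqrt x + sqrt y)"
        using that by (simp add: algebra_simps)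
      then show ?thesis using that by (simp add: abs_mult)
    qed
    also have "\<dots> \<ge> \<bar>sqrt x - sqrt y\<bar> * sqrt y"
      using that by (intro mult_left_mono) auto
    finally show ?thesis using that by (simp add: field_simps)
  qed
  show ?thesis
  proof (cases "y > 0")
    case True then show ?thesis using assms *[of y x] by auto
  next
    case False
    then have "y < 0" "x < 0" using assms by auto
    then show ?thesis using *[of "-y" "-x"] by (simp add: real_sqrt_minus abs_minus_commute)
  qed
qed

text \<open>The lower bound concerns \<open>\<bar>f 0 c\<bar>\<close>, so for a Gram determinant on
  a compact set it is enough to know that it does not vanish.\<close>

lemma quad_close_sqrt:
  assumes "quad_close B f" and m: "m > 0" "\<And>c. c \<in> B \<Longrightarrow> \<bar>f 0 c\<bar> \<ge> m"
  shows "quad_close B (\<lambda>t c. sqrt (f t c))"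
proof -
  from assms(1) obtain C d where C: "d > 0" "C \<ge> 0" "d \<le> 1"
    "\<And>t c. \<bar>t\<bar> < d \<Longrightarrow> c \<in> B \<Longrightarrow> \<bar>f t c - f 0 c\<bar> \<le> C * t\<^sup>2" "\<And>c. c \<in> B \<Longrightarrow> \<bar>f 0 c\<bar> \<le> C"
    by (rule quad_closeE) blast
  define d' where "d' = min d (m / (2 * (C + 1)))"
  have d': "d' > 0" using C m by (simp add: d'_def)
  define D where "D = C / sqrt m + sqrt C"
  show ?thesis
    unfolding quad_close_def
  proof (rule exI[of _ D], rule exI[of _ d'], intro conjI allI impI)
    fix t c assume t: "\<bar>t\<bar> < d'" "c \<in> B"
    have "C * t\<^sup>2 \<le> C * \<bar>t\<bar>"
    proof -
      have "\<bar>t\<bar> * \<bar>t\<bar> \<le> 1 * \<bar>t\<bar>" using t C by (intro mult_right_mono) (auto simp: d'_def)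
      then show ?thesis using C(2) by (intro mult_left_mono) (auto simp: power2_eq_square)
    qed
    also have "\<dots> \<le> (C + 1) * (m / (2 * (C + 1)))"
      using t C by (intro mult_mono) (auto simp: d'_def)
    also have "\<dots> = m / 2" using C(2) by (simp add: field_simps)
    finally have "C * t\<^sup>2 \<le> m / 2" .
    then have ft: "\<bar>f t c - f 0 c\<bar> \<le> C * t\<^sup>2" "\<bar>f t c - f 0 c\<bar> < \<bar>f 0 c\<bar>"
      using C(4)[of t c] t m(1) m(2)[of c] by (auto simp: d'_def)
    have "\<bar>sqrt (f t c) - sqrt (f 0 c)\<bar> \<le> \<bar>f t c - f 0 c\<bar> / sqrt \<bar>f 0 c\<bar>"
      by (rule sqrt_diff_le[OF ft(2)])
    also have "\<dots> \<le> (C * t\<^sup>2) / sqrt m"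
      using ft m(1) m(2)[OF t(2)] by (intro frac_le) auto
    also have "\<dots> = C / sqrt m * t\<^sup>2" by simp
    also have "\<dots> \<le> D * t\<^sup>2" unfolding D_def using C by (intro mult_right_mono) auto
    finally show "\<bar>sqrt (f t c) - sqrt (f 0 c)\<bar> \<le> D * t\<^sup>2" .
    have "\<bar>sqrt (f 0 c)\<bar> \<le> sqrt C"
    proof -
      have "\<bar>sqrt x\<bar> = sqrt \<bar>x\<bar>" for x
        by (cases "x \<ge> 0") (auto simp: real_sqrt_minus abs_if)
      then show ?thesis using C(5)[OF t(2)] by simp
    qed
    then show "\<bar>sqrt (f 0 c)\<bar> \<le> D" unfolding D_def using C m by (simp add: add_increasing)
  qed (use d' in auto)
qed

subsection \<open>Central projection of the three geometries\<close>

text \<open>With \<open>flat\<close> equal to \<open>1\<close> in the affine model and to \<open>0\<close> in the two linear models the three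
  geometries share their formulas.\<close>

definition flat :: "'n::finite geometry \<Rightarrow> real" where
  "flat g = (if g = Euclidean then 1 else 0)"

text \<open>The curvature of the space, which in the two linear models is also the value of
  \<open>form g x x\<close> on the model space.\<close>

definition curv :: "'n::finite geometry \<Rightarrow> real" where
  "curv g = (case g of Euclidean \<Rightarrow> 0 | Spherical \<Rightarrow> 1 | Hyperbolic _ \<Rightarrow> -1)"

lemma flat_simps [simp]: "flat Euclidean = 1" "flat Spherical = 0" "flat (Hyperbolic i0) = 0"
  by (simp_all add: flat_def)

lemma curv_simps [simp]: "curv Euclidean = 0" "curv Spherical = 1" "curv (Hyperbolic i0) = -1"
  by (simp_all add: curv_def)

lemma flat_0: "g \<noteq> Euclidean \<Longrightarrow> flat g = 0"
  by (simp add: flat_def)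

lemma curv_square: "g \<noteq> Euclidean \<Longrightarrow> curv g * curv g = 1"
  by (cases g) auto

text \<open>Rewrites the form as a Euclidean inner product, so that linearity, continuity and the
  Cauchy-Schwarz bound carry over to the indefinite case.\<close>

definition metric_dual :: "'n::finite geometry \<Rightarrow> real ^ 'n \<Rightarrow> real ^ 'n" where
  "metric_dual g x = (\<chi> i. if g = Hyperbolic i then - x $ i else x $ i)"

lemma form_eq_inner: "form g x y = metric_dual g x \<bullet> y"
proof (cases g)
  case (Hyperbolic i0)
  have "metric_dual g x \<bullet> y = (\<Sum>i\<in>UNIV. (if i = i0 then - x $ i else x $ i) * y $ i)"
    unfolding inner_vec_def metric_dual_def using Hyperbolic
    by (auto intro!: sum.cong)
  also have "\<dots> = - (x $ i0 * y $ i0) + (\<Sum>i\<in>UNIV - {i0}. x $ i * y $ i)"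
    by (subst sum.remove[of _ i0]) auto
  finally show ?thesis by (simp add: form_def Hyperbolic)
qed (auto simp: form_def metric_dual_def)

lemma form_commute: "form g x y = form g y x"
  by (cases g) (auto simp: form_def inner_commute mult.commute)

lemma form_linear: "linear (form g a)"
  unfolding form_eq_inner[abs_def] by (intro linearI) (auto simp: inner_add_right)

lemmas form_add_right = linear_add[OF form_linear]
  and form_diff_right = linear_diff[OF form_linear]
  and form_scale_right = linear_scale[OF form_linear, simplified]
  and form_sum_right = linear_sum[OF form_linear]
  and form_zero_right [simp] = linear_0[OF form_linear]
  and form_minus_right = linear_neg[OF form_linear]

lemma form_add_left: "form g (x + y) z = form g x z + form g y z"
  and form_diff_left: "form g (x - y) z = form g x z - form g y z"
  and form_scale_left: "form g (c *\<^sub>R x) z = c * form g x z"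
  and form_sum_left: "form g (\<Sum>i\<in>I. h i) z = (\<Sum>i\<in>I. form g (h i) z)"
  and form_zero_left [simp]: "form g 0 z = 0"
  and form_minus_left: "form g (- x) z = - form g x z"
  unfolding form_commute[of g _ z]
  by (simp_all add: form_add_right form_diff_right form_scale_right form_sum_right form_minus_right)

lemmas form_simps = form_add_left form_add_right form_diff_left form_diff_right
  form_scale_left form_scale_right form_minus_left form_minus_right

lemma norm_metric_dual [simp]: "norm (metric_dual g x) = norm x"
proof (rule antisym)
  show "norm (metric_dual g x) \<le> norm x" by (rule norm_le_componentwise_cart) (simp add: metric_dual_def)
  show "norm x \<le> norm (metric_dual g x)" by (rule norm_le_componentwise_cart) (simp add: metric_dual_def)
qed

lemma form_bound: "\<bar>form g x y\<bar> \<le> norm x * norm y"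
  using Cauchy_Schwarz_ineq2[of "metric_dual g x" y] by (simp add: form_eq_inner)

lemma bounded_bilinear_form: "bounded_bilinear (form g)"
  by (rule bounded_bilinear.intro)
    (simp_all add: form_simps, metis form_bound mult.right_neutral)

lemmas form_continuous [continuous_intros] = bounded_bilinear.continuous_on[OF bounded_bilinear_form]
  and form_tendsto [tendsto_intros] = bounded_bilinear.tendsto[OF bounded_bilinear_form]
  and form_derivative = bounded_bilinear.FDERIV[OF bounded_bilinear_form]

text \<open>The square of the factor by which a vector is divided to reach the model space;
  constantly 1 in the affine model, where no rescaling takes place.\<close>

definition nrm2 :: "'n::finite geometry \<Rightarrow> real ^ 'n \<Rightarrow> real" where
  "nrm2 g x = flat g + curv g * form g x x"

lemma nrm2_Euclidean [simp]: "nrm2 Euclidean x = 1"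
  by (simp add: nrm2_def)

lemma nrm2_flat: "g = Euclidean \<Longrightarrow> nrm2 g x = 1"
  by simp

lemma nrm2_scale: "g \<noteq> Euclidean \<Longrightarrow> nrm2 g (a *\<^sub>R x) = a\<^sup>2 * nrm2 g x"
  by (simp add: nrm2_def flat_0 form_simps power2_eq_square)

lemma model_space_nrm2: "x \<in> model_space g \<Longrightarrow> nrm2 g x = 1"
  by (cases g) (auto simp: model_space_def nrm2_def form_def power2_norm_eq_inner[symmetric])

lemma model_space_iff:
  "x \<in> model_space g \<longleftrightarrow> nrm2 g x = 1 \<and> (\<forall>i0. g = Hyperbolic i0 \<longrightarrow> x $ i0 > 0)"
  by (cases g) (auto simp: model_space_def nrm2_def form_def norm_eq_1)

section \<open>Signs of the Lorentzian form\<close>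

definition space_part :: "'n::finite \<Rightarrow> real ^ 'n \<Rightarrow> real ^ 'n" where
  "space_part i0 x = (\<chi> i. if i = i0 then 0 else x $ i)"

lemma form_Hyperbolic:
  "form (Hyperbolic i0) x y = - (x $ i0 * y $ i0) + space_part i0 x \<bullet> space_part i0 y"
proof -
  have "space_part i0 x \<bullet> space_part i0 y = (\<Sum>i\<in>UNIV - {i0}. x $ i * y $ i)"
    unfolding inner_vec_def by (subst sum.remove[of _ i0]) (auto simp: space_part_def)
  then show ?thesis by (simp add: form_def)
qed

text \<open>The complement of a time-like vector is positive definite: orthogonality equates the
  time part \<open>v $ i0 * p $ i0\<close> with a spatial product, and since \<open>p $ i0\<close>
  exceeds the norm of the spatial part of \<open>p\<close>, Cauchy-Schwarz makes the time part of
  \<open>v\<close> smaller than its spatial part.\<close>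

lemma form_pos_Hyperbolic:
  assumes p: "p \<in> model_space (Hyperbolic i0)" and vp: "form (Hyperbolic i0) v p = 0" and v: "v \<noteq> 0"
  shows "form (Hyperbolic i0) v v > 0"
proof -
  let ?v = "space_part i0 v" and ?p = "space_part i0 p"
  have p0: "p $ i0 > 0" and p1: "(p $ i0)\<^sup>2 = 1 + (norm ?p)\<^sup>2"
    using p by (auto simp: model_space_def form_Hyperbolic power2_eq_square dot_square_norm)
  have e: "v $ i0 * p $ i0 = ?v \<bullet> ?p" using vp by (simp add: form_Hyperbolic)
  have "?v \<noteq> 0"
  proof
    assume "?v = 0"
    then have "v $ i0 = 0" using e p0 by simp
    moreover have "v $ i = 0" if "i \<noteq> i0" for i
      using arg_cong[OF \<open>?v = 0\<close>, of "\<lambda>x. x $ i"] that by (simp add: space_part_def)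
    ultimately have "v $ i = 0" for i by (cases "i = i0") auto
    then have "v = 0" by (simp add: vec_eq_iff)
    then show False using v by simp
  qed
  then have nv: "norm ?v > 0" by simp
  have "(v $ i0)\<^sup>2 * (p $ i0)\<^sup>2 = (?v \<bullet> ?p)\<^sup>2" by (simp add: e[symmetric] power_mult_distrib)
  also have "\<dots> \<le> (norm ?v)\<^sup>2 * (norm ?p)\<^sup>2"
    using power_mono[OF Cauchy_Schwarz_ineq2[of ?v ?p], of 2] by (simp add: power_mult_distrib)
  also have "\<dots> < (norm ?v)\<^sup>2 * (p $ i0)\<^sup>2" using nv p1 by (intro mult_strict_left_mono) auto
  finally have "(v $ i0)\<^sup>2 < (norm ?v)\<^sup>2" using p0 by (simp add: mult_less_cancel_right)
  then show ?thesis by (simp add: form_Hyperbolic power2_eq_square dot_square_norm)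
qed

text \<open>For time-like vectors the product of the time coordinates dominates the spatial product,
  so the form with a future point only sees the sign of \<open>z $ i0\<close>.\<close>

lemma timelike_sign:
  assumes p: "p \<in> model_space (Hyperbolic i0)" and z: "form (Hyperbolic i0) z z < 0"
  shows "form (Hyperbolic i0) z p < 0 \<longleftrightarrow> z $ i0 > 0"
proof -
  let ?z = "space_part i0 z" and ?p = "space_part i0 p"
  have p0: "p $ i0 > 0" and p1: "(p $ i0)\<^sup>2 = 1 + (norm ?p)\<^sup>2"
    using p by (auto simp: model_space_def form_Hyperbolic power2_eq_square dot_square_norm)
  have "(norm ?p)\<^sup>2 < (p $ i0)\<^sup>2" using p1 by simp
  then have pp: "norm ?p < p $ i0" using p0 by (simp add: power2_less_imp_less)
  have "(norm ?z)\<^sup>2 < \<bar>z $ i0\<bar>\<^sup>2" using z by (simp add: form_Hyperbolic power2_eq_square dot_square_norm)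
  then have zz: "norm ?z < \<bar>z $ i0\<bar>" by (rule power2_less_imp_less) simp
  have "\<bar>?z \<bullet> ?p\<bar> \<le> norm ?z * norm ?p" by (rule Cauchy_Schwarz_ineq2)
  also have "\<dots> \<le> norm ?z * p $ i0" using pp by (intro mult_left_mono) auto
  also have "\<dots> < \<bar>z $ i0\<bar> * p $ i0" using zz p0 by (intro mult_strict_right_mono) auto
  finally have b: "\<bar>?z \<bullet> ?p\<bar> < \<bar>z $ i0\<bar> * p $ i0" .
  show ?thesis
  proof (cases "z $ i0 > 0")
    case True
    then show ?thesis using b by (simp add: form_Hyperbolic)
  next
    case False
    then have "\<bar>z $ i0\<bar> * p $ i0 = - (z $ i0 * p $ i0)" by simp
    then show ?thesis using b False by (simp add: form_Hyperbolic)
  qed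
qed

lemma form_model_space_neg:
  "p \<in> model_space (Hyperbolic i0) \<Longrightarrow> x \<in> model_space (Hyperbolic i0) \<Longrightarrow> form (Hyperbolic i0) x p < 0"
  using timelike_sign[of p i0 x] by (simp add: model_space_def)

lemma form_pos:
  assumes "\<And>i0. g = Hyperbolic i0 \<Longrightarrow> p \<in> model_space g \<and> form g v p = 0" and "v \<noteq> 0"
  shows "form g v v > 0"
proof (cases g)
  case (Hyperbolic i0)
  then show ?thesis using assms form_pos_Hyperbolic[of p i0 v] by simp
qed (use assms(2) in \<open>simp_all add: form_def\<close>)

text \<open>The ambient flat whose section by the model space is the geodesic hull.\<close>

definition ahull :: "'n::finite geometry \<Rightarrow> (real ^ 'n) set \<Rightarrow> (real ^ 'n) set" where
  "ahull g Q = (if g = Euclidean then affine hull Q else span Q)"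

lemma geodesic_hull_eq: "geodesic_hull g Q = model_space g \<inter> ahull g Q"
  by (cases g) (auto simp: geodesic_hull_def ahull_def model_space_def)

lemma ahull_superset: "Q \<subseteq> ahull g Q"
  by (auto simp: ahull_def hull_inc span_base)

lemma ahull_mono: "F \<subseteq> Q \<Longrightarrow> ahull g F \<subseteq> ahull g Q"
  by (simp add: ahull_def hull_mono span_mono)

lemma ahull_scale: "g \<noteq> Euclidean \<Longrightarrow> x \<in> ahull g Q \<Longrightarrow> a *\<^sub>R x \<in> ahull g Q"
  by (auto simp: ahull_def span_scale)

lemma convex_polytope_subset: "convex_polytope g Q \<Longrightarrow> Q \<subseteq> model_space g"
  by (auto simp: convex_polytope_def)

lemma subset_geodesic_hull: "convex_polytope g Q \<Longrightarrow> Q \<subseteq> geodesic_hull g Q"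
  using convex_polytope_subset[of g Q] ahull_superset[of Q g] by (auto simp: geodesic_hull_eq)

definition slice :: "'n::finite geometry \<Rightarrow> real ^ 'n \<Rightarrow> real ^ 'n \<Rightarrow> real" where
  "slice g q x = flat g + form g x q"

definition coords :: "'n::finite geometry \<Rightarrow> ('k::finite \<Rightarrow> real ^ 'n) \<Rightarrow> ('k \<Rightarrow> real) \<Rightarrow> real ^ 'n \<Rightarrow> real ^ 'k" where
  "coords g e r x = (\<chi> i. form g x (e i) - flat g * r i)"

lemma slice_scale: "g \<noteq> Euclidean \<Longrightarrow> slice g q (a *\<^sub>R x) = a * slice g q x"
  by (simp add: slice_def flat_0 form_simps)

lemma coords_scale: "g \<noteq> Euclidean \<Longrightarrow> coords g e r (a *\<^sub>R x) = a *\<^sub>R coords g e r x"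
  by (simp add: coords_def flat_0 form_simps vec_eq_iff)

text \<open>The denominator of the central projection is \<open>slice g q\<close>; a totally geodesic hull becomes a
  whole affine space in the coordinates \<open>coords g e r / slice g q\<close>.\<close>

locale chart =
  fixes g :: "'n::finite geometry" and Q :: "(real ^ 'n) set" and q :: "real ^ 'n"
    and e :: "'k::finite \<Rightarrow> real ^ 'n" and r :: "'k \<Rightarrow> real" and P :: "real \<times> (real ^ 'k) \<Rightarrow> real ^ 'n"
  assumes poly: "convex_polytope g Q" and Q_ne: "Q \<noteq> {}"
    and flat_q: "g = Euclidean \<Longrightarrow> q = 0"
    and lin_P: "linear P"
    and P_hull: "P (1, c) \<in> ahull g Q"
    and slice_P: "slice g q (P (1, c)) = 1"
    and coords_P: "coords g e r (P (1, c)) = c"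
    and P_inverse: "x \<in> ahull g Q \<Longrightarrow> P (slice g q x, coords g e r x) = x"
    and slice_pos: "x \<in> Q \<Longrightarrow> slice g q x > 0"
    and future: "g = Hyperbolic i0 \<Longrightarrow> - q \<in> model_space g"
begin

abbreviation "sl \<equiv> slice g q"
abbreviation "co \<equiv> coords g e r"

text \<open>\<open>\<Psi>\<close> lifts coordinates to the plane \<open>sl = 1\<close>,
  \<open>chi\<close> is the central projection, \<open>\<phi>\<close> pushes the lift radially into
  the model space, and \<open>W\<close> is where this is possible: everywhere, except in the
  hyperbolic case, where it is a Klein model.\<close>

definition \<Psi> :: "real ^ 'k \<Rightarrow> real ^ 'n" where "\<Psi> c = P (1, c)"
definition chi :: "real ^ 'n \<Rightarrow> real ^ 'k" where "chi x = co x /\<^sub>R sl x"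
definition \<phi> :: "real ^ 'k \<Rightarrow> real ^ 'n" where "\<phi> c = \<Psi> c /\<^sub>R sqrt (nrm2 g (\<Psi> c))"
definition W :: "(real ^ 'k) set" where "W = {c. nrm2 g (\<Psi> c) > 0}"

lemma slice_Euclidean: "g = Euclidean \<Longrightarrow> sl x = 1"
  by (simp add: slice_def flat_q)

lemma \<Psi>_chi:
  assumes "x \<in> ahull g Q" "sl x > 0"
  shows "\<Psi> (chi x) = x /\<^sub>R sl x"
proof -
  have "\<Psi> (chi x) = P ((1 / sl x) *\<^sub>R (sl x, co x))"
    using assms by (simp add: \<Psi>_def chi_def divide_inverse)
  also have "\<dots> = (1 / sl x) *\<^sub>R x"
    by (subst linear_scale[OF lin_P]) (simp add: P_inverse[OF assms(1)])
  finally show ?thesis by (simp add: divide_inverse)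
qed

lemma nrm2_\<Psi>_chi:
  assumes "x \<in> geodesic_hull g Q" "sl x > 0"
  shows "nrm2 g (\<Psi> (chi x)) = 1 / (sl x)\<^sup>2"
proof (cases "g = Euclidean")
  case True show ?thesis by (simp add: slice_Euclidean[OF True] nrm2_flat[OF True])
next
  case False
  then show ?thesis
    using assms model_space_nrm2[of x g]
    by (simp add: \<Psi>_chi geodesic_hull_eq nrm2_scale field_simps)
qed

lemma \<phi>_chi:
  assumes "x \<in> geodesic_hull g Q" "sl x > 0"
  shows "chi x \<in> W" "\<phi> (chi x) = x"
proof -
  show "chi x \<in> W" using assms by (simp add: W_def nrm2_\<Psi>_chi)
  show "\<phi> (chi x) = x" unfolding \<phi>_def nrm2_\<Psi>_chi[OF assms]
    using assms by (simp add: \<Psi>_chi geodesic_hull_eq real_sqrt_divide)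
qed

text \<open>In the hyperbolic case positive \<open>nrm2\<close> leaves two sheets. A positive
  denominator is a negative product with the future point \<open>- q\<close> and selects the right
  one.\<close>

lemma nrm2_pos_model:
  assumes "nrm2 g z > 0" "sl z > 0"
  shows "z /\<^sub>R sqrt (nrm2 g z) \<in> model_space g"
proof (cases g)
  case Euclidean then show ?thesis by (simp add: model_space_def)
next
  case Spherical
  then show ?thesis using assms
    by (simp add: model_space_iff nrm2_scale power_inverse)
next
  case (Hyperbolic i0)
  have "form g z z < 0" using assms Hyperbolic by (simp add: nrm2_def)
  moreover have "form g z (- q) < 0" using assms Hyperbolic by (simp add: slice_def form_simps)
  ultimately have "z $ i0 > 0" using timelike_sign[of "-q" i0 z] future Hyperbolic by simp
  then show ?thesis using assms Hyperbolic
    by (simp add: model_space_iff nrm2_scale power_inverse)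
qed

lemma chi_\<phi>:
  assumes "c \<in> W"
  shows "\<phi> c \<in> geodesic_hull g Q" "sl (\<phi> c) > 0" "chi (\<phi> c) = c"
proof -
  have n: "nrm2 g (\<Psi> c) > 0" using assms by (simp add: W_def)
  have s1: "sl (\<Psi> c) = 1" by (simp add: \<Psi>_def slice_P)
  have ph: "\<phi> c \<in> ahull g Q"
  proof (cases "g = Euclidean")
    case True show ?thesis by (simp add: \<phi>_def nrm2_flat[OF True]) (simp add: \<Psi>_def P_hull)
  next
    case False then show ?thesis by (simp add: \<phi>_def \<Psi>_def P_hull ahull_scale)
  qed
  then show "\<phi> c \<in> geodesic_hull g Q"
    using nrm2_pos_model[OF n] s1 by (simp add: geodesic_hull_eq \<phi>_def)
  show "sl (\<phi> c) > 0"
  proof (cases "g = Euclidean")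
    case True show ?thesis by (simp add: slice_Euclidean[OF True])
  next
    case False then show ?thesis using n s1 by (simp add: \<phi>_def slice_scale)
  qed
  show "chi (\<phi> c) = c"
  proof (cases "g = Euclidean")
    case True show ?thesis
      by (simp add: chi_def slice_Euclidean[OF True] \<phi>_def nrm2_flat[OF True]) (simp add: \<Psi>_def coords_P)
  next
    case False then show ?thesis using n s1
      by (simp add: chi_def \<phi>_def slice_scale coords_scale) (simp add: \<Psi>_def coords_P)
  qed
qed

lemma inj_chi: "x \<in> geodesic_hull g Q \<Longrightarrow> y \<in> geodesic_hull g Q \<Longrightarrow> sl x > 0 \<Longrightarrow> sl y > 0 \<Longrightarrow>
    chi x = chi y \<Longrightarrow> x = y"
  by (subst \<phi>_chi(2)[of x, symmetric], assumption+, subst \<phi>_chi(2)[of y, symmetric], assumption+) (rule arg_cong)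

lemma inj_\<phi>: "inj_on \<phi> W"
  by (rule inj_on_inverseI[of _ chi]) (rule chi_\<phi>(3))

lemma hull_Q: "x \<in> Q \<Longrightarrow> x \<in> geodesic_hull g Q"
  using subset_geodesic_hull[OF poly] by blast

lemma \<Psi>_affine: "\<Psi> c = P (1, 0) + P (0, c)"
  using linear_add[OF lin_P, of "(1,0)" "(0,c)"] by (simp only: \<Psi>_def add_Pair add_0_left add_0_right)

lemma linear_P0: "linear (\<lambda>c. P (0, c))"
proof (rule linearI)
  show "P (0, x + y) = P (0, x) + P (0, y)" for x y
    using linear_add[OF lin_P, of "(0,x)" "(0,y)"] by (simp only: add_Pair add_0_left)
  show "P (0, a *\<^sub>R x) = a *\<^sub>R P (0, x)" for a x
    using linear_scale[OF lin_P, of a "(0,x)"] by (simp only: scaleR_Pair scaleR_zero_right)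
qed

lemma inj_\<Psi>: "inj \<Psi>"
  by (rule inj_on_inverseI[of _ co]) (simp add: \<Psi>_def coords_P)

lemma inj_P0: "inj (\<lambda>c. P (0, c))"
  using inj_\<Psi> by (simp add: inj_def \<Psi>_affine)

lemma aff_dim_\<Psi>: "aff_dim (\<Psi> ` C) = aff_dim C"
proof -
  have "\<Psi> ` C = (+) (P (1, 0)) ` ((\<lambda>c. P (0, c)) ` C)"
    by (auto simp: \<Psi>_affine image_image)
  then show ?thesis
    by (simp add: aff_dim_translation_eq aff_dim_injective_linear_image[OF linear_P0 inj_P0])
qed

text \<open>In the linear models \<open>X\<close> has the span of its radial projection
  \<open>Y\<close> to the plane \<open>sl = 1\<close>. That plane misses the origin, so the linear
  dimension exceeds the affine one by 1, which cancels the 1 subtracted in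
  \<open>geodesic_dim\<close>.\<close>

lemma geodesic_dim_chi:
  assumes X: "X \<subseteq> geodesic_hull g Q" "\<And>x. x \<in> X \<Longrightarrow> sl x > 0"
  shows "geodesic_dim g X = aff_dim (chi ` X)"
proof (cases "g = Euclidean")
  case True
  have "X = \<Psi> ` chi ` X"
  proof -
    have "\<Psi> (chi x) = x" if "x \<in> X" for x
      using \<Psi>_chi[of x] that X by (auto simp: geodesic_hull_eq slice_Euclidean[OF True])
    then show ?thesis by (simp add: image_image)
  qed
  then have "aff_dim X = aff_dim (chi ` X)" using aff_dim_\<Psi>[of "chi ` X"] by simp
  then show ?thesis by (simp add: geodesic_dim_def True)
next
  case False
  define Y where "Y = \<Psi> ` chi ` X"
  have Yx: "\<Psi> (chi x) = x /\<^sub>R sl x" if "x \<in> X" for x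
    using that X by (intro \<Psi>_chi) (auto simp: geodesic_hull_eq)
  have "span X = span Y"
  proof (rule span_eq[THEN iffD2], intro conjI subsetI)
    fix x assume x: "x \<in> X"
    then have "x = sl x *\<^sub>R \<Psi> (chi x)" using Yx X(2)[OF x] by simp
    moreover have "sl x *\<^sub>R \<Psi> (chi x) \<in> span Y" by (intro span_scale span_base) (use x in \<open>auto simp: Y_def\<close>)
    ultimately show "x \<in> span Y" by simp
  next
    fix y assume "y \<in> Y"
    then show "y \<in> span X" by (auto simp: Y_def Yx span_scale span_base)
  qed
  then have "dim X = dim Y" using dim_span[of X] dim_span[of Y] by simp
  moreover have "int (dim Y) = aff_dim Y + 1"
  proof -
    have "linear sl" by (rule linearI) (simp_all add: slice_def flat_0[OF False] form_simps)
    have "affine {x. sl x = 1}"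
      by (auto simp: affine_def slice_def flat_0[OF False] form_simps)
    moreover have "Y \<subseteq> {x. sl x = 1}" by (auto simp: Y_def \<Psi>_def slice_P)
    ultimately have "affine hull Y \<subseteq> {x. sl x = 1}" by (rule hull_minimal[rotated])
    moreover have "sl 0 \<noteq> 1" by (simp add: slice_def flat_0[OF False])
    ultimately have n: "0 \<notin> affine hull Y" by auto
    have "aff_dim (insert 0 Y) = int (dim (insert 0 Y))" by (rule aff_dim_zero) (simp add: hull_inc)
    moreover have "dim (insert 0 Y) = dim Y" using dim_span[of "insert 0 Y"] dim_span[of Y] by (simp add: span_insert_0)
    ultimately show ?thesis using n by (simp add: aff_dim_insert)
  qed
  ultimately show ?thesis
    using False aff_dim_\<Psi>[of "chi ` X"] by (cases g) (simp_all add: geodesic_dim_def Y_def)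
qed

end

subsection \<open>Polytopes\<close>

text \<open>A segment from an interior point to a point outside leaves \<open>S\<close> through a
  facet, on which one of the functionals vanishes. It is positive at the interior point, so it is
  negative beyond the facet.\<close>

lemma polytope_halfspace_representation:
  fixes S :: "'a::euclidean_space set"
  assumes S: "polytope S" and ne: "interior S \<noteq> {}"
    and nonneg: "\<And>i x. i \<in> I \<Longrightarrow> x \<in> S \<Longrightarrow> \<alpha> i \<bullet> x + \<beta> i \<ge> 0"
    and pos: "\<And>i. i \<in> I \<Longrightarrow> \<exists>x\<in>S. \<alpha> i \<bullet> x + \<beta> i > 0"
    and facets: "\<And>E. E facet_of S \<Longrightarrow> \<exists>i\<in>I. \<forall>x\<in>E. \<alpha> i \<bullet> x + \<beta> i = (0::real)"
  shows "S = {x. \<forall>i\<in>I. \<alpha> i \<bullet> x + \<beta> i \<ge> 0}"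
proof (intro subset_antisym subsetI)
  show "x \<in> {x. \<forall>i\<in>I. \<alpha> i \<bullet> x + \<beta> i \<ge> 0}" if "x \<in> S" for x using nonneg that by simp
next
  fix c assume c: "c \<in> {x. \<forall>i\<in>I. \<alpha> i \<bullet> x + \<beta> i \<ge> 0}"
  show "c \<in> S"
  proof (rule ccontr)
    assume nc: "c \<notin> S"
    obtain p where p: "p \<in> interior S" using ne by auto
    then have pS: "p \<in> S" using interior_subset by auto
    have "closed_segment p c \<inter> frontier S \<noteq> {}"
      by (rule connected_Int_frontier) (use pS nc in auto)
    then obtain z where z: "z \<in> closed_segment p c" "z \<in> frontier S" by auto
    have "rel_frontier S = \<Union>{F. F facet_of S}"
      by (rule rel_frontier_of_polyhedron[OF polytope_imp_polyhedron[OF S]])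
    then obtain E where E: "E facet_of S" "z \<in> E"
      using z(2) rel_frontier_nonempty_interior[OF ne] by auto
    then have zS: "z \<in> S" using facet_of_imp_subset by blast
    obtain i where i: "i \<in> I" "\<alpha> i \<bullet> z + \<beta> i = 0" using facets[OF E(1)] E(2) by auto
    obtain y where y: "y \<in> S" "\<alpha> i \<bullet> y + \<beta> i > 0" using pos[OF i(1)] by auto
    have pp: "\<alpha> i \<bullet> p + \<beta> i > 0"
    proof -
      obtain d where d: "d > 0" "ball p d \<subseteq> S" using p by (auto simp: mem_interior)
      \<comment> \<open>The point beyond \<open>p\<close> as seen from \<open>y\<close> stays in the
        ball; a functional that is nonnegative there and positive at \<open>y\<close> is positive at
        \<open>p\<close> in between.\<close>
      define h where "h = d / (2 * (norm (y - p) + 1))"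
      have den: "norm (y - p) + 1 > 0" by (simp add: add_nonneg_pos)
      have h: "h > 0" unfolding h_def using d den by simp
      have "h * norm (y - p) \<le> d / 2"
      proof -
        have "h * norm (y - p) \<le> h * (norm (y - p) + 1)" using h by simp
        also have "\<dots> = d / 2" unfolding h_def using den by (simp add: field_simps)
        finally show ?thesis .
      qed
      then have "p - h *\<^sub>R (y - p) \<in> ball p d" using d h by (simp add: dist_norm)
      then have "p - h *\<^sub>R (y - p) \<in> S" using d by blast
      then have "\<alpha> i \<bullet> (p - h *\<^sub>R (y - p)) + \<beta> i \<ge> 0" by (rule nonneg[OF i(1)])
      then have "(1 + h) * (\<alpha> i \<bullet> p + \<beta> i) \<ge> h * (\<alpha> i \<bullet> y + \<beta> i)"
        by (simp add: algebra_simps)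
      moreover have "h * (\<alpha> i \<bullet> y + \<beta> i) > 0" using h y by simp
      ultimately have "(1 + h) * (\<alpha> i \<bullet> p + \<beta> i) > 0" by linarith
      then show ?thesis using h by (simp add: zero_less_mult_iff)
    qed
    obtain u where u: "0 \<le> u" "u \<le> 1" "z = (1 - u) *\<^sub>R p + u *\<^sub>R c"
      using z(1) by (auto simp: in_segment)
    have "u \<noteq> 1" using u zS nc by auto
    have "(1 - u) * (\<alpha> i \<bullet> p + \<beta> i) + u * (\<alpha> i \<bullet> c + \<beta> i) = 0"
      using i(2) unfolding u(3) by (simp add: algebra_simps)
    moreover have "(1 - u) * (\<alpha> i \<bullet> p + \<beta> i) > 0" using u \<open>u \<noteq> 1\<close> pp by simp
    moreover have "u * (\<alpha> i \<bullet> c + \<beta> i) \<ge> 0" using u c i by simp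
    ultimately show False by linarith
  qed
qed

lemma poly_face_subset: "poly_face g F Q \<Longrightarrow> F \<subseteq> Q"
  by (auto simp: poly_face_def)

lemma poly_face_functional:
  assumes "poly_face g F Q" "F \<noteq> {}" "F \<noteq> Q"
  obtains a b where "g \<noteq> Euclidean \<Longrightarrow> b = 0" "\<And>x. x \<in> Q \<Longrightarrow> form g a x \<le> b" "F = {x \<in> Q. form g a x = b}"
proof -
  obtain a b where "bounds_half_space g a b" "Q \<subseteq> half_space g a b" "F = {x \<in> Q. form g a x = b}"
    using assms by (auto simp: poly_face_def)
  then show thesis
    by (intro that[of b a]) (auto simp: bounds_half_space_def half_space_def split: geometry.splits)
qed

context chart
begin

lemma slice_continuous [continuous_intros]: "continuous_on A sl"
  unfolding slice_def by (intro continuous_intros)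

lemma co_continuous [continuous_intros]: "continuous_on A co"
  unfolding coords_def by (intro continuous_intros)

lemma chi_continuous: "(\<And>x. x \<in> A \<Longrightarrow> sl x \<noteq> 0) \<Longrightarrow> continuous_on A chi"
  unfolding chi_def by (intro continuous_intros) auto

definition sliced :: "(real ^ 'n) set" where "sliced = (\<lambda>x. x /\<^sub>R sl x) ` Q"

lemma compact_Q: "compact Q" using poly by (simp add: convex_polytope_def)

lemma slice_nz: "x \<in> Q \<Longrightarrow> sl x \<noteq> 0" using slice_pos[of x] by simp

text \<open>The half spaces of the cell cut a polyhedron \<open>C\<close> out of the plane
  \<open>sl = 1\<close>. In the curved cases \<open>sliced\<close> is the part of \<open>C\<close>
  over which the model space lies, hence open in \<open>C\<close>; being compact it is also closed,
  and \<open>C\<close> is connected.\<close>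

lemma polytope_sliced: "polytope sliced"
proof -
  obtain N where N: "finite N" "\<And>a b. (a, b) \<in> N \<Longrightarrow> bounds_half_space g a b"
      "Q = model_space g \<inter> (\<Inter>(a, b)\<in>N. half_space g a b)"
    using poly by (auto simp: convex_polytope_def)
  define C where "C = {z. sl z = 1 \<and> (\<forall>(a, b)\<in>N. form g a z \<le> b)}"
  have comp: "compact sliced"
    unfolding sliced_def
    by (intro compact_continuous_image compact_Q continuous_intros) (use slice_nz in auto)
  have "polyhedron C"
  proof -
    have "C = {z. metric_dual g q \<bullet> z = 1 - flat g} \<inter> (\<Inter>(a, b)\<in>N. {z. metric_dual g a \<bullet> z \<le> b})"
      by (auto simp: C_def slice_def form_eq_inner[symmetric] form_commute[of g q])
    moreover have "polyhedron (\<Inter>(a, b)\<in>N. {z. metric_dual g a \<bullet> z \<le> b})"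
      by (rule polyhedron_Inter) (use N(1) in \<open>auto simp: polyhedron_halfspace_le\<close>)
    ultimately show ?thesis by (simp add: polyhedron_hyperplane)
  qed
  have "sliced = C"
  proof (cases "g = Euclidean")
    case True
    have "sliced = Q" by (simp add: sliced_def slice_Euclidean[OF True])
    moreover have "C = Q"
      unfolding N(3) C_def slice_Euclidean[OF True] using True by (auto simp: half_space_def model_space_def)
    ultimately show ?thesis by simp
  next
    case False
    have b0: "b = 0" if "(a, b) \<in> N" for a b
      using N(2)[OF that] False by (cases g) (auto simp: bounds_half_space_def)
    have eq: "sliced = C \<inter> {z. nrm2 g z > 0}"
    proof (intro subset_antisym subsetI)
      fix z assume "z \<in> sliced"
      then obtain x where x: "x \<in> Q" "z = x /\<^sub>R sl x" by (auto simp: sliced_def)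
      have s: "sl x > 0" by (rule slice_pos[OF x(1)])
      have "sl z = 1" using s False by (simp add: x slice_scale)
      moreover have "form g a z \<le> b" if "(a, b) \<in> N" for a b
      proof -
        have "form g a x \<le> 0" using x(1) that b0[OF that] unfolding N(3) by (auto simp: half_space_def)
        then show ?thesis using s b0[OF that] by (simp add: x form_simps mult_nonneg_nonpos)
      qed
      moreover have "nrm2 g z > 0"
      proof -
        have "nrm2 g x = 1" using model_space_nrm2 convex_polytope_subset[OF poly] x(1) by blast
        then show ?thesis using s False by (simp add: x nrm2_scale)
      qed
      ultimately show "z \<in> C \<inter> {z. nrm2 g z > 0}" by (auto simp: C_def)
    next
      fix z assume z: "z \<in> C \<inter> {z. nrm2 g z > 0}"
      then have n: "nrm2 g z > 0" and s: "sl z = 1" by (auto simp: C_def)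
      define x where "x = z /\<^sub>R sqrt (nrm2 g z)"
      have "x \<in> model_space g" unfolding x_def by (rule nrm2_pos_model) (use n s in auto)
      moreover have "form g a x \<le> b" if "(a, b) \<in> N" for a b
      proof -
        have "form g a z \<le> 0" using z that b0[OF that] by (auto simp: C_def)
        then show ?thesis using n b0[OF that] by (simp add: x_def form_simps mult_nonneg_nonpos)
      qed
      ultimately have "x \<in> Q" unfolding N(3) by (auto simp: half_space_def)
      moreover have "z = x /\<^sub>R sl x" using n s False by (simp add: x_def slice_scale)
      ultimately show "z \<in> sliced" by (auto simp: sliced_def)
    qed
    have "connected C" using \<open>polyhedron C\<close> by (intro convex_connected polyhedron_imp_convex)
    moreover have "openin (top_of_set C) sliced"
    proof -
      have "open {z. nrm2 g z > 0}" unfolding nrm2_def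
        by (intro open_Collect_less continuous_intros)
      then show ?thesis unfolding eq by (rule openin_open_Int)
    qed
    moreover have "closedin (top_of_set C) sliced"
      using compact_imp_closed[OF comp] eq by (intro closed_subset) auto
    ultimately have "sliced = {} \<or> sliced = C"
      unfolding connected_clopen by blast
    then show ?thesis using Q_ne by (auto simp: sliced_def)
  qed
  then show ?thesis
    using \<open>polyhedron C\<close> comp by (simp add: polytope_eq_bounded_polyhedron compact_imp_bounded)
qed

lemma polytope_chi: "polytope (chi ` Q)"
proof -
  define L where "L = (\<lambda>z. \<chi> i. form g z (e i))"
  have L: "linear L"
    by (rule linearI) (simp_all add: L_def form_simps vec_eq_iff)
  have "chi x = - (flat g *\<^sub>R (\<chi> i. r i)) + L (x /\<^sub>R sl x)" if "x \<in> Q" for x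
  proof (cases "g = Euclidean")
    case True
    show ?thesis
      by (simp add: chi_def slice_Euclidean[OF True] coords_def L_def vec_eq_iff)
  next
    case False
    show ?thesis
      using slice_nz[OF that] by (simp add: chi_def coords_def L_def vec_eq_iff flat_0[OF False] form_simps)
  qed
  then have "chi ` Q = (+) (- (flat g *\<^sub>R (\<chi> i. r i))) ` (L ` sliced)"
    unfolding sliced_def image_image by (rule image_cong[OF refl])
  then show ?thesis
    using polytope_linear_image[OF L polytope_sliced] by (simp only: polytope_translation_eq)
qed

text \<open>Clearing the denominator of the projection turns an affine functional of the coordinates
  into one given by an ambient vector.\<close>

lemma functional_pullback:
  assumes "x \<in> Q"
  shows "sl x * (a \<bullet> chi x - b) = form g ((\<Sum>i\<in>UNIV. a $ i *\<^sub>R e i) - b *\<^sub>R q) x - flat g * ((\<Sum>i\<in>UNIV. a $ i * r i) + b)"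
proof -
  have "sl x * (a \<bullet> chi x) = a \<bullet> co x"
    using slice_nz[OF assms] by (simp add: chi_def)
  also have "\<dots> = (\<Sum>i\<in>UNIV. a $ i * form g x (e i)) - flat g * (\<Sum>i\<in>UNIV. a $ i * r i)"
    by (simp add: inner_vec_def coords_def algebra_simps sum_subtractf sum_distrib_left)
  finally show ?thesis
    by (simp add: form_commute[of g _ x] form_simps form_sum_right slice_def algebra_simps)
qed

text \<open>In the hyperbolic case the ambient normal has to be space-like. It is, because it is
  orthogonal to a point of the nonempty face, and it is nonzero because the face is proper.\<close>

lemma poly_face_pullback:
  assumes E: "E exposed_face_of chi ` Q" and ne: "E \<noteq> {}" "E \<noteq> chi ` Q"
  shows "poly_face g {x \<in> Q. chi x \<in> E} Q"
proof -
  obtain a b where ab: "chi ` Q \<subseteq> {x. a \<bullet> x \<le> b}" "E = chi ` Q \<inter> {x. a \<bullet> x = b}"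
    using E by (auto simp: exposed_face_of_def)
  define v where "v = (\<Sum>i\<in>UNIV. a $ i *\<^sub>R e i) - b *\<^sub>R q"
  define \<beta> where "\<beta> = flat g * ((\<Sum>i\<in>UNIV. a $ i * r i) + b)"
  have key: "sl x * (a \<bullet> chi x - b) = form g v x - \<beta>" if "x \<in> Q" for x
    using functional_pullback[OF that] by (simp add: v_def \<beta>_def)
  have le: "form g v x \<le> \<beta>" if "x \<in> Q" for x
  proof -
    have "sl x * (a \<bullet> chi x - b) \<le> 0"
      using slice_pos[OF that] ab(1) that by (intro mult_nonneg_nonpos) auto
    then show ?thesis using key[OF that] by simp
  qed
  have eq: "form g v x = \<beta> \<longleftrightarrow> chi x \<in> E" if "x \<in> Q" for x
    using key[OF that] slice_pos[OF that] that by (auto simp: ab(2))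
  have v0: "v \<noteq> 0"
  proof
    assume "v = 0"
    then have "chi x \<in> E \<longleftrightarrow> \<beta> = 0" if "x \<in> Q" for x using eq[OF that] by auto
    then show False using ne ab(2) by auto
  qed
  have "bounds_half_space g v \<beta>"
  proof (cases g)
    case (Hyperbolic i0)
    obtain x where x: "x \<in> Q" "chi x \<in> E" using ne ab(2) by auto
    have "form g v x = 0" using eq[OF x(1)] x(2) Hyperbolic by (simp add: \<beta>_def)
    moreover have "x \<in> model_space g" using x(1) convex_polytope_subset[OF poly] by auto
    ultimately have "form g v v > 0" by (intro form_pos[OF _ v0, of g x]) auto
    then show ?thesis using Hyperbolic by (simp add: bounds_half_space_def \<beta>_def)
  qed (use v0 in \<open>auto simp: bounds_half_space_def \<beta>_def\<close>)
  moreover have "Q \<subseteq> half_space g v \<beta>"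
    using le convex_polytope_subset[OF poly] by (auto simp: half_space_def)
  moreover have "{x \<in> Q. chi x \<in> E} = {x \<in> Q. form g v x = \<beta>}" using eq by auto
  ultimately show ?thesis unfolding poly_face_def by blast
qed

text \<open>Minkowski's theorem in the chart. Vertices of a polytope are exposed, so each of them
  pulls back to a face of the cell that consists of one point.\<close>

lemma chi_vertices:
  assumes "aff_dim (chi ` Q) \<ge> 1"
  shows "chi ` Q = convex hull (chi ` {v. poly_face g {v} Q})"
proof
  have po: "polytope (chi ` Q)" by (rule polytope_chi)
  have "chi ` Q = convex hull {x. x extreme_point_of (chi ` Q)}"
    by (rule Krein_Milman_Minkowski) (use po in \<open>auto simp: polytope_imp_compact polytope_imp_convex\<close>)
  moreover have "{x. x extreme_point_of (chi ` Q)} \<subseteq> chi ` {v. poly_face g {v} Q}"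
  proof safe
    fix c assume "c extreme_point_of (chi ` Q)"
    then have f: "{c} face_of chi ` Q" by (simp add: face_of_singleton)
    then have ex: "{c} exposed_face_of chi ` Q"
      using exposed_face_of_polyhedron[OF polytope_imp_polyhedron[OF po]] by blast
    have "{c} \<noteq> chi ` Q" using assms by (metis aff_dim_sing not_one_le_zero)
    from poly_face_pullback[OF ex _ this] have pf: "poly_face g {x \<in> Q. chi x \<in> {c}} Q" by simp
    obtain v where v: "v \<in> Q" "chi v = c" using face_of_imp_subset[OF f] by auto
    have "{x \<in> Q. chi x \<in> {c}} = {v}"
      using v by (auto intro!: inj_chi hull_Q slice_pos)
    then show "c \<in> chi ` {v. poly_face g {v} Q}" using pf v by auto
  qed
  ultimately show "chi ` Q \<subseteq> convex hull (chi ` {v. poly_face g {v} Q})"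
    using hull_mono[of _ _ convex] by blast
  show "convex hull (chi ` {v. poly_face g {v} Q}) \<subseteq> chi ` Q"
    by (rule hull_minimal) (use po poly_face_subset[of g "{_}" Q] in \<open>auto simp: polytope_imp_convex\<close>)
qed

lemma geodesic_dim_Q: "geodesic_dim g Q = aff_dim (chi ` Q)"
  by (rule geodesic_dim_chi) (auto intro: hull_Q slice_pos)

lemma facet_pullback:
  assumes E: "E facet_of chi ` Q"
  shows "poly_face g {x \<in> Q. chi x \<in> E} Q" "geodesic_dim g {x \<in> Q. chi x \<in> E} = geodesic_dim g Q - 1"
    "chi ` {x \<in> Q. chi x \<in> E} = E"
proof -
  have ne: "E \<noteq> {}" "E \<noteq> chi ` Q" using E facet_of_irrefl by (auto simp: facet_of_def)
  have f: "E face_of chi ` Q" using E by (rule facet_of_imp_face_of)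
  then have "E exposed_face_of chi ` Q"
    using exposed_face_of_polyhedron[OF polytope_imp_polyhedron[OF polytope_chi]] by blast
  then show "poly_face g {x \<in> Q. chi x \<in> E} Q" by (rule poly_face_pullback[OF _ ne])
  show im: "chi ` {x \<in> Q. chi x \<in> E} = E" using face_of_imp_subset[OF f] by auto
  have "geodesic_dim g {x \<in> Q. chi x \<in> E} = aff_dim (chi ` {x \<in> Q. chi x \<in> E})"
    by (rule geodesic_dim_chi) (auto intro: hull_Q slice_pos)
  then show "geodesic_dim g {x \<in> Q. chi x \<in> E} = geodesic_dim g Q - 1"
    using E unfolding im by (simp add: geodesic_dim_Q facet_of_def)
qed

end

subsection \<open>Volume\<close>

lemma det_continuous_on:
  fixes A :: "'a::topological_space \<Rightarrow> real ^ 'k::finite ^ 'k"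
  assumes "\<And>i j. continuous_on S (\<lambda>x. A x $ i $ j)"
  shows "continuous_on S (\<lambda>x. det (A x))"
  unfolding det_def by (intro continuous_intros assms)

lemma integrable_on_compact:
  fixes f :: "'a::euclidean_space \<Rightarrow> real"
  assumes "compact S" "continuous_on S f"
  shows "f absolutely_integrable_on S"
proof -
  have i: "integrable lborel (\<lambda>x. indicator S x *\<^sub>R f x)"
    by (rule borel_integrable_compact[OF assms])
  have "(\<lambda>x. indicator S x *\<^sub>R f x) \<in> borel_measurable lborel"
    using i by (rule borel_measurable_integrable)
  from integrable_completion[OF this] i show ?thesis
    unfolding set_integrable_def by blast
qed

context chart
begin

definition frame :: "'k \<Rightarrow> real ^ 'n" where "frame i = P (0, axis i 1)"

text \<open>The Gram determinant of the differential of \<open>\<phi>\<close> in closed form: the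
  subtracted term removes the radial components of the frame vectors, and the outer division comes
  from the normalisation.\<close>

definition dens :: "real ^ 'k \<Rightarrow> real" where
  "dens c = sqrt (det (\<chi> i j. (form g (frame i) (frame j) -
      curv g * form g (\<Psi> c) (frame i) * form g (\<Psi> c) (frame j) / nrm2 g (\<Psi> c)) / nrm2 g (\<Psi> c)))"

definition d\<phi> :: "real ^ 'k \<Rightarrow> real ^ 'k \<Rightarrow> real ^ 'n" where
  "d\<phi> c v = P (0, v) /\<^sub>R sqrt (nrm2 g (\<Psi> c)) -
     (curv g * form g (\<Psi> c) (P (0, v)) / (nrm2 g (\<Psi> c) * sqrt (nrm2 g (\<Psi> c)))) *\<^sub>R \<Psi> c"

lemma \<Psi>_derivative: "(\<Psi> has_derivative (\<lambda>v. P (0, v))) (at c within S)"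
proof -
  have "((\<lambda>c. P (1, 0) + P (0, c)) has_derivative (\<lambda>v. 0 + P (0, v))) (at c within S)"
    by (intro has_derivative_add has_derivative_const bounded_linear_imp_has_derivative)
      (use linear_P0 in \<open>simp add: linear_conv_bounded_linear\<close>)
  then show ?thesis by (simp add: \<Psi>_affine[abs_def])
qed

lemma \<Psi>_continuous [continuous_intros]: "continuous_on S \<Psi>"
  by (rule has_derivative_continuous_on[OF \<Psi>_derivative])

lemma open_W: "open W"
  unfolding W_def nrm2_def by (intro open_Collect_less continuous_intros)

lemma nrm2_\<Psi>_derivative:
  "((\<lambda>c. nrm2 g (\<Psi> c)) has_derivative (\<lambda>v. 2 * curv g * form g (\<Psi> c) (P (0, v)))) (at c within S)"
proof -
  have "((\<lambda>c. flat g + curv g * form g (\<Psi> c) (\<Psi> c)) has_derivative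
      (\<lambda>v. 0 + curv g * (form g (\<Psi> c) (P (0, v)) + form g (P (0, v)) (\<Psi> c)))) (at c within S)"
    by (intro has_derivative_add has_derivative_const has_derivative_mult_right form_derivative \<Psi>_derivative)
  moreover have "curv g * (form g (\<Psi> c) (P (0, v)) + form g (P (0, v)) (\<Psi> c)) = 2 * curv g * form g (\<Psi> c) (P (0, v))" for v
    by (simp add: form_commute[of g "P (0, v)"])
  ultimately show ?thesis by (simp add: nrm2_def)
qed

lemma \<phi>_derivative:
  assumes "c \<in> W"
  shows "(\<phi> has_derivative d\<phi> c) (at c within S)"
proof -
  let ?n = "\<lambda>c. nrm2 g (\<Psi> c)"
  have n: "?n c > 0" using assms by (simp add: W_def)
  have 1: "((\<lambda>c. sqrt (?n c)) has_derivative
      (\<lambda>v. (2 * curv g * form g (\<Psi> c) (P (0, v))) * (inverse (sqrt (?n c)) / 2))) (at c within S)"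
  proof -
    have "(sqrt has_derivative (\<lambda>h. h * (inverse (sqrt (?n c)) / 2))) (at (?n c))"
    proof -
      have "(\<lambda>h. h * (inverse (sqrt (?n c)) / 2)) = (*) (inverse (sqrt (?n c)) / 2)"
        by (simp add: fun_eq_iff)
      then show ?thesis using DERIV_real_sqrt[OF n] by (simp only: has_field_derivative_def)
    qed
    from has_derivative_compose[OF nrm2_\<Psi>_derivative this] show ?thesis .
  qed
  have 2: "((\<lambda>c. inverse (sqrt (?n c))) has_derivative
      (\<lambda>v. - (inverse (sqrt (?n c)) * ((2 * curv g * form g (\<Psi> c) (P (0, v))) * (inverse (sqrt (?n c)) / 2)) * inverse (sqrt (?n c)))))
      (at c within S)"
    by (rule Deriv.has_derivative_inverse[OF _ 1]) (use n in simp)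
  have "((\<lambda>c. inverse (sqrt (?n c)) *\<^sub>R \<Psi> c) has_derivative
      (\<lambda>v. inverse (sqrt (?n c)) *\<^sub>R P (0, v) +
        (- (inverse (sqrt (?n c)) * ((2 * curv g * form g (\<Psi> c) (P (0, v))) * (inverse (sqrt (?n c)) / 2)) * inverse (sqrt (?n c)))) *\<^sub>R \<Psi> c))
      (at c within S)"
    by (rule has_derivative_scaleR[OF 2 \<Psi>_derivative])
  moreover have "inverse (sqrt (?n c)) *\<^sub>R P (0, v) +
        (- (inverse (sqrt (?n c)) * ((2 * curv g * form g (\<Psi> c) (P (0, v))) * (inverse (sqrt (?n c)) / 2)) * inverse (sqrt (?n c)))) *\<^sub>R \<Psi> c
      = d\<phi> c v" for v
  proof -
    define i where "i = inverse (sqrt (?n c))"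
    define F where "F = form g (\<Psi> c) (P (0, v))"
    have "inverse (?n c) = i * i"
      using n by (simp add: i_def inverse_mult_distrib[symmetric] del: inverse_mult_distrib)
    then have "curv g * F / (?n c * sqrt (?n c)) = curv g * F * (i * i * i)"
      by (simp add: divide_inverse i_def)
    then have "i * ((2 * curv g * F) * (i / 2)) * i = curv g * F / (?n c * sqrt (?n c))"
      by simp
    then have "inverse (sqrt (?n c)) * ((2 * curv g * form g (\<Psi> c) (P (0, v))) * (inverse (sqrt (?n c)) / 2)) * inverse (sqrt (?n c))
      = curv g * form g (\<Psi> c) (P (0, v)) / (?n c * sqrt (?n c))"
      by (simp only: i_def F_def)
    then show ?thesis by (simp add: d\<phi>_def)
  qed
  ultimately show ?thesis by (simp add: \<phi>_def[abs_def])
qed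

lemma form_d\<phi>:
  assumes "c \<in> W"
  shows "form g (d\<phi> c v) (d\<phi> c w) = (form g (P (0, v)) (P (0, w)) -
      curv g * form g (\<Psi> c) (P (0, v)) * form g (\<Psi> c) (P (0, w)) / nrm2 g (\<Psi> c)) / nrm2 g (\<Psi> c)"
proof -
  define n where "n = nrm2 g (\<Psi> c)"
  define s where "s = sqrt n"
  have n: "n > 0" using assms by (simp add: W_def n_def)
  have s: "s > 0" "s * s = n" using n by (simp_all add: s_def)
  \<comment> \<open>Both sides are 0 in the flat case and agree in the curved ones because
    \<open>n = curv g * form g (\<Psi> c) (\<Psi> c)\<close>; this treats the three geometries at
    once.\<close>
  have cc: "curv g * (curv g * form g (\<Psi> c) (\<Psi> c)) = curv g * n"
    by (cases g) (simp_all add: n_def nrm2_def)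
  define a where "a = form g (\<Psi> c) (P (0, v))"
  define b where "b = form g (\<Psi> c) (P (0, w))"
  have "form g (d\<phi> c v) (d\<phi> c w) =
      inverse s * inverse s * form g (P (0, v)) (P (0, w)) - 2 * inverse s * (curv g * a * b / (n * s))
      + (curv g * a / (n * s)) * (curv g * b / (n * s)) * form g (\<Psi> c) (\<Psi> c)"
    unfolding d\<phi>_def n_def[symmetric] s_def[symmetric]
    by (simp add: form_simps a_def b_def form_commute[of g "P (0, v)" "\<Psi> c"] algebra_simps)
  also have "(curv g * a / (n * s)) * (curv g * b / (n * s)) * form g (\<Psi> c) (\<Psi> c)
      = (curv g * (curv g * form g (\<Psi> c) (\<Psi> c))) * a * b / (n * s * (n * s))" by (simp add: mult_ac)
  also have "n * s * (n * s) = n * n * (s * s)" by (simp add: mult_ac)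
  also have "(curv g * (curv g * form g (\<Psi> c) (\<Psi> c))) * a * b / (n * n * (s * s)) = curv g * a * b / (n * n)"
    unfolding cc s(2) using n by (simp add: field_simps)
  also have "2 * inverse s * (curv g * a * b / (n * s)) = 2 * (curv g * a * b / (n * n))"
  proof -
    have "inverse s * (curv g * a * b / (n * s)) = curv g * a * b / (n * (s * s))"
      by (simp add: divide_inverse mult_ac)
    then show ?thesis unfolding s(2) by simp
  qed
  also have "inverse s * inverse s = inverse n" using s by (simp add: nonzero_inverse_mult_distrib[symmetric])
  finally show ?thesis
    using n unfolding n_def[symmetric] a_def b_def by (simp add: field_simps)
qed

lemma dens_gram:
  assumes "c \<in> W"
  shows "dens c = sqrt (det (\<chi> i j. form g (d\<phi> c (axis i 1)) (d\<phi> c (axis j 1))))"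
  unfolding dens_def frame_def form_d\<phi>[OF assms] ..

lemma dens_continuous: "continuous_on W dens"
proof -
  have "nrm2 g (\<Psi> c) \<noteq> 0" if "c \<in> W" for c using that by (simp add: W_def)
  then show ?thesis
    unfolding dens_def
    by (intro continuous_on_real_sqrt det_continuous_on) (auto simp: nrm2_def intro!: continuous_intros)
qed

lemma chi_differentiable:
  assumes "sl x \<noteq> 0"
  shows "chi differentiable (at x)"
proof -
  have "linear (\<lambda>x. form g x q)" by (rule linearI) (simp_all add: form_simps)
  then have s: "sl differentiable (at x)"
    unfolding slice_def[abs_def] by (intro differentiable_add differentiable_const linear_imp_differentiable)
  have l: "linear (\<lambda>x. (\<chi> i. form g x (e i)) :: real ^ 'k)"
    by (rule linearI) (simp_all add: form_simps vec_eq_iff)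
  have "co = (\<lambda>x. (\<chi> i. form g x (e i)) - (\<chi> i. flat g * r i))"
    by (simp add: coords_def vec_eq_iff fun_eq_iff)
  then have "co differentiable (at x)"
    using linear_imp_differentiable[OF l] by (simp add: differentiable_diff)
  then show ?thesis
    unfolding chi_def[abs_def] using s assms by (intro differentiable_scaleR differentiable_inverse)
qed

text \<open>Any parametrisation factors as \<open>\<phi>\<close> after \<open>h\<close>, with
  \<open>h\<close> the chart expression of \<open>\<phi>'\<close>. Its Gram matrix is congruent to
  that of \<open>\<phi>\<close> by the Jacobian of \<open>h\<close>, so the change of variables
  absorbs the determinant. \<open>X\<close> is general because the regions met later are not
  cells.\<close>

lemma volume_param:
  fixes \<phi>' :: "real ^ 'k \<Rightarrow> real ^ 'n"
  assumes W': "open W'" and inj: "inj_on \<phi>' W'" and diff: "\<phi>' differentiable_on W'"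
    and hull: "\<phi>' ` W' \<subseteq> geodesic_hull g Q" and X: "X \<subseteq> \<phi>' ` W'" "compact X" "\<And>x. x \<in> X \<Longrightarrow> sl x > 0"
  shows "integral {c \<in> W'. \<phi>' c \<in> X} (volume_element g \<phi>') = integral (chi ` X) dens"
proof -
  define S where "S = {c \<in> W'. \<phi>' c \<in> X}"
  define h where "h = (\<lambda>c. chi (\<phi>' c))"
  define h' where "h' = (\<lambda>c. frechet_derivative h (at c))"
  have cont: "continuous_on W' \<phi>'" by (rule differentiable_imp_continuous_on[OF diff])
  have Seq: "S = W' \<inter> \<phi>' -` X" by (auto simp: S_def)
  have "closedin (top_of_set W') S"
    unfolding Seq by (rule continuous_closedin_preimage[OF cont compact_imp_closed[OF X(2)]])
  then obtain T where "closed T" "S = W' \<inter> T" by (auto simp: closedin_closed)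
  then have S: "S \<in> sets lebesgue" using W' by simp
  \<comment> \<open>\<open>\<phi>'\<close> may run outside the half sphere of the projection; on
    this open set \<open>h\<close> is differentiable and
    \<open>\<phi> (h c) = \<phi>' c\<close>.\<close>
  define U where "U = {c \<in> W'. sl (\<phi>' c) > 0}"
  have U: "open U"
  proof -
    have "continuous_on W' (\<lambda>c. sl (\<phi>' c))"
      unfolding slice_def by (intro continuous_intros cont)
    then have "open (W' \<inter> (\<lambda>c. sl (\<phi>' c)) -` {0<..})"
      by (rule continuous_open_preimage[OF _ W']) simp
    moreover have "U = W' \<inter> (\<lambda>c. sl (\<phi>' c)) -` {0<..}" by (auto simp: U_def)
    ultimately show ?thesis by simp
  qed
  have SU: "S \<subseteq> U" using X(3) by (auto simp: S_def U_def)
  have hullU: "\<phi>' c \<in> geodesic_hull g Q" "sl (\<phi>' c) > 0" if "c \<in> U" for c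
    using that hull by (auto simp: U_def)
  have hd: "h differentiable (at c)" if "c \<in> U" for c
  proof -
    have "\<phi>' differentiable (at c)"
      using diff that W' by (auto simp: U_def differentiable_on_eq_differentiable_at)
    moreover have "chi differentiable (at (\<phi>' c))" using hullU[OF that] by (intro chi_differentiable) auto
    ultimately show ?thesis
      unfolding h_def using differentiable_chain_at[of \<phi>' c chi] by (simp add: o_def)
  qed
  have der: "(h has_derivative h' c) (at c within S)" if "c \<in> S" for c
    using hd that SU frechet_derivative_works has_derivative_at_withinI unfolding h'_def by blast
  have injh: "inj_on h S"
  proof (rule inj_onI)
    fix c d assume cd: "c \<in> S" "d \<in> S" "h c = h d"
    then have "\<phi>' c = \<phi>' d" using SU hullU by (intro inj_chi) (auto simp: h_def)
    then show "c = d" using inj cd by (auto simp: S_def dest: inj_onD)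
  qed
  have im: "h ` S = chi ` X" using X(1) by (auto simp: h_def S_def)
  have XW: "chi ` X \<subseteq> W"
  proof safe
    fix x assume "x \<in> X"
    then show "chi x \<in> W" using X hull by (intro \<phi>_chi) auto
  qed
  have "continuous_on X chi" using X(3) by (intro chi_continuous) force
  then have "compact (chi ` X)" by (rule compact_continuous_image[OF _ X(2)])
  then have int: "dens absolutely_integrable_on (h ` S)"
    unfolding im by (rule integrable_on_compact) (rule continuous_on_subset[OF dens_continuous XW])
  have vol: "volume_element g \<phi>' c = \<bar>det (matrix (h' c))\<bar> * dens (h c)" if "c \<in> S" for c
  proof -
    have c: "c \<in> U" using that SU by auto
    have hW: "h c \<in> W" using XW im that by blast
    have hh: "(h has_derivative h' c) (at c)"
      using hd[OF c] unfolding h'_def by (simp add: frechet_derivative_works)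
    have "((\<lambda>c. \<phi> (h c)) has_derivative (\<lambda>v. d\<phi> (h c) (h' c v))) (at c)"
      by (rule has_derivative_compose[OF hh \<phi>_derivative[OF hW]])
    then have "(\<phi>' has_derivative (\<lambda>v. d\<phi> (h c) (h' c v))) (at c)"
      by (rule has_derivative_transform_within_open[OF _ U c])
        (simp add: h_def \<phi>_chi(2) hullU)
    then have fr: "frechet_derivative \<phi>' (at c) = (\<lambda>v. d\<phi> (h c) (h' c v))"
      by (rule frechet_derivative_at[symmetric])
    define M where "M = matrix (h' c)"
    define G where "G = (\<chi> i j. form g (d\<phi> (h c) (axis i 1)) (d\<phi> (h c) (axis j 1)))"
    have lin: "linear (h' c)" using hh has_derivative_linear by blast
    have lind: "linear (d\<phi> (h c))" using \<phi>_derivative[OF hW] has_derivative_linear by blast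
    have col: "d\<phi> (h c) (h' c (axis j 1)) = (\<Sum>i\<in>UNIV. M $ i $ j *\<^sub>R d\<phi> (h c) (axis i 1))" for j
    proof -
      have "h' c (axis j 1) = (\<Sum>i\<in>UNIV. M $ i $ j *\<^sub>R axis i 1)"
        by (subst basis_expansion[of "h' c (axis j 1)", symmetric])
          (simp add: M_def matrix_def scalar_mult_eq_scaleR)
      then show ?thesis by (simp add: linear_sum[OF lind] linear_scale[OF lind])
    qed
    have "(\<chi> i j. form g (d\<phi> (h c) (h' c (axis i 1))) (d\<phi> (h c) (h' c (axis j 1)))) = transpose M ** G ** M"
    proof -
      have "form g (d\<phi> (h c) (h' c (axis i 1))) (d\<phi> (h c) (h' c (axis j 1))) =
          (\<Sum>b\<in>UNIV. \<Sum>a\<in>UNIV. M $ a $ i * G $ a $ b * M $ b $ j)" for i j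
        unfolding col form_sum_left form_sum_right
        by (simp add: form_simps G_def mult_ac)
      then show ?thesis
        by (simp add: vec_eq_iff matrix_matrix_mult_def transpose_def sum_distrib_right)
    qed
    then have "volume_element g \<phi>' c = sqrt ((det M)\<^sup>2 * det G)"
      unfolding volume_element_def fr by (simp add: det_mul power2_eq_square mult_ac)
    also have "\<dots> = \<bar>det M\<bar> * dens (h c)"
      unfolding dens_gram[OF hW] G_def[symmetric] by (simp add: real_sqrt_mult)
    finally show ?thesis by (simp add: M_def)
  qed
  have "integral S (volume_element g \<phi>') = integral S (\<lambda>c. \<bar>det (matrix (h' c))\<bar> * dens (h c))"
    by (rule integral_cong) (rule vol)
  also have "\<dots> = integral (h ` S) dens"
    by (rule change_of_variables_cart(2)[OF S der injh int])
  finally show ?thesis unfolding im unfolding S_def .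
qed

lemma \<phi>_param:
  "inj_on \<phi> W" "\<phi> differentiable_on W" "\<phi> ` W \<subseteq> geodesic_hull g Q"
  "X \<subseteq> geodesic_hull g Q \<Longrightarrow> (\<And>x. x \<in> X \<Longrightarrow> sl x > 0) \<Longrightarrow> X \<subseteq> \<phi> ` W"
proof -
  show "inj_on \<phi> W" by (rule inj_\<phi>)
  show "\<phi> differentiable_on W"
    unfolding differentiable_on_def differentiable_def using \<phi>_derivative by blast
  show "\<phi> ` W \<subseteq> geodesic_hull g Q" using chi_\<phi>(1) by auto
  show "X \<subseteq> \<phi> ` W" if "X \<subseteq> geodesic_hull g Q" "\<And>x. x \<in> X \<Longrightarrow> sl x > 0"
  proof
    fix x assume "x \<in> X"
    then show "x \<in> \<phi> ` W" using \<phi>_chi[of x] that by force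
  qed
qed

text \<open>All admissible parametrisations give the integral in the chart, and
  \<open>\<phi>\<close> is one of them; this resolves the definite description.\<close>

theorem cell_volume_chart: "cell_volume g TYPE('k) Q = integral (chi ` Q) dens"
proof -
  have *: "integral {c \<in> W'. \<phi>' c \<in> Q} (volume_element g \<phi>') = integral (chi ` Q) dens"
    if "open W'" "inj_on \<phi>' W'" "\<phi>' differentiable_on W'" "\<phi>' ` W' \<subseteq> geodesic_hull g Q" "Q \<subseteq> \<phi>' ` W'"
    for \<phi>' :: "real ^ 'k \<Rightarrow> real ^ 'n" and W'
    by (rule volume_param[OF that compact_Q slice_pos])
  have Q: "Q \<subseteq> \<phi> ` W" by (rule \<phi>_param(4)) (auto intro: hull_Q slice_pos)
  show ?thesis
    unfolding cell_volume_def
  proof (rule the_equality)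
    show "\<exists>(\<phi> :: real ^ 'k \<Rightarrow> real ^ 'n) W. open W \<and> inj_on \<phi> W \<and> \<phi> differentiable_on W \<and> \<phi> ` W \<subseteq> geodesic_hull g Q \<and>
        Q \<subseteq> \<phi> ` W \<and> integral (chi ` Q) dens = integral {c \<in> W. \<phi> c \<in> Q} (volume_element g \<phi>)"
      by (rule exI[of _ \<phi>], rule exI[of _ W]) (use *[OF open_W \<phi>_param(1-3) Q] open_W \<phi>_param(1-3) Q in simp)
  qed (use * in auto)
qed

end

text \<open>Both integrals compute the volume of \<open>X\<close> in the same parametrisation, that
  of the second chart.\<close>

lemma chart_change:
  fixes e1 e2 :: "'k::finite \<Rightarrow> real ^ 'n::finite"
  assumes 1: "chart g Q q1 e1 r1 P1" and 2: "chart g Q q2 e2 r2 P2"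
    and X: "compact X" "X \<subseteq> geodesic_hull g Q" "\<And>x. x \<in> X \<Longrightarrow> slice g q1 x > 0" "\<And>x. x \<in> X \<Longrightarrow> slice g q2 x > 0"
  shows "integral (chart.chi g q1 e1 r1 ` X) (chart.dens g P1) = integral (chart.chi g q2 e2 r2 ` X) (chart.dens g P2)"
proof -
  interpret c1: chart g Q q1 e1 r1 P1 by fact
  interpret c2: chart g Q q2 e2 r2 P2 by fact
  have X2: "X \<subseteq> c2.\<phi> ` c2.W" by (rule c2.\<phi>_param(4)[OF X(2,4)])
  show ?thesis
    using c1.volume_param[OF c2.open_W c2.\<phi>_param(1-3) X2 X(1,3)]
      c2.volume_param[OF c2.open_W c2.\<phi>_param(1-3) X2 X(1,4)] by simp
qed

subsection \<open>Orthonormal frames and conormals\<close>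

text \<open>Orthogonal vectors with nonzero squares are independent even for an indefinite form, so
  \<open>dim V\<close> of them form a basis.\<close>

lemma orthogonal_expansion:
  fixes b :: "'i \<Rightarrow> real ^ 'n::finite"
  assumes J: "finite J" and orth: "\<And>i j. i \<in> J \<Longrightarrow> j \<in> J \<Longrightarrow> i \<noteq> j \<Longrightarrow> form g (b i) (b j) = 0"
    and nz: "\<And>i. i \<in> J \<Longrightarrow> form g (b i) (b i) \<noteq> 0"
    and V: "subspace V" "b ` J \<subseteq> V" "dim V = card J" and v: "v \<in> V"
  shows "v = (\<Sum>j\<in>J. (form g v (b j) / form g (b j) (b j)) *\<^sub>R b j)"
proof -
  define f where "f = (\<lambda>v. \<Sum>j\<in>J. (form g v (b j) / form g (b j) (b j)) *\<^sub>R b j)"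
  have f: "linear f"
    by (rule linearI) (simp_all add: f_def form_simps add_divide_distrib scaleR_add_left sum.distrib scaleR_sum_right)
  have fb: "f (b i) = b i" if "i \<in> J" for i
  proof -
    have "f (b i) = (\<Sum>j\<in>J. if j = i then b i else 0)"
      unfolding f_def by (rule sum.cong[OF refl]) (use that orth nz in auto)
    then show ?thesis using that J by simp
  qed
  have "inj_on b J"
    using orth nz by (intro inj_onI) metis
  then have card: "card (b ` J) = dim V" by (simp add: card_image V(3))
  have "independent (b ` J)"
  proof (rule independent_if_scalars_zero)
    show "finite (b ` J)" using J by simp
    fix u x assume s: "(\<Sum>x\<in>b ` J. u x *\<^sub>R x) = 0" and x: "x \<in> b ` J"
    then obtain i where i: "i \<in> J" "x = b i" by auto
    have "0 = form g (\<Sum>x\<in>b ` J. u x *\<^sub>R x) (b i)" by (simp add: s)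
    also have "\<dots> = (\<Sum>j\<in>J. u (b j) * form g (b j) (b i))"
      by (simp add: sum.reindex[OF \<open>inj_on b J\<close>] form_sum_left form_simps)
    also have "\<dots> = (\<Sum>j\<in>J. if j = i then u (b i) * form g (b i) (b i) else 0)"
      by (rule sum.cong[OF refl]) (use i orth in auto)
    also have "\<dots> = u (b i) * form g (b i) (b i)" using i J by simp
    finally show "u x = 0" using nz[OF i(1)] i(2) by simp
  qed
  then have "V \<subseteq> span (b ` J)"
    using card_eq_dim[OF V(2) card] J by simp
  then have "f v = id v"
    using linear_eq_on_span[OF f linear_id, of "b ` J" v] fb v by auto
  then show ?thesis by (simp add: f_def)
qed

text \<open>One Gram-Schmidt step, starting from a vector outside the span of the given
  ones.\<close>

lemma orthonormal_extension:
  fixes T :: "(real ^ 'n::finite) set"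
  assumes T: "subspace T" and pos: "\<And>v. v \<in> T \<Longrightarrow> v \<noteq> 0 \<Longrightarrow> form g v v > 0"
    and I: "finite I" "j \<notin> I" "card I < dim T"
    and e: "\<And>i. i \<in> I \<Longrightarrow> e i \<in> T" "\<And>i k. i \<in> I \<Longrightarrow> k \<in> I \<Longrightarrow> form g (e i) (e k) = (if i = k then 1 else 0)"
  obtains u where "u \<in> T" "form g u u = 1" "\<And>i. i \<in> I \<Longrightarrow> form g u (e i) = 0"
proof -
  have "\<not> T \<subseteq> span (e ` I)"
  proof
    assume "T \<subseteq> span (e ` I)"
    then have "dim T \<le> card (e ` I)" using I by (intro dim_le_card) auto
    also have "\<dots> \<le> card I" by (rule card_image_le[OF I(1)])
    finally show False using I by simp
  qed
  then obtain v where v: "v \<in> T" "v \<notin> span (e ` I)" by auto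
  define w where "w = v - (\<Sum>i\<in>I. form g v (e i) *\<^sub>R e i)"
  have wT: "w \<in> T" unfolding w_def
    by (intro subspace_diff[OF T] v subspace_sum[OF T] subspace_scale[OF T] e)
  have "(\<Sum>i\<in>I. form g v (e i) *\<^sub>R e i) \<in> span (e ` I)"
    by (intro span_sum span_scale span_base) auto
  then have w0: "w \<noteq> 0" using v(2) by (auto simp: w_def)
  have wp: "form g w w > 0" by (rule pos[OF wT w0])
  have we: "form g w (e k) = 0" if "k \<in> I" for k
  proof -
    have "(\<Sum>i\<in>I. form g v (e i) * form g (e i) (e k)) = (\<Sum>i\<in>I. if i = k then form g v (e k) else 0)"
      by (rule sum.cong[OF refl]) (use e(2) that in auto)
    then show ?thesis using that I by (simp add: w_def form_simps form_sum_left)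
  qed
  show thesis
  proof (rule that[of "w /\<^sub>R sqrt (form g w w)"])
    show "w /\<^sub>R sqrt (form g w w) \<in> T" by (rule subspace_scale[OF T wT])
    show "form g (w /\<^sub>R sqrt (form g w w)) (w /\<^sub>R sqrt (form g w w)) = 1"
      using wp by (simp add: form_simps power2_eq_square[symmetric] field_simps)
    show "form g (w /\<^sub>R sqrt (form g w w)) (e i) = 0" if "i \<in> I" for i
      using we[OF that] by (simp add: form_simps)
  qed
qed

lemma orthonormal_exists:
  fixes T :: "(real ^ 'n::finite) set"
  assumes T: "subspace T" and pos: "\<And>v. v \<in> T \<Longrightarrow> v \<noteq> 0 \<Longrightarrow> form g v v > 0"
    and I: "finite I" "card I \<le> dim T"
  shows "\<exists>e. (\<forall>i\<in>I. e i \<in> T) \<and> (\<forall>i\<in>I. \<forall>k\<in>I. form g (e i) (e k) = (if i = k then 1 else 0))"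
  using I
proof (induction I rule: finite_induct)
  case (insert j I)
  then obtain e where e: "\<forall>i\<in>I. e i \<in> T" "\<forall>i\<in>I. \<forall>k\<in>I. form g (e i) (e k) = (if i = k then 1 else 0)"
    by auto
  obtain u where u: "u \<in> T" "form g u u = 1" "\<And>i. i \<in> I \<Longrightarrow> form g u (e i) = 0"
    by (rule orthonormal_extension[OF T pos insert(1,2), of e]) (use insert e in auto)
  show ?case
  proof (rule exI[of _ "e(j := u)"], intro conjI ballI)
    fix i assume "i \<in> insert j I" then show "(e(j := u)) i \<in> T" using e u by auto
  next
    fix i k assume "i \<in> insert j I" "k \<in> insert j I"
    then show "form g ((e(j := u)) i) ((e(j := u)) k) = (if i = k then 1 else 0)"
      using e u insert(2) u(3)[of i] form_commute[of g u "e i"] by (cases "i = j"; cases "k = j") auto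
  qed
qed auto

text \<open>Tangent directions in the affine model. In the linear models it is the full span, which
  also contains the radial direction, so its dimension is larger by 1.\<close>

definition dirs :: "'n::finite geometry \<Rightarrow> (real ^ 'n) set \<Rightarrow> (real ^ 'n) set" where
  "dirs g Q = (if g = Euclidean then span {x - y | x y. x \<in> Q \<and> y \<in> Q} else span Q)"

lemma subspace_dirs: "subspace (dirs g Q)"
  by (simp add: dirs_def)

lemma dirs_mono: "F \<subseteq> Q \<Longrightarrow> dirs g F \<subseteq> dirs g Q"
  by (auto simp: dirs_def intro!: span_mono)

lemma dirs_Euclidean:
  assumes "g = Euclidean" "y \<in> Q"
  shows "dirs g Q = span ((\<lambda>x. x - y) ` Q)"
proof -
  have "span {x - y | x y. x \<in> Q \<and> y \<in> Q} \<subseteq> span ((\<lambda>x. x - y) ` Q)"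
  proof (rule span_minimal[OF _ subspace_span], safe)
    fix x z assume "x \<in> Q" "z \<in> Q"
    then have "(x - y) - (z - y) \<in> span ((\<lambda>x. x - y) ` Q)" by (intro span_diff span_base) auto
    then show "x - z \<in> span ((\<lambda>x. x - y) ` Q)" by simp
  qed
  moreover have "span ((\<lambda>x. x - y) ` Q) \<subseteq> span {x - y | x y. x \<in> Q \<and> y \<in> Q}"
    by (rule span_mono) (use assms in auto)
  ultimately show ?thesis using assms by (auto simp: dirs_def)
qed

lemma tangent_space_eq:
  assumes "y \<in> Q"
  shows "tangent_space g Q y = {v \<in> dirs g Q. g \<noteq> Euclidean \<longrightarrow> form g v y = 0}"
proof (cases "g = Euclidean")
  case True
  then show ?thesis using dirs_Euclidean[OF True assms] by (simp add: tangent_space_def)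
next
  case False
  then show ?thesis by (cases g) (auto simp: tangent_space_def dirs_def)
qed

lemma dim_dirs:
  assumes "Q \<noteq> {}"
  shows "int (dim (dirs g Q)) = geodesic_dim g Q + (if g = Euclidean then 0 else 1)"
proof (cases "g = Euclidean")
  case True
  obtain y where y: "y \<in> Q" using assms by auto
  have "aff_dim Q = int (dim ((\<lambda>x. x - y) ` Q))"
    by (rule aff_dim_eq_dim_subtract) (simp add: hull_inc y)
  moreover have "geodesic_dim g Q = aff_dim Q" using True by (simp add: geodesic_dim_def)
  ultimately show ?thesis using True unfolding dirs_Euclidean[OF True y] by (simp only: dim_span) simp
next
  case False
  then show ?thesis by (cases g) (simp_all add: dirs_def geodesic_dim_def)
qed

lemma affine_hull_dirs:
  assumes "g = Euclidean" "y \<in> Q"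
  shows "ahull g Q = (+) y ` dirs g Q"
  using affine_hull_span_gen[of y Q] assms dirs_Euclidean[OF assms] by (simp add: hull_inc ahull_def)

lemma ahull_diff_dirs:
  assumes "x \<in> ahull g Q" "g = Euclidean \<Longrightarrow> p \<in> Q"
  shows "x - flat g *\<^sub>R p \<in> dirs g Q"
proof (cases "g = Euclidean")
  case True
  then show ?thesis using assms affine_hull_dirs[OF True assms(2)[OF True]] by auto
next
  case False
  then show ?thesis using assms by (simp add: flat_0 dirs_def ahull_def)
qed

lemma ahull_add_dirs:
  assumes "p \<in> ahull g Q" "v \<in> dirs g Q" "g = Euclidean \<Longrightarrow> p \<in> Q \<and> a = 1"
  shows "a *\<^sub>R p + v \<in> ahull g Q"
proof (cases "g = Euclidean")
  case True
  then show ?thesis using assms affine_hull_dirs[OF True, of p Q] by auto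
next
  case False
  then show ?thesis using assms by (simp add: dirs_def ahull_def span_add span_scale)
qed

text \<open>In the curved cases \<open>p\<close> completes \<open>e\<close> to an orthogonal basis
  of the span of \<open>Q\<close>, with square \<open>curv g\<close>; it need not lie in
  \<open>Q\<close>. In the affine model \<open>p\<close> is a base point in
  \<open>Q\<close>.\<close>

definition unit_frame :: "'n::finite geometry \<Rightarrow> (real ^ 'n) set \<Rightarrow> real ^ 'n \<Rightarrow> 'i set \<Rightarrow> ('i \<Rightarrow> real ^ 'n) \<Rightarrow> bool" where
  "unit_frame g Q p I e \<longleftrightarrow>
     finite I \<and> int (card I) = geodesic_dim g Q \<and> (g = Euclidean \<longrightarrow> p \<in> Q) \<and>
     (g \<noteq> Euclidean \<longrightarrow> p \<in> dirs g Q \<and> form g p p = curv g \<and> (\<forall>i\<in>I. form g (e i) p = 0)) \<and>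
     (\<forall>i\<in>I. e i \<in> dirs g Q) \<and> (\<forall>i\<in>I. \<forall>k\<in>I. form g (e i) (e k) = (if i = k then 1 else 0))"

text \<open>In the curved cases \<open>form g p p = curv g\<close> is its own inverse, which gives
  the coefficient of \<open>p\<close>; in the flat case the factor \<open>curv g\<close> removes
  that term.\<close>

lemma unit_frame_expansion:
  assumes f: "unit_frame g Q p I e" and Q: "Q \<noteq> {}" and v: "v \<in> dirs g Q"
  shows "v = (curv g * form g v p) *\<^sub>R p + (\<Sum>i\<in>I. form g v (e i) *\<^sub>R e i)"
proof (cases "g = Euclidean")
  case True
  have "v = (\<Sum>j\<in>I. (form g v (e j) / form g (e j) (e j)) *\<^sub>R e j)"
    by (rule orthogonal_expansion[OF _ _ _ subspace_dirs _ _ v])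
      (use f dim_dirs[OF Q, of g] True in \<open>auto simp: unit_frame_def\<close>)
  also have "\<dots> = (\<Sum>j\<in>I. form g v (e j) *\<^sub>R e j)"
    by (rule sum.cong[OF refl]) (use f in \<open>auto simp: unit_frame_def\<close>)
  finally show ?thesis using True by simp
next
  case False
  \<comment> \<open>\<open>None\<close> is the index of \<open>p\<close> in the enlarged orthogonal
    system.\<close>
  define J where "J = insert None (Some ` I)"
  define b where "b = (\<lambda>i. case i of None \<Rightarrow> p | Some i \<Rightarrow> e i)"
  have I: "finite I" using f by (simp add: unit_frame_def)
  have c0: "curv g \<noteq> 0" using False by (cases g) auto
  have J: "finite J" "card J = card I + 1"
    using I by (auto simp: J_def card_insert_if card_image)
  have pe: "form g p (e i) = 0" if "i \<in> I" for i
    using f that False by (subst form_commute) (auto simp: unit_frame_def)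
  have "v = (\<Sum>j\<in>J. (form g v (b j) / form g (b j) (b j)) *\<^sub>R b j)"
  proof (rule orthogonal_expansion[OF J(1) _ _ subspace_dirs _ _ v])
    show "form g (b i) (b j) = 0" if "i \<in> J" "j \<in> J" "i \<noteq> j" for i j
    proof -
      have ee: "form g (e k) (e l) = 0" if "k \<in> I" "l \<in> I" "k \<noteq> l" for k l
        using f that by (simp add: unit_frame_def)
      have ep: "form g (e k) p = 0" if "k \<in> I" for k
        using f that False by (simp add: unit_frame_def)
      show ?thesis using that ep pe by (auto simp: J_def b_def) (use ee in blast)
    qed
    show "form g (b i) (b i) \<noteq> 0" if "i \<in> J" for i
      using that f False c0 by (auto simp: J_def b_def unit_frame_def)
    show "b ` J \<subseteq> dirs g Q" using f False by (auto simp: J_def b_def unit_frame_def)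
    show "dim (dirs g Q) = card J"
      using dim_dirs[OF Q, of g] f False J by (auto simp: unit_frame_def)
  qed
  also have "\<dots> = (form g v p / form g p p) *\<^sub>R p + (\<Sum>i\<in>I. (form g v (e i) / form g (e i) (e i)) *\<^sub>R e i)"
    unfolding J_def using I by (subst sum.insert) (auto simp: b_def sum.reindex)
  also have "(\<Sum>i\<in>I. (form g v (e i) / form g (e i) (e i)) *\<^sub>R e i) = (\<Sum>i\<in>I. form g v (e i) *\<^sub>R e i)"
    by (rule sum.cong[OF refl]) (use f in \<open>auto simp: unit_frame_def\<close>)
  also have "form g v p / form g p p = curv g * form g v p"
  proof -
    have "form g p p = curv g" using f False by (simp add: unit_frame_def)
    then show ?thesis using False by (cases g) auto
  qed
  finally show ?thesis .
qed

text \<open>A centre of projection in the hull of the cell. On the sphere the vector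
  \<open>a\<close> that bounds the open half sphere is projected orthogonally to the span, which
  does not change its products with points of \<open>Q\<close>, and normalised; otherwise any point
  of \<open>Q\<close> serves.\<close>

lemma cell_point:
  assumes Q: "convex_polytope g Q" "Q \<noteq> {}" and sph: "g = Spherical \<Longrightarrow> \<exists>a. \<forall>x\<in>Q. a \<bullet> x > 0"
  obtains p where "p \<in> ahull g Q" "g = Euclidean \<Longrightarrow> p \<in> Q" "g \<noteq> Euclidean \<Longrightarrow> p \<in> dirs g Q \<and> form g p p = curv g"
    "\<And>i0. g = Hyperbolic i0 \<Longrightarrow> p \<in> model_space g" "\<And>x. x \<in> Q \<Longrightarrow> flat g + curv g * form g x p > 0"
proof (cases g)
  case Euclidean
  obtain p where "p \<in> Q" using Q by auto
  then show thesis using that[of p] Euclidean ahull_superset[of Q g] by auto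
next
  case Spherical
  obtain a where a: "\<And>x. x \<in> Q \<Longrightarrow> a \<bullet> x > 0" using sph[OF Spherical] by auto
  obtain y z where y: "y \<in> span Q" "\<And>w. w \<in> span Q \<Longrightarrow> orthogonal z w" "a = y + z"
    using orthogonal_subspace_decomp_exists[of Q a] by metis
  have yx: "y \<bullet> x > 0" if "x \<in> Q" for x
    using a[OF that] y(2)[of x] span_base[OF that] by (simp add: y(3) inner_add_left orthogonal_def)
  have y0: "y \<noteq> 0" using yx Q(2) by force
  define p where "p = y /\<^sub>R norm y"
  have pS: "p \<in> span Q" using y(1) by (simp add: p_def span_scale)
  have "p \<bullet> p = 1" using y0 by (simp add: p_def power2_norm_eq_inner[symmetric] power2_eq_square[symmetric] field_simps)
  moreover have "x \<bullet> p > 0" if "x \<in> Q" for x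
    using yx[OF that] y0 by (simp add: p_def inner_commute)
  ultimately show thesis
    using pS Spherical by (intro that[of p]) (auto simp: ahull_def dirs_def form_def)
next
  case (Hyperbolic i0)
  obtain p where p: "p \<in> Q" using Q by auto
  have m: "Q \<subseteq> model_space g" by (rule convex_polytope_subset[OF Q(1)])
  have "form g x p < 0" if "x \<in> Q" for x
    using form_model_space_neg[of p i0 x] m p that Hyperbolic by auto
  moreover have "form g p p = -1" using m p Hyperbolic by (auto simp: model_space_def)
  ultimately show thesis
    using p m Hyperbolic by (intro that[of p]) (auto simp: ahull_def dirs_def span_base)
qed

lemma tangent_dim:
  assumes Q: "Q \<noteq> {}" and p: "g \<noteq> Euclidean \<Longrightarrow> p \<in> dirs g Q \<and> form g p p = curv g"
  defines "T \<equiv> {v \<in> dirs g Q. g \<noteq> Euclidean \<longrightarrow> form g v p = 0}"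
  shows "subspace T" "int (dim T) = geodesic_dim g Q"
proof -
  show T: "subspace T"
    using subspace_dirs[of g Q] by (auto simp: T_def subspace_def form_simps)
  show "int (dim T) = geodesic_dim g Q"
  proof (cases "g = Euclidean")
    case True
    then have "T = dirs g Q" by (auto simp: T_def)
    then show ?thesis using dim_dirs[OF Q, of g] True by simp
  next
    case False
    have c1: "curv g * curv g = 1" by (rule curv_square[OF False])
    have "p \<notin> T" using p False c1 by (auto simp: T_def)
    then have "p \<notin> span T" using T by (simp add: span_eq_iff[THEN iffD2])
    moreover have "span (insert p T) = dirs g Q"
    proof
      show "span (insert p T) \<subseteq> dirs g Q"
        by (rule span_minimal[OF _ subspace_dirs]) (use p False in \<open>auto simp: T_def\<close>)
      show "dirs g Q \<subseteq> span (insert p T)"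
      proof
        fix v assume v: "v \<in> dirs g Q"
        define w where "w = v - (curv g * form g v p) *\<^sub>R p"
        have "form g w p = 0"
          using p[OF False] c1 by (simp add: w_def form_simps mult_ac)
        then have "w \<in> T"
          using v p[OF False] by (auto simp: T_def w_def intro!: subspace_diff[OF subspace_dirs] subspace_scale[OF subspace_dirs])
        then have "w + (curv g * form g v p) *\<^sub>R p \<in> span (insert p T)"
          by (intro span_add span_scale span_base) auto
        then show "v \<in> span (insert p T)" by (simp add: w_def)
      qed
    qed
    ultimately have "dim (dirs g Q) = dim T + 1"
      using dim_insert[of p T] dim_span[of "insert p T"] by simp
    then show ?thesis using dim_dirs[OF Q, of g] False by simp
  qed
qed

lemma unit_frame_exists:
  assumes Q: "Q \<noteq> {}" and p: "g = Euclidean \<Longrightarrow> p \<in> Q" "g \<noteq> Euclidean \<Longrightarrow> p \<in> dirs g Q \<and> form g p p = curv g"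
    "\<And>i0. g = Hyperbolic i0 \<Longrightarrow> p \<in> model_space g" and I: "finite I" "int (card I) = geodesic_dim g Q"
  shows "\<exists>e. unit_frame g Q p I e"
proof -
  define T where "T = {v \<in> dirs g Q. g \<noteq> Euclidean \<longrightarrow> form g v p = 0}"
  have "\<exists>e. (\<forall>i\<in>I. e i \<in> T) \<and> (\<forall>i\<in>I. \<forall>k\<in>I. form g (e i) (e k) = (if i = k then 1 else 0))"
  proof (rule orthonormal_exists[OF _ _ I(1)])
    show "subspace T" "card I \<le> dim T" unfolding T_def using tangent_dim[OF Q p(2)] I by simp_all
    show "form g v v > 0" if "v \<in> T" "v \<noteq> 0" for v
      by (rule form_pos[of g p]) (use that p(3) in \<open>auto simp: T_def\<close>)
  qed
  then show ?thesis using p I by (auto simp: unit_frame_def T_def)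
qed

text \<open>The frame of \<open>F\<close> extends to the tangent space of \<open>G\<close> by one
  unit vector, unique up to sign. The functional that exposes \<open>F\<close> annihilates the
  directions of \<open>F\<close> and so is a multiple of the product with that vector; the side on
  which \<open>G\<close> lies fixes the sign. The normal is thereby described at the base point
  \<open>p\<close>, which may lie outside \<open>F\<close>.\<close>

lemma facet_normal:
  assumes G: "convex_polytope g G" and face: "poly_face g F G" "F \<noteq> {}"
    and dimG: "geodesic_dim g G = geodesic_dim g F + 1"
    and p: "\<And>i0. g = Hyperbolic i0 \<Longrightarrow> p \<in> model_space g"
    and fr: "unit_frame g F p I e" and m: "m \<notin> I"
  shows "unit_frame g G p (insert m I) (e(m := inward_normal g F G))"
    "\<And>x. x \<in> G \<Longrightarrow> form g (inward_normal g F G) (x - flat g *\<^sub>R p) \<ge> 0"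
    "F = {x \<in> G. form g (inward_normal g F G) (x - flat g *\<^sub>R p) = 0}"
proof -
  have FG: "F \<subseteq> G" by (rule poly_face_subset[OF face(1)])
  have Gne: "G \<noteq> {}" using FG face(2) by auto
  have FneG: "F \<noteq> G" using dimG by auto
  have I: "finite I" "int (card I) = geodesic_dim g F" using fr by (auto simp: unit_frame_def)
  have pF: "g = Euclidean \<Longrightarrow> p \<in> F" "g \<noteq> Euclidean \<Longrightarrow> p \<in> dirs g F \<and> form g p p = curv g"
    using fr by (auto simp: unit_frame_def)
  have dFG: "dirs g F \<subseteq> dirs g G" by (rule dirs_mono[OF FG])
  define T where "T = {v \<in> dirs g G. g \<noteq> Euclidean \<longrightarrow> form g v p = 0}"
  have T: "subspace T" "int (dim T) = geodesic_dim g G"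
    unfolding T_def using tangent_dim[OF Gne, of g p] pF dFG by auto
  obtain u0 where u0: "u0 \<in> T" "form g u0 u0 = 1" "\<And>i. i \<in> I \<Longrightarrow> form g u0 (e i) = 0"
  proof (rule orthonormal_extension[OF T(1) _ I(1) m, of g e])
    show "form g v v > 0" if "v \<in> T" "v \<noteq> 0" for v
      by (rule form_pos[of g p]) (use that p in \<open>auto simp: T_def\<close>)
    show "card I < dim T" using I T dimG by linarith
    show "e i \<in> T" if "i \<in> I" for i using fr that dFG by (auto simp: unit_frame_def T_def)
  qed (use fr in \<open>auto simp: unit_frame_def\<close>)
  obtain a b where ab: "g \<noteq> Euclidean \<Longrightarrow> b = 0" "\<And>x. x \<in> G \<Longrightarrow> form g a x \<le> b" "F = {x \<in> G. form g a x = b}"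
    using poly_face_functional[OF face FneG] by blast
  have adF: "form g a v = 0" if "v \<in> dirs g F" for v
  proof -
    have s: "subspace {v. form g a v = 0}" by (auto simp: subspace_def form_simps)
    have "dirs g F \<subseteq> {v. form g a v = 0}"
    proof (cases "g = Euclidean")
      case True
      have "{x - y |x y. x \<in> F \<and> y \<in> F} \<subseteq> {v. form g a v = 0}"
        using ab(3) by (auto simp: form_simps)
      from span_minimal[OF this s] show ?thesis using True by (simp add: dirs_def)
    next
      case False
      have "F \<subseteq> {v. form g a v = 0}" using ab(3) ab(1)[OF False] by auto
      from span_minimal[OF this s] show ?thesis using False by (simp add: dirs_def)
    qed
    then show ?thesis using that by auto
  qed
  have ap: "form g a p = b"
    using pF ab adF by (cases "g = Euclidean") auto
  have frame: "unit_frame g G p (insert m I) (e(m := u))"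
    if "u \<in> T" "form g u u = 1" "\<And>i. i \<in> I \<Longrightarrow> form g u (e i) = 0" for u
    unfolding unit_frame_def
  proof (intro conjI impI ballI)
    show "finite (insert m I)" using I by simp
    show "int (card (insert m I)) = geodesic_dim g G" using I m dimG by simp
    show "p \<in> G" if "g = Euclidean" using pF(1)[OF that] FG by auto
    show "p \<in> dirs g G" "form g p p = curv g" if "g \<noteq> Euclidean" using pF(2)[OF that] dFG by auto
    show "form g ((e(m := u)) i) p = 0" if "g \<noteq> Euclidean" "i \<in> insert m I" for i
      using that \<open>u \<in> T\<close> fr by (auto simp: T_def unit_frame_def)
    show "(e(m := u)) i \<in> dirs g G" if "i \<in> insert m I" for i
      using that \<open>u \<in> T\<close> fr dFG by (auto simp: T_def unit_frame_def)
    show "form g ((e(m := u)) i) ((e(m := u)) k) = (if i = k then 1 else 0)"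
      if "i \<in> insert m I" "k \<in> insert m I" for i k
      using that \<open>form g u u = 1\<close> fr m \<open>i \<in> I \<Longrightarrow> form g u (e i) = 0\<close> \<open>k \<in> I \<Longrightarrow> form g u (e k) = 0\<close>
        form_commute[of g u "e i"]
      by (cases "i = m"; cases "k = m") (auto simp: unit_frame_def)
  qed
  have expand: "v = (curv g * form g v p) *\<^sub>R p + ((\<Sum>i\<in>I. form g v (e i) *\<^sub>R e i) + form g v u *\<^sub>R u)"
    if "u \<in> T" "form g u u = 1" "\<And>i. i \<in> I \<Longrightarrow> form g u (e i) = 0" "v \<in> dirs g G" for u v
  proof -
    have "(\<Sum>i\<in>insert m I. form g v ((e(m := u)) i) *\<^sub>R (e(m := u)) i)
        = form g v u *\<^sub>R u + (\<Sum>i\<in>I. form g v ((e(m := u)) i) *\<^sub>R (e(m := u)) i)"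
      using I m by (subst sum.insert) auto
    also have "(\<Sum>i\<in>I. form g v ((e(m := u)) i) *\<^sub>R (e(m := u)) i) = (\<Sum>i\<in>I. form g v (e i) *\<^sub>R e i)"
      by (rule sum.cong[OF refl]) (use m in auto)
    finally show ?thesis
      using unit_frame_expansion[OF frame[OF that(1-3)] Gne that(4)] by (simp add: add.commute)
  qed
  have xG: "x - flat g *\<^sub>R p \<in> dirs g G" if "x \<in> G" for x
    by (rule ahull_diff_dirs) (use that ahull_superset pF FG in auto)
  have ax: "form g a x - b = form g a u0 * form g u0 (x - flat g *\<^sub>R p)" if "x \<in> G" for x
  proof -
    define v where "v = x - flat g *\<^sub>R p"
    have "form g a v = form g a ((curv g * form g v p) *\<^sub>R p + ((\<Sum>i\<in>I. form g v (e i) *\<^sub>R e i) + form g v u0 *\<^sub>R u0))"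
      using expand[OF u0 xG[OF that]] by (simp add: v_def)
    also have "\<dots> = curv g * form g v p * form g a p + form g v u0 * form g a u0"
    proof -
      have "(\<Sum>i\<in>I. form g v (e i) * form g a (e i)) = 0"
        by (rule sum.neutral) (use adF fr in \<open>auto simp: unit_frame_def\<close>)
      then show ?thesis by (simp add: form_simps form_sum_right)
    qed
    also have "curv g * form g v p * form g a p = 0"
      using ap ab(1) by (cases g) auto
    finally have "form g a v = form g a u0 * form g u0 v" by (simp add: form_commute mult.commute)
    moreover have "form g a v = form g a x - b"
      using ap ab(1) by (cases "g = Euclidean") (simp_all add: v_def form_simps flat_0)
    ultimately show ?thesis by (simp add: v_def)
  qed
  \<comment> \<open>The half space is \<open>form g a x \<le> b\<close>, so the inward vector has
    negative product with \<open>a\<close>.\<close>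
  define s where "s = (if form g a u0 < 0 then 1 else - 1 :: real)"
  have s2: "s * s = 1" by (simp add: s_def)
  define u where "u = s *\<^sub>R u0"
  have u: "u \<in> T" "form g u u = 1" "\<And>i. i \<in> I \<Longrightarrow> form g u (e i) = 0"
    using u0 subspace_scale[OF T(1) u0(1)] s2 by (auto simp: u_def form_simps mult.assoc[symmetric])
  obtain x0 where x0: "x0 \<in> G" "x0 \<notin> F" using FG FneG by auto
  have au0: "form g a u0 \<noteq> 0" using ax[OF x0(1)] ab(3) x0 by auto
  define l where "l = \<bar>form g a u0\<bar>"
  have l: "l > 0" using au0 by (simp add: l_def)
  have axu: "form g a x - b = - (l * form g u (x - flat g *\<^sub>R p))" if "x \<in> G" for x
    using ax[OF that] by (auto simp: u_def s_def l_def form_simps algebra_simps)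
  have upos: "form g u (x - flat g *\<^sub>R p) \<ge> 0" if "x \<in> G" for x
  proof -
    have "l * form g u (x - flat g *\<^sub>R p) \<ge> 0" using axu[OF that] ab(2)[OF that] by linarith
    then show ?thesis using l by (simp add: zero_le_mult_iff)
  qed
  have Feq: "F = {x \<in> G. form g u (x - flat g *\<^sub>R p) = 0}"
  proof -
    have "form g a x = b \<longleftrightarrow> form g u (x - flat g *\<^sub>R p) = 0" if "x \<in> G" for x
      using axu[OF that] l by auto
    then show ?thesis using ab(3) by auto
  qed
  have udiff: "form g u (x - y) = form g u (x - flat g *\<^sub>R p)" if "y \<in> F" for x y
  proof -
    have "form g u (y - flat g *\<^sub>R p) = 0" using Feq that by auto
    then show ?thesis by (simp add: form_simps)
  qed
  have udF: "form g u w = 0" if "w \<in> dirs g F" for w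
  proof -
    have "form g u w = form g u ((curv g * form g w p) *\<^sub>R p + (\<Sum>i\<in>I. form g w (e i) *\<^sub>R e i))"
      using unit_frame_expansion[OF fr face(2) that] by simp
    also have "\<dots> = curv g * form g w p * form g u p"
      using u(3) by (simp add: form_simps form_sum_right)
    also have "\<dots> = 0" using u(1) by (cases "g = Euclidean") (auto simp: T_def)
    finally show ?thesis .
  qed
  have "inward_normal g F G = u"
    unfolding inward_normal_def
  proof (rule the_equality)
    show "\<forall>y\<in>F. u \<in> tangent_space g G y \<and> (\<forall>w\<in>tangent_space g F y. form g u w = 0) \<and> form g u u = 1 \<and> (\<forall>x\<in>G. 0 \<le> form g u (x - y))"
    proof (intro ballI conjI)
      fix y assume y: "y \<in> F"
      have "form g u y = 0" if "g \<noteq> Euclidean"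
        using Feq y that by (auto simp: flat_0)
      then show "u \<in> tangent_space g G y"
        using y FG u(1) by (subst tangent_space_eq) (auto simp: T_def)
      show "form g u w = 0" if "w \<in> tangent_space g F y" for w
        using that udF by (auto simp: tangent_space_eq[OF y])
      show "form g u u = 1" by (rule u)
      show "0 \<le> form g u (x - y)" if "x \<in> G" for x using udiff[OF y] upos[OF that] by simp
    qed
  next
    fix u' assume u': "\<forall>y\<in>F. u' \<in> tangent_space g G y \<and> (\<forall>w\<in>tangent_space g F y. form g u' w = 0) \<and> form g u' u' = 1 \<and> (\<forall>x\<in>G. 0 \<le> form g u' (x - y))"
    obtain y where y: "y \<in> F" using face(2) by auto
    then have yG: "y \<in> G" using FG by auto
    have u'G: "u' \<in> dirs g G" "g \<noteq> Euclidean \<Longrightarrow> form g u' y = 0"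
      using u' y yG by (auto simp: tangent_space_eq)
    have u'F: "form g u' w = 0" if "w \<in> dirs g F" for w
    proof (cases "g = Euclidean")
      case True
      then show ?thesis using u' y that by (auto simp: tangent_space_eq)
    next
      case False
      have yy: "form g y y = curv g"
        using model_space_nrm2[of y g] convex_polytope_subset[OF G] yG False
        by (cases g) (auto simp: nrm2_def)
      have ydF: "y \<in> dirs g F" using False y by (simp add: dirs_def span_base)
      \<comment> \<open>Subtracting the component along \<open>y\<close> makes \<open>w\<close>
        tangent at \<open>y\<close>, and \<open>u'\<close> does not see that component.\<close>
      define w' where "w' = w - (curv g * form g w y) *\<^sub>R y"
      have "form g w' y = 0"
        using curv_square[OF False] by (simp add: w'_def form_simps yy mult_ac)
      moreover have "w' \<in> dirs g F" unfolding w'_def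
        by (intro subspace_diff[OF subspace_dirs] subspace_scale[OF subspace_dirs] that ydF)
      ultimately have "form g u' w' = 0" using u' y by (auto simp: tangent_space_eq)
      then show ?thesis using u'G(2)[OF False] by (simp add: w'_def form_simps)
    qed
    have "curv g * form g u' p = 0" using u'F pF(2) by (cases "g = Euclidean") auto
    moreover have "(\<Sum>i\<in>I. form g u' (e i) *\<^sub>R e i) = 0"
      by (rule sum.neutral) (use u'F fr in \<open>auto simp: unit_frame_def\<close>)
    ultimately have eq: "u' = form g u' u *\<^sub>R u"
      using expand[OF u u'G(1)] by (simp only: scaleR_zero_left add_0_left)
    define c where "c = form g u' u"
    have uc: "u' = c *\<^sub>R u" using eq by (simp add: c_def)
    have "c * c = 1" using u' y u(2) by (auto simp: uc form_simps)
    moreover have "c \<ge> 0"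
    proof -
      have "form g u (x0 - y) > 0"
        using udiff[OF y, of x0] upos[OF x0(1)] Feq x0 by (auto simp: less_le)
      moreover have "0 \<le> form g u' (x0 - y)" using u' y x0(1) by blast
      then have "0 \<le> c * form g u (x0 - y)" by (simp only: uc form_scale_left)
      ultimately show ?thesis by (simp add: zero_le_mult_iff)
    qed
    ultimately have "c = 1"
      using power2_eq_1_iff[of c] by (auto simp: power2_eq_square)
    then show "u' = u" by (simp add: uc)
  qed
  then show "unit_frame g G p (insert m I) (e(m := inward_normal g F G))"
    "\<And>x. x \<in> G \<Longrightarrow> form g (inward_normal g F G) (x - flat g *\<^sub>R p) \<ge> 0"
    "F = {x \<in> G. form g (inward_normal g F G) (x - flat g *\<^sub>R p) = 0}"
    using frame[OF u] upos Feq by simp_all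
qed


section \<open>Charts from orthonormal frames\<close>

definition frame_slice :: "'n::finite geometry \<Rightarrow> real ^ 'n \<Rightarrow> ('k \<Rightarrow> real ^ 'n) \<Rightarrow> real \<Rightarrow> 'k \<Rightarrow> real ^ 'n" where
  "frame_slice g p e \<kappa> m = curv g *\<^sub>R p + \<kappa> *\<^sub>R e m"

definition frame_origin :: "'n::finite geometry \<Rightarrow> real ^ 'n \<Rightarrow> ('k \<Rightarrow> real ^ 'n) \<Rightarrow> 'k \<Rightarrow> real" where
  "frame_origin g p e i = form g p (e i)"

text \<open>The inverse of denominator and coordinates: the denominator is the coefficient of
  \<open>p\<close> plus the tilt times the \<open>m\<close>-th coordinate, so the tilt is subtracted
  again.\<close>

definition frame_map :: "real ^ 'n::finite \<Rightarrow> ('k::finite \<Rightarrow> real ^ 'n) \<Rightarrow> real \<Rightarrow> 'k \<Rightarrow> real \<times> (real ^ 'k) \<Rightarrow> real ^ 'n" where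
  "frame_map p e \<kappa> m v = (fst v - \<kappa> * snd v $ m) *\<^sub>R p + (\<Sum>i\<in>UNIV. snd v $ i *\<^sub>R e i)"

text \<open>A nonzero \<open>\<kappa>\<close> tilts the plane of projection. Only the sphere needs this: a cell need not lie
  in the open half sphere around a point of its facet.\<close>

definition good_frame :: "'n::finite geometry \<Rightarrow> (real ^ 'n) set \<Rightarrow> real ^ 'n \<Rightarrow> ('k::finite \<Rightarrow> real ^ 'n) \<Rightarrow> real \<Rightarrow> 'k \<Rightarrow> bool" where
  "good_frame g Q p e \<kappa> m \<longleftrightarrow> convex_polytope g Q \<and> Q \<noteq> {} \<and> p \<in> ahull g Q \<and> unit_frame g Q p UNIV e \<and>
    (\<forall>i0. g = Hyperbolic i0 \<longrightarrow> p \<in> model_space g) \<and> (g \<noteq> Spherical \<longrightarrow> \<kappa> = 0) \<and>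
    (\<forall>x\<in>Q. slice g (frame_slice g p e \<kappa> m) x > 0)"

lemma linear_frame_map: "linear (frame_map p e \<kappa> m)"
  by (rule linearI)
    (simp_all add: frame_map_def algebra_simps sum.distrib scaleR_sum_right)

lemma good_frame_chart:
  assumes f: "good_frame g Q p (e :: 'k::finite \<Rightarrow> real ^ 'n::finite) \<kappa> m"
  shows "chart g Q (frame_slice g p e \<kappa> m) e (frame_origin g p e) (frame_map p e \<kappa> m)"
proof -
  have Q: "convex_polytope g Q" "Q \<noteq> {}" and pA: "p \<in> ahull g Q" and u: "unit_frame g Q p UNIV e"
    and hyp: "\<And>i0. g = Hyperbolic i0 \<Longrightarrow> p \<in> model_space g" and \<kappa>: "g \<noteq> Spherical \<Longrightarrow> \<kappa> = 0"
    and pos: "\<And>x. x \<in> Q \<Longrightarrow> slice g (frame_slice g p e \<kappa> m) x > 0"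
    using f by (auto simp: good_frame_def)
  have ee: "form g (e i) (e j) = (if i = j then 1 else 0)" for i j using u by (simp add: unit_frame_def)
  have ed: "e i \<in> dirs g Q" for i using u by (simp add: unit_frame_def)
  have pE: "p \<in> Q" if "g = Euclidean" using u that by (simp add: unit_frame_def)
  have pp: "p \<in> dirs g Q" "form g p p = curv g" "form g (e i) p = 0" "form g p (e i) = 0" if "g \<noteq> Euclidean" for i
  proof -
    show "p \<in> dirs g Q" "form g p p = curv g" "form g (e i) p = 0" using u that by (auto simp: unit_frame_def)
    then show "form g p (e i) = 0" by (subst form_commute)
  qed
  have sum_e: "(\<Sum>i\<in>UNIV. c $ i * form g (e i) (e j)) = c $ j" for c :: "real ^ 'k" and j
    by (simp add: ee if_distrib[of "\<lambda>x. c $ _ * x"] cong: if_cong)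
  show ?thesis
  proof (rule chart.intro)
    show "convex_polytope g Q" "Q \<noteq> {}" by fact+
    show "frame_slice g p e \<kappa> m = 0" if "g = Euclidean" using that \<kappa> by (simp add: frame_slice_def)
    show "linear (frame_map p e \<kappa> m)" by (rule linear_frame_map)
    show "frame_map p e \<kappa> m (1, c) \<in> ahull g Q" for c
    proof -
      have "(\<Sum>i\<in>UNIV. c $ i *\<^sub>R e i) \<in> dirs g Q"
        by (intro subspace_sum[OF subspace_dirs] subspace_scale[OF subspace_dirs] ed)
      moreover have "p \<in> Q \<and> 1 - \<kappa> * c $ m = 1" if "g = Euclidean" using that pE \<kappa> by simp
      ultimately show ?thesis
        using ahull_add_dirs[OF pA] by (simp add: frame_map_def)
    qed
    show "slice g (frame_slice g p e \<kappa> m) (frame_map p e \<kappa> m (1, c)) = 1" for c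
    proof (cases "g = Euclidean")
      case True
      then show ?thesis using \<kappa> by (simp add: slice_def frame_slice_def)
    next
      case False
      have "form g (\<Sum>i\<in>UNIV. c $ i *\<^sub>R e i) p = 0"
        by (simp add: form_sum_left form_simps pp[OF False])
      then show ?thesis
        using curv_square[OF False]
        by (simp add: slice_def frame_slice_def frame_map_def flat_0[OF False] form_simps pp[OF False] form_sum_left sum_e
            algebra_simps)
    qed
    show "coords g e (frame_origin g p e) (frame_map p e \<kappa> m (1, c)) = c" for c
    proof (cases "g = Euclidean")
      case True
      then show ?thesis
        using \<kappa> by (simp add: coords_def frame_map_def frame_origin_def form_simps form_sum_left vec_eq_iff)
          (use sum_e True in simp)
    next
      case False
      then show ?thesis
        by (simp add: coords_def frame_map_def frame_origin_def form_simps form_sum_left vec_eq_iff pp flat_0 sum_e)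
    qed
    show "frame_map p e \<kappa> m (slice g (frame_slice g p e \<kappa> m) x, coords g e (frame_origin g p e) x) = x"
      if x: "x \<in> ahull g Q" for x
    proof (cases "g = Euclidean")
      case True
      define v where "v = x - p"
      have "v \<in> dirs g Q" using ahull_diff_dirs[OF x pE] True by (simp add: v_def)
      then have "v = (\<Sum>i\<in>UNIV. form g v (e i) *\<^sub>R e i)"
        using unit_frame_expansion[OF u Q(2)] True by simp
      then have "x = p + (\<Sum>i\<in>UNIV. (form g x (e i) - form g p (e i)) *\<^sub>R e i)"
        by (simp add: v_def form_simps diff_eq_eq add.commute)
      then show ?thesis
        using True \<kappa> by (simp add: frame_map_def slice_def frame_slice_def coords_def frame_origin_def)
    next
      case False
      have "x \<in> dirs g Q" using ahull_diff_dirs[OF x pE] False by (simp add: flat_0)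
      then have "x = (curv g * form g x p) *\<^sub>R p + (\<Sum>i\<in>UNIV. form g x (e i) *\<^sub>R e i)"
        by (rule unit_frame_expansion[OF u Q(2)])
      moreover have "slice g (frame_slice g p e \<kappa> m) x = curv g * form g x p + \<kappa> * form g x (e m)"
        by (simp add: slice_def flat_0[OF False] frame_slice_def form_simps)
      ultimately show ?thesis
        by (simp add: frame_map_def coords_def frame_origin_def flat_0[OF False])
    qed
    show "0 < slice g (frame_slice g p e \<kappa> m) x" if "x \<in> Q" for x by (rule pos[OF that])
    show "- frame_slice g p e \<kappa> m \<in> model_space g" if "g = Hyperbolic i0" for i0
      using hyp[OF that] \<kappa> that by (simp add: frame_slice_def)
  qed
qed

subsection \<open>Motion of a cell\<close>

context chart
begin

text \<open>A kernel vector of the Gram matrix gives a tangent vector of square 0 at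
  \<open>\<phi> c\<close>, hence 0. Then \<open>P (0, x)\<close> is a multiple of
  \<open>\<Psi> c\<close>; in the curved cases comparing denominators, 0 against 1, shows that the
  multiple is 0, and the lift is injective.\<close>

lemma det_gram_nonzero:
  assumes c: "c \<in> W"
  shows "det (\<chi> i j. form g (d\<phi> c (axis i 1)) (d\<phi> c (axis j 1))) \<noteq> 0"
proof
  define H where "H = (\<chi> i j. form g (d\<phi> c (axis i 1)) (d\<phi> c (axis j 1)))"
  assume "det (\<chi> i j. form g (d\<phi> c (axis i 1)) (d\<phi> c (axis j 1))) = 0"
  then have "\<not> invertible H" by (simp add: invertible_det_nz H_def)
  then obtain x where x: "H *v x = 0" "x \<noteq> 0"
    using matrix_left_invertible_ker[of H] invertible_left_inverse[of H] by auto
  have lin: "linear (d\<phi> c)" using \<phi>_derivative[OF c] has_derivative_linear by blast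
  define v where "v = d\<phi> c x"
  have n: "nrm2 g (\<Psi> c) > 0" using c by (simp add: W_def)
  have vs: "v = (\<Sum>i\<in>UNIV. x $ i *\<^sub>R d\<phi> c (axis i 1))"
  proof -
    have "d\<phi> c x = d\<phi> c (\<Sum>i\<in>UNIV. x $ i *\<^sub>R axis i 1)"
      using basis_expansion[of x] by (simp add: scalar_mult_eq_scaleR)
    then show ?thesis by (simp add: v_def linear_sum[OF lin] linear_scale[OF lin])
  qed
  have "form g (d\<phi> c (axis i 1)) v = (H *v x) $ i" for i
    unfolding vs by (simp add: form_sum_right form_simps matrix_vector_mult_def H_def mult.commute)
  then have "form g (d\<phi> c (axis i 1)) v = 0" for i by (simp add: x(1))
  then have "form g v v = 0"
    by (subst (1) vs) (simp add: form_sum_left form_simps)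
  moreover have "form g v v > 0" if "v \<noteq> 0"
  proof (rule form_pos[of g "\<phi> c", OF _ that])
    fix i0 assume h: "g = Hyperbolic i0"
    have "form g v (\<Psi> c) = 0"
    proof -
      have f: "form g (\<Psi> c) (\<Psi> c) = - nrm2 g (\<Psi> c)" using h by (simp add: nrm2_def)
      show ?thesis
        using n unfolding v_def d\<phi>_def form_diff_left form_scale_left f
        using h by (simp add: field_simps) (rule form_commute)
    qed
    then have "form g v (\<phi> c) = 0" by (simp add: \<phi>_def form_simps)
    then show "\<phi> c \<in> model_space g \<and> form g v (\<phi> c) = 0"
      using chi_\<phi>(1)[OF c] by (simp add: geodesic_hull_eq)
  qed
  ultimately have "v = 0" by auto
  define l where "l = curv g * form g (\<Psi> c) (P (0, x)) / nrm2 g (\<Psi> c)"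
  have "P (0, x) = l *\<^sub>R \<Psi> c"
  proof -
    have "sqrt (nrm2 g (\<Psi> c)) *\<^sub>R v = P (0, x) - l *\<^sub>R \<Psi> c"
      using n by (simp add: v_def d\<phi>_def scaleR_diff_right l_def)
    then show ?thesis using \<open>v = 0\<close> by simp
  qed
  have "x = 0"
  proof (cases "g = Euclidean")
    case True
    then have "P (0, x) = P (0, 0)"
      using \<open>P (0, x) = l *\<^sub>R \<Psi> c\<close> linear_0[OF linear_P0] by (simp add: l_def)
    then show ?thesis using inj_P0 by (simp add: inj_def)
  next
    case False
    have "sl (P (0, x)) = 0"
    proof -
      have "P (0, x) = \<Psi> x - \<Psi> 0" by (simp add: \<Psi>_affine linear_0[OF linear_P0])
      moreover have "sl (\<Psi> y) = 1" for y by (simp add: \<Psi>_def slice_P)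
      ultimately show ?thesis by (simp add: slice_def flat_0[OF False] form_simps)
    qed
    then have "l = 0" using \<open>P (0, x) = l *\<^sub>R \<Psi> c\<close> False by (simp add: slice_scale \<Psi>_def slice_P)
    then have "P (0, x) = P (0, 0)"
      using \<open>P (0, x) = l *\<^sub>R \<Psi> c\<close> linear_0[OF linear_P0] by simp
    then show ?thesis using inj_P0 by (simp add: inj_def)
  qed
  then show False using x(2) by simp
qed

text \<open>Positivity of a linear denominator is a convex condition in the chart, and the cell is
  there the convex hull of its vertices. The motion of a cell is controlled at the vertices
  only.\<close>

lemma vertex_slice_pos:
  assumes d: "aff_dim (chi ` Q) \<ge> 1" and curved: "g \<noteq> Euclidean"
    and v: "\<And>v. poly_face g {v} Q \<Longrightarrow> slice g q' v > 0" and x: "x \<in> Q"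
  shows "slice g q' x > 0"
proof -
  define S where "S = {c. slice g q' (\<Psi> c) > 0}"
  have \<Psi>s: "\<Psi> (chi y) = y /\<^sub>R sl y" if "y \<in> Q" for y
    using hull_Q[OF that] slice_pos[OF that] by (intro \<Psi>_chi) (auto simp: geodesic_hull_eq)
  have "convex S"
  proof (rule convexI)
    fix a b and u v :: real assume h: "a \<in> S" "b \<in> S" "0 \<le> u" "0 \<le> v" "u + v = 1"
    have "\<Psi> (u *\<^sub>R a + v *\<^sub>R b) = u *\<^sub>R \<Psi> a + v *\<^sub>R \<Psi> b"
    proof -
      have "u *\<^sub>R (1, a) + v *\<^sub>R (1, b) = (1 :: real, u *\<^sub>R a + v *\<^sub>R b)" using h by simp
      then show ?thesis
        unfolding \<Psi>_def by (metis linear_add[OF lin_P] linear_scale[OF lin_P])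
    qed
    then have e: "slice g q' (\<Psi> (u *\<^sub>R a + v *\<^sub>R b)) = u * slice g q' (\<Psi> a) + v * slice g q' (\<Psi> b)"
      by (simp add: slice_def flat_0[OF curved] form_simps)
    show "u *\<^sub>R a + v *\<^sub>R b \<in> S"
    proof (cases "u = 0")
      case True then show ?thesis using h by simp
    next
      case False
      then have "u * slice g q' (\<Psi> a) > 0" using h by (simp add: S_def)
      moreover have "v * slice g q' (\<Psi> b) \<ge> 0" using h by (simp add: S_def)
      ultimately show ?thesis unfolding S_def mem_Collect_eq e by linarith
    qed
  qed
  moreover have "chi ` {v. poly_face g {v} Q} \<subseteq> S"
  proof safe
    fix w assume w: "poly_face g {w} Q"
    then have "w \<in> Q" using poly_face_subset by blast
    then show "chi w \<in> S"
      using v[OF w] slice_pos[of w] by (simp add: S_def \<Psi>s slice_scale[OF curved])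
  qed
  ultimately have "chi ` Q \<subseteq> S"
    unfolding chi_vertices[OF d] by (rule hull_minimal[rotated])
  then have "slice g q' (x /\<^sub>R sl x) > 0" using x \<Psi>s[OF x] by (auto simp: S_def)
  then show ?thesis using slice_pos[OF x] by (simp add: slice_scale[OF curved] zero_less_mult_iff)
qed

end

lemma lipschitz_at_derivative:
  fixes f :: "real \<Rightarrow> 'a::real_normed_vector"
  assumes "(f has_vector_derivative f') (at 0)"
  shows "\<exists>C d. d > 0 \<and> (\<forall>t. \<bar>t\<bar> < d \<longrightarrow> norm (f t - f 0) \<le> C * \<bar>t\<bar>)"
proof -
  have "((\<lambda>t. norm (f t - f 0 - t *\<^sub>R f') / norm t) \<longlongrightarrow> 0) (at 0)"
    using assms by (simp add: has_vector_derivative_def has_derivative_iff_norm)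
  then have "\<forall>\<^sub>F t in at 0. norm (f t - f 0 - t *\<^sub>R f') / norm t < 1"
    by (rule order_tendstoD) simp
  then obtain d where d: "d > 0" "\<And>t. t \<noteq> 0 \<Longrightarrow> \<bar>t\<bar> < d \<Longrightarrow> norm (f t - f 0 - t *\<^sub>R f') / norm t < 1"
    by (auto simp: eventually_at dist_norm)
  show ?thesis
  proof (rule exI[of _ "norm f' + 1"], rule exI[of _ d], intro conjI allI impI d)
    fix t assume t: "\<bar>t\<bar> < d"
    show "norm (f t - f 0) \<le> (norm f' + 1) * \<bar>t\<bar>"
    proof (cases "t = 0")
      case False
      then have "norm (f t - f 0 - t *\<^sub>R f') \<le> \<bar>t\<bar>" using d(2)[OF False t] by (simp add: divide_less_eq)
      moreover have "norm (f t - f 0) \<le> norm (f t - f 0 - t *\<^sub>R f') + norm (t *\<^sub>R f')"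
        using norm_triangle_ineq[of "f t - f 0 - t *\<^sub>R f'" "t *\<^sub>R f'"] by simp
      ultimately show ?thesis by (simp add: algebra_simps)
    qed simp
  qed
qed

text \<open>The last coordinate forces the coefficients of the linear combination to add up to
  1.\<close>

lemma span_lift_affine:
  fixes x :: "'a::real_vector"
  assumes "(x, 1 :: real) \<in> span ((\<lambda>v. (v, 1)) ` A)"
  shows "x \<in> affine hull A"
proof -
  obtain T u where T: "finite T" "T \<subseteq> (\<lambda>v. (v, 1)) ` A" "(\<Sum>b\<in>T. u b *\<^sub>R b) = (x, 1 :: real)"
    using assms unfolding span_explicit by auto
  obtain T' where T': "T' \<subseteq> A" "finite T'" "T = (\<lambda>v. (v, 1)) ` T'"
    using finite_subset_image[OF T(1,2)] by auto
  have inj: "inj_on (\<lambda>v. (v, 1 :: real)) T'" by (auto intro: inj_onI)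
  have s: "(\<Sum>v\<in>T'. u (v, 1) *\<^sub>R (v, 1 :: real)) = (x, 1)"
    using T(3) unfolding T'(3) by (simp add: sum.reindex[OF inj])
  have 1: "(\<Sum>v\<in>T'. u (v, 1) *\<^sub>R v) = x"
    using arg_cong[OF s, of fst] by (simp add: fst_sum)
  have 2: "(\<Sum>v\<in>T'. u (v, 1)) = 1"
    using arg_cong[OF s, of snd] by (simp add: snd_sum)
  have "T' \<noteq> {}" using 2 by auto
  then show ?thesis
    unfolding affine_hull_explicit using T' 1 2 by blast
qed

text \<open>Near \<open>t = 0\<close> the moved cell has a chart with the same denominator and
  coordinates as the cell at 0. Its lift \<open>P t\<close> is the perturbed section through the
  moved vertices, so its difference from \<open>P0\<close> is annihilated by the coordinate map: it
  is orthogonal to \<open>q\<close> and to all \<open>e i\<close>.\<close>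

lemma moving_chart:
  fixes e :: "'k::finite \<Rightarrow> real ^ 'n::finite"
  assumes ch: "chart g Q q e r P0" and k: "geodesic_dim g Q = int CARD('k)"
    and V: "finite V" "V = {v. poly_face g {v} Q}"
    and \<gamma>: "\<And>v. v \<in> V \<Longrightarrow> \<gamma> v 0 = v" "\<And>v. v \<in> V \<Longrightarrow> (\<gamma> v has_vector_derivative \<gamma>' v) (at 0)"
    and Q0: "Qt 0 = Q"
    and Qt: "\<forall>\<^sub>F t in nhds 0. convex_polytope g (Qt t) \<and> Qt t \<noteq> {} \<and> geodesic_dim g (Qt t) = int CARD('k) \<and>
        {w. poly_face g {w} (Qt t)} = (\<lambda>v. \<gamma> v t) ` V \<and> (g = Spherical \<longrightarrow> (\<exists>a. \<forall>x\<in>Qt t. a \<bullet> x > 0))"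
  obtains C P where "C \<ge> 0" "P 0 = P0"
    "\<forall>\<^sub>F t in nhds 0. chart g (Qt t) q e r (P t) \<and>
       (\<forall>w. norm (P t w - P0 w) \<le> C * \<bar>t\<bar> * norm w \<and> form g (P t w - P0 w) q = 0 \<and> (\<forall>i. form g (P t w - P0 w) (e i) = 0))"
proof -
  interpret c0: chart g Q q e r P0 by (rule ch)
  \<comment> \<open>An extra coordinate, equal to \<open>flat g\<close> on points, homogenises the
    affine model and is 0 in the linear ones, so that spans serve in all cases.\<close>
  define S where "S = (\<lambda>z :: (real ^ 'n) \<times> real. (snd z + form g (fst z) q, (\<chi> i. form g (fst z) (e i) - snd z * r i) :: real ^ 'k))"
  define P0' where "P0' = (\<lambda>v :: real \<times> (real ^ 'k). (P0 v, fst v * flat g))"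
  define X where "X = (\<lambda>v t. (\<gamma> v t, flat g))"
  have card1: "1 \<le> CARD('k)" by (simp add: Suc_le_eq)
  have SX: "S (x, flat g) = (c0.sl x, c0.co x)" for x
    by (simp add: S_def slice_def coords_def)
  have lS: "linear S"
    by (rule linearI) (simp_all add: S_def form_simps vec_eq_iff algebra_simps)
  have lP0': "linear P0'"
    by (rule linearI)
      (simp_all add: P0'_def linear_add[OF c0.lin_P] linear_scale[OF c0.lin_P] algebra_simps)
  have VQ: "v \<in> Q" if "v \<in> V" for v using V(2) that poly_face_subset by blast
  have X0: "P0' (S (X v 0)) = X v 0" if "v \<in> V" for v
  proof -
    have "P0 (c0.sl v, c0.co v) = v" by (rule c0.P_inverse) (use VQ[OF that] ahull_superset in auto)
    moreover have "c0.sl v * flat g = flat g" using c0.slice_Euclidean[of v] by (cases "g = Euclidean") (auto simp: flat_0)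
    ultimately show ?thesis by (simp add: X_def \<gamma>(1)[OF that] SX P0'_def)
  qed
  have ad: "aff_dim (c0.chi ` Q) = int CARD('k)" using k c0.geodesic_dim_Q by simp
  \<comment> \<open>The vertices affinely span the chart, which is full-dimensional, so with a
    leading 1 they linearly span.\<close>
  have sp: "span ((\<lambda>v. S (X v 0)) ` V) = UNIV"
  proof -
    define U where "U = span ((\<lambda>v. S (X v 0)) ` V)"
    have 1: "(1, c0.chi v) \<in> U" if "v \<in> V" for v
    proof -
      have "(c0.sl v, c0.co v) \<in> U"
        unfolding U_def using that SX[of v] \<gamma>(1)[OF that] by (intro span_base) (force simp: X_def)
      then have "(1 / c0.sl v) *\<^sub>R (c0.sl v, c0.co v) \<in> U" unfolding U_def by (rule span_scale)
      then show ?thesis using c0.slice_nz[OF VQ[OF that]] by (simp add: c0.chi_def divide_inverse)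
    qed
    have aff: "affine {c. (1, c) \<in> U}"
    proof (unfold affine_def, intro ballI allI impI)
      fix x y u v assume h: "x \<in> {c. (1 :: real, c) \<in> U}" "y \<in> {c. (1 :: real, c) \<in> U}" "u + v = (1 :: real)"
      have "u *\<^sub>R (1 :: real, x) + v *\<^sub>R (1, y) \<in> U" using h unfolding U_def by (intro span_add span_scale) auto
      then show "u *\<^sub>R x + v *\<^sub>R y \<in> {c. (1, c) \<in> U}" using h by simp
    qed
    have "affine hull (c0.chi ` V) = UNIV"
    proof -
      have "aff_dim (c0.chi ` V) = int CARD('k)"
        using ad c0.chi_vertices card1 V(2) by (simp add: aff_dim_convex_hull)
      then show ?thesis by (simp add: aff_dim_eq_full[symmetric])
    qed
    moreover have "affine hull (c0.chi ` V) \<subseteq> {c. (1, c) \<in> U}"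
    proof (rule hull_minimal)
      show "c0.chi ` V \<subseteq> {c. (1, c) \<in> U}" using 1 by auto
    qed (rule aff)
    ultimately have all: "(1, c) \<in> U" for c by auto
    have "(a, c) \<in> U" for a c
    proof -
      have "(a - 1) *\<^sub>R (1, 0) + (1, c) \<in> U" using all unfolding U_def by (intro span_add span_scale) auto
      then show ?thesis by simp
    qed
    then show ?thesis by (auto simp: U_def)
  qed
  have lip: "\<exists>C d. d > 0 \<and> (\<forall>t. \<bar>t\<bar> < d \<longrightarrow> norm (X v t - X v 0) \<le> C * \<bar>t\<bar>)" if "v \<in> V" for v
    using lipschitz_at_derivative[OF \<gamma>(2)[OF that]] by (simp add: X_def norm_Pair)
  obtain C d where Cd: "d > 0" "C \<ge> 0" "\<And>t. \<bar>t\<bar> < d \<Longrightarrow> \<exists>P. linear P \<and> range P \<subseteq> span ((\<lambda>v. X v t) ` V) \<and>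
    (\<forall>v. S (P v) = v) \<and> (\<forall>v. norm (P v - P0' v) \<le> C * \<bar>t\<bar> * norm v)"
    using perturbed_section[OF lS lP0' V(1) X0 sp lip] by blast
  have SP0': "S (P0' w) = w" for w
  proof -
    have "linear (\<lambda>w. S (P0' w))" using linear_compose[OF lP0' lS] by (simp add: o_def)
    then have "S (P0' w) = id w"
      by (rule linear_eq_on_span[OF _ linear_id, of _ "(\<lambda>v. S (X v 0)) ` V"]) (use X0 sp in auto)
    then show ?thesis by simp
  qed
  have slV: "\<forall>\<^sub>F t in nhds 0. \<forall>v\<in>V. c0.sl (\<gamma> v t) > 0"
  proof (rule eventually_ball_finite[OF V(1)], rule ballI)
    fix v assume v: "v \<in> V"
    have "isCont (\<gamma> v) 0" using \<gamma>(2)[OF v] by (rule has_vector_derivative_continuous)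
    then have "isCont (\<lambda>t. c0.sl (\<gamma> v t)) 0"
      unfolding slice_def isCont_def by (intro tendsto_intros)
    then have "(\<lambda>t. c0.sl (\<gamma> v t)) \<midarrow>0\<rightarrow> c0.sl (\<gamma> v 0)" by (simp add: isCont_def)
    then have "((\<lambda>t. c0.sl (\<gamma> v t)) \<longlongrightarrow> c0.sl (\<gamma> v 0)) (nhds 0)" by (simp add: tendsto_nhds_iff)
    then show "\<forall>\<^sub>F t in nhds 0. c0.sl (\<gamma> v t) > 0"
      by (rule order_tendstoD) (use c0.slice_pos[OF VQ[OF v]] \<gamma>(1)[OF v] in simp)
  qed
  define R where "R = (\<lambda>t P. chart g (Qt t) q e r P \<and>
       (\<forall>w. norm (P w - P0 w) \<le> C * \<bar>t\<bar> * norm w \<and> form g (P w - P0 w) q = 0 \<and> (\<forall>i. form g (P w - P0 w) (e i) = 0)))"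
  have ev: "\<forall>\<^sub>F t in nhds 0. \<exists>P. R t P"
  proof -
    have "\<forall>\<^sub>F t in nhds 0. \<bar>t\<bar> < d" using Cd(1) by (auto simp: eventually_nhds_metric dist_norm)
    then show ?thesis
      using Qt slV
    proof eventually_elim
      case (elim t)
      have cp: "convex_polytope g (Qt t)" "Qt t \<noteq> {}" "geodesic_dim g (Qt t) = int CARD('k)"
        and vt: "{w. poly_face g {w} (Qt t)} = (\<lambda>v. \<gamma> v t) ` V" and sph: "g = Spherical \<Longrightarrow> \<exists>a. \<forall>x\<in>Qt t. a \<bullet> x > 0"
        using elim(2) by auto
      obtain P' where P': "linear P'" "range P' \<subseteq> span ((\<lambda>v. X v t) ` V)" "\<And>v. S (P' v) = v"
          "\<And>v. norm (P' v - P0' v) \<le> C * \<bar>t\<bar> * norm v"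
        using Cd(3)[OF elim(1)] by blast
      define P where "P = (\<lambda>w. fst (P' w))"
      have lP: "linear P" by (rule linearI) (simp_all add: P_def linear_add[OF P'(1)] linear_scale[OF P'(1)])
      have \<gamma>Q: "\<gamma> v t \<in> Qt t" if "v \<in> V" for v
      proof -
        have "poly_face g {\<gamma> v t} (Qt t)" using vt that by blast
        then show ?thesis using poly_face_subset by blast
      qed
      have snd0: "snd z = 0" if "g \<noteq> Euclidean" "z \<in> span ((\<lambda>v. X v t) ` V)" for z
      proof -
        have "subspace {z :: (real ^ 'n) \<times> real. snd z = 0}" by (auto simp: subspace_def)
        moreover have "(\<lambda>v. X v t) ` V \<subseteq> {z. snd z = 0}" using that(1) by (auto simp: X_def flat_0)
        ultimately show ?thesis using span_minimal that(2) by blast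
      qed
      have sndP: "snd (P' w) = fst w * flat g" for w
      proof (cases "g = Euclidean")
        case True
        have "fst (S (P' w)) = fst w" by (simp add: P'(3))
        then show ?thesis using True c0.flat_q by (simp add: S_def)
      next
        case False
        then show ?thesis using snd0[OF False, of "P' w"] P'(2) by (auto simp: flat_0)
      qed
      have P'eq: "P' w = (P w, fst w * flat g)" for w
        using sndP[of w] by (simp add: P_def prod_eq_iff)
      have SP: "S (P w, fst w * flat g) = w" for w using P'(3)[of w] by (simp add: P'eq)
      have S1: "c0.sl (P (1, c)) = 1" "c0.co (P (1, c)) = c" for c
        using SP[of "(1, c)"] by (simp_all add: SX)
      have fstspan: "fst z \<in> span (Qt t)" if "z \<in> span ((\<lambda>v. X v t) ` V)" for z
      proof -
        have "subspace {z :: (real ^ 'n) \<times> real. fst z \<in> span (Qt t)}"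
          by (auto simp: subspace_def span_zero span_add span_scale)
        moreover have "(\<lambda>v. X v t) ` V \<subseteq> {z. fst z \<in> span (Qt t)}" using \<gamma>Q by (auto simp: X_def span_base)
        ultimately show ?thesis using span_minimal that by blast
      qed
      have hull: "P (1, c) \<in> ahull g (Qt t)" for c
      proof (cases "g = Euclidean")
        case True
        have "P' (1, c) \<in> span ((\<lambda>v. (v, 1)) ` ((\<lambda>v. \<gamma> v t) ` V))"
          using P'(2) True by (auto simp: X_def image_image)
        then have "P (1, c) \<in> affine hull ((\<lambda>v. \<gamma> v t) ` V)"
          by (intro span_lift_affine) (simp add: P'eq True)
        also have "\<dots> \<subseteq> affine hull (Qt t)" by (rule hull_mono) (use \<gamma>Q in auto)
        finally show ?thesis using True by (simp add: ahull_def)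
      next
        case False
        have "P' (1, c) \<in> span ((\<lambda>v. X v t) ` V)" using P'(2) by auto
        then show ?thesis using fstspan False by (simp add: ahull_def P_def)
      qed
      \<comment> \<open>By a count of dimensions: the range of the lift lies in the moved hull and
        has its dimension, so \<open>x\<close> is in the range, and there the coordinate map
        recovers the preimage.\<close>
      have inv: "P (c0.sl x, c0.co x) = x" if x: "x \<in> ahull g (Qt t)" for x
      proof (cases "g = Euclidean")
        case True
        define A where "A = (\<lambda>c. P (1, c)) ` UNIV"
        have Pa: "P (1, c) = P (1, 0) + P (0, c)" for c
          using linear_add[OF lP, of "(1, 0)" "(0, c)"] by (simp only: add_Pair add_0_left add_0_right)
        have l0: "linear (\<lambda>c. P (0, c))"
        proof (rule linearI)
          show "P (0, x + y) = P (0, x) + P (0, y)" for x y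
            using linear_add[OF lP, of "(0,x)" "(0,y)"] by (simp only: add_Pair add_0_left)
          show "P (0, a *\<^sub>R x) = a *\<^sub>R P (0, x)" for a x
            using linear_scale[OF lP, of a "(0,x)"] by (simp only: scaleR_Pair scaleR_zero_right)
        qed
        have i0: "inj (\<lambda>c. P (0, c))"
        proof (rule injI)
          fix c c' assume "P (0, c) = P (0, c')"
          then have "P (1, c) = P (1, c')" by (subst (1 2) Pa) simp
          then show "c = c'" using S1(2) by metis
        qed
        have Aeq: "A = (+) (P (1, 0)) ` range (\<lambda>c. P (0, c))"
          unfolding A_def image_image by (rule image_cong[OF refl]) (rule Pa)
        have "aff_dim A = int CARD('k)"
          unfolding Aeq aff_dim_translation_eq aff_dim_injective_linear_image[OF l0 i0] by simp
        moreover have "affine A"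
          unfolding Aeq by (intro affine_translation[THEN iffD1] subspace_imp_affine linear_subspace_image[OF l0] subspace_UNIV)
        moreover have "A \<subseteq> affine hull (Qt t)" using hull True by (auto simp: A_def ahull_def)
        moreover have "aff_dim (affine hull (Qt t)) = int CARD('k)"
          using cp(3) True by (simp add: geodesic_dim_def)
        ultimately have "A = affine hull (Qt t)"
          by (intro affine_dim_equal affine_affine_hull) (auto simp: A_def)
        then obtain c where c: "x = P (1, c)" using x True by (auto simp: A_def ahull_def)
        show ?thesis unfolding c S1 ..
      next
        case False
        have SP0: "S (P w, 0) = w" for w using SP[of w] False by (simp add: flat_0)
        have injP: "inj P" by (rule injI) (metis SP0)
        have "dim (range P) = dim (UNIV :: (real \<times> (real ^ 'k)) set)"
          by (rule dim_image_eq[OF lP]) (use injP in \<open>auto intro: inj_on_subset\<close>)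
        then have "dim (range P) = CARD('k) + 1" by (simp add: dim_UNIV)
        moreover have "int (dim (Qt t)) = int CARD('k) + 1"
          using cp(3) False by (cases g) (simp_all add: geodesic_dim_def)
        moreover have "P w \<in> span (Qt t)" for w
          using fstspan[of "P' w"] P'(2) by (auto simp: P_def)
        then have "range P \<subseteq> span (Qt t)" by blast
        ultimately have "range P = span (Qt t)"
          by (intro subspace_dim_equal linear_subspace_image[OF lP] subspace_UNIV subspace_span) auto
        then have "x \<in> range P" using x False by (simp add: ahull_def)
        then obtain w where w: "x = P w" by blast
        have "(c0.sl x, c0.co x) = w" using SX[of x] SP0[of w] False w by (simp add: flat_0)
        then show ?thesis using w by simp
      qed
      have pos: "c0.sl x > 0" if x: "x \<in> Qt t" for x
      proof (cases g)
        case Euclidean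
        show ?thesis using c0.slice_Euclidean[OF Euclidean, of x] by simp
      next
        case (Hyperbolic i0)
        have "x \<in> model_space g" using x convex_polytope_subset[OF cp(1)] by auto
        then have "form g x (- q) < 0" using form_model_space_neg[of "-q" i0 x] c0.future Hyperbolic by simp
        then show ?thesis using Hyperbolic by (simp add: slice_def form_simps)
      next
        case Spherical
        \<comment> \<open>On the sphere positivity of the fixed denominator is known only at the
          moved vertices. An auxiliary chart of the moved cell around its own centre spreads it to
          the cell.\<close>
        obtain p where p: "p \<in> ahull g (Qt t)" "p \<in> dirs g (Qt t) \<and> form g p p = curv g"
            "\<And>x. x \<in> Qt t \<Longrightarrow> flat g + curv g * form g x p > 0"
          using cell_point[OF cp(1,2) sph] Spherical by auto
        obtain e' :: "'k \<Rightarrow> real ^ 'n" where e': "unit_frame g (Qt t) p UNIV e'"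
          using unit_frame_exists[OF cp(2), of g p "UNIV :: 'k set"] p(2) Spherical cp(3) by auto
        have gf: "good_frame g (Qt t) p e' 0 undefined"
          using cp p e' Spherical
          by (auto simp: good_frame_def slice_def frame_slice_def form_simps)
        interpret ct: chart g "Qt t" "frame_slice g p e' 0 undefined" e' "frame_origin g p e'" "frame_map p e' 0 undefined"
          by (rule good_frame_chart[OF gf])
        show ?thesis
        proof (rule ct.vertex_slice_pos[OF _ _ _ x])
          show "1 \<le> aff_dim (ct.chi ` Qt t)" using ct.geodesic_dim_Q cp(3) card1 by linarith
          show "g \<noteq> Euclidean" using Spherical by simp
          show "c0.sl w > 0" if "poly_face g {w} (Qt t)" for w
          proof -
            have "w \<in> (\<lambda>v. \<gamma> v t) ` V" using that vt by auto
            then show ?thesis using elim(3) by auto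
          qed
        qed
      qed
      have chart: "chart g (Qt t) q e r P"
        by (rule chart.intro) (use cp lP hull S1 inv pos c0.flat_q c0.future in auto)
      have nS: "form g (P w - P0 w) q = 0" "form g (P w - P0 w) (e i) = 0" for w i
      proof -
        have "S (P' w - P0' w) = 0" by (simp add: linear_diff[OF lS] P'(3) SP0')
        then have "S (P w - P0 w, 0) = 0" by (simp add: P'eq P0'_def)
        then show "form g (P w - P0 w) q = 0" "form g (P w - P0 w) (e i) = 0"
          by (auto simp: S_def prod_eq_iff vec_eq_iff)
      qed
      have "norm (P w - P0 w) \<le> C * \<bar>t\<bar> * norm w" for w
        using P'(4)[of w] by (simp add: P'eq P0'_def norm_Pair)
      then show ?case using chart nS unfolding R_def by blast
    qed
  qed
  \<comment> \<open>At \<open>t = 0\<close> the given lift is kept; elsewhere any lift with property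
    \<open>R t\<close> is chosen.\<close>
  define PP where "PP = (\<lambda>t. if t = 0 then P0 else SOME P. R t P)"
  have R0: "R 0 P0" unfolding R_def using ch Q0 by simp
  have "\<forall>\<^sub>F t in nhds 0. R t (PP t)"
    using ev
  proof (rule eventually_mono)
    fix t assume "\<exists>P. R t P"
    then show "R t (PP t)" using R0 someI_ex[of "R t"] by (auto simp: PP_def)
  qed
  then show thesis
    using that[OF Cd(2), of PP] by (simp add: PP_def R_def)
qed

text \<open>For compact \<open>K\<close> the closed \<open>\<epsilon>\<close>-neighbourhood, written
  as a Minkowski sum so that compactness and convexity are inherited.\<close>

definition thick :: "real \<Rightarrow> 'a::real_normed_vector set \<Rightarrow> 'a set" where
  "thick \<epsilon> K = (\<Union>x\<in>K. \<Union>y\<in>cball 0 \<epsilon>. {x + y})"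

lemma compact_thick: "compact K \<Longrightarrow> compact (thick \<epsilon> K)" for K :: "'a::euclidean_space set"
  unfolding thick_def by (rule compact_sums') auto

lemma convex_thick: "convex K \<Longrightarrow> convex (thick \<epsilon> K)"
  unfolding thick_def by (rule convex_sums) auto

lemma ball_subset_thick: "x \<in> K \<Longrightarrow> ball x \<epsilon> \<subseteq> thick \<epsilon> K"
proof
  fix y assume x: "x \<in> K" and y: "y \<in> ball x \<epsilon>"
  then have "y - x \<in> cball 0 \<epsilon>" by (simp add: dist_norm norm_minus_commute)
  moreover have "y = x + (y - x)" by simp
  ultimately show "y \<in> thick \<epsilon> K" using x unfolding thick_def by blast
qed

lemma thick_subset_open:
  fixes K :: "'a::euclidean_space set"
  assumes "compact K" "open U" "K \<subseteq> U"
  obtains \<epsilon> where "\<epsilon> > 0" "thick \<epsilon> K \<subseteq> U"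
proof -
  obtain d where d: "d > 0" "\<And>x y. x \<in> K \<Longrightarrow> y \<in> - U \<Longrightarrow> d \<le> dist x y"
  proof -
    have "K \<inter> - U = {}" using assms by auto
    then show thesis
      using separate_compact_closed[OF assms(1), of "- U"] assms(2) that by (auto simp: open_closed)
  qed
  show thesis
  proof (rule that[of "d / 2"])
    show "thick (d / 2) K \<subseteq> U"
    proof
      fix z assume "z \<in> thick (d / 2) K"
      then obtain x y where xy: "x \<in> K" "norm y \<le> d / 2" "z = x + y" by (auto simp: thick_def)
      then have "dist x z < d" using d(1) by (simp add: dist_norm)
      then show "z \<in> U" using d(2)[OF xy(1), of z] by auto
    qed
  qed (use d in simp)
qed

text \<open>In the curved cases orthogonality to the slice vector and to \<open>e m\<close> entails
  orthogonality to \<open>p\<close>. In the flat case the base point is out of reach, and only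
  differences of lifted points are covered.\<close>

lemma frame_map_orthogonal:
  assumes f: "good_frame g Q p e \<kappa> m"
    and n: "form g n (frame_slice g p e \<kappa> m) = 0" "\<And>i. form g n (e i) = 0"
  shows "g \<noteq> Euclidean \<Longrightarrow> form g n (frame_map p e \<kappa> m w) = 0" "form g n (frame_map p e \<kappa> m (0, c)) = 0"
proof -
  have *: "form g n p = 0" if "g \<noteq> Euclidean"
    using n that by (cases g) (auto simp: frame_slice_def form_simps)
  then show "g \<noteq> Euclidean \<Longrightarrow> form g n (frame_map p e \<kappa> m w) = 0"
    by (simp add: frame_map_def form_simps form_sum_right n)
  show "form g n (frame_map p e \<kappa> m (0, c)) = 0"
  proof (cases "g = Euclidean")
    case True
    then have "\<kappa> = 0" using f by (auto simp: good_frame_def)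
    then show ?thesis by (simp add: frame_map_def form_simps form_sum_right n)
  next
    case False
    then show ?thesis using * by (simp add: frame_map_def form_simps form_sum_right n)
  qed
qed

text \<open>Both displacements are of size \<open>O(t)\<close> and orthogonal to the old vectors, so
  the mixed terms vanish and the change is a product of two displacements.\<close>

lemma quad_close_form:
  fixes P0 :: "'v::euclidean_space \<Rightarrow> real ^ 'n::finite"
  assumes d: "d > 0" and P0: "linear P0" and C: "C \<ge> 0"
    and cl: "\<And>t w. \<bar>t\<bar> < d \<Longrightarrow> norm (P t w - P0 w) \<le> C * \<bar>t\<bar> * norm w"
    and orth: "\<And>t c. \<bar>t\<bar> < d \<Longrightarrow> form g (P t (w c) - P0 (w c)) (P0 (w' c)) = 0"
        "\<And>t c. \<bar>t\<bar> < d \<Longrightarrow> form g (P t (w' c) - P0 (w' c)) (P0 (w c)) = 0"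
    and M: "\<And>c. c \<in> B \<Longrightarrow> norm (w c) \<le> M" "\<And>c. c \<in> B \<Longrightarrow> norm (w' c) \<le> M"
  shows "quad_close B (\<lambda>t c. form g (P t (w c)) (P t (w' c)))"
proof -
  have P00: "P 0 v = P0 v" for v using cl[of 0 v] d by simp
  obtain K where K: "K > 0" "\<And>v. norm (P0 v) \<le> K * norm v" using linear_bounded_pos[OF P0] by blast
  define D where "D = C * C * (\<bar>M\<bar> * \<bar>M\<bar>) + K * \<bar>M\<bar> * (K * \<bar>M\<bar>)"
  have M': "norm (w c) \<le> \<bar>M\<bar>" "norm (w' c) \<le> \<bar>M\<bar>" if "c \<in> B" for c using M[OF that] by auto
  show ?thesis
    unfolding quad_close_def P00
  proof (rule exI[of _ D], rule exI[of _ d], intro conjI allI impI d)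
    fix t c assume t: "\<bar>t\<bar> < d" "c \<in> B"
    define n where "n = P t (w c) - P0 (w c)"
    define n' where "n' = P t (w' c) - P0 (w' c)"
    have "P t (w c) = P0 (w c) + n" "P t (w' c) = P0 (w' c) + n'" by (simp_all add: n_def n'_def)
    then have "form g (P t (w c)) (P t (w' c)) - form g (P0 (w c)) (P0 (w' c)) = form g n n'"
      using orth(1)[OF t(1), of c] orth(2)[OF t(1), of c] form_commute[of g n' "P0 (w c)"]
      by (simp add: form_simps n_def[symmetric] n'_def[symmetric])
    moreover have "\<bar>form g n n'\<bar> \<le> (C * \<bar>t\<bar> * \<bar>M\<bar>) * (C * \<bar>t\<bar> * \<bar>M\<bar>)"
    proof (rule order_trans[OF form_bound mult_mono])
      show "norm n \<le> C * \<bar>t\<bar> * \<bar>M\<bar>"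
        using cl[OF t(1), of "w c"] mult_left_mono[OF M'(1)[OF t(2)], of "C * \<bar>t\<bar>"] C by (simp add: n_def)
      show "norm n' \<le> C * \<bar>t\<bar> * \<bar>M\<bar>"
        using cl[OF t(1), of "w' c"] mult_left_mono[OF M'(2)[OF t(2)], of "C * \<bar>t\<bar>"] C by (simp add: n'_def)
    qed (use C in auto)
    moreover have "(C * \<bar>t\<bar> * \<bar>M\<bar>) * (C * \<bar>t\<bar> * \<bar>M\<bar>) = C * C * (\<bar>M\<bar> * \<bar>M\<bar>) * t\<^sup>2"
      by (simp add: power2_eq_square mult_ac abs_mult_self_eq)
    moreover have "C * C * (\<bar>M\<bar> * \<bar>M\<bar>) * t\<^sup>2 \<le> D * t\<^sup>2"
      unfolding D_def using K by (intro mult_right_mono) auto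
    ultimately show "\<bar>form g (P t (w c)) (P t (w' c)) - form g (P0 (w c)) (P0 (w' c))\<bar> \<le> D * t\<^sup>2" by linarith
    have "\<bar>form g (P0 (w c)) (P0 (w' c))\<bar> \<le> K * \<bar>M\<bar> * (K * \<bar>M\<bar>)"
    proof (rule order_trans[OF form_bound mult_mono])
      show "norm (P0 (w c)) \<le> K * \<bar>M\<bar>"
        by (rule order_trans[OF K(2)]) (use M'(1)[OF t(2)] K(1) in \<open>auto intro: mult_left_mono\<close>)
      show "norm (P0 (w' c)) \<le> K * \<bar>M\<bar>"
        by (rule order_trans[OF K(2)]) (use M'(2)[OF t(2)] K(1) in \<open>auto intro: mult_left_mono\<close>)
    qed (use K in auto)
    then show "\<bar>form g (P0 (w c)) (P0 (w' c))\<bar> \<le> D" unfolding D_def using C by (simp add: add_increasing)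
  qed
qed

text \<open>\<open>chart.dens\<close> with the lift as an argument, so that lifts at different
  parameters can be compared on one domain.\<close>

definition density :: "'n::finite geometry \<Rightarrow> (real \<times> (real ^ 'k::finite) \<Rightarrow> real ^ 'n) \<Rightarrow> real ^ 'k \<Rightarrow> real" where
  "density g P c = sqrt (det (\<chi> i j. (form g (P (0, axis i 1)) (P (0, axis j 1)) -
      curv g * form g (P (1, c)) (P (0, axis i 1)) * form g (P (1, c)) (P (0, axis j 1)) / nrm2 g (P (1, c))) / nrm2 g (P (1, c))))"

lemma (in chart) dens_density: "dens = density g P"
  by (simp add: fun_eq_iff dens_def density_def frame_def \<Psi>_def)

text \<open>Formed from products of the form by polynomial operations, division and a square root,
  with denominators and determinant bounded away from 0 on the compact set. In the flat case
  displacements need not be orthogonal to positions, but the terms concerned carry the factor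
  \<open>curv g = 0\<close>.\<close>

lemma density_quad_close:
  fixes e :: "'k::finite \<Rightarrow> real ^ 'n::finite"
  assumes f: "good_frame g Q p e \<kappa> m" and d: "d > 0" and C: "C \<ge> 0"
    and cl: "\<And>t w. \<bar>t\<bar> < d \<Longrightarrow> norm (P t w - frame_map p e \<kappa> m w) \<le> C * \<bar>t\<bar> * norm w"
      "\<And>t w. \<bar>t\<bar> < d \<Longrightarrow> form g (P t w - frame_map p e \<kappa> m w) (frame_slice g p e \<kappa> m) = 0"
      "\<And>t w i. \<bar>t\<bar> < d \<Longrightarrow> form g (P t w - frame_map p e \<kappa> m w) (e i) = 0"
    and B: "compact B" "B \<subseteq> chart.W g (frame_map p e \<kappa> m)"
  shows "quad_close B (\<lambda>t. density g (P t))"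
proof -
  define P0 where "P0 = frame_map p e \<kappa> m"
  interpret c0: chart g Q "frame_slice g p e \<kappa> m" e "frame_origin g p e" P0
    unfolding P0_def by (rule good_frame_chart[OF f])
  have P00: "P 0 = P0" using cl(1)[of 0] d by (auto simp: P0_def)
  have BW: "B \<subseteq> c0.W" using B by (simp add: P0_def)
  obtain M0 where M0: "\<And>c. c \<in> B \<Longrightarrow> norm c \<le> M0"
    using compact_imp_bounded[OF B(1)] by (auto simp: bounded_iff)
  define M where "M = 1 + \<bar>M0\<bar>"
  have M: "norm ((0 :: real), axis i (1::real) :: real ^ 'k) \<le> M" "c \<in> B \<Longrightarrow> norm ((1 :: real), c) \<le> M" for i c
    using M0[of c] norm_Pair_le[of "1 :: real" c] by (auto simp: M_def norm_Pair)
  have o1: "form g (P t w - P0 w) (P0 w') = 0" if "\<bar>t\<bar> < d" "g \<noteq> Euclidean" for t w w'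
    unfolding P0_def by (rule frame_map_orthogonal(1)[OF f cl(2,3)[OF that(1)] that(2)])
  have o2: "form g (P t w - P0 w) (P0 (0, c)) = 0" if "\<bar>t\<bar> < d" for t w c
    unfolding P0_def by (rule frame_map_orthogonal(2)[OF f cl(2,3)[OF that]])
  note qc = quad_close_form[OF d c0.lin_P C cl(1)[folded P0_def], where M = M]
  have g1: "quad_close B (\<lambda>t c. form g (P t (0, axis i 1)) (P t (0, axis j 1)))" for i j
    by (rule qc[where w="\<lambda>_. (0, axis i 1)" and w'="\<lambda>_. (0, axis j 1)"]) (use o2 M in auto)
  have g2: "quad_close B (\<lambda>t c. form g (P t (1, c)) (P t (0, axis i 1)))" if "g \<noteq> Euclidean" for i
    by (rule qc[where w="\<lambda>c. (1, c)" and w'="\<lambda>_. (0, axis i 1)"]) (use o1 that M in auto)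
  have g3: "quad_close B (\<lambda>t c. form g (P t (1, c)) (P t (1, c)))" if "g \<noteq> Euclidean"
    by (rule qc[where w="\<lambda>c. (1, c)" and w'="\<lambda>c. (1, c)"]) (use o1 that M in auto)
  have n: "quad_close B (\<lambda>t c. nrm2 g (P t (1, c)))"
  proof (cases "g = Euclidean")
    case True then show ?thesis by (simp add: quad_close_const[where C=1])
  next
    case False
    show ?thesis unfolding nrm2_def
      by (intro quad_close_add quad_close_mult g3[OF False] quad_close_const[OF order_refl])
  qed
  obtain m1 where m1: "m1 > 0" "\<And>c. c \<in> B \<Longrightarrow> \<bar>nrm2 g (P 0 (1, c))\<bar> \<ge> m1"
  proof (cases "B = {}")
    case True then show thesis using that[of 1] by auto
  next
    case False
    have "continuous_on B (\<lambda>c. nrm2 g (c0.\<Psi> c))"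
      unfolding nrm2_def by (intro continuous_intros)
    from continuous_attains_inf[OF B(1) False this] obtain c1 where c1: "c1 \<in> B"
      "\<And>c. c \<in> B \<Longrightarrow> nrm2 g (c0.\<Psi> c1) \<le> nrm2 g (c0.\<Psi> c)" by auto
    show thesis
    proof (rule that[of "nrm2 g (c0.\<Psi> c1)"])
      show "nrm2 g (c0.\<Psi> c1) > 0" using BW c1 by (auto simp: c0.W_def)
      show "nrm2 g (c0.\<Psi> c1) \<le> \<bar>nrm2 g (P 0 (1, c))\<bar>" if "c \<in> B" for c
        using c1(2)[OF that] by (simp add: P00 c0.\<Psi>_def)
    qed
  qed
  have inv: "quad_close B (\<lambda>t c. inverse (nrm2 g (P t (1, c))))"
    by (rule quad_close_inverse[OF n m1])
  have cf: "quad_close B (\<lambda>t c. curv g * form g (P t (1, c)) (P t (0, axis i 1)) * form g (P t (1, c)) (P t (0, axis j 1)))" for i j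
  proof (cases "g = Euclidean")
    case True then show ?thesis by (simp add: quad_close_const[where C=0])
  next
    case False
    show ?thesis
      by (intro quad_close_mult g2[OF False] quad_close_const[OF order_refl])
  qed
  define H where "H = (\<lambda>t c. (\<chi> i j. (form g (P t (0, axis i 1)) (P t (0, axis j 1)) -
      curv g * form g (P t (1, c)) (P t (0, axis i 1)) * form g (P t (1, c)) (P t (0, axis j 1)) * inverse (nrm2 g (P t (1, c)))) * inverse (nrm2 g (P t (1, c)))) :: real ^ 'k ^ 'k)"
  have HH: "density g (P t) c = sqrt (det (H t c))" for t c
    by (simp add: density_def H_def divide_inverse)
  have det: "quad_close B (\<lambda>t c. det (H t c))"
    by (rule quad_close_det) (simp add: H_def, intro quad_close_mult quad_close_diff g1 cf inv)
  have H0: "det (H 0 c) = det (\<chi> i j. form g (c0.d\<phi> c (axis i 1)) (c0.d\<phi> c (axis j 1)))" if "c \<in> B" for c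
    using c0.form_d\<phi>[of c] that BW by (simp add: H_def P00 c0.\<Psi>_def divide_inverse subset_iff)
  obtain m2 where m2: "m2 > 0" "\<And>c. c \<in> B \<Longrightarrow> \<bar>det (H 0 c)\<bar> \<ge> m2"
  proof (cases "B = {}")
    case True then show thesis using that[of 1] by auto
  next
    case False
    have nz: "nrm2 g (c0.\<Psi> c) \<noteq> 0" if "c \<in> B" for c using BW that by (auto simp: c0.W_def)
    have "continuous_on B (\<lambda>c. \<bar>det (H 0 c)\<bar>)"
      unfolding H_def P00 c0.\<Psi>_def[symmetric]
      by (intro continuous_on_rabs det_continuous_on) (auto simp: nrm2_def intro!: continuous_intros nz[unfolded nrm2_def])
    from continuous_attains_inf[OF B(1) False this] obtain c1 where c1: "c1 \<in> B"
      "\<And>c. c \<in> B \<Longrightarrow> \<bar>det (H 0 c1)\<bar> \<le> \<bar>det (H 0 c)\<bar>" by auto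
    show thesis
    proof (rule that[of "\<bar>det (H 0 c1)\<bar>"])
      show "\<bar>det (H 0 c1)\<bar> > 0" using c0.det_gram_nonzero[of c1] H0[OF c1(1)] BW c1(1) by auto
    qed (rule c1(2))
  qed
  have "quad_close B (\<lambda>t c. sqrt (det (H t c)))" by (rule quad_close_sqrt[OF det m2])
  then show ?thesis by (simp add: HH[abs_def])
qed

text \<open>The data of one moving cell: its vertices are differentiable at 0, and the cell is
  constrained only for \<open>t\<close> near 0.\<close>

locale moving_cell =
  fixes g :: "'n::finite geometry" and Q :: "(real ^ 'n) set" and V :: "(real ^ 'n) set"
    and \<gamma> \<gamma>' and Qt :: "real \<Rightarrow> (real ^ 'n) set" and kk :: "'k::finite itself"
  assumes k: "geodesic_dim g Q = int CARD('k)"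
    and V: "finite V" "V = {v. poly_face g {v} Q}"
    and \<gamma>: "\<And>v. v \<in> V \<Longrightarrow> \<gamma> v 0 = v" "\<And>v. v \<in> V \<Longrightarrow> (\<gamma> v has_vector_derivative \<gamma>' v) (at 0)"
    and Q0: "Qt 0 = Q"
    and Qt: "\<forall>\<^sub>F t in nhds 0. convex_polytope g (Qt t) \<and> Qt t \<noteq> {} \<and> geodesic_dim g (Qt t) = int CARD('k) \<and>
        {w. poly_face g {w} (Qt t)} = (\<lambda>v. \<gamma> v t) ` V \<and> (g = Spherical \<longrightarrow> (\<exists>a. \<forall>x\<in>Qt t. a \<bullet> x > 0))"
begin

lemma moving_frame:
  fixes e :: "'k \<Rightarrow> real ^ 'n"
  assumes f: "good_frame g Q p e \<kappa> m"
  obtains C P where "C \<ge> 0" "P 0 = frame_map p e \<kappa> m"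
    "\<forall>\<^sub>F t in nhds 0. chart g (Qt t) (frame_slice g p e \<kappa> m) e (frame_origin g p e) (P t) \<and>
       (\<forall>w. norm (P t w - frame_map p e \<kappa> m w) \<le> C * \<bar>t\<bar> * norm w \<and>
         form g (P t w - frame_map p e \<kappa> m w) (frame_slice g p e \<kappa> m) = 0 \<and> (\<forall>i. form g (P t w - frame_map p e \<kappa> m w) (e i) = 0))"
  using moving_chart[OF good_frame_chart[OF f] k V \<gamma> Q0 Qt] by blast

lemma chi_continuous_at:
  fixes e :: "'k \<Rightarrow> real ^ 'n"
  assumes ch: "chart g Q q e r P" and v: "v \<in> V"
  shows "isCont (\<lambda>t. chart.chi g q e r (\<gamma> v t)) 0"
proof -
  interpret c0: chart g Q q e r P by (rule ch)
  have vQ: "v \<in> Q" using v V(2) poly_face_subset by blast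
  have "isCont (\<gamma> v) 0" using \<gamma>(2)[OF v] by (rule has_vector_derivative_continuous)
  moreover have "isCont c0.chi (\<gamma> v 0)"
    using c0.chi_differentiable[of v] c0.slice_nz[OF vQ] \<gamma>(1)[OF v]
    by (simp add: differentiable_imp_continuous_within)
  ultimately show ?thesis using isCont_o2 by blast
qed

text \<open>The neighbourhood is convex and contains the projected moved vertices, hence their
  convex hull.\<close>

lemma chi_Qt_thick:
  fixes e :: "'k \<Rightarrow> real ^ 'n"
  assumes f: "good_frame g Q p e \<kappa> m" and \<epsilon>: "\<epsilon> > 0"
  defines "chi \<equiv> chart.chi g (frame_slice g p e \<kappa> m) e (frame_origin g p e)"
  shows "\<forall>\<^sub>F t in nhds 0. chi ` Qt t \<subseteq> thick \<epsilon> (chi ` Q)"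
proof -
  interpret c0: chart g Q "frame_slice g p e \<kappa> m" e "frame_origin g p e" "frame_map p e \<kappa> m"
    by (rule good_frame_chart[OF f])
  have chi: "chi = c0.chi" by (simp add: chi_def)
  obtain P where P: "\<forall>\<^sub>F t in nhds 0. chart g (Qt t) (frame_slice g p e \<kappa> m) e (frame_origin g p e) (P t)"
    by (rule moving_frame[OF f], rule that, erule eventually_mono) blast
  have near: "\<forall>\<^sub>F t in nhds 0. \<forall>v\<in>V. chi (\<gamma> v t) \<in> ball (chi v) \<epsilon>"
  proof (rule eventually_ball_finite[OF V(1)], rule ballI)
    fix v assume v: "v \<in> V"
    have "((\<lambda>t. chi (\<gamma> v t)) \<longlongrightarrow> chi (\<gamma> v 0)) (nhds 0)"
      using chi_continuous_at[OF good_frame_chart[OF f] v] by (simp add: chi isCont_def tendsto_nhds_iff)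
    then have "\<forall>\<^sub>F t in nhds 0. dist (chi (\<gamma> v t)) (chi (\<gamma> v 0)) < \<epsilon>" by (rule tendstoD[OF _ \<epsilon>])
    then show "\<forall>\<^sub>F t in nhds 0. chi (\<gamma> v t) \<in> ball (chi v) \<epsilon>"
      by (simp add: \<gamma>(1)[OF v] dist_commute)
  qed
  show ?thesis
    using P near Qt
  proof eventually_elim
    case (elim t)
    interpret ct: chart g "Qt t" "frame_slice g p e \<kappa> m" e "frame_origin g p e" "P t" by (rule elim(1))
    have "1 \<le> CARD('k)" by (simp add: Suc_le_eq)
    then have "1 \<le> aff_dim (chi ` Qt t)"
      using ct.geodesic_dim_Q elim(3) unfolding chi_def by linarith
    then have "chi ` Qt t = convex hull (chi ` {v. poly_face g {v} (Qt t)})"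
      using ct.chi_vertices by (simp add: chi_def)
    also have "\<dots> \<subseteq> thick \<epsilon> (chi ` Q)"
    proof (rule hull_minimal)
      show "convex (thick \<epsilon> (chi ` Q))"
        by (rule convex_thick) (use c0.polytope_chi in \<open>simp add: chi polytope_imp_convex\<close>)
      have "chi (\<gamma> v t) \<in> thick \<epsilon> (chi ` Q)" if "v \<in> V" for v
      proof -
        have "v \<in> Q" using that V(2) poly_face_subset by blast
        then show ?thesis using ball_subset_thick[of "chi v" "chi ` Q" \<epsilon>] elim(2) that by blast
      qed
      then show "chi ` {v. poly_face g {v} (Qt t)} \<subseteq> thick \<epsilon> (chi ` Q)" using elim(3) by auto
    qed
    finally show ?case .
  qed
qed

text \<open>The moved cell and its projection to the old hull have the same image in the
  coordinates. Only the densities differ, by at most \<open>D * t\<^sup>2\<close> on a fixed compact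
  set.\<close>

lemma volume_first_order:
  fixes e :: "'k \<Rightarrow> real ^ 'n"
  assumes f: "good_frame g Q p e \<kappa> m"
  defines "chi \<equiv> chart.chi g (frame_slice g p e \<kappa> m) e (frame_origin g p e)"
  shows "((\<lambda>t. (cell_volume g TYPE('k) (Qt t) - integral (chi ` Qt t) (density g (frame_map p e \<kappa> m))) / t) \<longlongrightarrow> 0) (at 0)"
proof -
  interpret c0: chart g Q "frame_slice g p e \<kappa> m" e "frame_origin g p e" "frame_map p e \<kappa> m"
    by (rule good_frame_chart[OF f])
  have chi: "chi = c0.chi" by (simp add: chi_def)
  obtain C P where P: "C \<ge> 0" "P 0 = frame_map p e \<kappa> m"
    "\<forall>\<^sub>F t in nhds 0. chart g (Qt t) (frame_slice g p e \<kappa> m) e (frame_origin g p e) (P t) \<and>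
       (\<forall>w. norm (P t w - frame_map p e \<kappa> m w) \<le> C * \<bar>t\<bar> * norm w \<and>
         form g (P t w - frame_map p e \<kappa> m w) (frame_slice g p e \<kappa> m) = 0 \<and> (\<forall>i. form g (P t w - frame_map p e \<kappa> m w) (e i) = 0))"
    by (rule moving_frame[OF f])
  have cQ: "compact (chi ` Q)" using c0.polytope_chi by (simp add: chi polytope_imp_compact)
  have "chi ` Q \<subseteq> c0.W" using c0.\<phi>_chi(1) c0.hull_Q c0.slice_pos by (auto simp: chi)
  then obtain \<epsilon> where \<epsilon>: "\<epsilon> > 0" "thick \<epsilon> (chi ` Q) \<subseteq> c0.W"
    using thick_subset_open[OF cQ c0.open_W] by blast
  \<comment> \<open>A fixed compact domain inside \<open>W\<close> that contains the images of all
    nearby cells.\<close>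
  define B where "B = thick \<epsilon> (chi ` Q)"
  have B: "compact B" "B \<subseteq> c0.W" unfolding B_def using \<epsilon> compact_thick[OF cQ] by auto
  obtain d where d: "d > 0" "\<And>t. \<bar>t\<bar> < d \<Longrightarrow> chart g (Qt t) (frame_slice g p e \<kappa> m) e (frame_origin g p e) (P t)"
    "\<And>t w. \<bar>t\<bar> < d \<Longrightarrow> norm (P t w - frame_map p e \<kappa> m w) \<le> C * \<bar>t\<bar> * norm w"
    "\<And>t w. \<bar>t\<bar> < d \<Longrightarrow> form g (P t w - frame_map p e \<kappa> m w) (frame_slice g p e \<kappa> m) = 0"
    "\<And>t w i. \<bar>t\<bar> < d \<Longrightarrow> form g (P t w - frame_map p e \<kappa> m w) (e i) = 0"
    "\<And>t. \<bar>t\<bar> < d \<Longrightarrow> chi ` Qt t \<subseteq> B"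
    using eventually_conj[OF P(3) chi_Qt_thick[OF f \<epsilon>(1)]] unfolding eventually_nhds_metric
    by (auto simp: dist_norm chi_def B_def)
  have "quad_close B (\<lambda>t. density g (P t))"
    by (rule density_quad_close[OF f d(1) P(1) d(3-5) B])
  then obtain D d' where D: "d' > 0" "D \<ge> 0"
    "\<And>t c. \<bar>t\<bar> < d' \<Longrightarrow> c \<in> B \<Longrightarrow> \<bar>density g (P t) c - density g (P 0) c\<bar> \<le> D * t\<^sup>2"
    by (rule quad_closeE) blast
  define mB where "mB = measure lebesgue B"
  have bound: "\<bar>cell_volume g TYPE('k) (Qt t) - integral (chi ` Qt t) (density g (frame_map p e \<kappa> m))\<bar> \<le> D * t\<^sup>2 * mB"
    if t: "\<bar>t\<bar> < min d d'" for t
  proof -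
    interpret ct: chart g "Qt t" "frame_slice g p e \<kappa> m" e "frame_origin g p e" "P t" using d(2) t by simp
    define A where "A = chi ` Qt t"
    have A: "compact A" using ct.polytope_chi by (simp add: A_def chi_def polytope_imp_compact)
    have AB: "A \<subseteq> B" using d(6) t by (simp add: A_def)
    have "A \<subseteq> ct.W" using ct.\<phi>_chi(1) ct.hull_Q ct.slice_pos by (auto simp: A_def chi_def)
    then have i1: "density g (P t) absolutely_integrable_on A"
      using integrable_on_compact[OF A] continuous_on_subset[OF ct.dens_continuous] by (metis ct.dens_density)
    have i2: "density g (P 0) absolutely_integrable_on A"
      using integrable_on_compact[OF A] continuous_on_subset[OF c0.dens_continuous] AB B(2)
      by (metis c0.dens_density P(2) subset_trans)
    have "cell_volume g TYPE('k) (Qt t) = integral A (density g (P t))"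
      using ct.cell_volume_chart by (simp add: ct.dens_density A_def chi_def)
    then have "cell_volume g TYPE('k) (Qt t) - integral A (density g (P 0)) = integral A (\<lambda>c. density g (P t) c - density g (P 0) c)"
      using i1 i2 by (simp add: integral_diff absolutely_integrable_on_def)
    also have "\<bar>\<dots>\<bar> \<le> integral A (\<lambda>c. D * t\<^sup>2)"
    proof -
      have "norm (integral A (\<lambda>c. density g (P t) c - density g (P 0) c)) \<le> integral A (\<lambda>c. D * t\<^sup>2)"
      proof (rule integral_norm_bound_integral)
        show "(\<lambda>c. density g (P t) c - density g (P 0) c) integrable_on A"
          using i1 i2 by (intro integrable_diff) (simp_all add: absolutely_integrable_on_def)
        show "(\<lambda>c. D * t\<^sup>2) integrable_on A"
          using integrable_on_compact[OF A, of "\<lambda>c. D * t\<^sup>2"] by (simp add: absolutely_integrable_on_def)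
        show "norm (density g (P t) c - density g (P 0) c) \<le> D * t\<^sup>2" if "c \<in> A" for c
          using D(3)[of t c] t that AB by auto
      qed
      then show ?thesis by simp
    qed
    also have "\<dots> = D * t\<^sup>2 * measure lebesgue A"
    proof -
      have "A \<in> lmeasurable" by (rule lmeasurable_compact[OF A])
      then have "integral A (\<lambda>c. 1 :: real) = measure lebesgue A" by (simp add: lmeasure_integral)
      then show ?thesis using integral_mult_right[of A "D * t\<^sup>2" "\<lambda>c. 1 :: real"] by simp
    qed
    also have "\<dots> \<le> D * t\<^sup>2 * mB"
      unfolding mB_def using D(2) AB lmeasurable_compact[OF A] lmeasurable_compact[OF B(1)]
      by (intro mult_left_mono measure_mono_fmeasurable) (auto simp: fmeasurableD)
    finally show ?thesis by (simp add: A_def P(2))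
  qed
  show ?thesis
  proof (rule Lim_null_comparison)
    show "\<forall>\<^sub>F t in at 0. norm ((cell_volume g TYPE('k) (Qt t) - integral (chi ` Qt t) (density g (frame_map p e \<kappa> m))) / t) \<le> D * mB * \<bar>t\<bar>"
      unfolding eventually_at
    proof (intro exI[of _ "min d d'"] conjI ballI impI)
      fix t :: real assume t: "t \<noteq> 0 \<and> dist t 0 < min d d'"
      then have "\<bar>cell_volume g TYPE('k) (Qt t) - integral (chi ` Qt t) (density g (frame_map p e \<kappa> m))\<bar> \<le> D * t\<^sup>2 * mB"
        by (intro bound) (simp add: dist_norm)
      also have "\<dots> = (D * mB * \<bar>t\<bar>) * \<bar>t\<bar>" by (simp add: power2_eq_square mult_ac abs_mult_self_eq)
      finally show "norm ((cell_volume g TYPE('k) (Qt t) - integral (chi ` Qt t) (density g (frame_map p e \<kappa> m))) / t) \<le> D * mB * \<bar>t\<bar>"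
        using t by (simp add: divide_le_eq)
    qed (use d D in auto)
    have "((\<lambda>t. D * mB * \<bar>t\<bar>) \<longlongrightarrow> D * mB * \<bar>0\<bar>) (at 0)" by (intro tendsto_intros)
    then show "((\<lambda>t. D * mB * \<bar>t\<bar>) \<longlongrightarrow> 0) (at 0)" by simp
  qed
qed

end

subsection \<open>Motion of the facets\<close>

lemma det_tendsto:
  fixes A :: "'a \<Rightarrow> real ^ 'k::finite ^ 'k"
  assumes "\<And>i j. ((\<lambda>t. A t $ i $ j) \<longlongrightarrow> B $ i $ j) F"
  shows "((\<lambda>t. det (A t)) \<longlongrightarrow> det B) F"
  unfolding det_def by (intro tendsto_intros assms)

lemma matrix_inv_both:
  fixes A :: "real ^ 'k::finite ^ 'k"
  assumes "det A \<noteq> 0"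
  shows "A ** matrix_inv A = mat 1" "matrix_inv A ** A = mat 1"
proof -
  have "\<exists>B. A ** B = mat 1 \<and> B ** A = mat 1"
    using assms by (simp add: invertible_det_nz[symmetric] invertible_def)
  then have "A ** matrix_inv A = mat 1 \<and> matrix_inv A ** A = mat 1"
    unfolding matrix_inv_def by (rule someI_ex)
  then show "A ** matrix_inv A = mat 1" "matrix_inv A ** A = mat 1" by auto
qed

lemma matrix_inv_cramer:
  fixes A :: "real ^ 'k::finite ^ 'k"
  assumes "det A \<noteq> 0"
  shows "matrix_inv A *v b = (\<chi> k. det (\<chi> i j. if j = k then b $ i else A $ i $ j) / det A)"
proof -
  have "A ** matrix_inv A = mat 1"
    by (rule matrix_inv_both(1)[OF assms])
  then have "A *v (matrix_inv A *v b) = b" by (simp add: matrix_vector_mul_assoc)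
  then show ?thesis using cramer[OF assms] by blast
qed

text \<open>As \<open>C 0 = 0\<close>, the difference quotient is the inverse of \<open>Z t\<close>
  applied to \<open>C t /\<^sub>R t\<close>, and continuity of \<open>Z\<close> is enough for its
  limit. Cramer's rule makes the continuity of the inverse explicit.\<close>

lemma linear_solution_derivative:
  fixes Z :: "real \<Rightarrow> real ^ 'k::finite ^ 'k" and C :: "real \<Rightarrow> real ^ 'k"
  assumes Z: "\<And>i j. isCont (\<lambda>t. Z t $ i $ j) 0" and nz: "det (Z 0) \<noteq> 0"
    and C: "(C has_vector_derivative C') (at 0)" "C 0 = 0"
  shows "((\<lambda>t. matrix_inv (Z t) *v C t) has_vector_derivative matrix_inv (Z 0) *v C') (at 0)"
    "\<forall>\<^sub>F t in nhds 0. det (Z t) \<noteq> 0"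
proof -
  have Zt: "((\<lambda>t. Z t $ i $ j) \<longlongrightarrow> Z 0 $ i $ j) (nhds 0)" for i j
    using Z[of i j] by (simp add: isCont_def tendsto_nhds_iff)
  then have dZ: "((\<lambda>t. det (Z t)) \<longlongrightarrow> det (Z 0)) (nhds 0)" by (rule det_tendsto)
  show ev: "\<forall>\<^sub>F t in nhds 0. det (Z t) \<noteq> 0"
    by (rule tendsto_imp_eventually_ne[OF dZ nz])
  have at: "at 0 \<le> nhds (0 :: real)" by (simp add: at_within_def)
  have Ct: "((\<lambda>t. C t /\<^sub>R t) \<longlongrightarrow> C') (at 0)"
  proof -
    have "((\<lambda>t. norm (C t - t *\<^sub>R C') / norm t) \<longlongrightarrow> 0) (at 0)"
      using C by (simp add: has_vector_derivative_def has_derivative_iff_norm)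
    moreover have "\<forall>\<^sub>F t in at 0. norm (C t - t *\<^sub>R C') / norm t = norm (C t /\<^sub>R t - C')"
      unfolding eventually_at
    proof (intro exI[of _ 1] conjI ballI impI)
      fix t :: real assume "t \<noteq> 0 \<and> dist t 0 < 1"
      then have "C t /\<^sub>R t - C' = (C t - t *\<^sub>R C') /\<^sub>R t" by (simp add: scaleR_diff_right)
      then show "norm (C t - t *\<^sub>R C') / norm t = norm (C t /\<^sub>R t - C')"
        by (simp add: divide_inverse mult.commute)
    qed simp
    ultimately have "((\<lambda>t. norm (C t /\<^sub>R t - C')) \<longlongrightarrow> 0) (at 0)" by (rule Lim_transform_eventually)
    then show ?thesis by (simp add: tendsto_norm_zero_iff Lim_null[of _ C'])
  qed
  have lim: "((\<lambda>t. (matrix_inv (Z t) *v C t) /\<^sub>R t) \<longlongrightarrow> matrix_inv (Z 0) *v C') (at 0)"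
  proof (rule Lim_transform_eventually)
    show "((\<lambda>t. \<chi> k. det (\<chi> i j. if j = k then (C t /\<^sub>R t) $ i else Z t $ i $ j) / det (Z t)) \<longlongrightarrow> matrix_inv (Z 0) *v C') (at 0)"
      unfolding matrix_inv_cramer[OF nz]
    proof (rule tendsto_vec_lambda, rule tendsto_divide[OF det_tendsto])
      fix k i j
      have "((\<lambda>t. (C t /\<^sub>R t) $ i) \<longlongrightarrow> C' $ i) (at 0)" by (rule tendsto_vec_nth[OF Ct])
      moreover have "((\<lambda>t. Z t $ i $ j) \<longlongrightarrow> Z 0 $ i $ j) (at 0)" by (rule tendsto_mono[OF at Zt])
      ultimately show "((\<lambda>t. (\<chi> i j. if j = k then (C t /\<^sub>R t) $ i else Z t $ i $ j) $ i $ j) \<longlongrightarrow>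
          (\<chi> i j. if j = k then C' $ i else Z 0 $ i $ j) $ i $ j) (at 0)"
        by (cases "j = k") auto
    qed (use tendsto_mono[OF at dZ] nz in auto)
    have "\<forall>\<^sub>F t in at 0. det (Z t) \<noteq> 0" using ev at by (rule filter_leD[rotated])
    then show "\<forall>\<^sub>F t in at 0. (\<chi> k. det (\<chi> i j. if j = k then (C t /\<^sub>R t) $ i else Z t $ i $ j) / det (Z t)) =
        (matrix_inv (Z t) *v C t) /\<^sub>R t"
    proof eventually_elim
      case (elim t)
      then show ?case
        using matrix_inv_cramer[of "Z t" "C t /\<^sub>R t"] by (simp add: matrix_vector_mult_scaleR)
    qed
  qed
  have "((\<lambda>t. norm ((matrix_inv (Z t) *v C t) /\<^sub>R t - matrix_inv (Z 0) *v C')) \<longlongrightarrow> 0) (at 0)"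
    using lim by (simp add: tendsto_norm_zero_iff Lim_null[of _ "matrix_inv (Z 0) *v C'"])
  moreover have "\<forall>\<^sub>F t in at 0. norm ((matrix_inv (Z t) *v C t) /\<^sub>R t - matrix_inv (Z 0) *v C') =
      norm (matrix_inv (Z t) *v C t - t *\<^sub>R (matrix_inv (Z 0) *v C')) / norm t"
    unfolding eventually_at
  proof (intro exI[of _ 1] conjI ballI impI)
    fix t :: real assume "t \<noteq> 0 \<and> dist t 0 < 1"
    then have "(matrix_inv (Z t) *v C t) /\<^sub>R t - matrix_inv (Z 0) *v C' =
        (matrix_inv (Z t) *v C t - t *\<^sub>R (matrix_inv (Z 0) *v C')) /\<^sub>R t" by (simp add: scaleR_diff_right)
    then show "norm ((matrix_inv (Z t) *v C t) /\<^sub>R t - matrix_inv (Z 0) *v C') =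
      norm (matrix_inv (Z t) *v C t - t *\<^sub>R (matrix_inv (Z 0) *v C')) / norm t"
      by (simp add: divide_inverse mult.commute)
  qed simp
  ultimately have "((\<lambda>t. norm (matrix_inv (Z t) *v C t - t *\<^sub>R (matrix_inv (Z 0) *v C')) / norm t) \<longlongrightarrow> 0) (at 0)"
    by (rule Lim_transform_eventually)
  then show "((\<lambda>t. matrix_inv (Z t) *v C t) has_vector_derivative matrix_inv (Z 0) *v C') (at 0)"
    using C(2) by (simp add: has_vector_derivative_def has_derivative_iff_norm bounded_linear_scaleR_left)
qed

text \<open>Homogeneous coordinates on a facet; the index \<open>m\<close> left free by the conormal serves for the
  homogenising coordinate.\<close>

definition facet_coords :: "'n::finite geometry \<Rightarrow> real ^ 'n \<Rightarrow> ('k \<Rightarrow> real ^ 'n) \<Rightarrow> 'k \<Rightarrow> real ^ 'n \<Rightarrow> real ^ 'k::finite" where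
  "facet_coords g p e m x = (\<chi> i. if i = m then flat g + curv g * form g x p else form g (x - flat g *\<^sub>R p) (e i))"

definition facet_matrix :: "'n::finite geometry \<Rightarrow> real ^ 'n \<Rightarrow> ('k \<Rightarrow> real ^ 'n) \<Rightarrow> 'k \<Rightarrow> ('k \<Rightarrow> real ^ 'n) \<Rightarrow> real ^ 'k ^ 'k::finite" where
  "facet_matrix g p e m x = (\<chi> j. facet_coords g p e m (x j))"

text \<open>The solution of the linear system that expresses the heights of the points
  \<open>x j\<close> along \<open>u\<close> through their homogeneous facet coordinates.\<close>

definition facet_slope :: "'n::finite geometry \<Rightarrow> real ^ 'n \<Rightarrow> ('k \<Rightarrow> real ^ 'n) \<Rightarrow> 'k \<Rightarrow> ('k \<Rightarrow> real ^ 'n) \<Rightarrow> real ^ 'n \<Rightarrow> real ^ 'k::finite" where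
  "facet_slope g p e m x u = matrix_inv (facet_matrix g p e m x) *v (\<chi> j. form g u (x j - flat g *\<^sub>R p))"

text \<open>The height of \<open>z\<close> above the hyperplane through the points
  \<open>x j\<close>, measured along \<open>u\<close>; it vanishes at each \<open>x j\<close> when
  the matrix is invertible.\<close>

definition facet_form :: "'n::finite geometry \<Rightarrow> real ^ 'n \<Rightarrow> ('k \<Rightarrow> real ^ 'n) \<Rightarrow> 'k \<Rightarrow> ('k::finite \<Rightarrow> real ^ 'n) \<Rightarrow> real ^ 'n \<Rightarrow> real ^ 'n \<Rightarrow> real" where
  "facet_form g p e m x u z = form g u (z - flat g *\<^sub>R p) - facet_coords g p e m z \<bullet> facet_slope g p e m x u"

text \<open>Every functional of this kind is a multiple of the facet functional because the
  \<open>CARD('k)\<close> chosen vertices determine the remaining coefficients.\<close>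

lemma facet_form_unique:
  fixes A :: "real ^ 'k::finite"
  assumes nz: "det (facet_matrix g p e m x) \<noteq> 0"
    and zero: "\<And>j. a * form g u (x j - flat g *\<^sub>R p) + A \<bullet> facet_coords g p e m (x j) = 0"
  shows "a * form g u (z - flat g *\<^sub>R p) + A \<bullet> facet_coords g p e m z = a * facet_form g p e m x u z"
proof -
  let ?Z = "facet_matrix g p e m x"
  have inv: "matrix_inv ?Z ** ?Z = mat 1"
    by (rule matrix_inv_both(2)[OF nz])
  have "?Z *v A = - a *\<^sub>R (\<chi> j. form g u (x j - flat g *\<^sub>R p))"
    using zero by (simp add: vec_eq_iff matrix_vector_mult_def facet_matrix_def inner_vec_def mult.commute eq_neg_iff_add_eq_0 add.commute)
  then have "matrix_inv ?Z *v (?Z *v A) = - a *\<^sub>R facet_slope g p e m x u"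
    unfolding facet_slope_def by (simp only: matrix_vector_mult_scaleR)
  then have "A = - a *\<^sub>R facet_slope g p e m x u"
    using inv by (simp add: matrix_vector_mul_assoc)
  then show ?thesis
    by (simp add: facet_form_def algebra_simps inner_commute)
qed

lemma facet_form_scale:
  "g \<noteq> Euclidean \<Longrightarrow> facet_form g p e m w u (a *\<^sub>R x) = a * facet_form g p e m w u x"
proof -
  assume g: "g \<noteq> Euclidean"
  have "facet_coords g p e m (a *\<^sub>R x) = a *\<^sub>R facet_coords g p e m x"
    by (simp add: facet_coords_def vec_eq_iff flat_0[OF g] form_simps)
  then show ?thesis by (simp add: facet_form_def flat_0[OF g] form_simps algebra_simps)
qed

text \<open>A moving cell with frames adapted to its facets: \<open>p\<close>, \<open>e\<close> and
  \<open>\<kappa>\<close> are the frame and tilt of a facet, \<open>w\<close> selects independent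
  vertices on it, and \<open>u\<close> is the conormal, the part of these data that depends on the
  cell.\<close>

locale moving_polytope = moving_cell g Q V \<gamma> \<gamma>' Qt kk
  for g :: "'n::finite geometry" and Q V \<gamma> \<gamma>' Qt and kk :: "'k::finite itself" +
  fixes Fac :: "(real ^ 'n) set set" and Ft :: "real \<Rightarrow> (real ^ 'n) set \<Rightarrow> (real ^ 'n) set" and m :: 'k
    and p :: "(real ^ 'n) set \<Rightarrow> real ^ 'n" and e :: "(real ^ 'n) set \<Rightarrow> 'k \<Rightarrow> real ^ 'n"
    and \<kappa> :: "(real ^ 'n) set \<Rightarrow> real" and w :: "(real ^ 'n) set \<Rightarrow> 'k \<Rightarrow> real ^ 'n"
    and u :: "(real ^ 'n) set \<Rightarrow> real ^ 'n"
  assumes Fac: "finite Fac"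
    and Fac_face: "F \<in> Fac \<Longrightarrow> poly_face g F Q \<and> F \<noteq> {} \<and> geodesic_dim g F = int CARD('k) - 1"
    and Ft: "\<forall>\<^sub>F t in nhds 0. (\<forall>F\<in>Fac. poly_face g (Ft t F) (Qt t) \<and> Ft t F \<noteq> {} \<and> geodesic_dim g (Ft t F) = int CARD('k) - 1 \<and>
          (\<forall>v\<in>V. v \<in> F \<longrightarrow> \<gamma> v t \<in> Ft t F)) \<and>
        (\<forall>X. poly_face g X (Qt t) \<and> geodesic_dim g X = int CARD('k) - 1 \<longrightarrow> X \<in> Ft t ` Fac)"
    and good: "F \<in> Fac \<Longrightarrow> good_frame g Q (p F) ((e F)(m := u F)) (\<kappa> F) m"
    and nonneg: "F \<in> Fac \<Longrightarrow> x \<in> Q \<Longrightarrow> form g (u F) (x - flat g *\<^sub>R p F) \<ge> 0"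
    and Fac_eq: "F \<in> Fac \<Longrightarrow> F = {x \<in> Q. form g (u F) (x - flat g *\<^sub>R p F) = 0}"
    and w: "F \<in> Fac \<Longrightarrow> w F j \<in> V \<and> w F j \<in> F"
    and nz: "F \<in> Fac \<Longrightarrow> det (facet_matrix g (p F) (e F) m (w F)) \<noteq> 0"
begin

text \<open>The slope, relative to the facet at 0, of the hyperplane through the moved vertices
  \<open>w F j\<close>.\<close>

definition \<theta> :: "(real ^ 'n) set \<Rightarrow> real \<Rightarrow> real ^ 'k" where
  "\<theta> F t = facet_slope g (p F) (e F) m (\<lambda>j. \<gamma> (w F j) t) (u F)"

text \<open>The moved half space of \<open>F\<close> is \<open>L F t x \<ge> 0\<close>.\<close>

definition L :: "(real ^ 'n) set \<Rightarrow> real \<Rightarrow> real ^ 'n \<Rightarrow> real" where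
  "L F t x = facet_form g (p F) (e F) m (\<lambda>j. \<gamma> (w F j) t) (u F) x"

lemma L_alt: "L F t x = form g (u F) (x - flat g *\<^sub>R p F) - facet_coords g (p F) (e F) m x \<bullet> \<theta> F t"
  by (simp add: L_def \<theta>_def facet_form_def)

text \<open>The derivative of \<open>\<theta> F\<close> at 0. The motion of the matrix does not
  enter since the heights vanish at 0.\<close>

definition \<theta>' :: "(real ^ 'n) set \<Rightarrow> real ^ 'k" where
  "\<theta>' F = matrix_inv (facet_matrix g (p F) (e F) m (w F)) *v (\<chi> j. form g (u F) (\<gamma>' (w F j)))"

lemma vertex_cont: "v \<in> V \<Longrightarrow> isCont (\<gamma> v) 0"
  using \<gamma>(2) by (rule has_vector_derivative_continuous)

lemma \<theta>_derivative:
  assumes F: "F \<in> Fac"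
  shows "(\<theta> F has_vector_derivative \<theta>' F) (at 0)" "\<theta> F 0 = 0"
    "\<forall>\<^sub>F t in nhds 0. det (facet_matrix g (p F) (e F) m (\<lambda>j. \<gamma> (w F j) t)) \<noteq> 0"
proof -
  have w0: "\<gamma> (w F j) 0 = w F j" for j using w[OF F, of j] \<gamma>(1) by simp
  have wc: "isCont (\<gamma> (w F j)) 0" for j using w[OF F, of j] by (simp add: vertex_cont)
  let ?Z = "\<lambda>t. facet_matrix g (p F) (e F) m (\<lambda>j. \<gamma> (w F j) t)"
  let ?C = "\<lambda>t. (\<chi> j. form g (u F) (\<gamma> (w F j) t - flat g *\<^sub>R p F)) :: real ^ 'k"
  have Z: "isCont (\<lambda>t. ?Z t $ i $ j) 0" for i j
    using wc[of i] unfolding facet_matrix_def facet_coords_def isCont_def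
    by (cases "j = m") (auto intro!: tendsto_intros)
  have Z0: "?Z 0 = facet_matrix g (p F) (e F) m (w F)" by (simp add: w0)
  have nz0: "det (?Z 0) \<noteq> 0" using nz[OF F] by (simp add: w0)
  have C0: "?C 0 = 0"
  proof -
    have "form g (u F) (w F j - flat g *\<^sub>R p F) = 0" for j
      using w[OF F, of j] Fac_eq[OF F] by auto
    then show ?thesis by (simp add: w0 vec_eq_iff)
  qed
  have C: "(?C has_vector_derivative (\<chi> j. form g (u F) (\<gamma>' (w F j)))) (at 0)"
    unfolding has_vector_derivative_def
  proof (subst has_derivative_componentwise_within, rule ballI)
    fix b :: "real ^ 'k" assume "b \<in> Basis"
    then obtain j where b: "b = axis j 1" by (auto simp: Basis_vec_def)
    have "(\<gamma> (w F j) has_derivative (\<lambda>x. x *\<^sub>R \<gamma>' (w F j))) (at 0)"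
      using \<gamma>(2)[of "w F j"] w[OF F, of j] by (simp add: has_vector_derivative_def)
    then have "((\<lambda>t. \<gamma> (w F j) t - flat g *\<^sub>R p F) has_derivative (\<lambda>x. x *\<^sub>R \<gamma>' (w F j) - 0)) (at 0)"
      by (intro has_derivative_diff has_derivative_const)
    then have "((\<lambda>t. form g (u F) (\<gamma> (w F j) t - flat g *\<^sub>R p F)) has_derivative (\<lambda>x. form g (u F) (x *\<^sub>R \<gamma>' (w F j) - 0))) (at 0)"
      by (rule bounded_linear.has_derivative[OF bounded_bilinear.bounded_linear_right[OF bounded_bilinear_form]])
    then show "((\<lambda>t. ?C t \<bullet> b) has_derivative (\<lambda>x. (x *\<^sub>R (\<chi> j. form g (u F) (\<gamma>' (w F j)))) \<bullet> b)) (at 0)"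
      by (simp add: b inner_axis form_simps)
  qed
  note D = linear_solution_derivative[OF Z nz0 C C0]
  show "(\<theta> F has_vector_derivative \<theta>' F) (at 0)"
    using D(1) unfolding Z0 by (simp add: \<theta>_def[abs_def] facet_slope_def \<theta>'_def)
  show "\<theta> F 0 = 0"
    using C0 by (simp add: \<theta>_def facet_slope_def)
  show "\<forall>\<^sub>F t in nhds 0. det (?Z t) \<noteq> 0" by (rule D(2))
qed

lemma \<theta>_tendsto: "F \<in> Fac \<Longrightarrow> (\<theta> F \<longlongrightarrow> 0) (nhds 0)"
  using has_vector_derivative_continuous[OF \<theta>_derivative(1)] \<theta>_derivative(2)
  by (auto simp: isCont_def tendsto_nhds_iff)

lemma L_0: "F \<in> Fac \<Longrightarrow> L F 0 x = form g (u F) (x - flat g *\<^sub>R p F)"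
  by (simp add: L_alt \<theta>_derivative(2))

lemma facet_coords_tendsto:
  assumes "(f \<longlongrightarrow> x) G"
  shows "((\<lambda>t. facet_coords g p0 e0 m (f t)) \<longlongrightarrow> facet_coords g p0 e0 m x) G"
  unfolding facet_coords_def
proof (rule tendsto_vec_lambda)
  fix i
  show "((\<lambda>t. if i = m then flat g + curv g * form g (f t) p0 else form g (f t - flat g *\<^sub>R p0) (e0 i)) \<longlongrightarrow>
      (if i = m then flat g + curv g * form g x p0 else form g (x - flat g *\<^sub>R p0) (e0 i))) G"
    by (cases "i = m") (auto intro!: tendsto_intros assms)
qed

lemma L_tendsto:
  assumes F: "F \<in> Fac" and f: "(f \<longlongrightarrow> x) (at 0)" and s: "s = (\<lambda>t. t) \<or> s = (\<lambda>t. 0)"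
  shows "((\<lambda>t. L F (s t) (f t)) \<longlongrightarrow> L F 0 x) (at 0)"
proof -
  have at: "at 0 \<le> nhds (0 :: real)" by (simp add: at_within_def)
  have "((\<lambda>t. \<theta> F (s t)) \<longlongrightarrow> 0) (at 0)"
    using s \<theta>_tendsto[OF F] \<theta>_derivative(2)[OF F] tendsto_mono[OF at] by auto
  then have "((\<lambda>t. form g (u F) (f t - flat g *\<^sub>R p F) - facet_coords g (p F) (e F) m (f t) \<bullet> \<theta> F (s t)) \<longlongrightarrow>
      form g (u F) (x - flat g *\<^sub>R p F) - facet_coords g (p F) (e F) m x \<bullet> 0) (at 0)"
    by (intro tendsto_intros f facet_coords_tendsto)
  then show ?thesis by (simp add: L_alt \<theta>_derivative(2)[OF F])
qed

lemma L_continuous_on [continuous_intros]: "continuous_on S f \<Longrightarrow> continuous_on S (\<lambda>x. L F t (f x))"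
  unfolding L_alt facet_coords_def
proof (intro continuous_intros continuous_on_vec_lambda)
  fix i assume "continuous_on S f"
  then show "continuous_on S (\<lambda>x. if i = m then flat g + curv g * form g (f x) (p F) else form g (f x - flat g *\<^sub>R p F) (e F i))"
    by (cases "i = m") (auto intro!: continuous_intros)
qed

lemma L_scale: "g \<noteq> Euclidean \<Longrightarrow> L F t (a *\<^sub>R x) = a * L F t x"
  unfolding L_def by (rule facet_form_scale)

lemma facet_dirs:
  assumes F: "F \<in> Fac"
  shows "u F \<in> dirs g Q" "i \<noteq> m \<Longrightarrow> e F i \<in> dirs g Q" "g \<noteq> Euclidean \<Longrightarrow> p F \<in> dirs g Q" "p F \<in> ahull g Q"
proof -
  have f: "unit_frame g Q (p F) UNIV ((e F)(m := u F))" "p F \<in> ahull g Q"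
    using good[OF F] by (auto simp: good_frame_def)
  have "((e F)(m := u F)) i \<in> dirs g Q" for i using f by (simp add: unit_frame_def)
  from this[of m] this[of i] show "u F \<in> dirs g Q" "i \<noteq> m \<Longrightarrow> e F i \<in> dirs g Q" by auto
  show "p F \<in> dirs g Q" if "g \<noteq> Euclidean" using f that by (simp add: unit_frame_def)
  show "p F \<in> ahull g Q" by (rule f)
qed

text \<open>\<open>L F t\<close> is built from products with directions of \<open>Q\<close>, so
  displacements orthogonal to the hull go unnoticed. A moved cell and its projection therefore
  satisfy the same inequalities.\<close>

lemma L_orthogonal:
  assumes F: "F \<in> Fac" and n: "\<And>v. v \<in> dirs g Q \<Longrightarrow> form g (x - y) v = 0"
  shows "L F t x = L F t y"
proof -
  have c: "facet_coords g (p F) (e F) m x = facet_coords g (p F) (e F) m y"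
  proof -
    have "curv g * form g x (p F) = curv g * form g y (p F)"
      using n[OF facet_dirs(3)[OF F]] by (cases "g = Euclidean") (auto simp: form_simps)
    moreover have "form g x (e F i) = form g y (e F i)" if "i \<noteq> m" for i
      using n[OF facet_dirs(2)[OF F that]] by (simp add: form_simps)
    ultimately show ?thesis by (auto simp: facet_coords_def vec_eq_iff form_simps)
  qed
  have "form g (u F) x = form g (u F) y"
    using n[OF facet_dirs(1)[OF F]] form_commute[of g "u F"] by (simp add: form_simps)
  then show ?thesis by (simp add: L_alt c form_simps)
qed

lemma frame_orthogonal_dirs:
  fixes e' :: "'k \<Rightarrow> real ^ 'n"
  assumes f: "good_frame g Q p' e' \<kappa>' m'"
    and n: "form g n (frame_slice g p' e' \<kappa>' m') = 0" "\<And>i. form g n (e' i) = 0" and v: "v \<in> dirs g Q"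
  shows "form g n v = 0"
proof -
  have "v = (curv g * form g v p') *\<^sub>R p' + (\<Sum>i\<in>UNIV. form g v (e' i) *\<^sub>R e' i)"
    by (rule unit_frame_expansion[OF _ _ v]) (use f in \<open>auto simp: good_frame_def\<close>)
  moreover have "curv g * form g n p' = 0"
    using n by (cases "g = Euclidean") (auto simp: frame_slice_def form_simps)
  ultimately have "form g n v = form g n ((curv g * form g v p') *\<^sub>R p' + (\<Sum>i\<in>UNIV. form g v (e' i) *\<^sub>R e' i))" by simp
  then show ?thesis using \<open>curv g * form g n p' = 0\<close> n
    by (auto simp: form_simps form_sum_right)
qed

end

lemma aff_dim_full_interior:
  fixes S :: "'a::euclidean_space set"
  assumes "convex S" "aff_dim S = int DIM('a)"
  shows "interior S \<noteq> {}"
proof -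
  have "affine hull S = UNIV" using assms(2) by (simp add: aff_dim_eq_full[symmetric])
  then have "rel_interior S = interior S" by (rule rel_interior_interior)
  moreover have "S \<noteq> {}" using assms(2) by auto
  ultimately show ?thesis using rel_interior_eq_empty[OF assms(1)] by simp
qed

text \<open>The adapted chart splits into the height over the facet, in coordinate \<open>m\<close>,
  and the homogeneous facet coordinates; the tilt enters only the denominator.\<close>

lemma good_frame_coords:
  assumes f: "good_frame g Q p ((e :: 'k::finite \<Rightarrow> real ^ 'n::finite)(m := u)) \<kappa> m"
  defines "q \<equiv> frame_slice g p (e(m := u)) \<kappa> m" and "r \<equiv> frame_origin g p (e(m := u))"
  shows "coords g (e(m := u)) r x $ m = form g u (x - flat g *\<^sub>R p)"
    "i \<noteq> m \<Longrightarrow> coords g (e(m := u)) r x $ i = facet_coords g p e m x $ i"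
    "slice g q x = facet_coords g p e m x $ m + \<kappa> * form g u (x - flat g *\<^sub>R p)"
proof -
  show "coords g (e(m := u)) r x $ m = form g u (x - flat g *\<^sub>R p)"
    by (simp add: r_def coords_def frame_origin_def form_simps form_commute[of g u])
  show "coords g (e(m := u)) r x $ i = facet_coords g p e m x $ i" if "i \<noteq> m"
    using that by (simp add: r_def coords_def frame_origin_def facet_coords_def form_simps)
  have "g = Euclidean \<Longrightarrow> \<kappa> = 0" using f by (auto simp: good_frame_def)
  then show "slice g q x = facet_coords g p e m x $ m + \<kappa> * form g u (x - flat g *\<^sub>R p)"
    by (cases "g = Euclidean")
      (auto simp: q_def slice_def frame_slice_def facet_coords_def form_simps flat_0 form_commute[of g u x])
qed

context moving_polytope
begin

abbreviation "fe F \<equiv> (e F)(m := u F)"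
abbreviation "fq F \<equiv> frame_slice g (p F) (fe F) (\<kappa> F) m"
abbreviation "fr F \<equiv> frame_origin g (p F) (fe F)"
abbreviation "fP F \<equiv> frame_map (p F) (fe F) (\<kappa> F) m"
abbreviation "fchi F \<equiv> chart.chi g (fq F) (fe F) (fr F)"

lemma facet_chart: "F \<in> Fac \<Longrightarrow> chart g Q (fq F) (fe F) (fr F) (fP F)"
  by (rule good_frame_chart[OF good])

lemma facet_chart_coords:
  assumes F: "F \<in> Fac"
  shows "coords g (fe F) (fr F) x $ m = form g (u F) (x - flat g *\<^sub>R p F)"
    "i \<noteq> m \<Longrightarrow> coords g (fe F) (fr F) x $ i = facet_coords g (p F) (e F) m x $ i"
    "slice g (fq F) x = facet_coords g (p F) (e F) m x $ m + \<kappa> F * form g (u F) (x - flat g *\<^sub>R p F)"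
  by (rule good_frame_coords[OF good[OF F]], erule good_frame_coords[OF good[OF F]], rule good_frame_coords[OF good[OF F]])

lemma facet_chart_\<Psi>:
  assumes F: "F \<in> Fac"
  shows "form g (u F) (fP F (1, c) - flat g *\<^sub>R p F) = c $ m"
    "facet_coords g (p F) (e F) m (fP F (1, c)) = (\<chi> i. if i = m then 1 - \<kappa> F * c $ m else c $ i)"
proof -
  interpret c: chart g Q "fq F" "fe F" "fr F" "fP F" by (rule facet_chart[OF F])
  show 1: "form g (u F) (fP F (1, c) - flat g *\<^sub>R p F) = c $ m"
    using facet_chart_coords(1)[OF F, of "fP F (1, c)"] c.coords_P[of c] by simp
  have "facet_coords g (p F) (e F) m (fP F (1, c)) $ m = 1 - \<kappa> F * c $ m"
    using facet_chart_coords(3)[OF F, of "fP F (1, c)"] c.slice_P[of c] 1 by simp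
  moreover have "facet_coords g (p F) (e F) m (fP F (1, c)) $ i = c $ i" if "i \<noteq> m" for i
    using facet_chart_coords(2)[OF F that, of "fP F (1, c)"] c.coords_P[of c] by simp
  ultimately show "facet_coords g (p F) (e F) m (fP F (1, c)) = (\<chi> i. if i = m then 1 - \<kappa> F * c $ m else c $ i)"
    by (simp add: vec_eq_iff)
qed

lemma sum_split_m: "(\<Sum>i\<in>UNIV. (if i = m then a else f i) :: real) = a + (\<Sum>i\<in>UNIV - {m}. f i)" for f :: "'k \<Rightarrow> real"
  by (subst sum.remove[of _ m]) (auto intro!: sum.cong)

text \<open>In the chart adapted to \<open>F\<close> the moved half space is bounded, for small
  \<open>t\<close>, by the graph of an affine function over the wall \<open>c $ m = 0\<close>; the
  tilt appears as a factor that equals 1 at \<open>t = 0\<close>.\<close>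

lemma L_facet_chart:
  assumes F: "F \<in> Fac"
  shows "L F t (fP F (1, c)) = c $ m * (1 + \<kappa> F * \<theta> F t $ m) - (\<theta> F t $ m + reset m 0 (\<theta> F t) \<bullet> c)"
proof -
  have "(\<chi> i. if i = m then 1 - \<kappa> F * c $ m else c $ i) \<bullet> \<theta> F t =
      (\<Sum>i\<in>UNIV. if i = m then (1 - \<kappa> F * c $ m) * \<theta> F t $ m else c $ i * \<theta> F t $ i)"
    unfolding inner_vec_def by (rule sum.cong) auto
  also have "\<dots> = (1 - \<kappa> F * c $ m) * \<theta> F t $ m + (\<Sum>i\<in>UNIV - {m}. c $ i * \<theta> F t $ i)"
    by (rule sum_split_m)
  also have "(\<Sum>i\<in>UNIV - {m}. c $ i * \<theta> F t $ i) = reset m 0 (\<theta> F t) \<bullet> c"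
  proof -
    have "reset m 0 (\<theta> F t) \<bullet> c = (\<Sum>i\<in>UNIV. if i = m then 0 else c $ i * \<theta> F t $ i)"
      unfolding inner_vec_def by (rule sum.cong) (auto simp: reset_def)
    then show ?thesis by (simp add: sum_split_m)
  qed
  finally show ?thesis
    by (simp add: L_alt facet_chart_\<Psi>[OF F] algebra_simps)
qed

lemma L_moving_frame:
  assumes f: "good_frame g Q p' (e' :: 'k \<Rightarrow> real ^ 'n) \<kappa>' m'" and F: "F \<in> Fac"
    and n: "form g (x - y) (frame_slice g p' e' \<kappa>' m') = 0" "\<And>i. form g (x - y) (e' i) = 0"
  shows "L F t x = L F t y"
  by (rule L_orthogonal[OF F]) (rule frame_orthogonal_dirs[OF f n])

lemma L_0_facet:
  assumes F: "F \<in> Fac" and x: "x \<in> Q"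
  shows "L F 0 x \<ge> 0" "L F 0 x = 0 \<longleftrightarrow> x \<in> F"
  using nonneg[OF F x] Fac_eq[OF F] x by (auto simp: L_0[OF F])

lemma facet_ne_Q: "F \<in> Fac \<Longrightarrow> F \<noteq> Q"
  using Fac_face k by force

text \<open>If all vertices lay in \<open>F\<close>, so would the cell, being their convex hull in
  the chart.\<close>

lemma vertex_off_facet:
  assumes F: "F \<in> Fac"
  obtains v where "v \<in> V" "v \<in> Q" "L F 0 v > 0"
proof -
  interpret c: chart g Q "fq F" "fe F" "fr F" "fP F" by (rule facet_chart[OF F])
  have FQ: "F \<subseteq> Q" using Fac_face[OF F] poly_face_subset by blast
  have VQ: "v \<in> Q" if "v \<in> V" for v using that V(2) poly_face_subset by blast
  have "\<exists>v\<in>V. v \<notin> F"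
  proof (rule ccontr)
    assume "\<not> (\<exists>v\<in>V. v \<notin> F)"
    then have VF: "v \<in> F" if "v \<in> V" for v using that by auto
    have "c.chi v $ m = 0" if "v \<in> V" for v
      using facet_chart_coords(1)[OF F, of v] VF[OF that] Fac_eq[OF F] by (auto simp: c.chi_def)
    moreover have "convex {c :: real ^ 'k. c $ m = 0}"
      by (rule convexI) simp
    ultimately have "convex hull (c.chi ` V) \<subseteq> {c. c $ m = 0}"
      by (intro hull_minimal) auto
    moreover have "aff_dim (c.chi ` Q) \<ge> 1"
      proof -
      have "1 \<le> CARD('k)" by (simp add: Suc_le_eq)
      then show ?thesis using c.geodesic_dim_Q k by linarith
    qed
    ultimately have chi0: "c.chi x $ m = 0" if "x \<in> Q" for x
      using c.chi_vertices that V(2) by auto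
    have "x \<in> F" if "x \<in> Q" for x
    proof -
      have "c.co x $ m = 0" using chi0[OF that] c.slice_nz[OF that] by (simp add: c.chi_def)
      then show ?thesis using facet_chart_coords(1)[OF F, of x] Fac_eq[OF F] that by auto
    qed
    then show False using facet_ne_Q[OF F] FQ by auto
  qed
  then obtain v where v: "v \<in> V" "v \<notin> F" by auto
  then have "L F 0 v > 0" using L_0_facet[OF F VQ[OF v(1)]] by auto
  then show thesis using that v VQ by blast
qed

text \<open>A functional exposing the moved facet vanishes at the moved vertices
  \<open>w F j\<close>, which determine it up to a factor. The sign of the factor is read off at a
  vertex that stays away from the facet.\<close>

lemma ahull_Qt_functional:
  assumes F: "F \<in> Fac"
  shows "\<forall>\<^sub>F t in nhds 0. \<forall>a b. (g \<noteq> Euclidean \<longrightarrow> b = 0) \<longrightarrow> (\<forall>x\<in>Qt t. form g a x \<le> b) \<longrightarrow>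
      Ft t F = {x \<in> Qt t. form g a x = b} \<longrightarrow>
      (\<exists>\<mu>>0. \<forall>x\<in>ahull g (Qt t). b - form g a x = \<mu> * L F t x)"
proof -
  obtain C P where P: "\<forall>\<^sub>F t in nhds 0. chart g (Qt t) (fq F) (fe F) (fr F) (P t)"
    by (rule moving_frame[OF good[OF F]], rule that, erule eventually_mono) blast
  obtain v where v: "v \<in> V" "v \<in> Q" "L F 0 v > 0" by (rule vertex_off_facet[OF F])
  have "((\<lambda>t. L F t (\<gamma> v t)) \<longlongrightarrow> L F 0 v) (at 0)"
    by (rule L_tendsto[OF F, where s="\<lambda>t. t"])
      (use vertex_cont[OF v(1)] \<gamma>(1)[OF v(1)] in \<open>auto simp: isCont_def\<close>)
  then have "((\<lambda>t. L F t (\<gamma> v t)) \<longlongrightarrow> L F 0 v) (nhds 0)"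
    using \<gamma>(1)[OF v(1)] by (simp add: tendsto_nhds_iff)
  then have Lv: "\<forall>\<^sub>F t in nhds 0. L F t (\<gamma> v t) > 0"
    by (rule order_tendstoD) (use v in simp)
  show ?thesis
    using P Lv Qt Ft \<theta>_derivative(3)[OF F]
  proof eventually_elim
    case (elim t)
    interpret ct: chart g "Qt t" "fq F" "fe F" "fr F" "P t" by (rule elim(1))
    have nzt: "det (facet_matrix g (p F) (e F) m (\<lambda>j. \<gamma> (w F j) t)) \<noteq> 0" by (rule elim(5))
    show ?case
    proof (intro allI impI)
      fix a b assume b: "g \<noteq> Euclidean \<longrightarrow> b = 0" and le: "\<forall>x\<in>Qt t. form g a x \<le> b"
        and Feq: "Ft t F = {x \<in> Qt t. form g a x = b}"
      \<comment> \<open>The functional as a function of denominator and coordinates. The constant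
        \<open>b\<close> is attached to the denominator, which is 1 in the affine model; in the
        linear ones \<open>b = 0\<close>.\<close>
      define h where "h = (\<lambda>z :: real \<times> (real ^ 'k). b * fst z - form g a (P t z))"
      have h: "linear h"
        by (rule linearI) (simp_all add: h_def linear_add[OF ct.lin_P] linear_scale[OF ct.lin_P] form_simps algebra_simps)
      define A :: "real ^ 'k" where "A = (\<chi> i. if i = m then h (1, 0) else h (0, axis i 1))"
      define al where "al = h (0, axis m 1) + \<kappa> F * h (1, 0)"
      have hx: "b - form g a x = al * form g (u F) (x - flat g *\<^sub>R p F) + A \<bullet> facet_coords g (p F) (e F) m x"
        if x: "x \<in> ahull g (Qt t)" for x
      proof -
        define s where "s = ct.sl x"
        define c where "c = ct.co x"
        have "(s, c) = s *\<^sub>R (1, 0) + (\<Sum>i\<in>UNIV. c $ i *\<^sub>R (0, axis i 1))"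
        proof -
          have "(\<Sum>i\<in>UNIV. c $ i *\<^sub>R ((0 :: real), axis i (1 :: real))) = (0, \<Sum>i\<in>UNIV. c $ i *\<^sub>R axis i 1)"
            by (simp add: prod_eq_iff fst_sum snd_sum)
          then show ?thesis using basis_expansion[of c] by (simp add: scalar_mult_eq_scaleR)
        qed
        then have "h (s, c) = s * h (1, 0) + (\<Sum>i\<in>UNIV. c $ i * h (0, axis i 1))"
          by (simp only: linear_add[OF h] linear_sum[OF h] linear_scale[OF h] real_scaleR_def)
        also have "(\<Sum>i\<in>UNIV. c $ i * h (0, axis i 1)) = c $ m * h (0, axis m 1) + (\<Sum>i\<in>UNIV - {m}. c $ i * h (0, axis i 1))"
          by (subst sum.remove[of _ m]) auto
        also have "(\<Sum>i\<in>UNIV - {m}. c $ i * h (0, axis i 1)) = (\<Sum>i\<in>UNIV - {m}. A $ i * facet_coords g (p F) (e F) m x $ i)"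
          by (rule sum.cong) (auto simp: c_def A_def facet_chart_coords(2)[OF F])
        finally have H1: "h (s, c) = s * h (1, 0) + (c $ m * h (0, axis m 1) + (\<Sum>i\<in>UNIV - {m}. A $ i * facet_coords g (p F) (e F) m x $ i))" .
        have H2: "s = facet_coords g (p F) (e F) m x $ m + \<kappa> F * form g (u F) (x - flat g *\<^sub>R p F)"
          by (simp add: s_def facet_chart_coords(3)[OF F])
        have H3: "c $ m = form g (u F) (x - flat g *\<^sub>R p F)"
          by (simp add: c_def facet_chart_coords(1)[OF F])
        have 1: "h (s, c) = al * form g (u F) (x - flat g *\<^sub>R p F) +
            (h (1, 0) * facet_coords g (p F) (e F) m x $ m + (\<Sum>i\<in>UNIV - {m}. A $ i * facet_coords g (p F) (e F) m x $ i))"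
          unfolding H1 unfolding H2 H3 by (simp add: al_def algebra_simps)
        have 2: "A \<bullet> facet_coords g (p F) (e F) m x =
            h (1, 0) * facet_coords g (p F) (e F) m x $ m + (\<Sum>i\<in>UNIV - {m}. A $ i * facet_coords g (p F) (e F) m x $ i)"
          unfolding inner_vec_def by (subst sum.remove[of _ m]) (auto simp: A_def)
        have "h (s, c) = b - form g a x"
          using b ct.slice_Euclidean[of x] ct.P_inverse[OF x] by (cases "g = Euclidean") (auto simp: h_def s_def c_def)
        then show ?thesis using 1 2 by simp
      qed
      have hw: "al * form g (u F) (\<gamma> (w F j) t - flat g *\<^sub>R p F) + A \<bullet> facet_coords g (p F) (e F) m (\<gamma> (w F j) t) = 0" for j
      proof -
        have "\<gamma> (w F j) t \<in> Ft t F" using elim(4) F w[OF F, of j] by blast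
        then have "form g a (\<gamma> (w F j) t) = b" "\<gamma> (w F j) t \<in> Qt t" using Feq by auto
        then show ?thesis using hx[of "\<gamma> (w F j) t"] ahull_superset by force
      qed
      have hL: "b - form g a x = al * L F t x" if x: "x \<in> ahull g (Qt t)" for x
        using hx[OF x] facet_form_unique[OF nzt hw, of x] by (simp add: L_def)
      have "\<gamma> v t \<in> Qt t"
      proof -
        have "\<gamma> v t \<in> {w. poly_face g {w} (Qt t)}" using elim(3) v(1) by blast
        then show ?thesis using poly_face_subset by blast
      qed
      then have "al * L F t (\<gamma> v t) \<ge> 0"
        using hL[of "\<gamma> v t"] le ahull_superset[of "Qt t" g] by force
      then have "al \<ge> 0" using elim(2) by (simp add: zero_le_mult_iff)
      \<comment> \<open>A zero factor would make the functional constant on the cell and the facet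
        equal to the cell, against the dimensions.\<close>
      moreover have "al \<noteq> 0"
      proof
        assume "al = 0"
        then have "form g a x = b" if "x \<in> Qt t" for x
          using hL[of x] that ahull_superset[of "Qt t" g] by auto
        then have "Ft t F = Qt t" using Feq by auto
        then show False using elim(3,4) F by force
      qed
      ultimately have "al > 0" by simp
      then show "\<exists>\<mu>>0. \<forall>x\<in>ahull g (Qt t). b - form g a x = \<mu> * L F t x" using hL by blast
    qed
  qed
qed

lemma L_chart_affine:
  assumes P: "linear (P :: real \<times> (real ^ 'k) \<Rightarrow> real ^ 'n)"
  shows "\<exists>al. \<forall>c. L F t (P (1, c)) = al \<bullet> c + L F t (P (1, 0))"
proof -
  define dv :: "real ^ 'n \<Rightarrow> real ^ 'k" where
    "dv = (\<lambda>y. \<chi> i. if i = m then curv g * form g y (p F) else form g y (e F i))"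
  define d where "d = (\<lambda>y. form g (u F) y - dv y \<bullet> \<theta> F t)"
  have dv: "dv (x + y) = dv x + dv y" "dv (a *\<^sub>R x) = a *\<^sub>R dv x" for x y a
    by (auto simp: dv_def vec_eq_iff form_simps algebra_simps)
  have dl: "linear d"
    by (rule linearI) (simp_all add: d_def dv form_simps algebra_simps)
  have Ld: "L F t (x + y) = L F t x + d y" for x y
  proof -
    have "facet_coords g (p F) (e F) m (x + y) = facet_coords g (p F) (e F) m x + dv y"
      by (auto simp: facet_coords_def dv_def vec_eq_iff form_simps algebra_simps)
    then show ?thesis by (simp add: L_alt d_def form_simps inner_add_left algebra_simps)
  qed
  have "L F t (P (1, c)) = (\<chi> i. d (P (0, axis i 1))) \<bullet> c + L F t (P (1, 0))" for c
  proof -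
    have "(0 :: real, c) = (\<Sum>i\<in>UNIV. c $ i *\<^sub>R (0, axis i 1))"
      using basis_expansion[of c] by (simp add: prod_eq_iff fst_sum snd_sum scalar_mult_eq_scaleR)
    then have "d (P (0, c)) = (\<Sum>i\<in>UNIV. c $ i * d (P (0, axis i 1)))"
      by (simp only: linear_sum[OF P] linear_sum[OF dl] linear_scale[OF P] linear_scale[OF dl] real_scaleR_def)
    moreover have "P (1, c) = P (1, 0) + P (0, c)"
      using linear_add[OF P, of "(1, 0)" "(0, c)"] by simp
    ultimately show ?thesis by (simp add: Ld inner_vec_def mult.commute)
  qed
  then show ?thesis by blast
qed

text \<open>In its own chart the moved cell is a full-dimensional polytope whose facets pull back to
  faces of codimension 1, hence to moved facets. Its lift differs from the fixed one by vectors
  orthogonal to the hull, so the inequalities can be stated with the fixed lift.\<close>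

theorem chi_Qt_halfspaces:
  assumes f: "good_frame g Q p' (e' :: 'k \<Rightarrow> real ^ 'n) \<kappa>' m'"
  shows "\<forall>\<^sub>F t in nhds 0. chart.chi g (frame_slice g p' e' \<kappa>' m') e' (frame_origin g p' e') ` Qt t =
    {c. \<forall>F\<in>Fac. L F t (frame_map p' e' \<kappa>' m' (1, c)) \<ge> 0}"
proof -
  obtain C P where P: "\<forall>\<^sub>F t in nhds 0. chart g (Qt t) (frame_slice g p' e' \<kappa>' m') e' (frame_origin g p' e') (P t) \<and>
       (\<forall>w. norm (P t w - frame_map p' e' \<kappa>' m' w) \<le> C * \<bar>t\<bar> * norm w \<and>
         form g (P t w - frame_map p' e' \<kappa>' m' w) (frame_slice g p' e' \<kappa>' m') = 0 \<and>
         (\<forall>i. form g (P t w - frame_map p' e' \<kappa>' m' w) (e' i) = 0))"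
    by (rule moving_frame[OF f]) blast
  have fnl: "\<forall>\<^sub>F t in nhds 0. \<forall>F\<in>Fac. \<forall>a b. (g \<noteq> Euclidean \<longrightarrow> b = 0) \<longrightarrow> (\<forall>x\<in>Qt t. form g a x \<le> b) \<longrightarrow>
      Ft t F = {x \<in> Qt t. form g a x = b} \<longrightarrow>
      (\<exists>\<mu>>0. \<forall>x\<in>ahull g (Qt t). b - form g a x = \<mu> * L F t x)"
    by (rule eventually_ball_finite[OF Fac]) (use ahull_Qt_functional in blast)
  show ?thesis
    using P fnl Qt Ft
  proof eventually_elim
    case (elim t)
    interpret ct: chart g "Qt t" "frame_slice g p' e' \<kappa>' m'" e' "frame_origin g p' e'" "P t" using elim(1) by blast
    have LP: "L F t (P t w) = L F t (frame_map p' e' \<kappa>' m' w)" if "F \<in> Fac" for F w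
      by (rule L_moving_frame[OF f that]) (use elim(1) in blast)+
    have face: "\<exists>a b \<mu>. (g \<noteq> Euclidean \<longrightarrow> b = 0) \<and> \<mu> > 0 \<and> (\<forall>x\<in>Qt t. form g a x \<le> b) \<and>
        Ft t F = {x \<in> Qt t. form g a x = b} \<and> (\<forall>x\<in>ahull g (Qt t). b - form g a x = \<mu> * L F t x)" if F: "F \<in> Fac" for F
    proof -
      have "poly_face g (Ft t F) (Qt t)" "Ft t F \<noteq> {}" "Ft t F \<noteq> Qt t" using elim(3,4) F by force+
      then obtain a b where ab: "g \<noteq> Euclidean \<Longrightarrow> b = 0" "\<And>x. x \<in> Qt t \<Longrightarrow> form g a x \<le> b"
          "Ft t F = {x \<in> Qt t. form g a x = b}"
        by (rule poly_face_functional) blast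
      then obtain \<mu> where "\<mu> > 0" "\<forall>x\<in>ahull g (Qt t). b - form g a x = \<mu> * L F t x"
        using elim(2) F by blast
      then show ?thesis using ab by blast
    qed
    have \<Psi>h: "ct.\<Psi> c \<in> ahull g (Qt t)" for c by (simp add: ct.\<Psi>_def ct.P_hull)
    have sc: "ct.\<Psi> (ct.chi x) = x /\<^sub>R ct.sl x" if "x \<in> Qt t" for x
      using ct.hull_Q[OF that] ct.slice_pos[OF that] by (intro ct.\<Psi>_chi) (auto simp: geodesic_hull_eq)
    have Lsc: "L F t (ct.\<Psi> (ct.chi x)) = L F t x / ct.sl x" if "x \<in> Qt t" for x F
    proof (cases "g = Euclidean")
      case True
      note sl = ct.slice_Euclidean[OF True, of x]
      show ?thesis unfolding sc[OF that] sl by simp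
    next
      case False then show ?thesis by (simp add: sc[OF that] L_scale divide_inverse mult.commute)
    qed
    have Lpos: "L F t x \<ge> 0" if F: "F \<in> Fac" and x: "x \<in> Qt t" for F x
    proof -
      obtain a b \<mu> where ab: "\<mu> > 0" "\<forall>x\<in>Qt t. form g a x \<le> b" "\<forall>x\<in>ahull g (Qt t). b - form g a x = \<mu> * L F t x"
        using face[OF F] by blast
      have "\<mu> * L F t x \<ge> 0" using ab x ahull_superset[of "Qt t" g] by force
      then show ?thesis using ab(1) by (simp add: zero_le_mult_iff)
    qed
    have L0: "L F t x = 0 \<longleftrightarrow> x \<in> Ft t F" if F: "F \<in> Fac" and x: "x \<in> Qt t" for F x
    proof -
      obtain a b \<mu> where ab: "\<mu> > 0" "Ft t F = {x \<in> Qt t. form g a x = b}" "\<forall>x\<in>ahull g (Qt t). b - form g a x = \<mu> * L F t x"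
        using face[OF F] by blast
      have "\<mu> * L F t x = b - form g a x" using ab x ahull_superset[of "Qt t" g] by force
      then show ?thesis using ab x by auto
    qed
    define l where "l = (\<lambda>F c. L F t (ct.\<Psi> c))"
    have "\<exists>al. \<forall>c. l F c = al \<bullet> c + l F 0" for F
      using L_chart_affine[OF ct.lin_P] unfolding l_def ct.\<Psi>_def by blast
    then obtain al where l_aff: "l F c = al F \<bullet> c + l F 0" for F c by metis
    have ad: "aff_dim (ct.chi ` Qt t) = int CARD('k)" using ct.geodesic_dim_Q elim(3) by linarith
    have "ct.chi ` Qt t = {c. \<forall>F\<in>Fac. al F \<bullet> c + l F 0 \<ge> 0}"
    proof (rule polytope_halfspace_representation[OF ct.polytope_chi])
      show "interior (ct.chi ` Qt t) \<noteq> {}"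
        by (rule aff_dim_full_interior) (use ct.polytope_chi ad in \<open>simp_all add: polytope_imp_convex\<close>)
      show "al F \<bullet> x + l F 0 \<ge> 0" if "F \<in> Fac" "x \<in> ct.chi ` Qt t" for F x
        unfolding l_aff[symmetric] unfolding l_def using that Lsc Lpos ct.slice_pos by (auto intro!: divide_nonneg_pos)
      show "\<exists>x\<in>ct.chi ` Qt t. al F \<bullet> x + l F 0 > 0" if F: "F \<in> Fac" for F
      proof -
        have "Ft t F \<subseteq> Qt t" "Ft t F \<noteq> Qt t" using elim(3,4) F poly_face_subset by force+
        then obtain x where x: "x \<in> Qt t" "x \<notin> Ft t F" by auto
        then have "L F t x > 0" using Lpos[OF F x(1)] L0[OF F x(1)] by auto
        then have "l F (ct.chi x) > 0" unfolding l_def Lsc[OF x(1)] using ct.slice_pos[OF x(1)] by simp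
        then show ?thesis unfolding l_aff[symmetric] using x by blast
      qed
      show "\<exists>F\<in>Fac. \<forall>x\<in>E. al F \<bullet> x + l F 0 = 0" if E: "E facet_of ct.chi ` Qt t" for E
      proof -
        define X where "X = {x \<in> Qt t. ct.chi x \<in> E}"
        have "poly_face g X (Qt t)" "geodesic_dim g X = int CARD('k) - 1" "ct.chi ` X = E"
          using ct.facet_pullback[OF E] elim(3) unfolding X_def by auto
        then obtain F where F: "F \<in> Fac" "X = Ft t F" using elim(4) by blast
        have "l F c = 0" if c: "c \<in> E" for c
        proof -
          obtain x where x: "x \<in> X" "c = ct.chi x" using c \<open>ct.chi ` X = E\<close> by auto
          then have "x \<in> Qt t" "L F t x = 0" using L0[OF F(1)] F(2) by (auto simp: X_def)
          then show ?thesis unfolding l_def x(2) by (simp add: Lsc)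
        qed
        then show ?thesis unfolding l_aff[symmetric] using F(1) by blast
      qed
    qed
    also have "\<dots> = {c. \<forall>F\<in>Fac. L F t (frame_map p' e' \<kappa>' m' (1, c)) \<ge> 0}"
      unfolding l_aff[symmetric] unfolding l_def ct.\<Psi>_def using LP by auto
    finally show ?case .
  qed
qed

end

subsection \<open>First variation of the volume\<close>

lemma hyperplane_null:
  fixes a :: "'a::euclidean_space"
  assumes "a \<noteq> 0 \<or> b \<noteq> 0"
  shows "AE x in lborel. a \<bullet> x + b \<noteq> 0"
proof -
  have "negligible {x. a \<bullet> x = - b}" using assms by (intro negligible_hyperplane) auto
  then have "{x. a \<bullet> x = - b} \<in> null_sets lebesgue" by (simp add: negligible_iff_null_sets)
  moreover have "{x. a \<bullet> x = - b} \<in> sets lborel" by (simp add: closed_hyperplane)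
  ultimately have "{x. a \<bullet> x = - b} \<in> null_sets lborel" by (simp add: null_sets_completion_iff)
  then have "AE x in lborel. x \<notin> {x. a \<bullet> x = - b}" by (rule AE_not_in)
  then show ?thesis by eventually_elim auto
qed

lemma integral_compact_LINT:
  fixes f :: "'a::euclidean_space \<Rightarrow> real"
  assumes "compact S" "continuous_on S f"
  shows "integrable lborel (\<lambda>x. f x * indicator S x)" "integral S f = (LINT x|lborel. f x * indicator S x)"
proof -
  have i: "set_integrable lborel S f"
    using borel_integrable_compact[OF assms] by (simp add: set_integrable_def)
  then show "integrable lborel (\<lambda>x. f x * indicator S x)"
    by (simp add: set_integrable_def mult.commute)
  show "integral S f = (LINT x|lborel. f x * indicator S x)"
    using set_borel_integral_eq_integral(2)[OF i] by (simp add: set_lebesgue_integral_def mult.commute)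
qed

context moving_polytope
begin

text \<open>An intermediate body in which the half spaces of the facets in \<open>S\<close> have
  moved and the others have not. It is confined to \<open>D\<close> since such a mixture need not be
  compact.\<close>

definition region :: "(real ^ 'n) set \<Rightarrow> (real ^ 'n) set set \<Rightarrow> real \<Rightarrow> (real ^ 'n) set" where
  "region D S t = {x \<in> D. \<forall>i\<in>Fac. L i (if i \<in> S then t else 0) x \<ge> 0}"

text \<open>The density on the wall, extended constantly in the \<open>m\<close>-th
  coordinate.\<close>

definition facet_density :: "(real ^ 'n) set \<Rightarrow> real ^ 'k \<Rightarrow> real" where
  "facet_density F c = density g (fP F) (reset m 0 c) * indicator (fchi F ` F) (reset m 0 c)"

text \<open>Minus the integral over the facet of the speed at which its wall moves inward. The slab
  of thickness 1 expresses an integral over the wall by Lebesgue measure on the whole coordinate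
  space.\<close>

definition facet_rate :: "(real ^ 'n) set \<Rightarrow> real" where
  "facet_rate F = - (LINT c|lborel. (\<theta>' F $ m + reset m 0 (\<theta>' F) \<bullet> c) * facet_density F c * of_bool (0 \<le> c $ m \<and> c $ m \<le> 1))"

lemma compact_region: "compact D \<Longrightarrow> compact (region D S t)"
proof -
  assume D: "compact D"
  have "closed {x. L i s x \<ge> 0}" for i s
    by (rule closed_Collect_le) (intro continuous_intros)+
  then have "closed (\<Inter>i\<in>Fac. {x. L i (if i \<in> S then t else 0) x \<ge> 0})" by blast
  then have "compact (D \<inter> (\<Inter>i\<in>Fac. {x. L i (if i \<in> S then t else 0) x \<ge> 0}))" by (rule compact_Int_closed[OF D])
  moreover have "D \<inter> (\<Inter>i\<in>Fac. {x. L i (if i \<in> S then t else 0) x \<ge> 0}) = region D S t" unfolding region_def by blast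
  ultimately show ?thesis by simp
qed

text \<open>If the functional of another facet vanished on the whole wall of \<open>F\<close>, it
  would be a multiple of that of \<open>F\<close>, and the facets would coincide or fill the cell.
  So almost every point of the wall lies strictly inside or outside the other half spaces, where
  indicator functions have limits.\<close>

lemma slack_null:
  assumes F: "F \<in> Fac" and i: "i \<in> Fac" "i \<noteq> F"
  shows "AE c in lborel. L i 0 (fP F (1, reset m 0 c)) \<noteq> 0"
proof -
  interpret c: chart g Q "fq F" "fe F" "fr F" "fP F" by (rule facet_chart[OF F])
  obtain al where al: "L i 0 (fP F (1, c)) = al \<bullet> c + L i 0 (fP F (1, 0))" for c
    using L_chart_affine[OF c.lin_P] by blast
  define b where "b = L i 0 (fP F (1, 0))"
  have split: "al \<bullet> c = al $ m * c $ m + reset m 0 al \<bullet> c" for c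
  proof -
    have "reset m 0 al \<bullet> c = (\<Sum>j\<in>UNIV. if j = m then 0 else al $ j * c $ j)"
      unfolding inner_vec_def by (rule sum.cong) (auto simp: reset_def)
    then show ?thesis unfolding inner_vec_def sum_split_m by (subst sum.remove[of _ m]) auto
  qed
  have rs: "reset m 0 al \<bullet> reset m 0 c = reset m 0 al \<bullet> c" for c
    unfolding inner_vec_def by (rule sum.cong) (auto simp: reset_def)
  have "reset m 0 al \<noteq> 0 \<or> b \<noteq> 0"
  proof (rule ccontr)
    assume "\<not> ?thesis"
    then have z: "L i 0 (fP F (1, c)) = al $ m * c $ m" for c
      using al[of c] split[of c] by (simp add: b_def)
    have iL: "L i 0 x = al $ m * L F 0 x" if x: "x \<in> Q" for x
    proof -
      have s: "c.sl x > 0" by (rule c.slice_pos[OF x])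
      have h: "x \<in> ahull g Q" using ahull_superset x by blast
      have Px: "fP F (1, c.chi x) = x /\<^sub>R c.sl x" using c.\<Psi>_chi[OF h s] by (simp add: c.\<Psi>_def)
      have "c.chi x $ m = L F 0 x / c.sl x"
        using facet_chart_coords(1)[OF F, of x] by (simp add: c.chi_def L_0[OF F] divide_inverse mult.commute)
      then have e: "L i 0 (x /\<^sub>R c.sl x) = al $ m * L F 0 x / c.sl x" using z[of "c.chi x"] unfolding Px by simp
      show ?thesis
      proof (cases "g = Euclidean")
        case True
        have s1: "c.sl x = 1" by (rule c.slice_Euclidean[OF True])
        show ?thesis using e unfolding s1 by simp
      next
        case False then show ?thesis using e s by (simp add: L_scale field_simps)
      qed
    qed
    have sub: "i \<subseteq> Q" "F \<subseteq> Q" using Fac_face i F poly_face_subset by blast+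
    show False
    proof (cases "al $ m = 0")
      case True
      then have "Q \<subseteq> i" using iL L_0_facet(2)[OF i(1)] by auto
      then show False using sub facet_ne_Q[OF i(1)] by auto
    next
      case False
      then have "x \<in> i \<longleftrightarrow> x \<in> F" if "x \<in> Q" for x
        using iL[OF that] L_0_facet(2)[OF i(1) that] L_0_facet(2)[OF F that] by simp
      then show False using sub i(2) by blast
    qed
  qed
  from hyperplane_null[OF this] show ?thesis
    by eventually_elim (simp add: al[of "reset m 0 _"] split[of "reset m 0 _"] rs b_def)
qed

text \<open>The lift is the point divided by its positive denominator. In the curved cases
  \<open>L\<close> is homogeneous and keeps its sign; in the flat case the denominator is 1.\<close>

lemma chi_image_region:
  assumes c: "chart g Q q (e' :: 'k \<Rightarrow> real ^ 'n) r P"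
    and D: "D \<subseteq> geodesic_hull g Q" "\<And>x. x \<in> D \<Longrightarrow> slice g q x > 0"
  shows "chart.chi g q e' r ` region D S t =
    {c \<in> chart.chi g q e' r ` D. \<forall>i\<in>Fac. L i (if i \<in> S then t else 0) (P (1, c)) \<ge> 0}"
proof -
  interpret c: chart g Q q e' r P by (rule c)
  have "L i s (P (1, c.chi x)) \<ge> 0 \<longleftrightarrow> L i s x \<ge> 0" if x: "x \<in> D" for i s x
  proof -
    have s: "c.sl x > 0" by (rule D(2)[OF x])
    have h: "x \<in> ahull g Q" using D(1) x by (auto simp: geodesic_hull_eq)
    have Px: "P (1, c.chi x) = x /\<^sub>R c.sl x" using c.\<Psi>_chi[OF h s] by (simp add: c.\<Psi>_def)
    show ?thesis
    proof (cases "g = Euclidean")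
      case True
      have s1: "c.sl x = 1" by (rule c.slice_Euclidean[OF True])
      show ?thesis unfolding Px s1 by simp
    next
      case False then show ?thesis unfolding Px using s by (simp add: L_scale zero_le_mult_iff)
    qed
  qed
  then show ?thesis unfolding region_def by blast
qed

lemma Q_halfspaces:
  assumes F: "F \<in> Fac"
  shows "fchi F ` Q = {c. \<forall>i\<in>Fac. L i 0 (fP F (1, c)) \<ge> 0}"
  using eventually_nhds_x_imp_x[OF chi_Qt_halfspaces[OF good[OF F]]] Q0 by simp

lemma F_in_chart:
  assumes F: "F \<in> Fac"
  shows "fchi F ` F = {c \<in> fchi F ` Q. c $ m = 0}"
proof -
  interpret c: chart g Q "fq F" "fe F" "fr F" "fP F" by (rule facet_chart[OF F])
  have "c.chi x $ m = 0 \<longleftrightarrow> form g (u F) (x - flat g *\<^sub>R p F) = 0" if "x \<in> Q" for x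
    using facet_chart_coords(1)[OF F, of x] c.slice_nz[OF that] by (simp add: c.chi_def)
  then have "x \<in> F \<longleftrightarrow> x \<in> Q \<and> c.chi x $ m = 0" for x
    using Fac_eq[OF F] by blast
  then show ?thesis by blast
qed

text \<open>\<open>\<theta> F\<close> vanishes and the denominator is 1 at 0, so the tilt leaves no
  trace in the first derivatives.\<close>

lemma slope_derivatives:
  assumes F: "F \<in> Fac"
  defines "b \<equiv> \<lambda>t. \<theta> F t $ m / (1 + \<kappa> F * \<theta> F t $ m)"
    and "a \<equiv> \<lambda>t. (1 / (1 + \<kappa> F * \<theta> F t $ m)) *\<^sub>R reset m 0 (\<theta> F t)"
  shows "(b has_real_derivative \<theta>' F $ m) (at 0)" "b 0 = 0"
    "(a has_vector_derivative reset m 0 (\<theta>' F)) (at 0)" "a 0 = 0" "a t $ m = 0"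
proof -
  note D = \<theta>_derivative[OF F]
  have D1: "((\<lambda>t. \<theta> F t $ i) has_real_derivative \<theta>' F $ i) (at 0)" for i
  proof -
    have "((\<lambda>t. \<theta> F t $ i) has_vector_derivative \<theta>' F $ i) (at 0)"
      using bounded_linear.has_vector_derivative[OF bounded_linear_vec_nth D(1)] .
    then show ?thesis by (simp add: has_real_derivative_iff_has_vector_derivative)
  qed
  have z: "\<theta> F 0 $ i = 0" for i by (simp add: D(2))
  show "(b has_real_derivative \<theta>' F $ m) (at 0)" unfolding b_def
    by (rule derivative_eq_intros D1 refl)+ (simp_all add: z)
  show "b 0 = 0" "a 0 = 0" "a t $ m = 0" by (simp_all add: a_def b_def z vec_eq_iff reset_def)
  have lin: "bounded_linear (reset m 0 :: real ^ 'k \<Rightarrow> real ^ 'k)"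
    by (rule linear_linear[THEN iffD2], rule linearI) (auto simp: reset_def vec_eq_iff)
  have R: "((\<lambda>t. reset m 0 (\<theta> F t)) has_vector_derivative reset m 0 (\<theta>' F)) (at 0)"
    by (rule bounded_linear.has_vector_derivative[OF lin D(1)])
  have I: "((\<lambda>t. 1 / (1 + \<kappa> F * \<theta> F t $ m)) has_field_derivative - (\<kappa> F * \<theta>' F $ m)) (at 0)"
    by (rule derivative_eq_intros D1 refl)+ (simp_all add: z)
  have "(a has_vector_derivative (1 / (1 + \<kappa> F * \<theta> F 0 $ m)) *\<^sub>R reset m 0 (\<theta>' F) + (- (\<kappa> F * \<theta>' F $ m)) *\<^sub>R reset m 0 (\<theta> F 0)) (at 0)"
    unfolding a_def by (rule has_vector_derivative_scaleR[OF I R])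
  moreover have "reset m 0 (\<theta> F 0) = 0" by (simp add: z vec_eq_iff reset_def)
  ultimately show "(a has_vector_derivative reset m 0 (\<theta>' F)) (at 0)" by (simp add: z)
qed

lemma reset_tendsto:
  assumes "(s \<longlongrightarrow> 0) G"
  shows "((\<lambda>t. reset m (s t) c) \<longlongrightarrow> reset m 0 c) G"
  unfolding reset_def
proof (rule tendsto_vec_lambda)
  fix i show "((\<lambda>t. if i = m then s t else c $ i) \<longlongrightarrow> (if i = m then 0 else c $ i)) G"
    using assms by (cases "i = m") auto
qed

lemma L_0_facet_chart: "F \<in> Fac \<Longrightarrow> L F 0 (fP F (1, c)) = c $ m"
proof -
  assume F: "F \<in> Fac"
  have z: "\<theta> F 0 = 0" by (rule \<theta>_derivative(2)[OF F])
  have "reset m 0 (0 :: real ^ 'k) = 0" by (simp add: reset_def vec_eq_iff)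
  then show ?thesis by (simp add: L_facet_chart[OF F] z)
qed

lemma facet_density_measurable:
  assumes F: "F \<in> Fac"
  shows "facet_density F \<in> borel_measurable borel"
proof -
  interpret c: chart g Q "fq F" "fe F" "fr F" "fP F" by (rule facet_chart[OF F])
  have "compact (c.chi ` Q)" using c.polytope_chi by (rule polytope_imp_compact)
  moreover have "closed {c :: real ^ 'k. c $ m = 0}" by (rule closed_Collect_eq) (intro continuous_intros)+
  ultimately have "compact (c.chi ` Q \<inter> {c. c $ m = 0})" by (rule compact_Int_closed)
  then have cF: "compact (c.chi ` F)" unfolding F_in_chart[OF F] by (simp add: Int_def conj_commute)
  have "c.chi ` F \<subseteq> c.W"
    using c.\<phi>_chi(1)[OF c.hull_Q c.slice_pos] Fac_face[OF F] poly_face_subset by blast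
  then have "continuous_on (c.chi ` F) (density g (fP F))"
    using continuous_on_subset[OF c.dens_continuous] by (simp add: c.dens_density)
  then have m: "(\<lambda>c. indicator (c.chi ` F) c *\<^sub>R density g (fP F) c) \<in> borel_measurable borel"
    using cF by (intro borel_measurable_continuous_on_indicator) (auto simp: compact_imp_closed)
  have "continuous_on UNIV (\<lambda>c :: real ^ 'k. reset m 0 c)" by (intro continuous_intros)
  then have "(\<lambda>c :: real ^ 'k. reset m 0 c) \<in> borel_measurable borel"
    by (rule borel_measurable_continuous_onI)
  from measurable_compose[OF this m] show ?thesis
    by (simp add: facet_density_def[abs_def] mult.commute)
qed

lemma facet_density_bounded:
  assumes F: "F \<in> Fac"
  obtains M R where "\<And>c. \<bar>facet_density F c\<bar> \<le> M" "M \<ge> 0" "\<And>c. facet_density F c \<noteq> 0 \<Longrightarrow> norm (reset m 0 c) \<le> R"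
proof -
  interpret c: chart g Q "fq F" "fe F" "fr F" "fP F" by (rule facet_chart[OF F])
  have cQ: "compact (c.chi ` Q)" using c.polytope_chi by (rule polytope_imp_compact)
  have "c.chi ` Q \<subseteq> c.W" using c.\<phi>_chi(1)[OF c.hull_Q c.slice_pos] by blast
  then have "continuous_on (c.chi ` Q) (density g (fP F))"
    using continuous_on_subset[OF c.dens_continuous] by (simp add: c.dens_density)
  from compact_imp_bounded[OF compact_continuous_image[OF this cQ]]
  obtain M where M: "\<And>c. c \<in> c.chi ` Q \<Longrightarrow> \<bar>density g (fP F) c\<bar> \<le> M" by (auto simp: bounded_iff)
  obtain R where R: "\<And>c. c \<in> c.chi ` Q \<Longrightarrow> norm c \<le> R"
    using compact_imp_bounded[OF cQ] by (auto simp: bounded_iff)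
  show thesis
  proof (rule that[of "\<bar>M\<bar>" R])
    show "\<bar>facet_density F c\<bar> \<le> \<bar>M\<bar>" for c
      using M[of "reset m 0 c"] F_in_chart[OF F] by (auto simp: facet_density_def indicator_def)
    show "norm (reset m 0 c) \<le> R" if "facet_density F c \<noteq> 0" for c
      using that R[of "reset m 0 c"] F_in_chart[OF F] by (auto simp: facet_density_def indicator_def split: if_splits)
  qed simp
qed

text \<open>The derivative formula for a moving graph, in the chart of \<open>F\<close>. The other
  half spaces and \<open>D\<close> go into the integrand; at almost every point of the wall its
  limit is the same whether they have moved already or not, so the result is independent of
  \<open>S\<close>.\<close>

lemma facet_step:
  assumes F: "F \<in> Fac" and S: "F \<notin> S"
    and D: "compact D" "D \<subseteq> geodesic_hull g Q" "\<And>x. x \<in> D \<Longrightarrow> slice g (fq F) x > 0"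
    and int: "fchi F ` Q \<subseteq> interior (fchi F ` D)"
  shows "((\<lambda>t. (integral (fchi F ` region D (insert F S) t) (density g (fP F)) -
      integral (fchi F ` region D S t) (density g (fP F))) / t) \<longlongrightarrow> facet_rate F) (at 0)"
proof -
  interpret c: chart g Q "fq F" "fe F" "fr F" "fP F" by (rule facet_chart[OF F])
  define D' where "D' = c.chi ` D"
  define \<rho> where "\<rho> = density g (fP F)"
  define Ct where "Ct = (\<lambda>t. {c \<in> D'. \<forall>i\<in>Fac - {F}. L i (if i \<in> S then t else 0) (fP F (1, c)) \<ge> 0})"
  define f where "f = (\<lambda>t c. \<rho> c * indicator (Ct t) c)"
  define b where "b = (\<lambda>t. \<theta> F t $ m / (1 + \<kappa> F * \<theta> F t $ m))"
  define a where "a = (\<lambda>t. (1 / (1 + \<kappa> F * \<theta> F t $ m)) *\<^sub>R reset m 0 (\<theta> F t))"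
  have cD': "compact D'" unfolding D'_def
    by (rule compact_continuous_image[OF c.chi_continuous D(1)]) (use D(3) in force)
  have D'W: "D' \<subseteq> c.W" unfolding D'_def using c.\<phi>_chi(1) D(2,3) by blast
  have \<rho>W: "continuous_on c.W \<rho>" using c.dens_continuous by (simp add: c.dens_density \<rho>_def)
  then have \<rho>c: "continuous_on D' \<rho>" by (rule continuous_on_subset[OF _ D'W])
  have \<Psi>c: "continuous_on A (\<lambda>c. fP F (1, c))" for A
  proof -
    have "continuous_on A (\<lambda>c. fP F (1, 0) + fP F (0, c))"
      by (intro continuous_intros linear_continuous_on_compose[OF continuous_on_id c.linear_P0])
    moreover have "(\<lambda>c. fP F (1, c)) = (\<lambda>c. fP F (1, 0) + fP F (0, c))"
      by (rule ext) (rule c.\<Psi>_affine[unfolded c.\<Psi>_def])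
    ultimately show ?thesis by (rule ssubst[rotated])
  qed
  have closedL: "closed {c. L i s (fP F (1, c)) \<ge> 0}" for i s
    by (rule closed_Collect_le) (intro continuous_intros \<Psi>c)+
  have cC: "compact (Ct t)" for t
  proof -
    have "closed (\<Inter>i\<in>Fac - {F}. {c. L i (if i \<in> S then t else 0) (fP F (1, c)) \<ge> 0})" using closedL by blast
    then have "compact (D' \<inter> (\<Inter>i\<in>Fac - {F}. {c. L i (if i \<in> S then t else 0) (fP F (1, c)) \<ge> 0}))"
      by (rule compact_Int_closed[OF cD'])
    moreover have "D' \<inter> (\<Inter>i\<in>Fac - {F}. {c. L i (if i \<in> S then t else 0) (fP F (1, c)) \<ge> 0}) = Ct t"
      unfolding Ct_def by blast
    ultimately show ?thesis by simp
  qed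
  obtain M where M: "\<And>c. c \<in> D' \<Longrightarrow> \<bar>\<rho> c\<bar> \<le> M" "M \<ge> 0"
  proof -
    have "bounded (\<rho> ` D')" using compact_continuous_image[OF \<rho>c cD'] by (rule compact_imp_bounded)
    then obtain M where "\<forall>x\<in>\<rho> ` D'. norm x \<le> M" by (auto simp: bounded_iff)
    then show thesis by (intro that[of "max M 0"]) force+
  qed
  obtain R where R: "\<And>c. c \<in> D' \<Longrightarrow> norm c \<le> R"
    using compact_imp_bounded[OF cD'] by (auto simp: bounded_iff)
  have CD: "Ct t \<subseteq> D'" for t unfolding Ct_def by blast
  have fm: "f t \<in> borel_measurable borel" for t
  proof -
    have "(\<lambda>c. indicator (Ct t) c *\<^sub>R \<rho> c) \<in> borel_measurable borel"
      using cC continuous_on_subset[OF \<rho>c CD]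
      by (intro borel_measurable_continuous_on_indicator) (auto simp: compact_imp_closed)
    then show ?thesis by (simp add: f_def mult.commute)
  qed
  have fM: "\<bar>f t c\<bar> \<le> M" for t c
    using M CD[of t] by (auto simp: f_def indicator_def)
  have fR: "f t c = 0" if "R < norm c" for t c
    using R[of c] CD[of t] that by (auto simp: f_def indicator_def)
  have sl: "(b has_real_derivative \<theta>' F $ m) (at 0)" "b 0 = 0"
    "(a has_vector_derivative reset m 0 (\<theta>' F)) (at 0)" "a 0 = 0" "\<And>t. a t $ m = 0"
    unfolding a_def b_def by (rule slope_derivatives[OF F])+
  have at: "at 0 \<le> nhds (0 :: real)" by (simp add: at_within_def)
  have slack: "AE c in lborel. \<forall>i\<in>Fac - {F}. L i 0 (fP F (1, reset m 0 c)) \<noteq> 0"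
    by (rule AE_finite_allI) (use Fac slack_null[OF F] in auto)
  have lim: "((\<lambda>t. f t (reset m ((b t + a t \<bullet> c) * c $ m) c)) \<longlongrightarrow> facet_density F c) (at 0)"
    if slack: "\<forall>i\<in>Fac - {F}. L i 0 (fP F (1, reset m 0 c)) \<noteq> 0" for c
  proof -
    define y where "y = (\<lambda>t. reset m ((b t + a t \<bullet> c) * c $ m) c)"
    define y0 where "y0 = reset m 0 c"
    have yt: "(y \<longlongrightarrow> y0) (at 0)"
      unfolding y_def y0_def
    proof (rule reset_tendsto)
      have "(b \<longlongrightarrow> b 0) (at 0)" "(a \<longlongrightarrow> a 0) (at 0)"
        using DERIV_isCont[OF sl(1)] has_vector_derivative_continuous[OF sl(3)] by (auto simp: isCont_def)
      then have "((\<lambda>t. (b t + a t \<bullet> c) * c $ m) \<longlongrightarrow> (b 0 + a 0 \<bullet> c) * c $ m) (at 0)" by (intro tendsto_intros)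
      then show "((\<lambda>t. (b t + a t \<bullet> c) * c $ m) \<longlongrightarrow> 0) (at 0)" by (simp add: sl)
    qed
    have \<Psi>t: "((\<lambda>t. fP F (1, y t)) \<longlongrightarrow> fP F (1, y0)) (at 0)"
      by (rule continuous_on_tendsto_compose[OF \<Psi>c[of UNIV] yt]) auto
    have Lt: "((\<lambda>t. L i (if i \<in> S then t else 0) (fP F (1, y t))) \<longlongrightarrow> L i 0 (fP F (1, y0))) (at 0)" if "i \<in> Fac" for i
      using L_tendsto[OF that \<Psi>t, of "\<lambda>t. if i \<in> S then t else 0"] by (cases "i \<in> S") auto
    have "((\<lambda>t. f t (y t)) \<longlongrightarrow> facet_density F c) (at 0)"
    \<comment> \<open>Off the other hyperplanes a point of the wall either violates an inequality
      strictly, and then integrand and limit are 0, or satisfies all of them strictly, and then it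
      lies in \<open>F\<close> and in the interior of the domain.\<close>
    proof (cases "\<exists>i\<in>Fac - {F}. L i 0 (fP F (1, y0)) < 0")
      case True
      then obtain i where i: "i \<in> Fac" "i \<noteq> F" "L i 0 (fP F (1, y0)) < 0" by auto
      have "\<forall>\<^sub>F t in at 0. L i (if i \<in> S then t else 0) (fP F (1, y t)) < 0"
        by (rule order_tendstoD(2)[OF Lt[OF i(1)] i(3)])
      then have "\<forall>\<^sub>F t in at 0. 0 = f t (y t)"
      proof eventually_elim
        case (elim t)
        then have "y t \<notin> Ct t" unfolding Ct_def using i(1,2) by force
        then show ?case by (simp add: f_def)
      qed
      then have "((\<lambda>t. f t (y t)) \<longlongrightarrow> 0) (at 0)" by (rule Lim_transform_eventually[OF tendsto_const])
      moreover have "y0 \<notin> fchi F ` F"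
        using i unfolding F_in_chart[OF F] Q_halfspaces[OF F] by force
      ultimately show ?thesis by (simp add: facet_density_def y0_def)
    next
      case False
      then have pos: "L i 0 (fP F (1, y0)) > 0" if "i \<in> Fac - {F}" for i
        using slack that by (force simp: y0_def)
      have LF: "L F 0 (fP F (1, y0)) = 0" by (simp add: L_0_facet_chart[OF F] y0_def)
      have "y0 \<in> c.chi ` Q" unfolding Q_halfspaces[OF F]
      proof (rule CollectI, rule ballI)
        fix i assume i: "i \<in> Fac"
        show "0 \<le> L i 0 (fP F (1, y0))" by (cases "i = F") (use pos[of i] LF i in auto)
      qed
      then have y0: "y0 \<in> fchi F ` F" "y0 \<in> interior D'"
        using int unfolding F_in_chart[OF F] by (auto simp: y0_def D'_def)
      have "\<forall>\<^sub>F t in at 0. y t \<in> interior D'"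
        by (rule topological_tendstoD[OF yt open_interior y0(2)])
      moreover have "\<forall>\<^sub>F t in at 0. \<forall>i\<in>Fac - {F}. L i (if i \<in> S then t else 0) (fP F (1, y t)) > 0"
      proof (rule eventually_ball_finite)
        show "finite (Fac - {F})" using Fac by simp
        show "\<forall>i\<in>Fac - {F}. \<forall>\<^sub>F t in at 0. L i (if i \<in> S then t else 0) (fP F (1, y t)) > 0"
        proof
          fix i assume i: "i \<in> Fac - {F}"
          show "\<forall>\<^sub>F t in at 0. L i (if i \<in> S then t else 0) (fP F (1, y t)) > 0"
            by (rule order_tendstoD(1)[OF Lt pos[OF i]]) (use i in simp)
        qed
      qed
      ultimately have ev: "\<forall>\<^sub>F t in at 0. \<rho> (y t) = f t (y t)"
      proof eventually_elim
        case (elim t)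
        then have "y t \<in> Ct t" unfolding Ct_def using interior_subset[of D'] less_imp_le by blast
        then show ?case by (simp add: f_def)
      qed
      have "isCont \<rho> y0"
        using \<rho>W c.open_W y0(2) interior_subset[of D'] D'W by (auto simp: continuous_on_eq_continuous_at)
      then have "((\<lambda>t. \<rho> (y t)) \<longlongrightarrow> \<rho> y0) (at 0)" by (rule isCont_tendsto_compose[OF _ yt])
      then have "((\<lambda>t. f t (y t)) \<longlongrightarrow> \<rho> y0) (at 0)" by (rule Lim_transform_eventually[OF _ ev])
      moreover have "facet_density F c = \<rho> y0" using y0(1) by (simp add: facet_density_def \<rho>_def y0_def)
      ultimately show ?thesis by simp
    qed
    then show ?thesis by (simp add: y_def)
  qed
  have main: "((\<lambda>t. (LINT c|lborel. f t c * (of_bool (b t + a t \<bullet> c \<le> c $ m) - of_bool (0 \<le> c $ m))) / t) \<longlongrightarrow> facet_rate F) (at 0)"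
    unfolding facet_rate_def
  proof (rule moving_graph_derivative[OF fm fM fR sl(5) sl(3,4,1,2) facet_density_measurable[OF F]])
    show "AE c in lborel. 0 \<le> c $ m \<longrightarrow> c $ m \<le> 1 \<longrightarrow>
        ((\<lambda>t. f t (reset m ((b t + a t \<bullet> c) * c $ m) c)) \<longlongrightarrow> facet_density F c) (at 0)"
      using slack by eventually_elim (use lim in blast)
  qed
  \<comment> \<open>For small \<open>t\<close> the factor is positive, so dividing by it turns the
    half space into the upper side of the graph.\<close>
  have "((\<lambda>t. 1 + \<kappa> F * \<theta> F t $ m) \<longlongrightarrow> 1 + \<kappa> F * 0 $ m) (at 0)"
    by (intro tendsto_intros tendsto_mono[OF at \<theta>_tendsto[OF F]])
  then have "\<forall>\<^sub>F t in at 0. 0 < 1 + \<kappa> F * \<theta> F t $ m" by (rule order_tendstoD(1)) simp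
  then have "\<forall>\<^sub>F t in at 0. (LINT c|lborel. f t c * (of_bool (b t + a t \<bullet> c \<le> c $ m) - of_bool (0 \<le> c $ m))) / t =
      (integral (fchi F ` region D (insert F S) t) (density g (fP F)) -
      integral (fchi F ` region D S t) (density g (fP F))) / t"
  proof eventually_elim
    case (elim t)
    have LF: "L F t (fP F (1, c)) \<ge> 0 \<longleftrightarrow> b t + a t \<bullet> c \<le> c $ m" for c
    proof -
      have "b t + a t \<bullet> c = (\<theta> F t $ m + reset m 0 (\<theta> F t) \<bullet> c) / (1 + \<kappa> F * \<theta> F t $ m)"
        by (simp add: a_def b_def add_divide_distrib)
      then show ?thesis using elim by (simp add: L_facet_chart[OF F] pos_divide_le_eq)
    qed
    note LF0 = L_0_facet_chart[OF F]
    have split: "(\<forall>i\<in>Fac. A i) \<longleftrightarrow> (\<forall>i\<in>Fac - {F}. B i) \<and> C" if "\<And>i. i \<noteq> F \<Longrightarrow> A i = B i" "A F = C"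
      for A B :: "(real ^ 'n) set \<Rightarrow> bool" and C
    proof -
      have "(\<forall>i\<in>Fac. A i) \<longleftrightarrow> (\<forall>i\<in>Fac - {F}. A i) \<and> A F" using F by blast
      moreover have "(\<forall>i\<in>Fac - {F}. A i) \<longleftrightarrow> (\<forall>i\<in>Fac - {F}. B i)"
        by (rule ball_cong) (use that(1) in blast)+
      ultimately show ?thesis using that(2) by simp
    qed
    have reg: "c.chi ` region D S' t = {c \<in> c.chi ` D. \<forall>i\<in>Fac. L i (if i \<in> S' then t else 0) (fP F (1, c)) \<ge> 0}" for S'
      by (rule chi_image_region[OF c.chart_axioms D(2,3)])
    have r1: "fchi F ` region D (insert F S) t = Ct t \<inter> {c. b t + a t \<bullet> c \<le> c $ m}"
    proof -
      have "(\<forall>i\<in>Fac. L i (if i \<in> insert F S then t else 0) (fP F (1, c)) \<ge> 0) \<longleftrightarrow>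
          (\<forall>i\<in>Fac - {F}. L i (if i \<in> S then t else 0) (fP F (1, c)) \<ge> 0) \<and> L F t (fP F (1, c)) \<ge> 0" for c
        by (rule split) simp_all
      then show ?thesis unfolding reg[of "insert F S"] Ct_def D'_def LF[symmetric] by (simp add: Int_def conj_assoc)
    qed
    have r2: "fchi F ` region D S t = Ct t \<inter> {c. 0 \<le> c $ m}"
    proof -
      have "(\<forall>i\<in>Fac. L i (if i \<in> S then t else 0) (fP F (1, c)) \<ge> 0) \<longleftrightarrow>
          (\<forall>i\<in>Fac - {F}. L i (if i \<in> S then t else 0) (fP F (1, c)) \<ge> 0) \<and> L F 0 (fP F (1, c)) \<ge> 0" for c
        by (rule split) (simp_all add: S)
      then show ?thesis unfolding reg[of S] Ct_def D'_def LF0[symmetric] by (simp add: Int_def conj_assoc)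
    qed
    have i: "integrable lborel (\<lambda>c. \<rho> c * indicator (Ct t \<inter> Y) c)"
      "integral (Ct t \<inter> Y) \<rho> = (LINT c|lborel. \<rho> c * indicator (Ct t \<inter> Y) c)" if Y: "closed Y" for Y
    proof -
      have "compact (Ct t \<inter> Y)" by (rule compact_Int_closed[OF cC Y])
      moreover have "continuous_on (Ct t \<inter> Y) \<rho>" by (rule continuous_on_subset[OF \<rho>c]) (use CD in blast)
      ultimately show "integrable lborel (\<lambda>c. \<rho> c * indicator (Ct t \<inter> Y) c)"
        "integral (Ct t \<inter> Y) \<rho> = (LINT c|lborel. \<rho> c * indicator (Ct t \<inter> Y) c)"
        by (rule integral_compact_LINT)+
    qed
    have Y: "closed {c. b t + a t \<bullet> c \<le> c $ m}" "closed {c :: real ^ 'k. 0 \<le> c $ m}"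
      by (rule closed_Collect_le; intro continuous_intros)+
    have "f t c * (of_bool (b t + a t \<bullet> c \<le> c $ m) - of_bool (0 \<le> c $ m)) =
        \<rho> c * indicator (Ct t \<inter> {c. b t + a t \<bullet> c \<le> c $ m}) c - \<rho> c * indicator (Ct t \<inter> {c. 0 \<le> c $ m}) c" for c
      by (auto simp: f_def indicator_def)
    then show ?case
      unfolding r1 r2 \<rho>_def[symmetric] i(2)[OF Y(1)] i(2)[OF Y(2)]
      using Bochner_Integration.integral_diff[OF i(1)[OF Y(1)] i(1)[OF Y(2)]] by simp
  qed
  then show ?thesis by (rule Lim_transform_eventually[OF main])
qed

text \<open>\<open>D\<close> is a compact neighbourhood of the cell within its hull, so small that
  all denominators, of the base chart and of every facet chart, are positive on it. Integrals over
  its compact subsets can then be moved from chart to chart.\<close>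

lemma common_domain:
  assumes f: "good_frame g Q pb (eb :: 'k \<Rightarrow> real ^ 'n) \<kappa>b mb"
  defines "chi \<equiv> chart.chi g (frame_slice g pb eb \<kappa>b mb) eb (frame_origin g pb eb)"
  obtains D \<epsilon> where "compact D" "D \<subseteq> geodesic_hull g Q" "Q \<subseteq> D" "\<epsilon> > 0" "chi ` D = thick \<epsilon> (chi ` Q)"
    "\<And>x. x \<in> D \<Longrightarrow> slice g (frame_slice g pb eb \<kappa>b mb) x > 0"
    "\<And>F x. F \<in> Fac \<Longrightarrow> x \<in> D \<Longrightarrow> slice g (fq F) x > 0"
    "\<And>F. F \<in> Fac \<Longrightarrow> fchi F ` Q \<subseteq> interior (fchi F ` D)"
proof -
  interpret b: chart g Q "frame_slice g pb eb \<kappa>b mb" eb "frame_origin g pb eb" "frame_map pb eb \<kappa>b mb"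
    by (rule good_frame_chart[OF f])
  have chi: "chi = b.chi" by (simp add: chi_def)
  have \<phi>c: "continuous_on b.W b.\<phi>"
    using b.\<phi>_param by (simp add: differentiable_imp_continuous_on)
  \<comment> \<open>Coordinates of the points at which every facet chart has a positive denominator;
    open because there are finitely many facets.\<close>
  define U where "U = b.W \<inter> (\<Inter>F\<in>Fac. b.\<phi> -` {x. slice g (fq F) x > 0})"
  have sl_open: "open {x. slice g q x > 0}" for q
    unfolding slice_def by (rule open_Collect_less) (intro continuous_intros)+
  have oU: "open U"
  proof -
    have "open (b.W \<inter> b.\<phi> -` {x. slice g (fq F) x > 0})" for F
      by (rule continuous_open_preimage[OF \<phi>c b.open_W sl_open])
    then have "open (b.W \<inter> (\<Inter>F\<in>Fac. b.W \<inter> b.\<phi> -` {x. slice g (fq F) x > 0}))"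
      using Fac by (intro open_Int b.open_W open_INT) auto
    moreover have "b.W \<inter> (\<Inter>F\<in>Fac. b.W \<inter> b.\<phi> -` {x. slice g (fq F) x > 0}) = U" unfolding U_def by blast
    ultimately show ?thesis by simp
  qed
  have cQ: "compact (b.chi ` Q)" using b.polytope_chi by (rule polytope_imp_compact)
  have "b.chi ` Q \<subseteq> U"
  proof
    fix c assume "c \<in> b.chi ` Q"
    then obtain x where x: "x \<in> Q" "c = b.chi x" by auto
    note h = b.\<phi>_chi[OF b.hull_Q[OF x(1)] b.slice_pos[OF x(1)]]
    have "slice g (fq F) x > 0" if "F \<in> Fac" for F using chart.slice_pos[OF facet_chart[OF that] x(1)] .
    then show "c \<in> U" unfolding U_def using h x(2) by auto
  qed
  then obtain \<epsilon> where \<epsilon>: "\<epsilon> > 0" "thick \<epsilon> (b.chi ` Q) \<subseteq> U"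
    using thick_subset_open[OF cQ oU] by blast
  define B where "B = thick \<epsilon> (b.chi ` Q)"
  have BW: "B \<subseteq> b.W" using \<epsilon>(2) unfolding B_def U_def by blast
  define D where "D = b.\<phi> ` B"
  have bchi: "b.chi (b.\<phi> c) = c" "b.\<phi> c \<in> geodesic_hull g Q" "b.sl (b.\<phi> c) > 0" if "c \<in> B" for c
    using b.chi_\<phi>[of c] that BW by blast+
  have QB: "b.chi x \<in> interior B" if "x \<in> Q" for x
    using interior_maximal[OF ball_subset_thick open_ball, of "b.chi x" "b.chi ` Q" \<epsilon>] that \<epsilon>(1) unfolding B_def by auto
  have DI: "x \<in> D" if "x \<in> geodesic_hull g Q" "b.sl x > 0" "b.chi x \<in> B" for x
    using b.\<phi>_chi(2)[OF that(1,2)] that(3) unfolding D_def by (metis image_eqI)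
  have Dsl: "slice g (fq F) x > 0" if "F \<in> Fac" "x \<in> D" for F x
    using \<epsilon>(2) that unfolding D_def B_def U_def by blast
  show thesis
  proof (rule that[of D \<epsilon>])
    show "compact D" unfolding D_def
      by (rule compact_continuous_image[OF continuous_on_subset[OF \<phi>c BW]]) (simp add: B_def compact_thick[OF cQ])
    show "D \<subseteq> geodesic_hull g Q" using bchi(2) by (auto simp: D_def)
    show "Q \<subseteq> D" using DI b.hull_Q b.slice_pos QB interior_subset by blast
    show "\<epsilon> > 0" by (rule \<epsilon>)
    show "chi ` D = thick \<epsilon> (chi ` Q)"
      using bchi(1) unfolding chi D_def B_def[symmetric] by (force simp: image_image)
    show "slice g (frame_slice g pb eb \<kappa>b mb) x > 0" if "x \<in> D" for x using that bchi(3) by (auto simp: D_def)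
    show "slice g (fq F) x > 0" if "F \<in> Fac" "x \<in> D" for F x by (rule Dsl[OF that])
    show "fchi F ` Q \<subseteq> interior (fchi F ` D)" if F: "F \<in> Fac" for F
    proof -
      interpret c: chart g Q "fq F" "fe F" "fr F" "fP F" by (rule facet_chart[OF F])
      have \<phi>Fc: "continuous_on c.W c.\<phi>" using c.\<phi>_param by (simp add: differentiable_imp_continuous_on)
      define O1 where "O1 = c.W \<inter> c.\<phi> -` {x. b.sl x > 0}"
      have oO1: "open O1" unfolding O1_def
        by (rule continuous_open_preimage[OF \<phi>Fc c.open_W sl_open])
      have "continuous_on O1 (\<lambda>c. b.chi (c.\<phi> c))"
      proof (rule continuous_on_compose2[OF b.chi_continuous])
        show "continuous_on O1 c.\<phi>" by (rule continuous_on_subset[OF \<phi>Fc]) (auto simp: O1_def)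
        show "c.\<phi> ` O1 \<subseteq> {x. b.sl x > 0}" by (auto simp: O1_def)
      qed auto
      then have o: "open (O1 \<inter> (\<lambda>c. b.chi (c.\<phi> c)) -` interior B)"
        by (rule continuous_open_preimage[OF _ oO1 open_interior])
      have "O1 \<inter> (\<lambda>c. b.chi (c.\<phi> c)) -` interior B \<subseteq> c.chi ` D"
      proof
        fix z assume z: "z \<in> O1 \<inter> (\<lambda>c. b.chi (c.\<phi> c)) -` interior B"
        then have zW: "z \<in> c.W" "b.sl (c.\<phi> z) > 0" "b.chi (c.\<phi> z) \<in> B" using interior_subset by (auto simp: O1_def)
        then have "c.\<phi> z \<in> D" using c.chi_\<phi>(1)[OF zW(1)] by (intro DI)
        moreover have "c.chi (c.\<phi> z) = z" by (rule c.chi_\<phi>(3)[OF zW(1)])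
        ultimately show "z \<in> c.chi ` D" by force
      qed
      then have sub: "O1 \<inter> (\<lambda>c. b.chi (c.\<phi> c)) -` interior B \<subseteq> interior (c.chi ` D)" by (rule interior_maximal[OF _ o])
      have "c.chi x \<in> O1 \<inter> (\<lambda>c. b.chi (c.\<phi> c)) -` interior B" if x: "x \<in> Q" for x
        using c.\<phi>_chi[OF c.hull_Q[OF x] c.slice_pos[OF x]] b.slice_pos[OF x] QB[OF x] by (simp add: O1_def)
      then show ?thesis using sub by blast
    qed
  qed
qed

text \<open>The steps telescope over the set of facets that have moved. All intermediate volumes are
  integrals in one base chart, and each difference is transported to the chart of its facet by
  \<open>chart_change\<close>; leaving the hull adds nothing to first order.\<close>

theorem cell_volume_derivative:
  assumes f: "good_frame g Q pb (eb :: 'k \<Rightarrow> real ^ 'n) \<kappa>b mb"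
  shows "((\<lambda>t. cell_volume g TYPE('k) (Qt t)) has_field_derivative (\<Sum>F\<in>Fac. facet_rate F)) (at 0)"
proof -
  interpret b: chart g Q "frame_slice g pb eb \<kappa>b mb" eb "frame_origin g pb eb" "frame_map pb eb \<kappa>b mb"
    by (rule good_frame_chart[OF f])
  define \<rho> where "\<rho> = density g (frame_map pb eb \<kappa>b mb)"
  have at: "at 0 \<le> nhds (0 :: real)" by (simp add: at_within_def)
  obtain D \<epsilon> where D: "compact D" "D \<subseteq> geodesic_hull g Q" "Q \<subseteq> D" "\<epsilon> > 0" "b.chi ` D = thick \<epsilon> (b.chi ` Q)"
    "\<And>x. x \<in> D \<Longrightarrow> b.sl x > 0" "\<And>F x. F \<in> Fac \<Longrightarrow> x \<in> D \<Longrightarrow> slice g (fq F) x > 0"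
    "\<And>F. F \<in> Fac \<Longrightarrow> fchi F ` Q \<subseteq> interior (fchi F ` D)"
    by (rule common_domain[OF f]) blast
  define v where "v = (\<lambda>S t. integral (b.chi ` region D S t) \<rho>)"
  have rD: "region D S t \<subseteq> D" for S t unfolding region_def by blast
  have change: "v S t = integral (fchi F ` region D S t) (density g (fP F))" if F: "F \<in> Fac" for F S t
  proof -
    interpret c: chart g Q "fq F" "fe F" "fr F" "fP F" by (rule facet_chart[OF F])
    have "integral (b.chi ` region D S t) b.dens = integral (c.chi ` region D S t) c.dens"
      by (rule chart_change[OF b.chart_axioms c.chart_axioms compact_region[OF D(1)]])
        (use rD D(2,6,7) F in blast)+
    then show ?thesis by (simp add: v_def \<rho>_def b.dens_density c.dens_density)
  qed
  have "((\<lambda>t. (v S t - v {} t) / t) \<longlongrightarrow> (\<Sum>F\<in>S. facet_rate F)) (at 0)" if "S \<subseteq> Fac" for S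
    using finite_subset[OF that Fac] that
  proof (induction S rule: finite_induct)
    case empty then show ?case by simp
  next
    case (insert F S)
    have F: "F \<in> Fac" using insert by simp
    have "((\<lambda>t. (v (insert F S) t - v S t) / t) \<longlongrightarrow> facet_rate F) (at 0)"
      unfolding change[OF F] by (rule facet_step[OF F insert(2) D(1,2) D(7)[OF F] D(8)[OF F]])
    then have "((\<lambda>t. (v (insert F S) t - v S t) / t + (v S t - v {} t) / t) \<longlongrightarrow> facet_rate F + (\<Sum>F\<in>S. facet_rate F)) (at 0)"
      using insert by (intro tendsto_add) auto
    then show ?case using insert by (simp add: add_divide_distrib[symmetric])
  qed
  from this[of Fac] have 1: "((\<lambda>t. (v Fac t - v {} t) / t) \<longlongrightarrow> (\<Sum>F\<in>Fac. facet_rate F)) (at 0)" by simp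
  have b_region: "b.chi ` region D S t = {c \<in> b.chi ` D. \<forall>i\<in>Fac. L i (if i \<in> S then t else 0) (frame_map pb eb \<kappa>b mb (1, c)) \<ge> 0}" for S t
    by (rule chi_image_region[OF b.chart_axioms D(2,6)])
  have half: "\<forall>\<^sub>F t in nhds 0. b.chi ` Qt t = {c. \<forall>F\<in>Fac. L F t (frame_map pb eb \<kappa>b mb (1, c)) \<ge> 0}"
    by (rule chi_Qt_halfspaces[OF f])
  \<comment> \<open>No facet has moved, so the region is the cell itself for every
    \<open>t\<close>.\<close>
  have v0: "v {} t = cell_volume g TYPE('k) Q" for t
  proof -
    have "b.chi ` Q \<subseteq> b.chi ` D" using D(3) by blast
    then have "b.chi ` region D {} t = b.chi ` Q"
      using eventually_nhds_x_imp_x[OF half] unfolding b_region Q0 by auto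
    then show ?thesis using b.cell_volume_chart by (simp add: v_def \<rho>_def b.dens_density)
  qed
  \<comment> \<open>All facets have moved; confinement to \<open>D\<close> cuts nothing off as soon
    as the moved cell projects into it.\<close>
  have "\<forall>\<^sub>F t in nhds 0. v Fac t = integral (b.chi ` Qt t) \<rho>"
    using half chi_Qt_thick[OF f D(4)]
  proof eventually_elim
    case (elim t)
    have "b.chi ` region D Fac t = b.chi ` Qt t"
      using elim D(5) unfolding b_region by auto
    then show ?case by (simp add: v_def)
  qed
  then have "\<forall>\<^sub>F t in at 0. v Fac t = integral (b.chi ` Qt t) \<rho>" using at by (rule filter_leD[rotated])
  then have ev: "\<forall>\<^sub>F t in at 0. (v Fac t - v {} t) / t + (cell_volume g TYPE('k) (Qt t) - integral (b.chi ` Qt t) \<rho>) / t =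
      (cell_volume g TYPE('k) (Qt t) - cell_volume g TYPE('k) (Qt 0)) / (t - 0)"
    by eventually_elim (simp add: v0 Q0 add_divide_distrib[symmetric])
  have "((\<lambda>t. (v Fac t - v {} t) / t + (cell_volume g TYPE('k) (Qt t) - integral (b.chi ` Qt t) \<rho>) / t) \<longlongrightarrow> (\<Sum>F\<in>Fac. facet_rate F) + 0) (at 0)"
    unfolding \<rho>_def by (intro tendsto_add volume_first_order[OF f] 1[unfolded \<rho>_def])
  then have "((\<lambda>t. (cell_volume g TYPE('k) (Qt t) - cell_volume g TYPE('k) (Qt 0)) / (t - 0)) \<longlongrightarrow> (\<Sum>F\<in>Fac. facet_rate F)) (at 0)"
    using Lim_transform_eventually[OF _ ev] by simp
  then show ?thesis by (simp add: has_field_derivative_iff)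
qed

end

subsection \<open>Contributions of the facets\<close>

context chart
begin

lemma form_\<Psi>: "form g a (\<Psi> c) = (\<chi> i. form g a (P (0, axis i 1))) \<bullet> c + form g a (\<Psi> 0)"
proof -
  have "P (0, c) = (\<Sum>i\<in>UNIV. c $ i *\<^sub>R P (0, axis i 1))"
    using basis_expansion[of c] linear_sum[OF linear_P0, of "\<lambda>i. c $ i *\<^sub>R axis i 1" UNIV]
    by (simp add: linear_scale[OF linear_P0] scalar_mult_eq_scaleR)
  moreover have "P (0, 0) = 0" by (rule linear_0[OF linear_P0])
  ultimately show ?thesis
    unfolding \<Psi>_affine[of c] \<Psi>_affine[of 0] by (simp add: form_simps form_sum_right inner_vec_def mult.commute)
qed

text \<open>A supporting functional divided by the positive denominator is affine in the
  coordinates; the constant survives since \<open>b = 0\<close> or the denominator is 1.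
  \<open>X\<close> is a face of the cell when faces of faces are treated.\<close>

lemma chi_face:
  assumes X: "X \<subseteq> Q" "convex (chi ` X)" and Y: "poly_face g Y X"
  shows "chi ` Y face_of chi ` X"
proof (cases "Y = {} \<or> Y = X")
  case True then show ?thesis using X(2) by (auto intro: face_of_refl)
next
  case False
  then obtain a b where ab: "bounds_half_space g a b" "X \<subseteq> half_space g a b" "Y = {x \<in> X. form g a x = b}"
    using Y by (auto simp: poly_face_def)
  define al where "al = (\<chi> i. form g a (P (0, axis i 1)))"
  have key: "al \<bullet> chi x - (b - form g a (\<Psi> 0)) = (form g a x - b) / sl x" if x: "x \<in> X" for x
  proof -
    have s: "sl x > 0" using slice_pos X(1) x by blast
    have "x \<in> ahull g Q" using ahull_superset X(1) x by blast
    then have "form g a (x /\<^sub>R sl x) = al \<bullet> chi x + form g a (\<Psi> 0)"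
      using form_\<Psi>[of a "chi x"] \<Psi>_chi[OF _ s] by (simp add: al_def)
    moreover have "b = b / sl x"
    proof (cases "g = Euclidean")
      case True
      have "sl x = 1" by (rule slice_Euclidean[OF True])
      then show ?thesis by simp
    next
      case False then show ?thesis using ab(1) by (cases g) (auto simp: bounds_half_space_def)
    qed
    ultimately show ?thesis by (simp add: form_simps divide_inverse algebra_simps)
  qed
  have le: "al \<bullet> chi x \<le> b - form g a (\<Psi> 0)" if "x \<in> X" for x
  proof -
    have "(form g a x - b) / sl x \<le> 0"
      using ab(2) that slice_pos X(1) by (intro divide_nonpos_pos) (auto simp: half_space_def)
    then show ?thesis using key[OF that] by linarith
  qed
  have eq: "al \<bullet> chi x = b - form g a (\<Psi> 0) \<longleftrightarrow> form g a x = b" if "x \<in> X" for x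
  proof -
    have "sl x > 0" using slice_pos X(1) that by blast
    then have "form g a x = b \<longleftrightarrow> (form g a x - b) / sl x = 0" by simp
    then show ?thesis using key[OF that] by linarith
  qed
  have "chi ` Y = chi ` X \<inter> {c. al \<bullet> c = b - form g a (\<Psi> 0)}"
    unfolding ab(3) using eq by auto
  moreover have "\<dots> face_of chi ` X"
    by (rule face_of_Int_supporting_hyperplane_le[OF X(2)]) (use le in auto)
  ultimately show ?thesis by simp
qed

text \<open>Transitivity of faces is available for convex sets in the chart. The way back to the
  cell is open because a face of a polytope is exposed.\<close>

lemma poly_face_vertex_trans:
  assumes F: "poly_face g F Q" and w: "poly_face g {w} F"
  shows "poly_face g {w} Q"
proof (cases "Q = {w}")
  case True then show ?thesis by (simp add: poly_face_def)
next
  case False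
  have po: "polytope (chi ` Q)" by (rule polytope_chi)
  have FQ: "F \<subseteq> Q" and wF: "w \<in> F" using F w poly_face_subset by blast+
  then have wQ: "w \<in> Q" by blast
  have f: "chi ` F face_of chi ` Q"
    by (rule chi_face[OF subset_refl polytope_imp_convex[OF po] F])
  have "chi ` {w} face_of chi ` F"
    by (rule chi_face[OF FQ face_of_imp_convex[OF f] w])
  then have "{chi w} face_of chi ` Q" using face_of_trans[OF _ f] by simp
  then have ex: "{chi w} exposed_face_of chi ` Q"
    using exposed_face_of_polyhedron[OF polytope_imp_polyhedron[OF po]] by blast
  have eq: "{x \<in> Q. chi x \<in> {chi w}} = {w}"
    using wQ by (auto intro!: inj_chi hull_Q slice_pos)
  have ne: "{chi w} \<noteq> chi ` Q"
  proof
    assume "{chi w} = chi ` Q"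
    then have "{x \<in> Q. chi x \<in> {chi w}} = Q" by auto
    then show False using eq False by simp
  qed
  from poly_face_pullback[OF ex _ ne] show ?thesis unfolding eq by simp
qed

end

lemma poly_face_vertex_restrict:
  assumes "poly_face g {v} G" "v \<in> F" "F \<subseteq> G"
  shows "poly_face g {v} F"
proof (cases "{v} = G")
  case True
  then have "F = {v}" using assms by blast
  then show ?thesis by (simp add: poly_face_def)
next
  case False
  then obtain a b where ab: "bounds_half_space g a b" "G \<subseteq> half_space g a b" "{v} = {x \<in> G. form g a x = b}"
    using assms(1) by (auto simp: poly_face_def)
  have "{v} = {x \<in> F. form g a x = b}" "F \<subseteq> half_space g a b" using ab assms(2,3) by blast+
  then show ?thesis using ab(1) unfolding poly_face_def by blast
qed

text \<open>The formula involves data of the facet only, not the cell that the facet bounds.\<close>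

definition facet_chi :: "'n::finite geometry \<Rightarrow> real ^ 'n \<Rightarrow> ('k \<Rightarrow> real ^ 'n) \<Rightarrow> 'k \<Rightarrow> real ^ 'n \<Rightarrow> real ^ 'k::finite" where
  "facet_chi g p e m x = (\<chi> i. if i = m then 0 else facet_coords g p e m x $ i / facet_coords g p e m x $ m)"

text \<open>On the facet the conormal coordinate vanishes, and with it the effect of the tilt on the
  denominator.\<close>

lemma chi_facet:
  assumes f: "good_frame g Q p ((e :: 'k::finite \<Rightarrow> real ^ 'n::finite)(m := u)) \<kappa> m"
    and x: "form g u (x - flat g *\<^sub>R p) = 0"
  shows "chart.chi g (frame_slice g p (e(m := u)) \<kappa> m) (e(m := u)) (frame_origin g p (e(m := u))) x = facet_chi g p e m x"
proof -
  interpret c: chart g Q "frame_slice g p (e(m := u)) \<kappa> m" "e(m := u)" "frame_origin g p (e(m := u))" "frame_map p (e(m := u)) \<kappa> m"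
    by (rule good_frame_chart[OF f])
  show ?thesis
    using good_frame_coords[OF f, where x=x] x
    by (auto simp: vec_eq_iff c.chi_def facet_chi_def divide_inverse mult.commute)
qed

text \<open>The vertices of \<open>F\<close> include the vertices of the cell that lie on it, and
  \<open>F\<close> projects into their hull. If their homogeneous coordinates satisfied a linear
  relation, the projection of \<open>F\<close> would lie in the wall and in a further hyperplane,
  too small for its dimension; so they span, and a basis can be selected.\<close>

lemma independent_vertices:
  fixes e :: "'k::finite \<Rightarrow> real ^ 'n::finite"
  assumes f: "good_frame g Q p (e(m := u)) \<kappa> m" and k: "geodesic_dim g Q = int CARD('k)"
    and F: "poly_face g F Q" "F \<noteq> {}" "geodesic_dim g F = int CARD('k) - 1"
    and Feq: "F = {x \<in> Q. form g u (x - flat g *\<^sub>R p) = 0}" and fin: "finite {v. poly_face g {v} Q}"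
  shows "\<exists>w. (\<forall>j. poly_face g {w j} F) \<and> det (facet_matrix g p e m w) \<noteq> 0"
proof -
  interpret c: chart g Q "frame_slice g p (e(m := u)) \<kappa> m" "e(m := u)" "frame_origin g p (e(m := u))" "frame_map p (e(m := u)) \<kappa> m"
    by (rule good_frame_chart[OF f])
  define V where "V = {v. poly_face g {v} F}"
  let ?\<Theta> = "facet_coords g p e m"
  have FQ: "F \<subseteq> Q" by (rule poly_face_subset[OF F(1)])
  have VF: "v \<in> F" if "v \<in> V" for v using that poly_face_subset by (auto simp: V_def)
  have po: "polytope (c.chi ` Q)" by (rule c.polytope_chi)
  have ff: "c.chi ` F face_of c.chi ` Q"
    by (rule c.chi_face[OF subset_refl polytope_imp_convex[OF po] F(1)])
  have "1 \<le> CARD('k)" by (simp add: Suc_le_eq)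
  then have ad: "aff_dim (c.chi ` Q) \<ge> 1" using c.geodesic_dim_Q k by linarith
  have adF: "aff_dim (c.chi ` F) = int CARD('k) - 1"
    using c.geodesic_dim_chi[of F] FQ F(3) c.hull_Q c.slice_pos by (metis subset_iff)
  have scale: "A \<bullet> ?\<Theta> x = c.sl x * (A $ m + reset m 0 A \<bullet> c.chi x)" if x: "x \<in> F" for x and A :: "real ^ 'k"
  proof -
    have u0: "form g u (x - flat g *\<^sub>R p) = 0" using x Feq by blast
    have s: "c.sl x > 0" using x FQ c.slice_pos by blast
    have sl: "c.sl x = ?\<Theta> x $ m" using good_frame_coords(3)[OF f, where x=x] u0 by simp
    have "c.sl x * (reset m 0 A \<bullet> c.chi x) = (\<Sum>i\<in>UNIV - {m}. A $ i * ?\<Theta> x $ i)"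
    proof -
      have "c.sl x * (reset m 0 A \<bullet> c.chi x) = reset m 0 A \<bullet> c.co x" using s by (simp add: c.chi_def)
      also have "\<dots> = (\<Sum>i\<in>UNIV - {m}. A $ i * ?\<Theta> x $ i)"
        unfolding inner_vec_def
        by (subst sum.remove[of _ m]) (auto intro!: sum.cong simp: reset_def good_frame_coords(2)[OF f])
      finally show ?thesis .
    qed
    moreover have "A \<bullet> ?\<Theta> x = A $ m * ?\<Theta> x $ m + (\<Sum>i\<in>UNIV - {m}. A $ i * ?\<Theta> x $ i)"
      unfolding inner_vec_def by (subst sum.remove[of _ m]) auto
    ultimately show ?thesis by (simp add: sl algebra_simps)
  qed
  have hull: "c.chi ` F \<subseteq> convex hull (c.chi ` V)"
  proof -
    obtain S where S: "S \<subseteq> c.chi ` {v. poly_face g {v} Q}" "c.chi ` F = convex hull S"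
    proof (rule face_of_convex_hull_subset)
      show "compact (c.chi ` {v. poly_face g {v} Q})"
        using fin by (simp add: finite_imp_compact)
      show "c.chi ` F face_of convex hull (c.chi ` {v. poly_face g {v} Q})"
        using ff c.chi_vertices[OF ad] by simp
    qed (rule that)
    have "S \<subseteq> c.chi ` V"
    proof
      fix z assume z: "z \<in> S"
      then obtain v where v: "poly_face g {v} Q" "z = c.chi v" using S(1) by blast
      have "v \<in> Q" using poly_face_subset[OF v(1)] by simp
      have "z \<in> c.chi ` F" unfolding S(2) using z by (rule hull_inc)
      then obtain x where x: "x \<in> F" "z = c.chi x" by blast
      have "x = v" using x v(2) \<open>v \<in> Q\<close> FQ by (intro c.inj_chi) (auto intro: c.hull_Q c.slice_pos)
      then have "poly_face g {v} F" using poly_face_vertex_restrict[OF v(1) _ FQ] x(1) by simp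
      then show "z \<in> c.chi ` V" using v(2) by (simp add: V_def)
    qed
    then show ?thesis unfolding S(2) by (rule hull_mono)
  qed
  have zero: "A = 0" if A: "\<And>v. v \<in> V \<Longrightarrow> A \<bullet> ?\<Theta> v = 0" for A
  proof (rule ccontr)
    assume nz: "A \<noteq> 0"
    \<comment> \<open>\<open>?S\<close> is the wall, \<open>?H\<close> the hyperplane of the
      relation. If \<open>A\<close> had only an \<open>m\<close>-th component, \<open>?H\<close>
      would be empty; this is excluded because \<open>F\<close> is nonempty.\<close>
    let ?H = "{c. reset m 0 A \<bullet> c = - A $ m}" and ?S = "{c :: real ^ 'k. axis m 1 \<bullet> c = 0}"
    have "c.chi v \<in> ?H" if "v \<in> V" for v
    proof -
      have "c.sl v > 0" using VF[OF that] FQ c.slice_pos by blast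
      then show ?thesis using A[OF that] scale[OF VF[OF that], of A] by simp
    qed
    then have "convex hull (c.chi ` V) \<subseteq> ?H"
      by (intro hull_minimal) (auto simp: convex_hyperplane)
    then have 1: "c.chi ` F \<subseteq> ?H" using hull by blast
    have 2: "c.chi ` F \<subseteq> ?S"
    proof
      fix z assume "z \<in> c.chi ` F"
      then obtain x where x: "x \<in> F" "z = c.chi x" by blast
      then have "form g u (x - flat g *\<^sub>R p) = 0" using Feq by blast
      then show "z \<in> ?S" using x(2) chi_facet[OF f] by (simp add: inner_axis' facet_chi_def)
    qed
    have "?S \<inter> ?H \<noteq> {}" using 1 2 F(2) by blast
    moreover have "\<not> ?S \<subseteq> ?H"
    proof
      assume s: "?S \<subseteq> ?H"
      have "(0 :: real ^ 'k) \<in> ?S" "reset m 0 A \<in> ?S" by (simp_all add: inner_axis' reset_def)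
      then have "0 \<in> ?H" "reset m 0 A \<in> ?H" using s by blast+
      then have z: "A $ m = 0" "reset m 0 A \<bullet> reset m 0 A = - A $ m" by simp_all
      then have "reset m 0 A = 0" by (simp only: inner_eq_zero_iff minus_zero)
      then have "A $ i = 0" for i using z(1) by (cases "i = m") (auto simp: reset_def vec_eq_iff split: if_splits)
      then show False using nz by (simp add: vec_eq_iff)
    qed
    ultimately have "aff_dim (?S \<inter> ?H) = aff_dim ?S - 1"
      using aff_dim_affine_Int_hyperplane[of ?S "reset m 0 A" "- A $ m"] affine_hyperplane by auto
    moreover have "aff_dim ?S = int CARD('k) - 1"
      using aff_dim_hyperplane[of "axis m (1 :: real) :: real ^ 'k" 0] by (simp add: axis_eq_0_iff)
    moreover have "aff_dim (c.chi ` F) \<le> aff_dim (?S \<inter> ?H)" using 1 2 by (intro aff_dim_subset) auto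
    ultimately show False using adF by linarith
  qed
  have span: "span (?\<Theta> ` V) = UNIV"
  proof (rule ccontr)
    assume "span (?\<Theta> ` V) \<noteq> UNIV"
    then obtain A where A: "A \<noteq> 0" "\<forall>y\<in>span (?\<Theta> ` V). A \<bullet> y = 0"
      using span_not_univ_subset_hyperplane by blast
    then have "A = 0" by (intro zero) (simp add: span_base)
    then show False using A(1) by simp
  qed
  obtain B where B: "B \<subseteq> ?\<Theta> ` V" "independent B" "?\<Theta> ` V \<subseteq> span B" "card B = dim (?\<Theta> ` V)"
    by (rule basis_exists[of "?\<Theta> ` V"]) blast
  have "span (?\<Theta> ` V) \<subseteq> span B" by (rule span_minimal[OF B(3) subspace_span])
  then have spB: "span B = UNIV" using span by auto
  have "finite B" using B(2) by (rule independent_imp_finite)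
  moreover have "card B = CARD('k)"
  proof -
    have "dim (?\<Theta> ` V) = dim (UNIV :: (real ^ 'k) set)" unfolding span[symmetric] dim_span ..
    then show ?thesis using B(4) by simp
  qed
  ultimately obtain h where h: "bij_betw h (UNIV :: 'k set) B"
    using finite_same_card_bij[of "UNIV :: 'k set" B] by auto
  have hB: "h j \<in> ?\<Theta> ` V" for j using bij_betw_apply[OF h, of j] B(1) by blast
  have "\<forall>j. \<exists>v. v \<in> V \<and> ?\<Theta> v = h j"
  proof
    fix j
    obtain v where "v \<in> V" "h j = ?\<Theta> v" by (rule imageE[OF hB[of j]])
    then show "\<exists>v. v \<in> V \<and> ?\<Theta> v = h j" by auto
  qed
  then have "\<exists>w. \<forall>j. w j \<in> V \<and> ?\<Theta> (w j) = h j" by (rule choice)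
  then obtain w where w: "\<And>j. w j \<in> V" "\<And>j. ?\<Theta> (w j) = h j" by blast
  have "rows (facet_matrix g p e m w) = B"
    using h by (auto simp: rows_def row_def facet_matrix_def w(2) bij_betw_def)
  then have "\<exists>C. C ** facet_matrix g p e m w = mat 1"
    unfolding matrix_left_invertible_span_rows spB[symmetric] by simp
  then have "det (facet_matrix g p e m w) \<noteq> 0"
    by (simp add: invertible_left_inverse[symmetric] invertible_det_nz)
  then show ?thesis using w(1) by (auto simp: V_def)
qed


text \<open>In an adapted frame all inner products in the volume density are determined by orthonormality.\<close>

definition std_density :: "'n::finite geometry \<Rightarrow> real \<Rightarrow> 'k \<Rightarrow> real ^ 'k::finite \<Rightarrow> real" where
  "std_density g \<kappa> m c =
    (let N = flat g + curv g * (curv g * (1 - \<kappa> * c $ m)\<^sup>2 + c \<bullet> c);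
         b = (\<lambda>i. c $ i - (if i = m then \<kappa> * curv g * (1 - \<kappa> * c $ m) else 0))
     in sqrt (det (\<chi> i j. ((if i = j then 1 else 0) + (if i = m \<and> j = m then \<kappa>\<^sup>2 * curv g else 0) -
          curv g * b i * b j / N) / N)))"

text \<open>The right-hand side mentions neither the cell nor its frame, so cells that share a facet
  and a tilt have the same density on its wall.\<close>

lemma density_frame:
  fixes f :: "'k::finite \<Rightarrow> real ^ 'n::finite"
  assumes f: "unit_frame g Q p UNIV f" and \<kappa>: "g = Euclidean \<Longrightarrow> \<kappa> = 0"
  shows "density g (frame_map p f \<kappa> m) c = std_density g \<kappa> m c"
proof -
  have ff: "form g (f i) (f j) = (if i = j then 1 else 0)" for i j
    using f by (simp add: unit_frame_def)
  have fp: "form g (f i) p = 0" "form g p (f i) = 0" "form g p p = curv g" if "g \<noteq> Euclidean" for i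
    using f that form_commute[of g p "f i"] by (auto simp: unit_frame_def)
  define fr where "fr = (\<lambda>i. frame_map p f \<kappa> m (0, axis i 1))"
  have frs: "frame_map p f \<kappa> m (0, axis i 1) = fr i" for i by (simp add: fr_def)
  have fr: "fr i = f i - (if i = m then \<kappa> else 0) *\<^sub>R p" for i
  proof -
    have "(\<Sum>j\<in>UNIV. axis i (1 :: real) $ j *\<^sub>R f j) = (\<Sum>j\<in>UNIV. if j = i then f i else 0)"
      by (rule sum.cong) (auto simp: axis_def)
    then show ?thesis by (simp add: fr_def frame_map_def axis_def)
  qed
  define \<Psi> where "\<Psi> = frame_map p f \<kappa> m (1, c)"
  have \<Psi>: "\<Psi> = (1 - \<kappa> * c $ m) *\<^sub>R p + (\<Sum>i\<in>UNIV. c $ i *\<^sub>R f i)" by (simp add: \<Psi>_def frame_map_def)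
  have sf: "form g (\<Sum>i\<in>UNIV. c $ i *\<^sub>R f i) (f j) = c $ j" for j
    by (simp add: form_sum_left form_simps ff if_distrib[of "\<lambda>x. _ * x"] cong: if_cong)
  have ss: "form g (\<Sum>i\<in>UNIV. c $ i *\<^sub>R f i) (\<Sum>i\<in>UNIV. c $ i *\<^sub>R f i) = c \<bullet> c"
    by (subst form_sum_right) (simp add: form_simps sf inner_vec_def)
  have A: "form g (fr i) (fr j) = (if i = j then 1 else 0) + (if i = m \<and> j = m then \<kappa>\<^sup>2 * curv g else 0)" for i j
  proof (cases "g = Euclidean")
    case True
    have "\<kappa> = 0" by (rule \<kappa>[OF True])
    then show ?thesis by (simp add: fr ff)
  next
    case False
    then show ?thesis by (simp add: fr form_simps ff fp power2_eq_square)
  qed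
  show ?thesis
  proof (cases "g = Euclidean")
    case True
    have "curv g = 0" "nrm2 g \<Psi> = 1" "flat g = 1" using True by (simp_all add: curv_def)
    then show ?thesis
      unfolding density_def frs \<Psi>_def[symmetric] A std_density_def Let_def by simp
  next
    case False
    have sp: "form g (\<Sum>i\<in>UNIV. c $ i *\<^sub>R f i) p = 0" "form g p (\<Sum>i\<in>UNIV. c $ i *\<^sub>R f i) = 0"
      by (simp_all add: form_sum_left form_sum_right form_simps fp[OF False])
    have B: "form g \<Psi> (fr i) = c $ i - (if i = m then \<kappa> * curv g * (1 - \<kappa> * c $ m) else 0)" for i
      by (simp add: \<Psi> fr form_simps sf sp fp[OF False])
    have N: "nrm2 g \<Psi> = flat g + curv g * (curv g * (1 - \<kappa> * c $ m)\<^sup>2 + c \<bullet> c)"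
      by (simp add: nrm2_def \<Psi> form_simps ss sp fp[OF False] power2_eq_square)
    show ?thesis
      unfolding density_def frs \<Psi>_def[symmetric] A B N std_density_def Let_def by simp
  qed
qed

text \<open>In the spherical case a hyperplane separating the whole cell from the origin is obtained by
  tilting the one that is adapted to the facet.\<close>

lemma tilt_exists:
  fixes a b :: "'a::topological_space \<Rightarrow> real"
  assumes G: "compact G" and c: "continuous_on G a" "continuous_on G b"
    and b: "\<And>x. x \<in> G \<Longrightarrow> b x \<ge> 0" and a: "\<And>x. x \<in> G \<Longrightarrow> b x = 0 \<Longrightarrow> a x > 0"
  shows "\<exists>\<kappa>0\<ge>0. \<forall>\<kappa>\<ge>\<kappa>0. \<forall>x\<in>G. a x + \<kappa> * b x > 0"
proof (cases "G = {}")
  case True then show ?thesis by (intro exI[of _ 0]) simp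
next
  case False
  obtain M where M: "\<And>x. x \<in> G \<Longrightarrow> - M \<le> a x" "M \<ge> 0"
  proof -
    obtain x0 where "x0 \<in> G" "\<And>x. x \<in> G \<Longrightarrow> a x0 \<le> a x"
      using continuous_attains_inf[OF G False c(1)] by blast
    then show thesis by (intro that[of "\<bar>a x0\<bar>"]) force+
  qed
  \<comment> \<open>Only on this compact set is a tilt needed; \<open>b\<close> is positive there
    and hence bounded below.\<close>
  define A where "A = {x \<in> G. a x \<le> 0}"
  show ?thesis
  proof (cases "A = {}")
    case True
    then have "a x + \<kappa> * b x > 0" if "x \<in> G" "\<kappa> \<ge> 0" for x \<kappa>
      using that b[OF that(1)] by (auto simp: A_def not_le intro!: add_pos_nonneg)
    then show ?thesis by (intro exI[of _ 0]) auto
  next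
    case neA: False
    have "compact A"
    proof -
      obtain C where C: "closed C" "C \<inter> G = a -` {..0} \<inter> G"
        using c(1) closed_atMost[of "0 :: real"] unfolding continuous_on_closed_invariant by blast
      have "A = G \<inter> C" using C(2) unfolding A_def by blast
      then show ?thesis using compact_Int_closed[OF G C(1)] by simp
    qed
    moreover have "continuous_on A b" by (rule continuous_on_subset[OF c(2)]) (auto simp: A_def)
    ultimately obtain x1 where x1: "x1 \<in> A" "\<And>x. x \<in> A \<Longrightarrow> b x1 \<le> b x"
      using continuous_attains_inf[OF _ neA] by blast
    have d: "b x1 > 0" using x1(1) a[of x1] b[of x1] by (force simp: A_def)
    \<comment> \<open>\<open>- M\<close> bounds \<open>a\<close> from below, \<open>b x1\<close> is
      the minimum of \<open>b\<close> on \<open>A\<close>, and the added 1 makes the inequality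
      strict.\<close>
    have "a x + \<kappa> * b x > 0" if x: "x \<in> G" and \<kappa>: "\<kappa> \<ge> (M + 1) / b x1" for x \<kappa>
    proof (cases "x \<in> A")
      case True
      have "M + 1 = (M + 1) / b x1 * b x1" using d by simp
      also have "\<dots> \<le> \<kappa> * b x" using \<kappa> x1(2)[OF True] d M(2) by (intro mult_mono) (auto intro: order_trans[OF _ \<kappa>])
      finally show ?thesis using M(1)[OF x] by linarith
    next
      case False
      have "\<kappa> \<ge> 0" using d M(2) by (intro order_trans[OF _ \<kappa>]) simp
      then show ?thesis using False x b[OF x] by (auto simp: A_def not_le intro!: add_pos_nonneg)
    qed
    then show ?thesis using d M(2) by (intro exI[of _ "(M + 1) / b x1"]) auto
  qed
qed

text \<open>The velocity of a facet is interpolated from the velocities of its chosen vertices.\<close>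

definition facet_velocity :: "'n::finite geometry \<Rightarrow> real ^ 'n \<Rightarrow> ('k \<Rightarrow> real ^ 'n) \<Rightarrow> 'k \<Rightarrow> ('k::finite \<Rightarrow> real ^ 'n) \<Rightarrow>
    (real ^ 'n \<Rightarrow> real ^ 'n) \<Rightarrow> real ^ 'k \<Rightarrow> real ^ 'n" where
  "facet_velocity g p e m w \<gamma>' c = (\<Sum>i\<in>UNIV. (if i = m then 1 else c $ i) *\<^sub>R
     (\<Sum>j\<in>UNIV. matrix_inv (facet_matrix g p e m w) $ i $ j *\<^sub>R \<gamma>' (w j)))"

text \<open>The weight of the normal speed in \<open>facet_rate\<close>, expressed without reference
  to the cell.\<close>

definition facet_weight :: "'n::finite geometry \<Rightarrow> real ^ 'n \<Rightarrow> ('k \<Rightarrow> real ^ 'n) \<Rightarrow> real \<Rightarrow> 'k \<Rightarrow>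
    (real ^ 'n) set \<Rightarrow> real ^ 'k::finite \<Rightarrow> real" where
  "facet_weight g p e \<kappa> m F c = std_density g \<kappa> m (reset m 0 c) *
     indicator (facet_chi g p e m ` F) (reset m 0 c) * of_bool (0 \<le> c $ m \<and> c $ m \<le> 1)"

context moving_polytope
begin

lemma facet_density_eq:
  assumes F: "F \<in> Fac"
  shows "facet_density F c * of_bool (0 \<le> c $ m \<and> c $ m \<le> 1) = facet_weight g (p F) (e F) (\<kappa> F) m F c"
proof -
  have "fchi F ` F = facet_chi g (p F) (e F) m ` F"
    by (rule image_cong[OF refl], rule chi_facet[OF good[OF F]]) (use Fac_eq[OF F] in blast)
  moreover have "density g (fP F) (reset m 0 c) = std_density g (\<kappa> F) m (reset m 0 c)"
    by (rule density_frame[where Q=Q]) (use good[OF F] in \<open>auto simp: good_frame_def\<close>)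
  ultimately show ?thesis by (simp add: facet_density_def facet_weight_def)
qed

text \<open>\<open>\<theta>'\<close> is linear in the products of the conormal with the vertex
  velocities. Pulling the conormal out of the sums leaves the interpolated velocity.\<close>

lemma facet_velocity_eq:
  "\<theta>' F $ m + reset m 0 (\<theta>' F) \<bullet> c = form g (u F) (facet_velocity g (p F) (e F) m (w F) \<gamma>' c)"
proof -
  let ?Z = "matrix_inv (facet_matrix g (p F) (e F) m (w F))"
  have th: "\<theta>' F $ i = form g (u F) (\<Sum>j\<in>UNIV. ?Z $ i $ j *\<^sub>R \<gamma>' (w F j))" for i
    by (simp add: \<theta>'_def matrix_vector_mult_def form_sum_right form_simps)
  have "\<theta>' F $ m + reset m 0 (\<theta>' F) \<bullet> c = (\<Sum>i\<in>UNIV. (if i = m then 1 else c $ i) * \<theta>' F $ i)"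
    unfolding inner_vec_def
    by (subst (1 2) sum.remove[of _ m]) (auto intro!: sum.cong simp: reset_def)
  then show ?thesis
    by (simp add: facet_velocity_def form_sum_right[of g "u F" _ UNIV] form_scale_right th)
qed

text \<open>Integrability is recorded so that the sum over the cells at a facet can be taken under
  the integral sign.\<close>

lemma facet_rate_eq:
  assumes F: "F \<in> Fac"
  defines "h \<equiv> \<lambda>c. form g (u F) (facet_velocity g (p F) (e F) m (w F) \<gamma>' c) * facet_weight g (p F) (e F) (\<kappa> F) m F c"
  shows "integrable lborel h" "facet_rate F = - (LINT c|lborel. h c)"
proof -
  have h: "h = (\<lambda>c. (\<theta>' F $ m + reset m 0 (\<theta>' F) \<bullet> c) * facet_density F c * of_bool (0 \<le> c $ m \<and> c $ m \<le> 1))"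
    unfolding h_def facet_velocity_eq[symmetric] facet_density_eq[OF F, symmetric] by (simp add: mult.assoc)
  show "facet_rate F = - (LINT c|lborel. h c)" unfolding h facet_rate_def ..
  obtain M R where M: "\<And>c. \<bar>facet_density F c\<bar> \<le> M" "M \<ge> 0" and R: "\<And>c. facet_density F c \<noteq> 0 \<Longrightarrow> norm (reset m 0 c) \<le> R"
    by (rule facet_density_bounded[OF F]) blast
  have contnth: "continuous_on UNIV (\<lambda>c :: real ^ 'k. c $ i)" for i
    by (intro continuous_intros)
  have nth [measurable]: "(\<lambda>c :: real ^ 'k. c $ i) \<in> borel_measurable borel" for i
    by (rule borel_measurable_continuous_onI[OF contnth])
  note facet_density_measurable[OF F, measurable]
  define K where "K = \<bar>\<theta>' F $ m\<bar> + norm (reset m 0 (\<theta>' F)) * (\<bar>R\<bar> + 1)"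
  have supp: "norm c \<le> \<bar>R\<bar> + 1" if "facet_density F c \<noteq> 0" "0 \<le> c $ m" "c $ m \<le> 1" for c
  proof -
    have "c = reset m 0 c + c $ m *\<^sub>R axis m 1" by (auto simp: vec_eq_iff reset_def axis_def)
    then have "norm c \<le> norm (reset m 0 c) + norm (c $ m *\<^sub>R axis m (1 :: real))" by (metis norm_triangle_ineq)
    also have "norm (c $ m *\<^sub>R axis m (1 :: real)) \<le> 1" using that by (simp add: norm_axis_1)
    finally show ?thesis using R[OF that(1)] by linarith
  qed
  show "integrable lborel h"
  proof (rule integrable_bounded_support[where M="K * M" and R="\<bar>R\<bar> + 1"])
    show "h \<in> borel_measurable borel" unfolding h by measurable
    show z: "h c = 0" if "\<bar>R\<bar> + 1 < norm c" for c using supp[of c] that unfolding h by fastforce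
    show "\<bar>h c\<bar> \<le> K * M" for c
    proof (cases "norm c \<le> \<bar>R\<bar> + 1")
      case True
      have "\<bar>reset m 0 (\<theta>' F) \<bullet> c\<bar> \<le> norm (reset m 0 (\<theta>' F)) * (\<bar>R\<bar> + 1)"
        by (rule order_trans[OF Cauchy_Schwarz_ineq2]) (use True in \<open>intro mult_left_mono, auto\<close>)
      then have "\<bar>\<theta>' F $ m + reset m 0 (\<theta>' F) \<bullet> c\<bar> \<le> K" unfolding K_def by linarith
      then have "\<bar>\<theta>' F $ m + reset m 0 (\<theta>' F) \<bullet> c\<bar> * \<bar>facet_density F c\<bar> \<le> K * M"
        using M(1)[of c] by (intro mult_mono) auto
      moreover have "K * M \<ge> 0" using M(2) by (simp add: K_def)
      ultimately show ?thesis unfolding h by (simp add: abs_mult)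
    next
      case False
      then show ?thesis using z[of c] M(2) by (simp add: K_def)
    qed
  qed
qed

end

subsection \<open>Families of cell complexes\<close>

lemma model_space_nonzero:
  assumes "g \<noteq> Euclidean" "x \<in> model_space g"
  shows "x \<noteq> 0"
proof
  assume "x = 0"
  then show False using assms by (cases g) (auto simp: model_space_def)
qed

lemma geodesic_dim_singleton:
  assumes "v \<in> model_space g"
  shows "geodesic_dim g {v} = 0"
proof (cases "g = Euclidean")
  case True then show ?thesis by (simp add: geodesic_dim_def)
next
  case False
  then have "dim {v} = 1" using model_space_nonzero[OF False assms] by (simp add: dim_insert)
  then show ?thesis using False by (cases g) (auto simp: geodesic_dim_def)
qed

text \<open>In the curved cases the span is a line, which contains at most two points of square
  \<open>curv g\<close>, negatives of each other. The open half sphere, respectively the positive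
  time coordinate, excludes one of them.\<close>

lemma zero_dim_polytope:
  assumes P: "convex_polytope g P" and d: "geodesic_dim g P = 0"
    and sph: "g = Spherical \<Longrightarrow> \<exists>a. \<forall>x\<in>P. a \<bullet> x > 0"
  shows "\<exists>v. P = {v}"
proof (cases "g = Euclidean")
  case True
  then have "aff_dim P = 0" using d by (simp add: geodesic_dim_def)
  then show ?thesis using aff_dim_eq_0 by blast
next
  case False
  then have d1: "dim P = 1" using d by (cases g) (auto simp: geodesic_dim_def)
  have M: "P \<subseteq> model_space g" by (rule convex_polytope_subset[OF P])
  obtain v where v: "v \<in> P" using d1 by (metis dim_empty ex_in_conv zero_neq_one)
  have v0: "v \<noteq> 0" using model_space_nonzero[OF False] v M by blast
  have sp: "span P = span {v}"
  proof (rule sym, rule dim_eq_span)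
    show "{v} \<subseteq> P" using v by simp
    show "dim P \<le> dim {v}" using d1 v0 by (simp add: dim_insert)
  qed
  have "x = v" if x: "x \<in> P" for x
  proof -
    have "x \<in> span {v}" using span_base[OF x] sp by simp
    then obtain a where a: "x = a *\<^sub>R v" by (auto simp: span_singleton)
    have nz: "form g v v \<noteq> 0" and eq: "form g x x = form g v v"
      using M v x False model_space_nrm2[of v g] model_space_nrm2[of x g]
      by (cases g; force simp: nrm2_def)+
    then have "a\<^sup>2 = 1" by (simp add: a form_simps power2_eq_square)
    then have a1: "a = 1 \<or> a = -1" by (simp add: power2_eq_1_iff)
    have "a \<noteq> -1"
    proof
      assume n: "a = -1"
      show False
      proof (cases g)
        case Euclidean then show False using False by simp
      next
        case Spherical
        then obtain b where b: "\<forall>x\<in>P. b \<bullet> x > 0" using sph by blast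
        have "b \<bullet> x > 0" "b \<bullet> v > 0" using b x v by auto
        then show False by (simp add: a n)
      next
        case (Hyperbolic i0)
        then have "x $ i0 > 0" "v $ i0 > 0" using M x v by (auto simp: model_space_def)
        then show False by (simp add: a n)
      qed
    qed
    then show ?thesis using a1 a by simp
  qed
  then have "P = {v}" using v by blast
  then show ?thesis by blast
qed

lemma geodesic_dim_nonempty:
  assumes "geodesic_dim g F = int d"
  shows "F \<noteq> {}"
proof
  assume "F = {}"
  then have "geodesic_dim g F = -1" by (cases g) (auto simp: geodesic_dim_def)
  then show False using assms by simp
qed

lemma facet_good_frame:
  fixes e :: "'k::finite \<Rightarrow> real ^ 'n::finite"
  assumes G: "convex_polytope g G" and face: "poly_face g F G" "F \<noteq> {}"
    and dimG: "geodesic_dim g G = geodesic_dim g F + 1"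
    and p: "p \<in> ahull g F" "\<And>i0. g = Hyperbolic i0 \<Longrightarrow> p \<in> model_space g" "\<And>x. x \<in> F \<Longrightarrow> flat g + curv g * form g x p > 0"
    and fr: "unit_frame g F p (UNIV - {m}) e"
  shows "\<exists>\<kappa>0\<ge>0. \<forall>\<kappa>\<ge>\<kappa>0. good_frame g G p (e(m := inward_normal g F G)) (if g = Spherical then \<kappa> else 0) m"
    "\<And>x. x \<in> G \<Longrightarrow> form g (inward_normal g F G) (x - flat g *\<^sub>R p) \<ge> 0"
    "F = {x \<in> G. form g (inward_normal g F G) (x - flat g *\<^sub>R p) = 0}"
proof -
  let ?u = "inward_normal g F G"
  have FG: "F \<subseteq> G" by (rule poly_face_subset[OF face(1)])
  have n: "unit_frame g G p (insert m (UNIV - {m})) (e(m := ?u))"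
    "\<And>x. x \<in> G \<Longrightarrow> form g ?u (x - flat g *\<^sub>R p) \<ge> 0" "F = {x \<in> G. form g ?u (x - flat g *\<^sub>R p) = 0}"
    by (rule facet_normal[OF G face dimG _ fr], rule p(2); simp)+
  show nn: "form g ?u (x - flat g *\<^sub>R p) \<ge> 0" if "x \<in> G" for x by (rule n(2)[OF that])
  show Feq: "F = {x \<in> G. form g ?u (x - flat g *\<^sub>R p) = 0}" by (rule n(3))
  have uf: "unit_frame g G p UNIV (e(m := ?u))" using n(1) by (simp add: insert_absorb)
  have pG: "p \<in> ahull g G" using p(1) ahull_mono[OF FG] by blast
  have gf: "good_frame g G p (e(m := ?u)) \<kappa> m" if "g \<noteq> Spherical \<longrightarrow> \<kappa> = 0" "\<forall>x\<in>G. slice g (frame_slice g p (e(m := ?u)) \<kappa> m) x > 0" for \<kappa>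
    using G face(2) FG pG uf p(2) that unfolding good_frame_def by blast
  show "\<exists>\<kappa>0\<ge>0. \<forall>\<kappa>\<ge>\<kappa>0. good_frame g G p (e(m := ?u)) (if g = Spherical then \<kappa> else 0) m"
  proof (cases g)
    case Euclidean
    then have "slice g (frame_slice g p (e(m := ?u)) 0 m) x > 0" for x
      by (simp add: slice_def frame_slice_def curv_def)
    then show ?thesis using gf[of 0] Euclidean by auto
  next
    case (Hyperbolic i0)
    have "slice g (frame_slice g p (e(m := ?u)) 0 m) x > 0" if "x \<in> G" for x
      using form_model_space_neg[of p i0 x] p(2)[OF Hyperbolic] convex_polytope_subset[OF G] that Hyperbolic
      by (auto simp: slice_def frame_slice_def curv_def form_simps)
    then show ?thesis using gf[of 0] Hyperbolic by auto
  next
    case Spherical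
    have fl: "flat g = 0" "curv g = 1" using Spherical by (simp_all add: curv_def)
    have "\<exists>\<kappa>0\<ge>0. \<forall>\<kappa>\<ge>\<kappa>0. \<forall>x\<in>G. form g x p + \<kappa> * form g x ?u > 0"
    proof (rule tilt_exists)
      show "compact G" using G by (simp add: convex_polytope_def)
      show "continuous_on G (\<lambda>x. form g x p)" "continuous_on G (\<lambda>x. form g x ?u)" by (intro continuous_intros)+
      show "form g x ?u \<ge> 0" if "x \<in> G" for x using nn[OF that] by (simp add: fl form_commute[of g x])
      show "form g x p > 0" if "x \<in> G" "form g x ?u = 0" for x
      proof -
        have "form g ?u (x - flat g *\<^sub>R p) = 0" using that(2) by (simp add: fl form_commute[of g x])
        then have "x \<in> F" using Feq that(1) by blast
        then show ?thesis using p(3) by (simp add: fl)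
      qed
    qed
    moreover have "slice g (frame_slice g p (e(m := ?u)) \<kappa> m) x = form g x p + \<kappa> * form g x ?u" for x \<kappa>
      by (simp add: slice_def frame_slice_def fl form_simps)
    ultimately show ?thesis using gf Spherical by auto
  qed
qed

locale cell_family =
  fixes g :: "'n::finite geometry" and T :: "real set" and K :: "(real ^ 'n) set set"
    and \<Phi> :: "real \<Rightarrow> (real ^ 'n) set \<Rightarrow> (real ^ 'n) set"
  assumes cplx: "cell_complex g K" and family: "smooth_family g T K \<Phi>"
begin

lemma fin: "finite K" using cplx by (simp add: cell_complex_def)

lemma T: "open T" "0 \<in> T" and \<Phi>_0: "G \<in> K \<Longrightarrow> \<Phi> 0 G = G"
  using family by (simp_all add: smooth_family_def)

lemma ev_T: "\<forall>\<^sub>F t in nhds 0. t \<in> T"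
  using T by (rule eventually_nhds_in_open)

lemma
  assumes "t \<in> T"
  shows complex_t: "cell_complex g (\<Phi> t ` K)"
    and dim_t: "G \<in> K \<Longrightarrow> geodesic_dim g (\<Phi> t G) = geodesic_dim g G"
    and face_t: "F \<in> K \<Longrightarrow> G \<in> K \<Longrightarrow> poly_face g (\<Phi> t F) (\<Phi> t G) \<longleftrightarrow> poly_face g F G"
  using family assms by (auto simp: smooth_family_def)

lemma
  assumes "t \<in> T" "G \<in> K"
  shows poly_t: "convex_polytope g (\<Phi> t G)" and hemi_t: "g = Spherical \<Longrightarrow> \<exists>a. \<forall>x\<in>\<Phi> t G. a \<bullet> x > 0"
    and face_K_t: "poly_face g F (\<Phi> t G) \<Longrightarrow> F \<in> \<Phi> t ` K"
  using complex_t[OF assms(1)] assms(2) by (simp_all add: cell_complex_def)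

lemma
  assumes "G \<in> K"
  shows poly: "convex_polytope g G" and hemi: "g = Spherical \<Longrightarrow> \<exists>a. \<forall>x\<in>G. a \<bullet> x > 0"
    and face_K: "poly_face g F G \<Longrightarrow> F \<in> K"
  using cplx assms by (simp_all add: cell_complex_def)

definition vertex_curve :: "real ^ 'n \<Rightarrow> real \<Rightarrow> real ^ 'n" where
  "vertex_curve v = (SOME \<gamma>. smooth_curve_on T \<gamma> \<and> (\<forall>t\<in>T. \<Phi> t {v} = {\<gamma> t}))"

definition vertex_velocity :: "real ^ 'n \<Rightarrow> real ^ 'n" where
  "vertex_velocity v = vector_derivative (vertex_curve v) (at 0)"

lemma vertex_curve:
  assumes "{v} \<in> K"
  shows "t \<in> T \<Longrightarrow> \<Phi> t {v} = {vertex_curve v t}" "vertex_curve v 0 = v"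
    "(vertex_curve v has_vector_derivative vertex_velocity v) (at 0)"
proof -
  have "\<exists>\<gamma>. smooth_curve_on T \<gamma> \<and> (\<forall>t\<in>T. \<Phi> t {v} = {\<gamma> t})"
    using family assms by (simp add: smooth_family_def)
  from someI_ex[OF this] have c: "smooth_curve_on T (vertex_curve v)" "\<forall>t\<in>T. \<Phi> t {v} = {vertex_curve v t}"
    unfolding vertex_curve_def by blast+
  show "t \<in> T \<Longrightarrow> \<Phi> t {v} = {vertex_curve v t}" using c(2) by blast
  show "vertex_curve v 0 = v" using c(2) T(2) \<Phi>_0[OF assms] by auto
  obtain D where "D 0 = vertex_curve v" "\<forall>m. \<forall>t\<in>T. (D m has_vector_derivative D (Suc m) t) (at t)"
    using c(1) by (auto simp: smooth_curve_on_def)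
  then have "(vertex_curve v has_vector_derivative D (Suc 0) 0) (at 0)" using T(2) by metis
  then show "(vertex_curve v has_vector_derivative vertex_velocity v) (at 0)"
    unfolding vertex_velocity_def by (simp add: vector_derivative_at)
qed

lemma finite_vertices: "G \<in> K \<Longrightarrow> finite {v. poly_face g {v} G}"
proof -
  assume G: "G \<in> K"
  have "(\<lambda>v. {v}) ` {v. poly_face g {v} G} \<subseteq> K" using face_K[OF G] by blast
  then have "finite ((\<lambda>v. {v}) ` {v. poly_face g {v} G})" using fin finite_subset by blast
  then show ?thesis by (rule finite_imageD) (simp add: inj_on_def)
qed

text \<open>A vertex of the moved cell belongs to the moved complex and so comes from a cell of the
  same dimension 0, which is a single point; the face relation is preserved in both
  directions.\<close>

lemma vertices_t:
  assumes t: "t \<in> T" and G: "G \<in> K"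
  shows "{w. poly_face g {w} (\<Phi> t G)} = (\<lambda>v. vertex_curve v t) ` {v. poly_face g {v} G}"
proof (intro equalityI subsetI)
  fix w assume "w \<in> {w. poly_face g {w} (\<Phi> t G)}"
  then have w: "poly_face g {w} (\<Phi> t G)" by simp
  obtain F where F: "F \<in> K" "{w} = \<Phi> t F" using face_K_t[OF t G w] by blast
  have "w \<in> model_space g"
    using poly_face_subset[OF w] convex_polytope_subset[OF poly_t[OF t G]] by blast
  then have "geodesic_dim g F = 0"
    using dim_t[OF t F(1)] geodesic_dim_singleton[of w g] by (simp add: F(2)[symmetric])
  then obtain v where v: "F = {v}" using zero_dim_polytope[OF poly[OF F(1)] _ hemi[OF F(1)]] by blast
  have "poly_face g {v} G" using face_t[OF t F(1) G] w by (simp add: F(2) v)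
  moreover have "w = vertex_curve v t" using vertex_curve(1)[of v t] F t by (simp add: v)
  ultimately show "w \<in> (\<lambda>v. vertex_curve v t) ` {v. poly_face g {v} G}" by blast
next
  fix w assume "w \<in> (\<lambda>v. vertex_curve v t) ` {v. poly_face g {v} G}"
  then obtain v where v: "poly_face g {v} G" "w = vertex_curve v t" by blast
  have vK: "{v} \<in> K" by (rule face_K[OF G v(1)])
  then show "w \<in> {w. poly_face g {w} (\<Phi> t G)}"
    using face_t[OF t vK G] v vertex_curve(1)[OF vK t] by simp
qed

lemma facet_t:
  assumes t: "t \<in> T" and G: "G \<in> K" and X: "poly_face g X (\<Phi> t G)" "geodesic_dim g X = d"
  shows "X \<in> \<Phi> t ` {F \<in> cells g K d. poly_face g F G}"
proof -
  obtain F where F: "F \<in> K" "X = \<Phi> t F" using face_K_t[OF t G X(1)] by blast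
  have "geodesic_dim g F = d" using dim_t[OF t F(1)] X(2) F(2) by simp
  moreover have "poly_face g F G" using face_t[OF t F(1) G] X(1) F(2) by simp
  ultimately show ?thesis using F by (auto simp: cells_def)
qed

end

lemma adapted_frame_exists:
  fixes F :: "(real ^ 'n::finite) set"
  assumes F: "convex_polytope g F" "F \<noteq> {}" "geodesic_dim g F = int (card I)" "finite I"
    and sph: "g = Spherical \<Longrightarrow> \<exists>a. \<forall>x\<in>F. a \<bullet> x > 0"
  shows "\<exists>p e. p \<in> ahull g F \<and> (\<forall>i0. g = Hyperbolic i0 \<longrightarrow> p \<in> model_space g) \<and>
    (\<forall>x\<in>F. flat g + curv g * form g x p > 0) \<and> unit_frame g F p I e"
proof -
  obtain p where p: "p \<in> ahull g F" "g = Euclidean \<Longrightarrow> p \<in> F" "g \<noteq> Euclidean \<Longrightarrow> p \<in> dirs g F \<and> form g p p = curv g"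
    "\<And>i0. g = Hyperbolic i0 \<Longrightarrow> p \<in> model_space g" "\<And>x. x \<in> F \<Longrightarrow> flat g + curv g * form g x p > 0"
    by (rule cell_point[OF F(1,2) sph]) blast+
  have "\<exists>e. unit_frame g F p I e"
    by (rule unit_frame_exists[OF F(2) p(2) p(3) p(4) F(4)]) (use F(3) in simp_all)
  then show ?thesis using p(1,4,5) by blast
qed

lemma good_frame_exists:
  fixes G :: "(real ^ 'n::finite) set" and m :: "'k::finite"
  assumes G: "convex_polytope g G" "geodesic_dim g G = int CARD('k)"
    and sph: "g = Spherical \<Longrightarrow> \<exists>a. \<forall>x\<in>G. a \<bullet> x > 0"
  shows "\<exists>p (e :: 'k \<Rightarrow> real ^ 'n). good_frame g G p e 0 m"
proof -
  have ne: "G \<noteq> {}" by (rule geodesic_dim_nonempty[OF G(2)])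
  obtain p and e :: "'k \<Rightarrow> real ^ 'n" where pe: "p \<in> ahull g G" "\<forall>i0. g = Hyperbolic i0 \<longrightarrow> p \<in> model_space g"
    "\<forall>x\<in>G. flat g + curv g * form g x p > 0" "unit_frame g G p UNIV e"
    using adapted_frame_exists[OF G(1) ne, of "UNIV :: 'k set"] G(2) sph by auto
  have "slice g (frame_slice g p e 0 m) x = flat g + curv g * form g x p" for x
    by (simp add: slice_def frame_slice_def form_simps)
  then show ?thesis using G(1) ne pe unfolding good_frame_def by (intro exI[of _ p]) auto
qed

context cell_family
begin

text \<open>The fixed combinatorics of the family translates vertices and facets of the cell at 0
  into those of the moved cell.\<close>

lemma cell_moving_polytope:
  fixes m :: "'k::finite" and e :: "(real ^ 'n) set \<Rightarrow> 'k \<Rightarrow> real ^ 'n"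
  assumes G: "G \<in> cells g K (int CARD('k))"
    and good: "\<And>F. F \<in> cells g K (int CARD('k) - 1) \<Longrightarrow> poly_face g F G \<Longrightarrow>
        good_frame g G (p F) ((e F)(m := inward_normal g F G)) (\<kappa> F) m"
    and nonneg: "\<And>F x. F \<in> cells g K (int CARD('k) - 1) \<Longrightarrow> poly_face g F G \<Longrightarrow> x \<in> G \<Longrightarrow>
        form g (inward_normal g F G) (x - flat g *\<^sub>R p F) \<ge> 0"
    and Feq: "\<And>F. F \<in> cells g K (int CARD('k) - 1) \<Longrightarrow> poly_face g F G \<Longrightarrow>
        F = {x \<in> G. form g (inward_normal g F G) (x - flat g *\<^sub>R p F) = 0}"
    and w: "\<And>F j. F \<in> cells g K (int CARD('k) - 1) \<Longrightarrow> poly_face g F G \<Longrightarrow> poly_face g {w F j} F"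
    and nz: "\<And>F. F \<in> cells g K (int CARD('k) - 1) \<Longrightarrow> poly_face g F G \<Longrightarrow> det (facet_matrix g (p F) (e F) m (w F)) \<noteq> 0"
  shows "moving_polytope g G {v. poly_face g {v} G} vertex_curve vertex_velocity (\<lambda>t. \<Phi> t G)
    {F \<in> cells g K (int CARD('k) - 1). poly_face g F G} \<Phi> m p e \<kappa> w (\<lambda>F. inward_normal g F G)"
proof -
  have GK: "G \<in> K" and dG: "geodesic_dim g G = int CARD('k)" using G by (auto simp: cells_def)
  have vK: "{v} \<in> K" if "poly_face g {v} G" for v by (rule face_K[OF GK that])
  show ?thesis
  proof
    show "geodesic_dim g G = int CARD('k)" by (rule dG)
    show "finite {v. poly_face g {v} G}" by (rule finite_vertices[OF GK])
    show "{v. poly_face g {v} G} = {v. poly_face g {v} G}" ..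
    show "vertex_curve v 0 = v" "(vertex_curve v has_vector_derivative vertex_velocity v) (at 0)"
      if "v \<in> {v. poly_face g {v} G}" for v
      using vertex_curve(2,3)[OF vK] that by auto
    show "\<Phi> 0 G = G" by (rule \<Phi>_0[OF GK])
    show "\<forall>\<^sub>F t in nhds 0. convex_polytope g (\<Phi> t G) \<and> \<Phi> t G \<noteq> {} \<and> geodesic_dim g (\<Phi> t G) = int CARD('k) \<and>
        {w. poly_face g {w} (\<Phi> t G)} = (\<lambda>v. vertex_curve v t) ` {v. poly_face g {v} G} \<and>
        (g = Spherical \<longrightarrow> (\<exists>a. \<forall>x\<in>\<Phi> t G. a \<bullet> x > 0))"
      using ev_T
    proof eventually_elim
      case (elim t)
      have d: "geodesic_dim g (\<Phi> t G) = int CARD('k)" using dim_t[OF elim GK] dG by simp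
      then show ?case
        using poly_t[OF elim GK] geodesic_dim_nonempty[OF d] vertices_t[OF elim GK] hemi_t[OF elim GK] by blast
    qed
    show "finite {F \<in> cells g K (int CARD('k) - 1). poly_face g F G}"
      by (rule finite_subset[OF _ fin]) (auto simp: cells_def)
    show "poly_face g F G \<and> F \<noteq> {} \<and> geodesic_dim g F = int CARD('k) - 1"
      if "F \<in> {F \<in> cells g K (int CARD('k) - 1). poly_face g F G}" for F
    proof -
      have "geodesic_dim g F = int (CARD('k) - 1)" using that by (simp add: cells_def of_nat_diff Suc_le_eq)
      from geodesic_dim_nonempty[OF this] show ?thesis using that by (simp add: cells_def)
    qed
    show "\<forall>\<^sub>F t in nhds 0. (\<forall>F\<in>{F \<in> cells g K (int CARD('k) - 1). poly_face g F G}. poly_face g (\<Phi> t F) (\<Phi> t G) \<and>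
          \<Phi> t F \<noteq> {} \<and> geodesic_dim g (\<Phi> t F) = int CARD('k) - 1 \<and>
          (\<forall>v\<in>{v. poly_face g {v} G}. v \<in> F \<longrightarrow> vertex_curve v t \<in> \<Phi> t F)) \<and>
        (\<forall>X. poly_face g X (\<Phi> t G) \<and> geodesic_dim g X = int CARD('k) - 1 \<longrightarrow>
          X \<in> \<Phi> t ` {F \<in> cells g K (int CARD('k) - 1). poly_face g F G})"
      using ev_T
    proof eventually_elim
      case (elim t)
      have "poly_face g (\<Phi> t F) (\<Phi> t G) \<and>
          \<Phi> t F \<noteq> {} \<and> geodesic_dim g (\<Phi> t F) = int CARD('k) - 1 \<and>
          (\<forall>v\<in>{v. poly_face g {v} G}. v \<in> F \<longrightarrow> vertex_curve v t \<in> \<Phi> t F)"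
        if F: "F \<in> cells g K (int CARD('k) - 1)" "poly_face g F G" for F
      proof (intro conjI ballI impI)
        have FK: "F \<in> K" and dF: "geodesic_dim g F = int CARD('k) - 1" using F(1) by (auto simp: cells_def)
        show "poly_face g (\<Phi> t F) (\<Phi> t G)" using face_t[OF elim FK GK] F(2) by simp
        show d: "geodesic_dim g (\<Phi> t F) = int CARD('k) - 1" using dim_t[OF elim FK] dF by simp
        have "geodesic_dim g (\<Phi> t F) = int (CARD('k) - 1)" using d by (simp add: of_nat_diff Suc_le_eq)
        then show "\<Phi> t F \<noteq> {}" by (rule geodesic_dim_nonempty)
        fix v assume v: "v \<in> {v. poly_face g {v} G}" "v \<in> F"
        have "poly_face g {v} F" using poly_face_vertex_restrict[of g v G F] v poly_face_subset[OF F(2)] by simp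
        then have "poly_face g (\<Phi> t {v}) (\<Phi> t F)" using face_t[OF elim vK FK] v by simp
        then show "vertex_curve v t \<in> \<Phi> t F"
          using poly_face_subset vertex_curve(1)[OF vK elim] v by auto
      qed
      then show ?case using facet_t[OF elim GK] by blast
    qed
    fix F assume "F \<in> {F \<in> cells g K (int CARD('k) - 1). poly_face g F G}"
    then have F: "F \<in> cells g K (int CARD('k) - 1)" "poly_face g F G" by auto
    show gf: "good_frame g G (p F) ((e F)(m := inward_normal g F G)) (\<kappa> F) m" by (rule good[OF F])
    show "form g (inward_normal g F G) (x - flat g *\<^sub>R p F) \<ge> 0" if "x \<in> G" for x by (rule nonneg[OF F that])
    show "F = {x \<in> G. form g (inward_normal g F G) (x - flat g *\<^sub>R p F) = 0}" by (rule Feq[OF F])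
    \<comment> \<open>A vertex of a facet is a vertex of the cell, by transitivity of faces in the
      chart.\<close>
    show "w F j \<in> {v. poly_face g {v} G} \<and> w F j \<in> F" for j
      using chart.poly_face_vertex_trans[OF good_frame_chart[OF gf] F(2) w[OF F]] poly_face_subset[OF w[OF F]] by auto
    show "det (facet_matrix g (p F) (e F) m (w F)) \<noteq> 0" by (rule nz[OF F])
  qed
qed

text \<open>The frame of a facet, the vertices chosen on it and the tilt must not depend on the cell that
  the facet bounds; only then is its contribution a linear function of the conormal.\<close>

lemma volume_derivatives:
  obtains y :: "(real ^ 'n) set \<Rightarrow> real ^ 'k::finite \<Rightarrow> real ^ 'n" and h :: "(real ^ 'n) set \<Rightarrow> real ^ 'k \<Rightarrow> real" where
    "\<And>F G. F \<in> cells g K (int CARD('k) - 1) \<Longrightarrow> G \<in> cells g K (int CARD('k)) \<Longrightarrow> poly_face g F G \<Longrightarrow>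
      integrable lborel (\<lambda>c. form g (inward_normal g F G) (y F c) * h F c)"
    "\<And>G. G \<in> cells g K (int CARD('k)) \<Longrightarrow>
      ((\<lambda>t. cell_volume g TYPE('k) (\<Phi> t G)) has_field_derivative
        (\<Sum>F | F \<in> cells g K (int CARD('k) - 1) \<and> poly_face g F G.
          - (LINT c|lborel. form g (inward_normal g F G) (y F c) * h F c))) (at 0)"
proof -
  \<comment> \<open>An arbitrary index; in every frame it is the place of the conormal.\<close>
  define m :: 'k where "m = undefined"
  define C where "C = cells g K (int CARD('k))"
  define B where "B = cells g K (int CARD('k) - 1)"
  have finC: "finite C" unfolding C_def cells_def using fin by simp
  have BK: "F \<in> K" "geodesic_dim g F = int CARD('k) - 1" "F \<noteq> {}" if "F \<in> B" for F
  proof -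
    show FK: "F \<in> K" "geodesic_dim g F = int CARD('k) - 1" using that by (auto simp: B_def cells_def)
    then have "geodesic_dim g F = int (CARD('k) - 1)" by (simp add: of_nat_diff Suc_le_eq)
    then show "F \<noteq> {}" by (rule geodesic_dim_nonempty)
  qed
  have CK: "G \<in> K" "geodesic_dim g G = int CARD('k)" if "G \<in> C" for G
    using that by (auto simp: C_def cells_def)
  have "\<exists>p e. p \<in> ahull g F \<and> (\<forall>i0. g = Hyperbolic i0 \<longrightarrow> p \<in> model_space g) \<and>
    (\<forall>x\<in>F. flat g + curv g * form g x p > 0) \<and> unit_frame g F p (UNIV - {m}) e" if F: "F \<in> B" for F
    by (rule adapted_frame_exists[OF poly[OF BK(1)[OF F]] BK(3)[OF F] _ _ hemi[OF BK(1)[OF F]]])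
      (use BK(2)[OF F] in \<open>simp_all add: card_Diff_singleton of_nat_diff Suc_le_eq\<close>)
  then obtain p and e :: "(real ^ 'n) set \<Rightarrow> 'k \<Rightarrow> real ^ 'n" where pe: "\<And>F. F \<in> B \<Longrightarrow> p F \<in> ahull g F"
    "\<And>F i0. F \<in> B \<Longrightarrow> g = Hyperbolic i0 \<Longrightarrow> p F \<in> model_space g"
    "\<And>F x. F \<in> B \<Longrightarrow> x \<in> F \<Longrightarrow> flat g + curv g * form g x (p F) > 0"
    "\<And>F. F \<in> B \<Longrightarrow> unit_frame g F (p F) (UNIV - {m}) (e F)"
    by metis
  have gf: "\<exists>\<kappa>0\<ge>0. \<forall>\<kappa>\<ge>\<kappa>0. good_frame g G (p F) ((e F)(m := inward_normal g F G)) (if g = Spherical then \<kappa> else 0) m"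
    "\<And>x. x \<in> G \<Longrightarrow> form g (inward_normal g F G) (x - flat g *\<^sub>R p F) \<ge> 0"
    "F = {x \<in> G. form g (inward_normal g F G) (x - flat g *\<^sub>R p F) = 0}"
    if F: "F \<in> B" and G: "G \<in> C" and face: "poly_face g F G" for F G
  proof -
    have d: "geodesic_dim g G = geodesic_dim g F + 1" using BK(2)[OF F] CK(2)[OF G] by simp
    note * = facet_good_frame[OF poly[OF CK(1)[OF G]] face BK(3)[OF F] d pe(1)[OF F] pe(2)[OF F] pe(3)[OF F] pe(4)[OF F]]
    show "\<exists>\<kappa>0\<ge>0. \<forall>\<kappa>\<ge>\<kappa>0. good_frame g G (p F) ((e F)(m := inward_normal g F G)) (if g = Spherical then \<kappa> else 0) m"
      by (rule *(1))
    show "form g (inward_normal g F G) (x - flat g *\<^sub>R p F) \<ge> 0" if "x \<in> G" for x by (rule *(2)) (use that in auto)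
    show "F = {x \<in> G. form g (inward_normal g F G) (x - flat g *\<^sub>R p F) = 0}" by (rule *(3))
  qed
  have "\<exists>\<kappa>. \<forall>G\<in>C. poly_face g F G \<longrightarrow> good_frame g G (p F) ((e F)(m := inward_normal g F G)) \<kappa> m" if F: "F \<in> B" for F
  proof -
    have "\<forall>G\<in>C. \<exists>\<kappa>0\<ge>0. poly_face g F G \<longrightarrow> (\<forall>\<kappa>\<ge>\<kappa>0. good_frame g G (p F) ((e F)(m := inward_normal g F G)) (if g = Spherical then \<kappa> else 0) m)"
      using gf(1)[OF F] by blast
    then obtain \<kappa>0 where k0: "\<And>G. G \<in> C \<Longrightarrow> \<kappa>0 G \<ge> (0 :: real)"
      "\<And>G \<kappa>. G \<in> C \<Longrightarrow> poly_face g F G \<Longrightarrow> \<kappa> \<ge> \<kappa>0 G \<Longrightarrow> good_frame g G (p F) ((e F)(m := inward_normal g F G)) (if g = Spherical then \<kappa> else 0) m"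
      by metis
    \<comment> \<open>The sum of the nonnegative thresholds bounds each of them and gives a tilt
      common to all cells at \<open>F\<close>.\<close>
    have "\<kappa>0 G \<le> (\<Sum>G\<in>C. \<kappa>0 G)" if "G \<in> C" for G
      by (rule member_le_sum[OF that]) (use k0(1) finC in auto)
    then show ?thesis using k0(2) by blast
  qed
  then obtain \<kappa> where \<kappa>: "\<And>F G. F \<in> B \<Longrightarrow> G \<in> C \<Longrightarrow> poly_face g F G \<Longrightarrow> good_frame g G (p F) ((e F)(m := inward_normal g F G)) (\<kappa> F) m"
    by metis
  have "\<exists>w. \<forall>G\<in>C. poly_face g F G \<longrightarrow> (\<forall>j. poly_face g {w j} F) \<and> det (facet_matrix g (p F) (e F) m w) \<noteq> 0" if F: "F \<in> B" for F
  \<comment> \<open>One cell at \<open>F\<close> suffices to find the vertices, since the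
    determinant involves data of \<open>F\<close> only; if \<open>F\<close> bounds no cell of
    \<open>C\<close>, the claim is vacuous.\<close>
  proof (cases "\<exists>G\<in>C. poly_face g F G")
    case True
    then obtain G where G: "G \<in> C" "poly_face g F G" by blast
    have "\<exists>w. (\<forall>j. poly_face g {w j} F) \<and> det (facet_matrix g (p F) (e F) m w) \<noteq> 0"
      by (rule independent_vertices[OF \<kappa>[OF F G] CK(2)[OF G(1)] G(2) BK(3)[OF F] BK(2)[OF F] gf(3)[OF F G]
          finite_vertices[OF CK(1)[OF G(1)]]])
    then show ?thesis by blast
  qed blast
  then obtain w where w: "\<And>F G j. F \<in> B \<Longrightarrow> G \<in> C \<Longrightarrow> poly_face g F G \<Longrightarrow> poly_face g {w F j} F"
    "\<And>F G. F \<in> B \<Longrightarrow> G \<in> C \<Longrightarrow> poly_face g F G \<Longrightarrow> det (facet_matrix g (p F) (e F) m (w F)) \<noteq> 0"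
    by metis
  define y where "y = (\<lambda>F. facet_velocity g (p F) (e F) m (w F) vertex_velocity)"
  define h where "h = (\<lambda>F. facet_weight g (p F) (e F) (\<kappa> F) m F)"
  have mp: "moving_polytope g G {v. poly_face g {v} G} vertex_curve vertex_velocity (\<lambda>t. \<Phi> t G)
    {F \<in> B. poly_face g F G} \<Phi> m p e \<kappa> w (\<lambda>F. inward_normal g F G)" if G: "G \<in> C" for G
    unfolding B_def
  proof (rule cell_moving_polytope, fold B_def C_def)
    show "G \<in> C" by (rule G)
    fix F assume F: "F \<in> B" "poly_face g F G"
    show "good_frame g G (p F) ((e F)(m := inward_normal g F G)) (\<kappa> F) m" by (rule \<kappa>[OF F(1) G F(2)])
    show "form g (inward_normal g F G) (x - flat g *\<^sub>R p F) \<ge> 0" if "x \<in> G" for x by (rule gf(2)[OF F(1) G F(2) that])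
    show "F = {x \<in> G. form g (inward_normal g F G) (x - flat g *\<^sub>R p F) = 0}" by (rule gf(3)[OF F(1) G F(2)])
    show "poly_face g {w F j} F" for j by (rule w(1)[OF F(1) G F(2)])
    show "det (facet_matrix g (p F) (e F) m (w F)) \<noteq> 0" by (rule w(2)[OF F(1) G F(2)])
  qed
  show thesis
  proof (rule that[of y h])
    fix F G assume "F \<in> cells g K (int CARD('k) - 1)" "G \<in> cells g K (int CARD('k))" and face: "poly_face g F G"
    then have F: "F \<in> B" and G: "G \<in> C" by (simp_all add: B_def C_def)
    show "integrable lborel (\<lambda>c. form g (inward_normal g F G) (y F c) * h F c)"
      using moving_polytope.facet_rate_eq(1)[OF mp[OF G], of F] F face by (simp add: y_def h_def)
  next
    fix G assume "G \<in> cells g K (int CARD('k))"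
    then have G: "G \<in> C" by (simp add: C_def)
    interpret moving_polytope g G "{v. poly_face g {v} G}" vertex_curve vertex_velocity "\<lambda>t. \<Phi> t G" "TYPE('k)"
      "{F \<in> B. poly_face g F G}" \<Phi> m p e \<kappa> w "\<lambda>F. inward_normal g F G" by (rule mp[OF G])
    obtain pb and eb :: "'k \<Rightarrow> real ^ 'n" where "good_frame g G pb eb 0 m"
      using good_frame_exists[OF poly[OF CK(1)[OF G]] CK(2)[OF G] hemi[OF CK(1)[OF G]]] by blast
    from cell_volume_derivative[OF this]
    have "((\<lambda>t. cell_volume g TYPE('k) (\<Phi> t G)) has_field_derivative (\<Sum>F | F \<in> B \<and> poly_face g F G. facet_rate F)) (at 0)" by simp
    also have "(\<Sum>F | F \<in> B \<and> poly_face g F G. facet_rate F) =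
        (\<Sum>F | F \<in> B \<and> poly_face g F G. - (LINT c|lborel. form g (inward_normal g F G) (y F c) * h F c))"
      by (rule sum.cong[OF refl]) (simp add: facet_rate_eq(2) y_def h_def)
    finally show "((\<lambda>t. cell_volume g TYPE('k) (\<Phi> t G)) has_field_derivative
        (\<Sum>F | F \<in> cells g K (int CARD('k) - 1) \<and> poly_face g F G.
          - (LINT c|lborel. form g (inward_normal g F G) (y F c) * h F c))) (at 0)" unfolding B_def .
  qed
qed

end

section \<open>The weighted sum of the volume derivatives over the complex\<close>

theorem theorem2p2:
  fixes g :: "'n::finite geometry"
    and k :: nat
    and T :: "real set"
    and K :: "(real ^ 'n) set set"
    and \<Phi> :: "real \<Rightarrow> (real ^ 'n) set \<Rightarrow> (real ^ 'n) set"
    and \<omega> :: "(real ^ 'n) set \<Rightarrow> real"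
  assumes "1 \<le> k"
    and "k = CARD('k::finite)"
    and "cell_complex g K"
    and "smooth_family g T K \<Phi>"
    and "is_stress g (k + 1) K \<omega>"
  shows "(\<forall>G\<in>cells g K (int k).
            (\<lambda>t. cell_volume g TYPE('k) (\<Phi> t G)) differentiable (at 0)) \<and>
         (\<Sum>G\<in>cells g K (int k).
            \<omega> G * deriv (\<lambda>t. cell_volume g TYPE('k) (\<Phi> t G)) 0) = 0"
proof -
  interpret cell_family g T K \<Phi> by standard (fact assms)+
  define C where "C = cells g K (int k)"
  define B where "B = cells g K (int k - 1)"
  have finite: "finite C" "finite B" using fin by (simp_all add: C_def B_def cells_def)
  obtain y :: "(real ^ 'n) set \<Rightarrow> real ^ 'k \<Rightarrow> real ^ 'n" and h where
    int: "\<And>F G. F \<in> B \<Longrightarrow> G \<in> C \<Longrightarrow> poly_face g F G \<Longrightarrow> integrable lborel (\<lambda>c. form g (inward_normal g F G) (y F c) * h F c)"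
    and D: "\<And>G. G \<in> C \<Longrightarrow> ((\<lambda>t. cell_volume g TYPE('k) (\<Phi> t G)) has_field_derivative
        (\<Sum>F | F \<in> B \<and> poly_face g F G. - (LINT c|lborel. form g (inward_normal g F G) (y F c) * h F c))) (at 0)"
    unfolding B_def C_def assms(2) by (rule volume_derivatives) blast
  have "(\<Sum>G\<in>C. \<omega> G * deriv (\<lambda>t. cell_volume g TYPE('k) (\<Phi> t G)) 0) =
      (\<Sum>G\<in>C. \<Sum>F | F \<in> B \<and> poly_face g F G. - \<omega> G * (LINT c|lborel. form g (inward_normal g F G) (y F c) * h F c))"
    by (rule sum.cong[OF refl]) (simp add: DERIV_imp_deriv[OF D] sum_distrib_left)
  \<comment> \<open>The incidences are regrouped by facets, where the stress condition acts.\<close>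
  also have "\<dots> = (\<Sum>F\<in>B. \<Sum>G | G \<in> C \<and> poly_face g F G. - \<omega> G * (LINT c|lborel. form g (inward_normal g F G) (y F c) * h F c))"
    by (rule sum.swap_restrict[OF finite])
  also have "\<dots> = (\<Sum>F\<in>B. 0)"
  proof (rule sum.cong[OF refl])
    fix F assume F: "F \<in> B"
    let ?S = "{G. G \<in> C \<and> poly_face g F G}"
    \<comment> \<open>A \<open>(k + 1)\<close>-stress lives on \<open>k\<close>-cells and is
      balanced at the \<open>(k - 1)\<close>-cells, the elements of \<open>B\<close>.\<close>
    have stress: "(\<Sum>G\<in>?S. \<omega> G *\<^sub>R inward_normal g F G) = 0"
      using assms(5) F unfolding is_stress_def B_def C_def by (auto simp: of_nat_diff)
    have "(\<Sum>G\<in>?S. - \<omega> G * (LINT c|lborel. form g (inward_normal g F G) (y F c) * h F c)) =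
        (\<Sum>G\<in>?S. LINT c|lborel. - \<omega> G * (form g (inward_normal g F G) (y F c) * h F c))"
      by (rule sum.cong[OF refl]) simp
    also have "\<dots> = (LINT c|lborel. (\<Sum>G\<in>?S. - \<omega> G * (form g (inward_normal g F G) (y F c) * h F c)))"
      by (rule Bochner_Integration.integral_sum[symmetric]) (use int[OF F] in auto)
    also have "\<dots> = (LINT c|(lborel :: (real ^ 'k) measure). 0)"
    proof (rule Bochner_Integration.integral_cong[OF refl])
      fix c
      \<comment> \<open>Velocity and weight are common to all cells at \<open>F\<close>, so
        linearity in the first argument of the form collects the conormals into the sum that the
        stress annihilates.\<close>
      have "(\<Sum>G\<in>?S. - \<omega> G * (form g (inward_normal g F G) (y F c) * h F c)) =
          - form g (\<Sum>G\<in>?S. \<omega> G *\<^sub>R inward_normal g F G) (y F c) * h F c"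
        by (simp add: form_sum_left form_scale_left sum_distrib_right sum_negf mult.assoc)
      also have "form g (\<Sum>G\<in>?S. \<omega> G *\<^sub>R inward_normal g F G) (y F c) = 0"
        unfolding stress using form_scale_left[of g 0 0 "y F c"] by simp
      finally show "(\<Sum>G\<in>?S. - \<omega> G * (form g (inward_normal g F G) (y F c) * h F c)) = 0" by simp
    qed
    finally show "(\<Sum>G | G \<in> C \<and> poly_face g F G. - \<omega> G * (LINT c|lborel. form g (inward_normal g F G) (y F c) * h F c)) = 0"
      by simp
  qed
  finally have "(\<Sum>G\<in>C. \<omega> G * deriv (\<lambda>t. cell_volume g TYPE('k) (\<Phi> t G)) 0) = 0" by simp
  moreover have "(\<lambda>t. cell_volume g TYPE('k) (\<Phi> t G)) differentiable (at 0)" if "G \<in> C" for G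
    using D[OF that] by (auto simp: differentiable_def has_field_derivative_def)
  ultimately show ?thesis unfolding C_def by blast
qed

end
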